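(* Let $(M^3,g)$ be a compact connected Hermitian manifold of complex dimension $3$ whose Chern connection $\nabla$ has parallel torsion and curvature, i.e. $\nabla T=0$ and $\nabla R=0$. Then either $g$ is Kähler (hence $(M,g)$ is a locally Hermitian symmetric space), or $g$ is Chern flat, i.e. $R=0$.
   Context: Manifolds are connected; a Hermitian manifold $(M^n,g)$ is a complex manifold of complex dimension $n$ with a $J$-compatible Riemannian metric $g$. The Chern connection $\nabla$ is the unique connection with $\nabla g=0$, $\nabla J=0$ and torsion satisfying $T(X,\overline{Y})=0$ for all $(1,0)$-vectors $X,Y$. Here $T(x,y)=\nabla_xy-\nabla_yx-[x,y]$ is its torsion and $R$ its curvature tensor. *)

theory Defs
  imports "HOL-Analysis.Analysis" "HOL-Library.Function_Algebras"
begin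

text \<open>
  The underlying set of a manifold is the universe of a Hausdorff, second countable type.
  A chart is a pair of a domain and a coordinate map; the values of the coordinate map outside
  the domain are irrelevant.  Tensors and connections act on globally defined smooth vector
  fields; only their values on such fields are meaningful.
\<close>

subsection \<open>Complex manifolds\<close>

type_synonym ('m, 'n) chart = "'m set \<times> ('m \<Rightarrow> complex ^ 'n)"

text \<open>Holomorphy in several variables: the real Frechet derivative exists and is complex linear.\<close>

definition cholomorphic_on ::
  "(complex ^ 'n \<Rightarrow> complex ^ 'k) \<Rightarrow> (complex ^ 'n) set \<Rightarrow> bool" where
  "cholomorphic_on F S \<longleftrightarrow>
     (\<forall>z\<in>S. \<exists>D. (F has_derivative D) (at z) \<and> (\<forall>c v. D (c *s v) = c *s D v))"

definition complex_atlas ::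
  "('m::{t2_space, second_countable_topology}, 'n::finite) chart set \<Rightarrow> bool" where
  "complex_atlas A \<longleftrightarrow>
     (\<Union>(U, \<phi>)\<in>A. U) = UNIV \<and>
     (\<forall>(U, \<phi>)\<in>A. open U \<and> open (\<phi> ` U) \<and> homeomorphism U (\<phi> ` U) \<phi> (inv_into U \<phi>)) \<and>
     (\<forall>(U, \<phi>)\<in>A. \<forall>(V, \<psi>)\<in>A. cholomorphic_on (\<psi> \<circ> inv_into U \<phi>) (\<phi> ` (U \<inter> V)))"

definition holomorphic_map_on ::
  "('m::topological_space, 'n::finite) chart set \<Rightarrow> ('m \<Rightarrow> 'm) \<Rightarrow> 'm set \<Rightarrow> bool" where
  "holomorphic_map_on A s W \<longleftrightarrow>
     open W \<and> continuous_on W s \<and>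
     (\<forall>(U, \<phi>)\<in>A. \<forall>(V, \<psi>)\<in>A.
        cholomorphic_on (\<psi> \<circ> s \<circ> inv_into U \<phi>) (\<phi> ` {q \<in> U \<inter> W. s q \<in> V}))"

subsection \<open>Smooth functions, tangent vectors and vector fields\<close>

text \<open>Intended for open \<open>S\<close> in a finite-dimensional space: \<open>k\<close> times continuously differentiable.\<close>

primrec Ck_on ::
  "nat \<Rightarrow> 'a::real_normed_vector set \<Rightarrow> ('a \<Rightarrow> 'b::real_normed_vector) \<Rightarrow> bool" where
  "Ck_on 0 S f \<longleftrightarrow> continuous_on S f"
| "Ck_on (Suc k) S f \<longleftrightarrow>
     (\<forall>x\<in>S. f differentiable (at x)) \<and>
     (\<forall>v. Ck_on k S (\<lambda>x. frechet_derivative f (at x) v))"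

definition smooth_fun :: "('m, 'n::finite) chart set \<Rightarrow> ('m \<Rightarrow> real) \<Rightarrow> bool" where
  "smooth_fun A f \<longleftrightarrow> (\<forall>(U, \<phi>)\<in>A. \<forall>k. Ck_on k (\<phi> ` U) (f \<circ> inv_into U \<phi>))"

type_synonym 'm tvec = "('m \<Rightarrow> real) \<Rightarrow> real"
type_synonym 'm vfield = "'m \<Rightarrow> 'm tvec"

text \<open>
  Real tangent vectors at \<open>p\<close> are the derivations at \<open>p\<close> of the algebra of global smooth
  functions.  They are extended by zero to non-smooth functions, so that equality of tangent
  vectors is equality in HOL.
\<close>

definition tangent_space :: "('m, 'n::finite) chart set \<Rightarrow> 'm \<Rightarrow> 'm tvec set" where
  "tangent_space A p = {v.
     (\<forall>f h a b. smooth_fun A f \<longrightarrow> smooth_fun A h \<longrightarrow>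
        v (\<lambda>q. a * f q + b * h q) = a * v f + b * v h) \<and>
     (\<forall>f h. smooth_fun A f \<longrightarrow> smooth_fun A h \<longrightarrow>
        v (\<lambda>q. f q * h q) = f p * v h + v f * h p) \<and>
     (\<forall>f. \<not> smooth_fun A f \<longrightarrow> v f = 0)}"

definition coord_vec ::
  "('m, 'n::finite) chart set \<Rightarrow> ('m, 'n) chart \<Rightarrow> 'm \<Rightarrow> complex ^ 'n \<Rightarrow> 'm tvec" where
  "coord_vec A c p e = (\<lambda>f. if smooth_fun A f
     then frechet_derivative (f \<circ> inv_into (fst c) (snd c)) (at (snd c p)) e else 0)"

text \<open>
  The complex structure is multiplication by \<open>\<i>\<close> in any holomorphic chart, i.e.
  \<open>J (\<partial>/\<partial>x\<^sub>k) = \<partial>/\<partial>y\<^sub>k\<close> and \<open>J (\<partial>/\<partial>y\<^sub>k) = - \<partial>/\<partial>x\<^sub>k\<close>.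
\<close>

definition cstruct :: "('m, 'n::finite) chart set \<Rightarrow> 'm \<Rightarrow> 'm tvec \<Rightarrow> 'm tvec" where
  "cstruct A p v = (THE w. \<exists>c\<in>A. \<exists>e. p \<in> fst c \<and>
     v = coord_vec A c p e \<and> w = coord_vec A c p (\<i> *s e))"

definition vector_field :: "('m, 'n::finite) chart set \<Rightarrow> 'm vfield \<Rightarrow> bool" where
  "vector_field A X \<longleftrightarrow>
     (\<forall>p. X p \<in> tangent_space A p) \<and>
     (\<forall>f. smooth_fun A f \<longrightarrow> smooth_fun A (\<lambda>p. X p f))"

definition fmult :: "('m \<Rightarrow> real) \<Rightarrow> 'm vfield \<Rightarrow> 'm vfield" where
  "fmult h X = (\<lambda>p f. h p * X p f)"

definition vapply :: "'m vfield \<Rightarrow> ('m \<Rightarrow> real) \<Rightarrow> ('m \<Rightarrow> real)" where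
  "vapply X f = (\<lambda>p. X p f)"

definition lie_bracket :: "'m vfield \<Rightarrow> 'm vfield \<Rightarrow> 'm vfield" where
  "lie_bracket X Y = (\<lambda>p f. X p (vapply Y f) - Y p (vapply X f))"

definition Jfield :: "('m, 'n::finite) chart set \<Rightarrow> 'm vfield \<Rightarrow> 'm vfield" where
  "Jfield A X = (\<lambda>p. cstruct A p (X p))"

subsection \<open>Hermitian metrics\<close>

type_synonym 'm metric_tensor = "'m \<Rightarrow> 'm tvec \<Rightarrow> 'm tvec \<Rightarrow> real"

definition gfun :: "'m metric_tensor \<Rightarrow> 'm vfield \<Rightarrow> 'm vfield \<Rightarrow> 'm \<Rightarrow> real" where
  "gfun g X Y = (\<lambda>p. g p (X p) (Y p))"

definition riemannian_metric ::
  "('m, 'n::finite) chart set \<Rightarrow> 'm metric_tensor \<Rightarrow> bool" where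
  "riemannian_metric A g \<longleftrightarrow>
     (\<forall>p. \<forall>u\<in>tangent_space A p. \<forall>v\<in>tangent_space A p. \<forall>w\<in>tangent_space A p. \<forall>a b.
        g p (\<lambda>f. a * u f + b * v f) w = a * g p u w + b * g p v w) \<and>
     (\<forall>p. \<forall>v\<in>tangent_space A p. \<forall>w\<in>tangent_space A p. g p v w = g p w v) \<and>
     (\<forall>p. \<forall>v\<in>tangent_space A p. v \<noteq> 0 \<longrightarrow> g p v v > 0) \<and>
     (\<forall>X Y. vector_field A X \<longrightarrow> vector_field A Y \<longrightarrow> smooth_fun A (gfun g X Y))"

definition hermitian_manifold ::
  "('m::{t2_space, second_countable_topology}, 'n::finite) chart set \<Rightarrow> 'm metric_tensor \<Rightarrow> bool"
  where
  "hermitian_manifold A g \<longleftrightarrow>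
     connected (UNIV :: 'm set) \<and> complex_atlas A \<and> riemannian_metric A g \<and>
     (\<forall>p. \<forall>v\<in>tangent_space A p. \<forall>w\<in>tangent_space A p.
        g p (cstruct A p v) (cstruct A p w) = g p v w)"

definition kaehler_form ::
  "('m, 'n::finite) chart set \<Rightarrow> 'm metric_tensor \<Rightarrow> 'm vfield \<Rightarrow> 'm vfield \<Rightarrow> 'm \<Rightarrow> real" where
  "kaehler_form A g X Y = gfun g (Jfield A X) Y"

text \<open>The Kaehler form is closed; its exterior derivative is given by the invariant formula.\<close>

definition kaehler :: "('m, 'n::finite) chart set \<Rightarrow> 'm metric_tensor \<Rightarrow> bool" where
  "kaehler A g \<longleftrightarrow> (\<forall>X Y Z. vector_field A X \<longrightarrow> vector_field A Y \<longrightarrow> vector_field A Z \<longrightarrow>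
     vapply X (kaehler_form A g Y Z) + vapply Y (kaehler_form A g Z X)
       + vapply Z (kaehler_form A g X Y)
       - kaehler_form A g (lie_bracket X Y) Z - kaehler_form A g (lie_bracket Y Z) X
       - kaehler_form A g (lie_bracket Z X) Y = 0)"

subsection \<open>Connections, torsion and curvature\<close>

type_synonym 'm connection = "'m vfield \<Rightarrow> 'm vfield \<Rightarrow> 'm vfield"

definition affine_connection :: "('m, 'n::finite) chart set \<Rightarrow> 'm connection \<Rightarrow> bool" where
  "affine_connection A D \<longleftrightarrow>
     (\<forall>X Y. vector_field A X \<longrightarrow> vector_field A Y \<longrightarrow> vector_field A (D X Y)) \<and>
     (\<forall>X Y Z. vector_field A X \<longrightarrow> vector_field A Y \<longrightarrow> vector_field A Z \<longrightarrow>
        D (X + Y) Z = D X Z + D Y Z \<and> D X (Y + Z) = D X Y + D X Z) \<and>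
     (\<forall>h X Y. smooth_fun A h \<longrightarrow> vector_field A X \<longrightarrow> vector_field A Y \<longrightarrow>
        D (fmult h X) Y = fmult h (D X Y) \<and>
        D X (fmult h Y) = fmult (vapply X h) Y + fmult h (D X Y))"

definition torsion :: "'m connection \<Rightarrow> 'm vfield \<Rightarrow> 'm vfield \<Rightarrow> 'm vfield" where
  "torsion D X Y = D X Y - D Y X - lie_bracket X Y"

definition curvature ::
  "'m connection \<Rightarrow> 'm vfield \<Rightarrow> 'm vfield \<Rightarrow> 'm vfield \<Rightarrow> 'm vfield" where
  "curvature D X Y Z = D X (D Y Z) - D Y (D X Z) - D (lie_bracket X Y) Z"

text \<open>A complex vector field \<open>X + \<i> Y\<close> is represented by the pair \<open>(X, Y)\<close> of real ones.\<close>

type_synonym 'm cvfield = "'m vfield \<times> 'm vfield"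

definition field_10 :: "('m, 'n::finite) chart set \<Rightarrow> 'm cvfield \<Rightarrow> bool" where
  "field_10 A Z \<longleftrightarrow> vector_field A (fst Z) \<and> vector_field A (snd Z) \<and>
     \<comment> \<open>\<open>J Z = \<i> Z\<close> for the complex linear extension of \<open>J\<close>\<close>
     (Jfield A (fst Z), Jfield A (snd Z)) = (- snd Z, fst Z)"

definition conj_field :: "'m cvfield \<Rightarrow> 'm cvfield" where
  "conj_field Z = (fst Z, - snd Z)"

text \<open>The complex bilinear extension of the torsion.\<close>

definition ctorsion :: "'m connection \<Rightarrow> 'm cvfield \<Rightarrow> 'm cvfield \<Rightarrow> 'm cvfield" where
  "ctorsion D Z W =
     (torsion D (fst Z) (fst W) - torsion D (snd Z) (snd W),
      torsion D (fst Z) (snd W) + torsion D (snd Z) (fst W))"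

definition chern_connection ::
  "('m, 'n::finite) chart set \<Rightarrow> 'm metric_tensor \<Rightarrow> 'm connection \<Rightarrow> bool" where
  "chern_connection A g D \<longleftrightarrow> affine_connection A D \<and>
     (\<forall>X Y Z. vector_field A X \<longrightarrow> vector_field A Y \<longrightarrow> vector_field A Z \<longrightarrow>
        vapply X (gfun g Y Z) = gfun g (D X Y) Z + gfun g Y (D X Z)) \<and>
     (\<forall>X Y. vector_field A X \<longrightarrow> vector_field A Y \<longrightarrow> D X (Jfield A Y) = Jfield A (D X Y)) \<and>
     (\<forall>Z W. field_10 A Z \<longrightarrow> field_10 A W \<longrightarrow> ctorsion D Z (conj_field W) = (0, 0))"

definition parallel_torsion :: "('m, 'n::finite) chart set \<Rightarrow> 'm connection \<Rightarrow> bool" where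
  "parallel_torsion A D \<longleftrightarrow>
     (\<forall>W X Y. vector_field A W \<longrightarrow> vector_field A X \<longrightarrow> vector_field A Y \<longrightarrow>
        D W (torsion D X Y) - torsion D (D W X) Y - torsion D X (D W Y) = 0)"

definition parallel_curvature :: "('m, 'n::finite) chart set \<Rightarrow> 'm connection \<Rightarrow> bool" where
  "parallel_curvature A D \<longleftrightarrow>
     (\<forall>W X Y Z. vector_field A W \<longrightarrow> vector_field A X \<longrightarrow> vector_field A Y \<longrightarrow> vector_field A Z \<longrightarrow>
        D W (curvature D X Y Z) - curvature D (D W X) Y Z - curvature D X (D W Y) Z
          - curvature D X Y (D W Z) = 0)"

definition flat :: "('m, 'n::finite) chart set \<Rightarrow> 'm connection \<Rightarrow> bool" where
  "flat A D \<longleftrightarrow>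
     (\<forall>X Y Z. vector_field A X \<longrightarrow> vector_field A Y \<longrightarrow> vector_field A Z \<longrightarrow> curvature D X Y Z = 0)"

subsection \<open>Locally Hermitian symmetric spaces\<close>

text \<open>
  The differential at \<open>q\<close> of a map \<open>s\<close> that is smooth near \<open>q\<close>.  Since tangent vectors act on
  global functions only, \<open>f \<circ> s\<close> is replaced by a global smooth function with the same germ at \<open>q\<close>.
\<close>

definition differential_at ::
  "('m::topological_space, 'n::finite) chart set \<Rightarrow> ('m \<Rightarrow> 'm) \<Rightarrow> 'm \<Rightarrow> 'm tvec \<Rightarrow> 'm tvec" where
  "differential_at A s q v = (THE w. w \<in> tangent_space A (s q) \<and>
     (\<forall>f h. smooth_fun A f \<longrightarrow> smooth_fun A h \<longrightarrow>
        (\<forall>\<^sub>F x in nhds q. h x = f (s x)) \<longrightarrow> w f = v h))"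

text \<open>
  Every point is an isolated fixed point of a local involutive holomorphic isometry
  (after shrinking the neighbourhood, its only fixed point there).
\<close>

definition locally_hermitian_symmetric ::
  "('m::topological_space, 'n::finite) chart set \<Rightarrow> 'm metric_tensor \<Rightarrow> bool" where
  "locally_hermitian_symmetric A g \<longleftrightarrow> (\<forall>p. \<exists>U s.
     open U \<and> p \<in> U \<and> s ` U \<subseteq> U \<and> (\<forall>q\<in>U. s (s q) = q) \<and>
     (\<forall>q\<in>U. s q = q \<longleftrightarrow> q = p) \<and>
     holomorphic_map_on A s U \<and>
     (\<forall>q\<in>U. \<forall>v\<in>tangent_space A q. \<forall>w\<in>tangent_space A q.
        g (s q) (differential_at A s q v) (differential_at A s q w) = g q v w))"

end

theory Submission
  imports Defs "HOL-Complex_Analysis.Complex_Analysis"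
begin

text \<open>
  Since the torsion \<open>T\<close> and the curvature \<open>R\<close> are parallel, their zero sets are open and closed, so
  each of them vanishes everywhere or nowhere.

  If \<open>T = 0\<close>, the Kaehler form is parallel for a torsion-free connection, hence closed.  With respect to a
  parallel frame along the geodesic with initial velocity \<open>v\<close>, the Jacobi field \<open>\<theta>\<close> with \<open>\<theta>(0) = 0\<close>,
  \<open>\<theta>'(0) = w\<close> solves \<open>\<theta>' = w + \<Omega> v\<close>, \<open>\<Omega>' = R(v, \<theta>)\<close>, where \<open>R\<close> is constant.  This system is
  invariant under \<open>(v, w, \<theta>, \<Omega>) \<mapsto> (-v, -w, -\<theta>, \<Omega>)\<close>, so the differential of the geodesic reflection
  is \<open>-1\<close> in parallel frames and the reflection is a holomorphic isometry.

  If neither \<open>T\<close> nor \<open>R\<close> vanishes anywhere, the Bianchi identities and the fact that \<open>R(x, y)\<close> acts on \<open>T\<close> and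
  \<open>R\<close> as a derivation force, in complex dimension 3, the form \<open>\<tau>(u) = tr T(u, \<cdot>)\<close> to be nonzero: there is a basis
  of eigenvectors of \<open>R(x, y)\<close> whose eigenvalues leave \<open>T\<close> hardly any nonzero entries.  The vector field \<open>F\<close> dual
  to \<open>\<tau>\<close> is parallel, and its divergence with respect to the Riemannian volume is \<open>\<tau>(F) = \<parallel>F\<parallel>\<^sup>2 > 0\<close>,
  which contradicts the divergence theorem on a compact manifold.
\<close>

text \<open>For the Chern connection \<open>T\<close> is complex bilinear, so the second Bianchi
  identity splits into its linear and antilinear parts; this forces the curvature to vanish as soon
  as one of its arguments is a value of \<open>T\<close>. Since \<open>R(x, y)\<close> kills the
  values of \<open>T\<close> but is a derivation of \<open>T\<close>, an entry
  \<open>T(a, b)\<close> with eigenvectors \<open>a\<close>, \<open>b\<close> survives only if the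
  two eigenvalues add up to 0. In dimension 3 two patterns remain. In the first, every
  \<open>T(u, \<cdot>)\<close> has rank one and a suitable \<open>u\<close> has nonzero trace. The
  obstacle is the second, with eigenvalues \<open>m\<close>, \<open>-m\<close>, 0 and
  \<open>T(e1, e2)\<close> nonzero, where \<open>\<tau>\<close> would be 0: it is excluded by the
  curvature, whose entries reduce to two numbers that a commutator identity annihilates. The
  divergence of a parallel field is \<open>\<tau>(F)\<close> because the connection is metric:
  differentiating the density and differentiating \<open>F\<close> produce the traces of the
  connection form in its two slots, and their difference is the trace of the torsion. Tangent
  vectors act on global functions only, so every local argument first passes to global functions or
  fields with the same germ.\<close>

section \<open>Calculus of \<open>Ck_on\<close> and smooth maps\<close>

definition smooth_on :: "'a::real_normed_vector set \<Rightarrow> ('a \<Rightarrow> 'b::real_normed_vector) \<Rightarrow> bool" where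
  "smooth_on S f \<longleftrightarrow> (\<forall>k. Ck_on k S f)"

lemma Ck_on_cong:
  assumes "open S" "\<And>x. x \<in> S \<Longrightarrow> f x = g x"
  shows "Ck_on k S f \<longleftrightarrow> Ck_on k S g"
proof -
  have imp: "Ck_on k S f \<Longrightarrow> Ck_on k S g" if "\<And>x. x \<in> S \<Longrightarrow> f x = g x"
    for f g :: "'a \<Rightarrow> 'b"
    using that
  proof (induction k arbitrary: f g)
    case 0
    then show ?case by (metis Ck_on.simps(1) continuous_on_cong)
  next
    case (Suc k)
    have "g differentiable at x" if "x \<in> S" for x
      using Suc.prems that assms(1) unfolding differentiable_def
      by (metis Ck_on.simps(2) differentiable_def has_derivative_transform_within_open)
    moreover have "frechet_derivative f (at x) v = frechet_derivative g (at x) v" if "x \<in> S" for x v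
      using frechet_derivative_transform_within_open[of f x S g] Suc.prems that assms(1) by simp
    moreover have "Ck_on k S (\<lambda>x. frechet_derivative g (at x) v)" for v
      by (rule Suc.IH[of "\<lambda>x. frechet_derivative f (at x) v"]) (use Suc.prems calculation in auto)
    ultimately show ?case by simp
  qed
  show ?thesis using imp[of f g] imp[of g f] assms(2) by auto
qed

lemma Ck_on_SucI:
  assumes "open S" "\<And>x. x \<in> S \<Longrightarrow> (f has_derivative f' x) (at x)"
    and "\<And>v. Ck_on k S (\<lambda>x. f' x v)"
  shows "Ck_on (Suc k) S f"
proof -
  have "frechet_derivative f (at x) = f' x" if "x \<in> S" for x
    using frechet_derivative_at[OF assms(2)[OF that]] by simp
  then have "Ck_on k S (\<lambda>x. frechet_derivative f (at x) v)" for v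
    using Ck_on_cong[OF assms(1), of "\<lambda>x. frechet_derivative f (at x) v" "\<lambda>x. f' x v" k]
      assms(3) by simp
  then show ?thesis using assms(2) by (auto simp: differentiable_def)
qed

lemma Ck_on_imp_continuous_on: "Ck_on k S f \<Longrightarrow> continuous_on S f"
  by (cases k) (auto intro!: continuous_at_imp_continuous_on differentiable_imp_continuous_within)

lemma Ck_on_SucD: "Ck_on (Suc k) S f \<Longrightarrow> Ck_on k S f"
proof (induction k arbitrary: f)
  case 0
  then show ?case using Ck_on_imp_continuous_on by (metis Ck_on.simps(1))
next
  case (Suc k)
  then show ?case by (metis Ck_on.simps(2))
qed

lemma Ck_on_subset: "Ck_on k S f \<Longrightarrow> T \<subseteq> S \<Longrightarrow> Ck_on k T f"
  by (induction k arbitrary: f) (auto intro: continuous_on_subset)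

lemma Ck_on_local:
  assumes "\<And>x. x \<in> S \<Longrightarrow> \<exists>T. open T \<and> x \<in> T \<and> Ck_on k T f"
  shows "Ck_on k S f"
  using assms
proof (induction k arbitrary: f)
  case 0
  then show ?case
    by (simp add: continuous_on_eq_continuous_at)
      (meson continuous_at_imp_continuous_on continuous_on_eq_continuous_at)
next
  case (Suc k)
  show ?case unfolding Ck_on.simps
  proof (intro conjI ballI allI)
    show "f differentiable at x" if "x \<in> S" for x using Suc.prems[OF that] by auto
    show "Ck_on k S (\<lambda>x. frechet_derivative f (at x) v)" for v
      by (rule Suc.IH) (use Suc.prems in fastforce)
  qed
qed

lemma has_derivative_frechet:
  "f differentiable at x \<Longrightarrow> (f has_derivative frechet_derivative f (at x)) (at x)"
  by (simp add: frechet_derivative_works)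

lemma Ck_on_const: "Ck_on k S (\<lambda>x. c)"
proof (induction k arbitrary: c)
  case (Suc k)
  show ?case using Suc by simp
qed simp

lemma Ck_on_bounded_linear:
  assumes "open S" "bounded_linear h"
  shows "Ck_on k S h"
proof (cases k)
  case 0
  then show ?thesis using linear_continuous_on[OF assms(2)] by simp
next
  case (Suc k)
  show ?thesis unfolding Suc
    by (rule Ck_on_SucI[OF assms(1), of _ "\<lambda>_. h"])
      (use assms(2) in \<open>auto intro: bounded_linear_imp_has_derivative Ck_on_const\<close>)
qed

lemma Ck_on_compose_linear:
  assumes "open S" "bounded_linear h" "Ck_on k S f"
  shows "Ck_on k S (\<lambda>x. h (f x))"
  using assms(3)
proof (induction k arbitrary: f)
  case 0
  then show ?case using bounded_linear.continuous_on[OF assms(2)] by simp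
next
  case (Suc k)
  show ?case
  proof (rule Ck_on_SucI[OF assms(1)])
    show "((\<lambda>x. h (f x)) has_derivative (\<lambda>v. h (frechet_derivative f (at x) v))) (at x)"
      if "x \<in> S" for x
      using Suc.prems that
      by (auto intro!: bounded_linear.has_derivative[OF assms(2)] has_derivative_frechet)
    show "Ck_on k S (\<lambda>x. h (frechet_derivative f (at x) v))" for v
      using Suc by auto
  qed
qed

lemma Ck_on_add:
  assumes "open S" "Ck_on k S f" "Ck_on k S g"
  shows "Ck_on k S (\<lambda>x. f x + g x)"
  using assms(2,3)
proof (induction k arbitrary: f g)
  case 0
  then show ?case by (simp add: continuous_on_add)
next
  case (Suc k)
  show ?case
  proof (rule Ck_on_SucI[OF assms(1)])
    show "((\<lambda>x. f x + g x) has_derivative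
       (\<lambda>v. frechet_derivative f (at x) v + frechet_derivative g (at x) v)) (at x)"
      if "x \<in> S" for x
      using Suc.prems that by (auto intro!: has_derivative_add has_derivative_frechet)
    show "Ck_on k S (\<lambda>x. frechet_derivative f (at x) v + frechet_derivative g (at x) v)" for v
      using Suc by auto
  qed
qed

lemma Ck_on_sum:
  assumes "open S" "\<And>i. i \<in> I \<Longrightarrow> Ck_on k S (f i)"
  shows "Ck_on k S (\<lambda>x. \<Sum>i\<in>I. f i x)"
  using assms(2)
  by (induction I rule: infinite_finite_induct) (auto intro: Ck_on_const Ck_on_add[OF assms(1)])

lemma Ck_on_bilinear:
  assumes "open S" "bounded_bilinear pr" "Ck_on k S f" "Ck_on k S g"
  shows "Ck_on k S (\<lambda>x. pr (f x) (g x))"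
  using assms(3,4)
proof (induction k arbitrary: f g)
  case 0
  then show ?case by (simp add: bounded_bilinear.continuous_on[OF assms(2)])
next
  case (Suc k)
  show ?case
  proof (rule Ck_on_SucI[OF assms(1)])
    show "((\<lambda>x. pr (f x) (g x)) has_derivative
       (\<lambda>v. pr (f x) (frechet_derivative g (at x) v) + pr (frechet_derivative f (at x) v) (g x))) (at x)"
      if "x \<in> S" for x
      using Suc.prems that
      by (auto intro!: bounded_bilinear.FDERIV[OF assms(2)] has_derivative_frechet)
    have "Ck_on k S f" "Ck_on k S g" using Suc.prems by (auto dest: Ck_on_SucD simp del: Ck_on.simps)
    then show "Ck_on k S (\<lambda>x. pr (f x) (frechet_derivative g (at x) v)
        + pr (frechet_derivative f (at x) v) (g x))" for v
      using Suc by (auto intro!: Ck_on_add[OF assms(1)])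
  qed
qed

lemma linear_basis_expansion:
  fixes f :: "'a::euclidean_space \<Rightarrow> 'b::real_vector"
  assumes "linear f"
  shows "f w = (\<Sum>b\<in>Basis. (w \<bullet> b) *\<^sub>R f b)"
proof -
  have "f (\<Sum>b\<in>Basis. (w \<bullet> b) *\<^sub>R b) = (\<Sum>b\<in>Basis. (w \<bullet> b) *\<^sub>R f b)"
    by (simp add: linear_sum[OF assms] linear_scale[OF assms])
  then show ?thesis by (simp add: euclidean_representation)
qed

text \<open>\<open>Ck_on\<close> only sees derivatives in a fixed direction \<open>v\<close>,
  whereas the chain rule evaluates the derivative of \<open>g\<close> in a moving direction.
  Expanding that direction in \<open>Basis\<close> gives a sum of products to which the induction
  hypothesis applies; this is why the middle space is Euclidean.\<close>

lemma Ck_on_compose: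
  fixes f :: "'a::real_normed_vector \<Rightarrow> 'b::euclidean_space" and g :: "'b \<Rightarrow> 'c::real_normed_vector"
  assumes "open S" "open T" "Ck_on k S f" "Ck_on k T g" "\<And>x. x \<in> S \<Longrightarrow> f x \<in> T"
  shows "Ck_on k S (\<lambda>x. g (f x))"
  using assms(3,4)
proof (induction k arbitrary: g)
  case 0
  then show ?case using assms(5) by (auto intro!: continuous_on_compose2[of T g S f])
next
  case (Suc k)
  define g' where "g' = (\<lambda>y v. frechet_derivative g (at y) v)"
  have g': "(g has_derivative g' y) (at y)" if "y \<in> T" for y
    using Suc.prems(2) that unfolding g'_def by (auto intro: has_derivative_frechet)
  have lin: "bounded_linear (g' y)" if "y \<in> T" for y using g'[OF that] by (rule has_derivative_bounded_linear)
  show ?case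
  proof (rule Ck_on_SucI[OF assms(1)])
    show "((\<lambda>x. g (f x)) has_derivative
       (\<lambda>v. \<Sum>b\<in>Basis. (frechet_derivative f (at x) v \<bullet> b) *\<^sub>R g' (f x) b)) (at x)"
      if "x \<in> S" for x
    proof -
      have "((\<lambda>x. g (f x)) has_derivative (\<lambda>v. g' (f x) (frechet_derivative f (at x) v))) (at x)"
        using Suc.prems that assms(5)
        by (intro has_derivative_compose[OF _ g'] has_derivative_frechet) auto
      moreover have "(\<lambda>v. g' (f x) (frechet_derivative f (at x) v)) =
          (\<lambda>v. \<Sum>b\<in>Basis. (frechet_derivative f (at x) v \<bullet> b) *\<^sub>R g' (f x) b)"
        using linear_basis_expansion bounded_linear.linear[OF lin] assms(5) that by blast
      ultimately show ?thesis by (rule has_derivative_eq_rhs)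
    qed
    have f: "Ck_on k S f" using Suc.prems(1) by (rule Ck_on_SucD)
    show "Ck_on k S (\<lambda>x. \<Sum>b\<in>Basis. (frechet_derivative f (at x) v \<bullet> b) *\<^sub>R g' (f x) b)" for v
    proof (intro Ck_on_sum[OF assms(1)] Ck_on_bilinear[OF assms(1) bounded_bilinear_scaleR])
      fix b :: 'b
      show "Ck_on k S (\<lambda>x. frechet_derivative f (at x) v \<bullet> b)"
        using Suc.prems(1) by (auto intro: Ck_on_compose_linear[OF assms(1) bounded_linear_inner_left])
      show "Ck_on k S (\<lambda>x. g' (f x) b)"
        using Suc.IH[OF f, of "\<lambda>y. g' y b"] Suc.prems(2) by (simp add: g'_def)
    qed
  qed
qed

lemma Ck_on_inverse:
  assumes "open S" "\<And>x. x \<in> S \<Longrightarrow> f x \<noteq> (0::real)" "Ck_on k S f"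
  shows "Ck_on k S (\<lambda>x. inverse (f x))"
  using assms(3)
proof (induction k)
  case 0
  then show ?case using assms(2) by (auto intro!: continuous_intros)
next
  case (Suc k)
  have f: "Ck_on k S f" using Suc.prems(1) by (rule Ck_on_SucD)
  have i: "Ck_on k S (\<lambda>x. inverse (f x))" by (rule Suc.IH[OF f])
  show ?case
  proof (rule Ck_on_SucI[OF assms(1)])
    show "((\<lambda>x. inverse (f x)) has_derivative
       (\<lambda>v. (-1) * (inverse (f x) * (frechet_derivative f (at x) v * inverse (f x))))) (at x)"
      if "x \<in> S" for x
      using Suc.prems that assms(2)
      by (auto intro!: derivative_eq_intros has_derivative_frechet)
    show "Ck_on k S (\<lambda>x. (-1) * (inverse (f x) * (frechet_derivative f (at x) v * inverse (f x))))" for v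
      using Suc.prems i
      by (intro Ck_on_bilinear[OF assms(1) bounded_bilinear_mult] Ck_on_const) auto
  qed
qed

lemma smooth_onD: "smooth_on S f \<Longrightarrow> x \<in> S \<Longrightarrow> (f has_derivative frechet_derivative f (at x)) (at x)"
  unfolding smooth_on_def by (metis Ck_on.simps(2) has_derivative_frechet)

lemma smooth_on_deriv: "smooth_on S f \<Longrightarrow> smooth_on S (\<lambda>x. frechet_derivative f (at x) v)"
  unfolding smooth_on_def by (metis Ck_on.simps(2))

lemma smooth_on_continuous: "smooth_on S f \<Longrightarrow> continuous_on S f"
  unfolding smooth_on_def by (metis Ck_on.simps(1))

lemma smooth_on_cong:
  "open S \<Longrightarrow> (\<And>x. x \<in> S \<Longrightarrow> f x = g x) \<Longrightarrow> smooth_on S f \<longleftrightarrow> smooth_on S g"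
  unfolding smooth_on_def using Ck_on_cong by metis

lemma smooth_on_subset: "smooth_on S f \<Longrightarrow> T \<subseteq> S \<Longrightarrow> smooth_on T f"
  unfolding smooth_on_def using Ck_on_subset by metis

lemma smooth_on_local:
  assumes "\<And>x. x \<in> S \<Longrightarrow> \<exists>T. open T \<and> x \<in> T \<and> smooth_on T f"
  shows "smooth_on S f"
  using assms unfolding smooth_on_def by (metis Ck_on_local)

lemma smooth_on_const: "smooth_on S (\<lambda>x. c)"
  unfolding smooth_on_def using Ck_on_const by blast

lemma smooth_on_bounded_linear: "open S \<Longrightarrow> bounded_linear h \<Longrightarrow> smooth_on S h"
  unfolding smooth_on_def using Ck_on_bounded_linear by blast

lemma smooth_on_compose_linear:
  "open S \<Longrightarrow> bounded_linear h \<Longrightarrow> smooth_on S f \<Longrightarrow> smooth_on S (\<lambda>x. h (f x))"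
  unfolding smooth_on_def using Ck_on_compose_linear by blast

lemma smooth_on_add:
  "open S \<Longrightarrow> smooth_on S f \<Longrightarrow> smooth_on S g \<Longrightarrow> smooth_on S (\<lambda>x. f x + g x)"
  unfolding smooth_on_def using Ck_on_add by blast

lemma smooth_on_bilinear:
  "open S \<Longrightarrow> bounded_bilinear pr \<Longrightarrow> smooth_on S f \<Longrightarrow> smooth_on S g
    \<Longrightarrow> smooth_on S (\<lambda>x. pr (f x) (g x))"
  unfolding smooth_on_def using Ck_on_bilinear by blast

lemmas smooth_on_mult = smooth_on_bilinear[OF _ bounded_bilinear_mult]
lemmas smooth_on_scaleR = smooth_on_bilinear[OF _ bounded_bilinear_scaleR]

lemma smooth_on_minus: "open S \<Longrightarrow> smooth_on S f \<Longrightarrow> smooth_on S (\<lambda>x. - f x)"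
  using smooth_on_compose_linear[OF _ bounded_linear_minus[OF bounded_linear_ident]] by blast

lemma smooth_on_diff:
  "open S \<Longrightarrow> smooth_on S f \<Longrightarrow> smooth_on S g \<Longrightarrow> smooth_on S (\<lambda>x. f x - g x)"
  using smooth_on_add[of S f "\<lambda>x. - g x"] smooth_on_minus[of S g] by simp

lemma smooth_on_sum:
  "open S \<Longrightarrow> (\<And>i. i \<in> I \<Longrightarrow> smooth_on S (f i)) \<Longrightarrow> smooth_on S (\<lambda>x. \<Sum>i\<in>I. f i x)"
  unfolding smooth_on_def by (intro allI Ck_on_sum) auto

lemma smooth_on_compose:
  fixes f :: "'a::real_normed_vector \<Rightarrow> 'b::euclidean_space" and g :: "'b \<Rightarrow> 'c::real_normed_vector"
  shows "open S \<Longrightarrow> open T \<Longrightarrow> smooth_on S f \<Longrightarrow> smooth_on T g \<Longrightarrow> (\<And>x. x \<in> S \<Longrightarrow> f x \<in> T)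
    \<Longrightarrow> smooth_on S (\<lambda>x. g (f x))"
  unfolding smooth_on_def using Ck_on_compose by blast

lemma smooth_on_inverse:
  "open S \<Longrightarrow> (\<And>x. x \<in> S \<Longrightarrow> f x \<noteq> (0::real)) \<Longrightarrow> smooth_on S f \<Longrightarrow> smooth_on S (\<lambda>x. inverse (f x))"
  unfolding smooth_on_def using Ck_on_inverse by blast

lemma smooth_on_id: "open S \<Longrightarrow> smooth_on S (\<lambda>x. x)"
  by (simp add: smooth_on_bounded_linear)

lemma smooth_on_deriv_field:
  fixes f :: "'a::euclidean_space \<Rightarrow> 'b::real_normed_vector"
  assumes "open S" "smooth_on S f" "smooth_on S v"
  shows "smooth_on S (\<lambda>x. frechet_derivative f (at x) (v x))"
proof -
  have "smooth_on S (\<lambda>x. \<Sum>b\<in>Basis. (v x \<bullet> b) *\<^sub>R frechet_derivative f (at x) b)"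
    using assms by (intro smooth_on_sum smooth_on_scaleR smooth_on_deriv)
      (auto intro: smooth_on_compose_linear[OF _ bounded_linear_inner_left])
  moreover have "frechet_derivative f (at x) (v x) = (\<Sum>b\<in>Basis. (v x \<bullet> b) *\<^sub>R frechet_derivative f (at x) b)"
    if "x \<in> S" for x
    using smooth_onD[OF assms(2) that] by (intro linear_basis_expansion has_derivative_linear)
  ultimately show ?thesis using smooth_on_cong[OF assms(1)] by (metis (no_types, lifting))
qed

lemma smooth_on_components:
  fixes f :: "'a::real_normed_vector \<Rightarrow> 'b::euclidean_space"
  assumes "open S" "\<And>b. b \<in> Basis \<Longrightarrow> smooth_on S (\<lambda>x. f x \<bullet> b)"
  shows "smooth_on S f"
proof -
  have "smooth_on S (\<lambda>x. \<Sum>b\<in>Basis. (f x \<bullet> b) *\<^sub>R b)"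
    using assms by (intro smooth_on_sum smooth_on_scaleR smooth_on_const) auto
  then show ?thesis by (simp add: euclidean_representation)
qed

subsection \<open>Bump functions\<close>

text \<open>The classical flat function \<open>exp (- 1 / t)\<close> with extra powers of
  \<open>1 / t\<close>. Derivatives of members are linear combinations of members, so smoothness can
  be proved for all \<open>m\<close> at once.\<close>

definition flat_exp :: "nat \<Rightarrow> real \<Rightarrow> real" where
  "flat_exp m t = (if t \<le> 0 then 0 else exp (- inverse t) * inverse t ^ m)"

lemma flat_exp_tendsto: "(flat_exp m \<longlongrightarrow> 0) (at 0)"
proof -
  have "((\<lambda>t. inverse t ^ m / exp (inverse t)) \<longlongrightarrow> 0) (at_right (0::real))"
    by (rule filterlim_compose[OF tendsto_power_div_exp_0 filterlim_inverse_at_top_right])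
  moreover have "\<forall>\<^sub>F t in at_right 0. inverse t ^ m / exp (inverse t) = flat_exp m t"
    by (auto simp: eventually_at_right_less flat_exp_def exp_minus divide_inverse mult.commute
        eventually_at_filter)
  ultimately have "(flat_exp m \<longlongrightarrow> 0) (at_right 0)" by (rule Lim_transform_eventually)
  moreover have "(flat_exp m \<longlongrightarrow> 0) (at_left 0)"
    by (rule Lim_transform_eventually[OF tendsto_const])
      (auto simp: flat_exp_def eventually_at_filter)
  ultimately show ?thesis by (simp add: filterlim_at_split)
qed

lemma flat_exp_deriv:
  "(flat_exp m has_field_derivative flat_exp (m + 2) t - real m * flat_exp (m + 1) t) (at t)"
proof -
  consider "t > 0" | "t < 0" | "t = 0" by linarith
  then show ?thesis
  proof cases
    case 1
    have e: "flat_exp (m + 2) t - real m * flat_exp (m + 1) t =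
       exp (- inverse t) * inverse t ^ (m + 2) - real m * (exp (- inverse t) * inverse t ^ (m + 1))"
      using 1 by (simp add: flat_exp_def)
    have p: "real m * inverse t ^ (m - Suc 0) * (inverse t * inverse t) = real m * inverse t ^ (m + 1)"
      by (cases m) (auto simp: algebra_simps)
    have d1: "((\<lambda>t. exp (- inverse t)) has_field_derivative exp (- inverse t) * (inverse t * inverse t)) (at t)"
      using 1 by (auto intro!: derivative_eq_intros)
    have d2: "((\<lambda>t. inverse t ^ m) has_field_derivative - (real m * inverse t ^ (m - Suc 0) * (inverse t * inverse t))) (at t)"
      using 1 by (auto intro!: derivative_eq_intros)
    have "((\<lambda>t. exp (- inverse t) * inverse t ^ m) has_field_derivative
       flat_exp (m + 2) t - real m * flat_exp (m + 1) t) (at t)"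
      using DERIV_mult[OF d1 d2] unfolding p e by (simp add: algebra_simps)
    then show ?thesis
      by (rule has_field_derivative_transform_within_open[of _ _ _ "{0<..}"])
        (use 1 in \<open>auto simp: flat_exp_def\<close>)
  next
    case 2
    have "((\<lambda>t. 0) has_field_derivative flat_exp (m + 2) t - real m * flat_exp (m + 1) t) (at t)"
      using 2 by (simp add: flat_exp_def)
    then show ?thesis
      by (rule has_field_derivative_transform_within_open[of _ _ _ "{..<0}"])
        (use 2 in \<open>auto simp: flat_exp_def\<close>)
  next
    case 3
    \<comment> \<open>At 0 the difference quotient of \<open>flat_exp m\<close> is
      \<open>flat_exp (m + 1)\<close>, which tends to 0.\<close>
    have "((\<lambda>h. (flat_exp m (0 + h) - flat_exp m 0) / h) \<longlongrightarrow> 0) (at 0)"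
      by (rule Lim_transform_eventually[OF flat_exp_tendsto[of "m + 1"]])
        (auto simp: flat_exp_def eventually_at_filter divide_inverse)
    then show ?thesis using 3 by (simp add: DERIV_def flat_exp_def)
  qed
qed

lemma Ck_on_flat_exp: "Ck_on k UNIV (flat_exp m)"
proof (induction k arbitrary: m)
  case 0
  show ?case using flat_exp_deriv by (auto intro!: DERIV_continuous_on continuous_at_imp_continuous_on DERIV_isCont)
next
  case (Suc k)
  show ?case
  proof (rule Ck_on_SucI[of _ _ "\<lambda>t v. (flat_exp (m + 2) t + (- real m) * flat_exp (m + 1) t) * v"])
    show "(flat_exp m has_derivative (\<lambda>v. (flat_exp (m + 2) t + (- real m) * flat_exp (m + 1) t) * v)) (at t)" for t
      using flat_exp_deriv[of m t] unfolding has_field_derivative_def by simp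
    show "Ck_on k UNIV (\<lambda>t. (flat_exp (m + 2) t + (- real m) * flat_exp (m + 1) t) * v)" for v
      by (intro Ck_on_bilinear[OF _ bounded_bilinear_mult] Ck_on_add Ck_on_const Suc.IH open_UNIV)
  qed simp
qed

lemma bump_exists:
  fixes x0 :: "'a::euclidean_space"
  assumes "0 < r"
  obtains b :: "'a \<Rightarrow> real" where "smooth_on UNIV b" "\<And>x. 0 \<le> b x" "\<And>x. b x \<le> 1"
    "\<And>x. dist x x0 \<le> r \<Longrightarrow> b x = 1" "\<And>x. x \<notin> cball x0 (2 * r) \<Longrightarrow> b x = 0"
proof -
  define s where "s = (\<lambda>x. ((x - x0) \<bullet> (x - x0)) / r\<^sup>2)"
  define e where "e = flat_exp 0"
  \<comment> \<open>\<open>s\<close> is the squared distance in units of \<open>r\<close>. The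
    quotient is 1 for \<open>s \<le> 1\<close> and 0 for \<open>s \<ge> 2\<close>; its denominator
    is positive since \<open>2 - s\<close> or \<open>s - 1\<close> is. Distance \<open>2 * r\<close>
    means \<open>s = 4\<close>, which leaves room.\<close>
  define b where "b = (\<lambda>x. e (2 - s x) * inverse (e (2 - s x) + e (s x - 1)))"
  have e: "e t > 0" if "t > 0" for t using that by (simp add: e_def flat_exp_def)
  have e0: "e t = 0" if "t \<le> 0" for t using that by (simp add: e_def flat_exp_def)
  have e1: "e t \<ge> 0" for t by (simp add: e_def flat_exp_def)
  have pos: "e (2 - t) + e (t - 1) > 0" for t
    using e[of "2 - t"] e[of "t - 1"] e1[of "2 - t"] e1[of "t - 1"] by (cases "t < 2") auto
  have es: "smooth_on UNIV e" unfolding smooth_on_def e_def using Ck_on_flat_exp by blast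
  have id: "smooth_on UNIV (\<lambda>x::'a. x - x0)" by (intro smooth_on_diff smooth_on_id smooth_on_const open_UNIV)
  have ss: "smooth_on UNIV s" unfolding s_def divide_inverse
    by (intro smooth_on_mult smooth_on_const smooth_on_bilinear[OF _ bounded_bilinear_inner] id open_UNIV)
  have s1: "smooth_on UNIV (\<lambda>x. e (2 - s x))" "smooth_on UNIV (\<lambda>x. e (s x - 1))"
    using ss by (auto intro!: smooth_on_compose[OF _ _ _ es] smooth_on_diff smooth_on_const)
  show ?thesis
  proof
    show "smooth_on UNIV b" unfolding b_def
      by (intro smooth_on_mult smooth_on_inverse smooth_on_add s1 open_UNIV) (use pos in \<open>simp add: less_imp_neq[symmetric]\<close>)
    show "0 \<le> b x" for x using pos[of "s x"] e1 by (simp add: b_def)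
    show "b x \<le> 1" for x using pos[of "s x"] e1[of "s x - 1"] by (simp add: b_def field_simps)
    fix x
    have sx: "s x = (dist x x0)\<^sup>2 / r\<^sup>2" by (simp add: s_def dist_norm power2_norm_eq_inner)
    show "b x = 1" if "dist x x0 \<le> r"
    proof -
      have "s x \<le> 1" using that assms by (simp add: sx power_mono)
      then show ?thesis using pos[of "s x"] e0[of "s x - 1"] by (simp add: b_def)
    qed
    show "b x = 0" if "x \<notin> cball x0 (2 * r)"
    proof -
      have "(2 * r)\<^sup>2 < (dist x x0)\<^sup>2" using that assms
        by (intro power_strict_mono) (auto simp: dist_commute)
      then have "2 * r\<^sup>2 < (dist x x0)\<^sup>2" using assms by (simp add: power_mult_distrib)
          (smt (verit) zero_le_power2)
      then have "s x \<ge> 2" using assms by (simp add: sx field_simps)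
      then show ?thesis using e0[of "2 - s x"] by (simp add: b_def)
    qed
  qed
qed

subsection \<open>Parametric integrals\<close>

lemma continuous_on_slice:
  assumes "continuous_on (U \<times> T) (\<lambda>(x, t). f x t)" "x \<in> U"
  shows "continuous_on T (f x)"
proof -
  have "continuous_on T (\<lambda>t. (x, t))" by (intro continuous_intros)
  then have "continuous_on T (\<lambda>t. case (x, t) of (x, t) \<Rightarrow> f x t)"
    by (rule continuous_on_compose2[OF assms(1)]) (use assms(2) in auto)
  then show ?thesis by simp
qed

text \<open>The Leibniz rule takes the derivative as a bounded linear function, hence the packing
  into \<open>Blinfun\<close>; continuity in each direction suffices because the domain is
  finite-dimensional.\<close>

lemma has_derivative_parametric_integral:
  fixes f :: "'a::euclidean_space \<Rightarrow> real \<Rightarrow> 'b::euclidean_space"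
  assumes U: "open U" "convex U" "x0 \<in> U"
    and der: "\<And>x t. x \<in> U \<Longrightarrow> t \<in> {a..b} \<Longrightarrow> ((\<lambda>x. f x t) has_derivative f' x t) (at x)"
    and cont': "\<And>v. continuous_on (U \<times> {a..b}) (\<lambda>(x, t). f' x t v)"
    and cont: "\<And>x. x \<in> U \<Longrightarrow> continuous_on {a..b} (f x)"
  shows "((\<lambda>x. integral {a..b} (f x)) has_derivative (\<lambda>v. integral {a..b} (\<lambda>t. f' x0 t v))) (at x0)"
proof -
  define fx where "fx = (\<lambda>x t. Blinfun (f' x t))"
  have fx: "blinfun_apply (fx x t) = f' x t" if "x \<in> U" "t \<in> {a..b}" for x t
    unfolding fx_def by (rule bounded_linear_Blinfun_apply[OF has_derivative_bounded_linear[OF der[OF that]]])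
  have c: "continuous_on (U \<times> cbox a b) (\<lambda>(x, t). fx x t)"
  proof (rule continuous_on_blinfun_componentwise)
    fix i :: 'a
    show "continuous_on (U \<times> cbox a b) (\<lambda>x. blinfun_apply (case x of (x, t) \<Rightarrow> fx x t) i)"
      using cont'[of i] by (auto simp: fx elim!: continuous_on_eq)
  qed
  have "((\<lambda>x. integral (cbox a b) (f x)) has_derivative integral (cbox a b) (fx x0)) (at x0 within U)"
  proof (rule leibniz_rule[OF _ _ c])
    show "((\<lambda>x. f x t) has_derivative blinfun_apply (fx x t)) (at x within U)"
      if "x \<in> U" "t \<in> cbox a b" for x t
      using der[of x t] fx[of x t] that by (simp add: has_derivative_at_withinI)
    show "f x integrable_on cbox a b" if "x \<in> U" for x
      using cont[OF that] by (simp add: integrable_continuous_real)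
  qed (use U in auto)
  then have 1: "((\<lambda>x. integral {a..b} (f x)) has_derivative integral {a..b} (fx x0)) (at x0)"
    by (simp only: at_within_open[OF U(3,1)] box_real)
  have "continuous_on (cbox a b) (fx x0)"
    by (rule continuous_on_slice[OF c U(3)])
  then have "fx x0 integrable_on {a..b}" using integrable_continuous[of a b "fx x0"] by simp
  then have "integral {a..b} (\<lambda>t. fx x0 t v) = integral {a..b} (fx x0) v" for v
    by (rule blinfun_apply_integral[symmetric])
  moreover have "integral {a..b} (\<lambda>t. fx x0 t v) = integral {a..b} (\<lambda>t. f' x0 t v)" for v
    by (rule integral_cong) (simp add: fx U)
  ultimately have "blinfun_apply (integral {a..b} (fx x0)) = (\<lambda>v. integral {a..b} (\<lambda>t. f' x0 t v))"
    by auto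
  then show ?thesis using 1 by simp
qed

lemma segment_in_ball:
  fixes x :: "'a::real_normed_vector"
  assumes "x \<in> ball x0 r" "0 \<le> t" "t \<le> (1::real)"
  shows "x0 + t *\<^sub>R (x - x0) \<in> ball x0 r"
proof -
  have "norm (t *\<^sub>R (x - x0)) \<le> norm (x - x0)" using assms(2,3) by (simp add: mult_left_le_one_le)
  then show ?thesis using assms(1) by (auto simp: dist_norm norm_minus_commute)
qed

text \<open>Differentiating in \<open>x\<close> under the integral brings out one more factor
  \<open>t\<close>. The weight \<open>t ^ m\<close> makes this class of integrals stable under
  differentiation, and the induction runs over \<open>m\<close> and \<open>G\<close>
  together.\<close>

lemma Ck_on_radial_integral:
  fixes G :: "'a::euclidean_space \<Rightarrow> 'b::euclidean_space"
  assumes "\<And>k. Ck_on k (ball x0 r) G"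
  shows "Ck_on k (ball x0 r) (\<lambda>x. integral {0..1} (\<lambda>t. t ^ m *\<^sub>R G (x0 + t *\<^sub>R (x - x0))))"
  proof -
  have cont: "continuous_on (ball x0 r \<times> {0..1}) (\<lambda>(x, t). t ^ m *\<^sub>R G (x0 + t *\<^sub>R (x - x0)))"
    if "continuous_on (ball x0 r) G" for m :: nat and G :: "'a \<Rightarrow> 'b"
    unfolding case_prod_unfold
    by (intro continuous_intros continuous_on_compose2[OF that]) (use segment_in_ball in auto)
  show ?thesis using assms
  proof (induction k arbitrary: m G)
    case 0
    have "continuous_on (ball x0 r) G" using 0[of 0] by simp
    then have "continuous_on (ball x0 r \<times> cbox 0 1) (\<lambda>(x, t). t ^ m *\<^sub>R G (x0 + t *\<^sub>R (x - x0)))"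
      using cont[of G m] by simp
    from integral_continuous_on_param[OF this] show ?case by simp
  next
    case (Suc k)
    define G' where "G' = (\<lambda>x v. frechet_derivative G (at x) v)"
    have G': "(G has_derivative G' x) (at x)" if "x \<in> ball x0 r" for x
      unfolding G'_def using Suc.prems[of 1] that by (auto intro: has_derivative_frechet)
    have Ck': "Ck_on k (ball x0 r) (\<lambda>x. G' x v)" for k v
      unfolding G'_def using Suc.prems[of "Suc k"] by auto
    have lin: "linear (G' x)" if "x \<in> ball x0 r" for x using G'[OF that] by (rule has_derivative_linear)
    show ?case
    proof (rule Ck_on_SucI[OF open_ball])
      fix x assume x: "x \<in> ball x0 r"
      show "((\<lambda>x. integral {0..1} (\<lambda>t. t ^ m *\<^sub>R G (x0 + t *\<^sub>R (x - x0)))) has_derivative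
        (\<lambda>v. integral {0..1} (\<lambda>t. t ^ Suc m *\<^sub>R G' (x0 + t *\<^sub>R (x - x0)) v))) (at x)"
      proof (rule has_derivative_parametric_integral[OF open_ball convex_ball x,
            where f'="\<lambda>y t v. t ^ Suc m *\<^sub>R G' (x0 + t *\<^sub>R (y - x0)) v"])
        fix y t assume y: "y \<in> ball x0 r" and t: "t \<in> {0..1::real}"
        have z: "x0 + t *\<^sub>R (y - x0) \<in> ball x0 r" using segment_in_ball y t by auto
        have "((\<lambda>y. G (x0 + t *\<^sub>R (y - x0))) has_derivative (\<lambda>v. G' (x0 + t *\<^sub>R (y - x0)) (t *\<^sub>R v))) (at y)"
          by (rule has_derivative_compose[where f="\<lambda>y. x0 + t *\<^sub>R (y - x0)" and g=G, OF _ G'[OF z]])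
            (auto intro!: derivative_eq_intros)
        then have "((\<lambda>y. t ^ m *\<^sub>R G (x0 + t *\<^sub>R (y - x0))) has_derivative
            (\<lambda>v. t ^ m *\<^sub>R G' (x0 + t *\<^sub>R (y - x0)) (t *\<^sub>R v))) (at y)"
          by (rule has_derivative_scaleR_right)
        then show "((\<lambda>y. t ^ m *\<^sub>R G (x0 + t *\<^sub>R (y - x0))) has_derivative
            (\<lambda>v. t ^ Suc m *\<^sub>R G' (x0 + t *\<^sub>R (y - x0)) v)) (at y)"
          by (simp add: linear_scale[OF lin[OF z]] mult.commute)
      next
        show "continuous_on (ball x0 r \<times> {0..1}) (\<lambda>(x, t). t ^ Suc m *\<^sub>R G' (x0 + t *\<^sub>R (x - x0)) v)" for v
          by (rule cont) (use Ck'[of 0 v] in simp)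
      next
        fix y assume "y \<in> ball x0 r"
        have "continuous_on (ball x0 r) G" using Suc.prems[of 0] by simp
        from continuous_on_slice[OF cont[OF this, of m] \<open>y \<in> ball x0 r\<close>]
        show "continuous_on {0..1} (\<lambda>t. t ^ m *\<^sub>R G (x0 + t *\<^sub>R (y - x0)))" .
      qed
    next
      show "Ck_on k (ball x0 r) (\<lambda>x. integral {0..1} (\<lambda>t. t ^ Suc m *\<^sub>R G' (x0 + t *\<^sub>R (x - x0)) v))" for v
        using Suc.IH[OF Ck'] .
    qed
  qed
qed

text \<open>The fundamental theorem of calculus on the segment from \<open>x0\<close> to
  \<open>x\<close>: \<open>g b\<close> is the average over the segment of the partial derivative in
  direction \<open>b\<close>.\<close>

lemma hadamard:
  fixes f :: "'a::euclidean_space \<Rightarrow> real"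
  assumes "smooth_on (ball x0 r) f"
  obtains g where "\<And>b. smooth_on (ball x0 r) (g b)"
    "\<And>x. x \<in> ball x0 r \<Longrightarrow> f x = f x0 + (\<Sum>b\<in>Basis. ((x - x0) \<bullet> b) * g b x)"
    "\<And>b. g b x0 = frechet_derivative f (at x0) b"
proof
  define f' where "f' = (\<lambda>x. frechet_derivative f (at x))"
  define g where "g = (\<lambda>b x. integral {0..1} (\<lambda>t::real. t ^ 0 *\<^sub>R f' (x0 + t *\<^sub>R (x - x0)) b))"
  have sm: "smooth_on (ball x0 r) (\<lambda>x. f' x b)" for b unfolding f'_def using assms by (rule smooth_on_deriv)
  show "smooth_on (ball x0 r) (g b)" for b
    unfolding g_def smooth_on_def
  proof
    fix k
    have "\<And>k. Ck_on k (ball x0 r) (\<lambda>x. f' x b)" using sm[of b] by (simp add: smooth_on_def)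
    then show "Ck_on k (ball x0 r) (\<lambda>x. integral {0..1} (\<lambda>t. t ^ 0 *\<^sub>R f' (x0 + t *\<^sub>R (x - x0)) b))"
      by (rule Ck_on_radial_integral)
  qed
  show "g b x0 = frechet_derivative f (at x0) b" for b by (simp add: g_def f'_def)
  fix x assume x: "x \<in> ball x0 r"
  have z: "x0 + t *\<^sub>R (x - x0) \<in> ball x0 r" if "t \<in> {0..1}" for t using segment_in_ball x that by auto
  have d: "((\<lambda>t. f (x0 + t *\<^sub>R (x - x0))) has_vector_derivative f' (x0 + t *\<^sub>R (x - x0)) (x - x0)) (at t within {0..1})"
    if "t \<in> {0..1}" for t
  proof -
    have f: "(f has_derivative f' (x0 + t *\<^sub>R (x - x0))) (at (x0 + t *\<^sub>R (x - x0)))"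
      unfolding f'_def using smooth_onD[OF assms z[OF that]] .
    have "((\<lambda>t. f (x0 + t *\<^sub>R (x - x0))) has_derivative (\<lambda>h. f' (x0 + t *\<^sub>R (x - x0)) (h *\<^sub>R (x - x0)))) (at t within {0..1})"
      by (rule has_derivative_compose[where f="\<lambda>t. x0 + t *\<^sub>R (x - x0)" and g=f, OF _ f])
        (auto intro!: derivative_eq_intros)
    then show ?thesis unfolding has_vector_derivative_def
      by (simp add: linear_scale[OF has_derivative_linear[OF f]])
  qed
  have "((\<lambda>t. f' (x0 + t *\<^sub>R (x - x0)) (x - x0)) has_integral f (x0 + 1 *\<^sub>R (x - x0)) - f (x0 + 0 *\<^sub>R (x - x0))) {0..1}"
    by (rule fundamental_theorem_of_calculus) (use d in auto)
  then have "f x - f x0 = integral {0..1} (\<lambda>t. f' (x0 + t *\<^sub>R (x - x0)) (x - x0))"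
    by (simp add: integral_unique)
  also have "\<dots> = integral {0..1} (\<lambda>t. \<Sum>b\<in>Basis. ((x - x0) \<bullet> b) * f' (x0 + t *\<^sub>R (x - x0)) b)"
  proof (rule integral_cong)
    fix t :: real assume "t \<in> {0..1}"
    have "linear (f' (x0 + t *\<^sub>R (x - x0)))"
      unfolding f'_def using smooth_onD[OF assms z[OF \<open>t \<in> {0..1}\<close>]] by (rule has_derivative_linear)
    from linear_basis_expansion[OF this, of "x - x0"]
    show "f' (x0 + t *\<^sub>R (x - x0)) (x - x0) = (\<Sum>b\<in>Basis. ((x - x0) \<bullet> b) * f' (x0 + t *\<^sub>R (x - x0)) b)" by simp
  qed
  also have "\<dots> = (\<Sum>b\<in>Basis. integral {0..1} (\<lambda>t. ((x - x0) \<bullet> b) * f' (x0 + t *\<^sub>R (x - x0)) b))"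
  proof (rule integral_sum)
    fix b :: 'a
    have "continuous_on {0..1} (\<lambda>t. f' (x0 + t *\<^sub>R (x - x0)) b)"
      by (rule continuous_on_compose2[OF smooth_on_continuous[OF sm]]) (use z in \<open>auto intro!: continuous_intros\<close>)
    then show "(\<lambda>t. ((x - x0) \<bullet> b) * f' (x0 + t *\<^sub>R (x - x0)) b) integrable_on {0..1}"
      by (intro integrable_continuous_real continuous_intros)
  qed simp
  also have "\<dots> = (\<Sum>b\<in>Basis. ((x - x0) \<bullet> b) * g b x)" by (simp add: g_def)
  finally show "f x = f x0 + (\<Sum>b\<in>Basis. ((x - x0) \<bullet> b) * g b x)" by simp
qed

subsection \<open>Symmetry of the second derivative\<close>

text \<open>Both mixed derivatives are limits of the second difference quotient
  \<open>\<Delta> u v t / t\<^sup>2\<close>, whose numerator is symmetric in \<open>u\<close> and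
  \<open>v\<close>.\<close>

lemma second_derivative_symmetric:
  fixes f :: "'a::euclidean_space \<Rightarrow> real"
  assumes "open S" "smooth_on S f" "x \<in> S"
  shows "frechet_derivative (\<lambda>x. frechet_derivative f (at x) u) (at x) v =
         frechet_derivative (\<lambda>x. frechet_derivative f (at x) v) (at x) u"
proof -
  define f' where "f' = (\<lambda>x. frechet_derivative f (at x))"
  define \<Delta> where "\<Delta> = (\<lambda>u v t. f (x + t *\<^sub>R u + t *\<^sub>R v) - f (x + t *\<^sub>R u) - f (x + t *\<^sub>R v) + f x)"
  have f': "(f has_derivative f' y) (at y)" if "y \<in> S" for y
    unfolding f'_def using smooth_onD[OF assms(2) that] .
  have lim: "((\<lambda>t. \<Delta> u v t / t\<^sup>2) \<longlongrightarrow> frechet_derivative (\<lambda>x. f' x u) (at x) v) (at_right 0)" for u v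
  proof (rule tendstoI)
    fix e :: real assume e: "e > 0"
    define h where "h = frechet_derivative (\<lambda>x. f' x u) (at x)"
    have h: "((\<lambda>x. f' x u) has_derivative h) (at x)"
      unfolding h_def f'_def by (rule smooth_onD[OF smooth_on_deriv[OF assms(2)] assms(3)])
    have lh: "linear h" using h by (rule has_derivative_linear)
    \<comment> \<open>\<open>t * N\<close> bounds every displacement by multiples of
      \<open>u\<close> and \<open>v\<close> between 0 and \<open>t\<close>. The tolerance
      \<open>e / (4 * N)\<close> therefore costs at most \<open>e * t / 4\<close> at each of the two
      points where derivatives are compared.\<close>
    define N where "N = 2 * norm u + norm v + 1"
    have N: "N > 0" by (simp add: N_def add_nonneg_pos)
    obtain d where d: "d > 0" "\<And>y. norm (y - x) < d \<Longrightarrow>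
        norm (f' y u - f' x u - h (y - x)) \<le> (e / (4 * N)) * norm (y - x)"
    proof -
      have "0 < e / (4 * N)" using e N by simp
      then show ?thesis using h that unfolding has_derivative_at_alt by blast
    qed
    obtain d2 where d2: "d2 > 0" "ball x d2 \<subseteq> S" using assms(1,3) open_contains_ball by blast
    define D where "D = min d d2 / N"
    have D: "D > 0" using d(1) d2(1) N by (simp add: D_def)
    have "dist (\<Delta> u v t / t\<^sup>2) (h v) < e" if t: "0 < t" "t < D" for t
    proof -
      have tN: "t * N < min d d2" using t N by (simp add: D_def pos_less_divide_eq)
      have bnd: "norm (s *\<^sub>R u + r *\<^sub>R v) \<le> t * N" if "0 \<le> s" "s \<le> t" "0 \<le> r" "r \<le> t" for s r
      proof -
        have "norm (s *\<^sub>R u + r *\<^sub>R v) \<le> s * norm u + r * norm v"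
          using that norm_triangle_ineq[of "s *\<^sub>R u" "r *\<^sub>R v"] by simp
        also have "\<dots> \<le> t * norm u + t * norm v" using that by (intro add_mono mult_right_mono) auto
        also have "\<dots> \<le> t * N" using t by (simp add: N_def algebra_simps)
        finally show ?thesis .
      qed
      have inS: "x + s *\<^sub>R u + r *\<^sub>R v \<in> S" if "0 \<le> s" "s \<le> t" "0 \<le> r" "r \<le> t" for s r
      proof -
        have "dist x (x + (s *\<^sub>R u + r *\<^sub>R v)) = norm (s *\<^sub>R u + r *\<^sub>R v)"
          by (metis add_diff_cancel_left' dist_commute dist_norm)
        then have "x + s *\<^sub>R u + r *\<^sub>R v \<in> ball x d2"
          using bnd[OF that] tN by (simp add: add.assoc)
        then show ?thesis using d2(2) by blast
      qed
      \<comment> \<open>The mean value theorem is applied to the difference in direction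
        \<open>v\<close> as a function of the step in direction \<open>u\<close>; only first
        derivatives in direction \<open>u\<close> at two points remain.\<close>
      define \<psi> where "\<psi> = (\<lambda>s. f (x + s *\<^sub>R u + t *\<^sub>R v) - f (x + s *\<^sub>R u))"
      have der: "(\<psi> has_real_derivative f' (x + s *\<^sub>R u + t *\<^sub>R v) u - f' (x + s *\<^sub>R u) u) (at s)"
        if s: "0 \<le> s" "s \<le> t" for s
      proof -
        have i1: "x + s *\<^sub>R u + t *\<^sub>R v \<in> S" using inS[of s t] s t by simp
        have i2: "x + s *\<^sub>R u \<in> S" using inS[of s 0] s t by simp
        have "((\<lambda>s. f (x + s *\<^sub>R u + t *\<^sub>R v)) has_derivative (\<lambda>k. f' (x + s *\<^sub>R u + t *\<^sub>R v) (k *\<^sub>R u))) (at s)"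
          by (rule has_derivative_compose[where f="\<lambda>s. x + s *\<^sub>R u + t *\<^sub>R v" and g=f, OF _ f'[OF i1]])
            (auto intro!: derivative_eq_intros)
        moreover have "((\<lambda>s. f (x + s *\<^sub>R u)) has_derivative (\<lambda>k. f' (x + s *\<^sub>R u) (k *\<^sub>R u))) (at s)"
          by (rule has_derivative_compose[where f="\<lambda>s. x + s *\<^sub>R u" and g=f, OF _ f'[OF i2]])
            (auto intro!: derivative_eq_intros)
        ultimately have "(\<psi> has_derivative (\<lambda>k. f' (x + s *\<^sub>R u + t *\<^sub>R v) (k *\<^sub>R u) - f' (x + s *\<^sub>R u) (k *\<^sub>R u))) (at s)"
          unfolding \<psi>_def by (rule has_derivative_diff)
        then show ?thesis unfolding has_field_derivative_def
          by (rule has_derivative_eq_rhs) (rule ext, simp only: linear_scale[OF has_derivative_linear[OF f'[OF i1]]]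
              linear_scale[OF has_derivative_linear[OF f'[OF i2]]] real_scaleR_def right_diff_distrib mult.commute)
      qed
 have "\<exists>\<sigma>>0. \<sigma> < t \<and> \<psi> t - \<psi> 0 = (t - 0) * (f' (x + \<sigma> *\<^sub>R u + t *\<^sub>R v) u - f' (x + \<sigma> *\<^sub>R u) u)"
        using der by (intro MVT2[OF t(1)]) auto
      then obtain \<sigma> where \<sigma>: "0 < \<sigma>" "\<sigma> < t" "\<psi> t - \<psi> 0 = (t - 0) * (f' (x + \<sigma> *\<^sub>R u + t *\<^sub>R v) u - f' (x + \<sigma> *\<^sub>R u) u)"
        by blast
      have \<Delta>: "\<Delta> u v t = t * (f' (x + \<sigma> *\<^sub>R u + t *\<^sub>R v) u - f' (x + \<sigma> *\<^sub>R u) u)"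
        using \<sigma>(3) by (simp add: \<Delta>_def \<psi>_def algebra_simps)
      have b1: "norm (f' (x + \<sigma> *\<^sub>R u + t *\<^sub>R v) u - f' x u - h (\<sigma> *\<^sub>R u + t *\<^sub>R v)) \<le> (e / (4 * N)) * (t * N)"
      proof -
        have n: "norm ((x + \<sigma> *\<^sub>R u + t *\<^sub>R v) - x) \<le> t * N" using bnd[of \<sigma> t] \<sigma> t by (simp add: algebra_simps)
        then have "norm (f' (x + \<sigma> *\<^sub>R u + t *\<^sub>R v) u - f' x u - h ((x + \<sigma> *\<^sub>R u + t *\<^sub>R v) - x)) \<le> (e / (4 * N)) * norm ((x + \<sigma> *\<^sub>R u + t *\<^sub>R v) - x)"
          using tN by (intro d(2)) auto
        also have "\<dots> \<le> (e / (4 * N)) * (t * N)" using n e N by (intro mult_left_mono) auto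
        finally show ?thesis by (simp add: algebra_simps)
      qed
      have b2: "norm (f' (x + \<sigma> *\<^sub>R u) u - f' x u - h (\<sigma> *\<^sub>R u)) \<le> (e / (4 * N)) * (t * N)"
      proof -
        have n: "norm ((x + \<sigma> *\<^sub>R u) - x) \<le> t * N" using bnd[of \<sigma> 0] \<sigma> t by (simp add: algebra_simps)
        then have "norm (f' (x + \<sigma> *\<^sub>R u) u - f' x u - h ((x + \<sigma> *\<^sub>R u) - x)) \<le> (e / (4 * N)) * norm ((x + \<sigma> *\<^sub>R u) - x)"
          using tN by (intro d(2)) auto
        also have "\<dots> \<le> (e / (4 * N)) * (t * N)" using n e N by (intro mult_left_mono) auto
        finally show ?thesis by (simp add: algebra_simps)
      qed
      have q: "(e / (4 * N)) * (t * N) = e * t / 4" using N by simp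
      define A where "A = f' (x + \<sigma> *\<^sub>R u + t *\<^sub>R v) u - f' (x + \<sigma> *\<^sub>R u) u"
      have "h (\<sigma> *\<^sub>R u + t *\<^sub>R v) - h (\<sigma> *\<^sub>R u) = t * h v"
        by (simp add: linear_add[OF lh] linear_scale[OF lh])
      then have "\<bar>A - t * h v\<bar> \<le> e * t / 2"
        using b1 b2 unfolding q A_def real_norm_def by linarith
      moreover have "\<Delta> u v t / t\<^sup>2 - h v = (A - t * h v) / t"
        using t(1) unfolding \<Delta> A_def[symmetric] by (simp add: field_simps power2_eq_square)
      moreover have "\<bar>A - t * h v\<bar> / t \<le> (e * t / 2) / t"
        using t(1) by (intro divide_right_mono) (use calculation in auto)
      ultimately have "\<bar>\<Delta> u v t / t\<^sup>2 - h v\<bar> \<le> e / 2" using t(1) by simp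
      then show ?thesis using e by (simp add: dist_real_def)
    qed
    then show "\<forall>\<^sub>F t in at_right 0. dist (\<Delta> u v t / t\<^sup>2) (frechet_derivative (\<lambda>x. f' x u) (at x) v) < e"
      unfolding eventually_at_right[OF D] h_def using D by (auto simp: h_def)
  qed
  have "\<Delta> u v = \<Delta> v u" by (auto simp: \<Delta>_def algebra_simps)
  then have "((\<lambda>t. \<Delta> u v t / t\<^sup>2) \<longlongrightarrow> frechet_derivative (\<lambda>x. f' x v) (at x) u) (at_right 0)"
    using lim[of v u] by metis
  from tendsto_unique[OF _ lim[of u v] this] show ?thesis by (simp add: f'_def)
qed

lemma second_derivative_symmetric_vec:
  fixes f :: "'a::euclidean_space \<Rightarrow> 'b::euclidean_space"
  assumes "open S" "smooth_on S f" "x \<in> S"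
  shows "frechet_derivative (\<lambda>x. frechet_derivative f (at x) u) (at x) v =
         frechet_derivative (\<lambda>x. frechet_derivative f (at x) v) (at x) u"
proof (rule euclidean_eqI)
  fix b :: 'b assume "b \<in> Basis"
  define fb where "fb = (\<lambda>x. f x \<bullet> b)"
  have sm: "smooth_on S fb" unfolding fb_def
    by (rule smooth_on_compose_linear[OF assms(1) bounded_linear_inner_left assms(2)])
  have d: "frechet_derivative (\<lambda>x. h x \<bullet> b) (at y) w = frechet_derivative h (at y) w \<bullet> b"
    if "smooth_on S h" "y \<in> S" for h :: "'a \<Rightarrow> 'b" and y w
    using frechet_derivative_at[OF bounded_linear.has_derivative[OF bounded_linear_inner_left smooth_onD[OF that]]]
    by metis
  have e: "frechet_derivative (\<lambda>x. frechet_derivative f (at x) u) (at x) v \<bullet> b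
      = frechet_derivative (\<lambda>x. frechet_derivative fb (at x) u) (at x) v" for u v
  proof -
    have "frechet_derivative (\<lambda>x. frechet_derivative f (at x) u) (at x) v \<bullet> b
        = frechet_derivative (\<lambda>x. frechet_derivative f (at x) u \<bullet> b) (at x) v"
      by (rule d[OF smooth_on_deriv[OF assms(2)] assms(3), symmetric])
    also have "frechet_derivative (\<lambda>x. frechet_derivative f (at x) u \<bullet> b) (at x)
        = frechet_derivative (\<lambda>x. frechet_derivative fb (at x) u) (at x)"
    proof (rule frechet_derivative_transform_within_open[OF _ assms(1,3)])
      show "(\<lambda>x. frechet_derivative f (at x) u \<bullet> b) differentiable at x"
        using bounded_linear.has_derivative[OF bounded_linear_inner_left smooth_onD[OF smooth_on_deriv[OF assms(2)] assms(3)]]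
        by (rule differentiableI)
    qed (simp add: fb_def d[OF assms(2)])
    finally show ?thesis .
  qed
  show "frechet_derivative (\<lambda>x. frechet_derivative f (at x) u) (at x) v \<bullet> b =
         frechet_derivative (\<lambda>x. frechet_derivative f (at x) v) (at x) u \<bullet> b"
    unfolding e by (rule second_derivative_symmetric[OF assms(1) sm assms(3)])
qed

text \<open>A product rule, proved by expanding the moving direction in \<open>Basis\<close> and
  reassembling. Brackets and second covariant derivatives of fields reduce to it in charts.\<close>

lemma has_derivative_deriv_field:
  fixes f :: "'a::euclidean_space \<Rightarrow> 'b::real_normed_vector"
  assumes "open S" "smooth_on S f" "x \<in> S" "(v has_derivative v') (at x)"
  shows "((\<lambda>x. frechet_derivative f (at x) (v x)) has_derivative
    (\<lambda>u. frechet_derivative (\<lambda>y. frechet_derivative f (at y) (v x)) (at x) u + frechet_derivative f (at x) (v' u))) (at x)"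
proof -
  define f' where "f' = (\<lambda>x. frechet_derivative f (at x))"
  have ex: "f' y w = (\<Sum>b\<in>Basis. (w \<bullet> b) *\<^sub>R f' y b)" if "y \<in> S" for y w
    unfolding f'_def by (rule linear_basis_expansion[OF has_derivative_linear[OF smooth_onD[OF assms(2) that]]])
  have d: "((\<lambda>y. f' y b) has_derivative frechet_derivative (\<lambda>y. f' y b) (at x)) (at x)" for b
    unfolding f'_def by (rule smooth_onD[OF smooth_on_deriv[OF assms(2)] assms(3)])
  have 1: "((\<lambda>y. \<Sum>b\<in>Basis. (v y \<bullet> b) *\<^sub>R f' y b) has_derivative
      (\<lambda>u. \<Sum>b\<in>Basis. (v x \<bullet> b) *\<^sub>R frechet_derivative (\<lambda>y. f' y b) (at x) u + (v' u \<bullet> b) *\<^sub>R f' x b)) (at x)"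
    by (intro has_derivative_sum has_derivative_scaleR d bounded_linear.has_derivative[OF bounded_linear_inner_left assms(4)])
  have 2: "((\<lambda>y. \<Sum>b\<in>Basis. (v x \<bullet> b) *\<^sub>R f' y b) has_derivative
      (\<lambda>u. \<Sum>b\<in>Basis. (v x \<bullet> b) *\<^sub>R frechet_derivative (\<lambda>y. f' y b) (at x) u)) (at x)"
    by (intro has_derivative_sum has_derivative_scaleR_right d)
  have "((\<lambda>y. f' y (v x)) has_derivative
      (\<lambda>u. \<Sum>b\<in>Basis. (v x \<bullet> b) *\<^sub>R frechet_derivative (\<lambda>y. f' y b) (at x) u)) (at x)"
    by (rule has_derivative_transform_within_open[OF 2 assms(1,3)]) (simp add: ex[symmetric])
  from frechet_derivative_at[OF this]
  have 3: "frechet_derivative (\<lambda>y. f' y (v x)) (at x)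
      = (\<lambda>u. \<Sum>b\<in>Basis. (v x \<bullet> b) *\<^sub>R frechet_derivative (\<lambda>y. f' y b) (at x) u)" by simp
  have "((\<lambda>y. f' y (v y)) has_derivative
      (\<lambda>u. \<Sum>b\<in>Basis. (v x \<bullet> b) *\<^sub>R frechet_derivative (\<lambda>y. f' y b) (at x) u + (v' u \<bullet> b) *\<^sub>R f' x b)) (at x)"
    by (rule has_derivative_transform_within_open[OF 1 assms(1,3)]) (simp add: ex[symmetric])
  then have "((\<lambda>y. f' y (v y)) has_derivative (\<lambda>u. frechet_derivative (\<lambda>y. f' y (v x)) (at x) u + f' x (v' u))) (at x)"
    by (rule has_derivative_eq_rhs) (simp only: 3 sum.distrib ex[OF assms(3), symmetric])
  then show ?thesis by (simp add: f'_def)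
qed

lemma smooth_on_vec_inner:
  fixes f :: "'a::real_normed_vector \<Rightarrow> 'b::real_inner"
  shows "open S \<Longrightarrow> smooth_on S f \<Longrightarrow> smooth_on S (\<lambda>x. f x \<bullet> b)"
  by (rule smooth_on_compose_linear[OF _ bounded_linear_inner_left])

subsection \<open>Holomorphic maps are smooth\<close>

definition scalar_holomorphic :: "(complex ^ 'n \<Rightarrow> complex) \<Rightarrow> (complex ^ 'n) set \<Rightarrow> bool" where
  "scalar_holomorphic f S \<longleftrightarrow>
     (\<forall>z\<in>S. \<exists>D. (f has_derivative D) (at z) \<and> (\<forall>c v. D (c *s v) = c * D v))"

lemma norm_vector_scale:
  fixes v :: "complex ^ 'n"
  shows "norm (c *s v) = norm c * norm v"
proof -
  have "norm (c *s v) = L2_set (\<lambda>i. norm c * norm (v $ i)) UNIV"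
    by (simp add: norm_vec_def norm_mult)
  then show ?thesis by (simp add: norm_vec_def L2_set_right_distrib)
qed

lemma bounded_linear_vector_scale: "bounded_linear (\<lambda>v :: complex ^ 'n. c *s v)"
  by (rule bounded_linear_intro[where K = "norm c"])
    (auto simp: vec_eq_iff algebra_simps norm_vector_scale)

lemma bounded_linear_vector_scale_left: "bounded_linear (\<lambda>c. c *s (v :: complex ^ 'n))"
  by (rule bounded_linear_intro[where K = "norm v"])
    (auto simp: vec_eq_iff algebra_simps norm_vector_scale)

text \<open>Cauchy's formula at the centre with the parametrisation \<open>u\<close> inserted: in
  \<open>h u / u\<^sup>2 * u'\<close> one factor \<open>u\<close> cancels because \<open>u'\<close>
  is a constant times \<open>u\<close>. A plain integral over \<open>{0..1}\<close> can be
  differentiated under the integral sign.\<close>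

lemma circlepath_derivative_formula:
  assumes "0 < R" "h holomorphic_on S" "open S" "cball 0 R \<subseteq> S"
  shows "deriv h 0 = integral {0..1} (\<lambda>t. h (of_real R * exp (2 * of_real pi * \<i> * of_real t))
      * inverse (of_real R * exp (2 * of_real pi * \<i> * of_real t)))"
proof -
  have c: "continuous_on (cball 0 R) h" and hol: "h holomorphic_on ball 0 R"
    using assms holomorphic_on_subset holomorphic_on_imp_continuous_on
    by (metis, metis ball_subset_cball holomorphic_on_subset)
  have "(h has_field_derivative (1 / (2 * of_real pi * \<i>) * contour_integral (circlepath 0 R) (\<lambda>u. h u / (u - 0)\<^sup>2))) (at 0)"
    using Cauchy_derivative_integral_circlepath(2)[OF c hol, of 0] assms(1) by simp
  then have "deriv h 0 = 1 / (2 * of_real pi * \<i>) * contour_integral (circlepath 0 R) (\<lambda>u. h u / u\<^sup>2)"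
    by (simp add: DERIV_imp_deriv)
  also have "contour_integral (circlepath 0 R) (\<lambda>u. h u / u\<^sup>2)
      = integral {0..1} (\<lambda>t. h (circlepath 0 R t) / (circlepath 0 R t)\<^sup>2 * vector_derivative (circlepath 0 R) (at t))"
    by (rule contour_integral_integral)
  also have "\<dots> = integral {0..1} (\<lambda>t. (2 * of_real pi * \<i>) * (h (of_real R * exp (2 * of_real pi * \<i> * of_real t))
      * inverse (of_real R * exp (2 * of_real pi * \<i> * of_real t))))"
  proof (rule integral_cong)
    fix t :: real assume t: "t \<in> {0..1}"
    have "of_real R * exp (2 * of_real pi * \<i> * of_real t) \<noteq> (0::complex)" using assms(1) by simp
    then show "h (circlepath 0 R t) / (circlepath 0 R t)\<^sup>2 * vector_derivative (circlepath 0 R) (at t)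
      = (2 * of_real pi * \<i>) * (h (of_real R * exp (2 * of_real pi * \<i> * of_real t))
      * inverse (of_real R * exp (2 * of_real pi * \<i> * of_real t)))"
      unfolding vector_derivative_circlepath using t by (simp add: circlepath field_simps power2_eq_square)
  qed
  finally show ?thesis by simp
qed

lemma scalar_holomorphic_frechet:
  assumes "scalar_holomorphic f S" "z \<in> S"
  shows "(f has_derivative frechet_derivative f (at z)) (at z)"
    "frechet_derivative f (at z) (c *s v) = c * frechet_derivative f (at z) v"
proof -
  obtain D where D: "(f has_derivative D) (at z)" "\<And>c v. D (c *s v) = c * D v"
    using assms unfolding scalar_holomorphic_def by blast
  with frechet_derivative_at[OF D(1)] show "(f has_derivative frechet_derivative f (at z)) (at z)"
    "frechet_derivative f (at z) (c *s v) = c * frechet_derivative f (at z) v" by simp_all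
qed

text \<open>The one-variable Cauchy formula on the complex line
  \<open>c \<mapsto> z + c *s v\<close>. The right-hand side involves only values of
  \<open>f\<close>, so regularity of the derivative in \<open>z\<close> can be read off from
  it.\<close>

lemma scalar_holomorphic_deriv_integral:
  assumes hol: "scalar_holomorphic f S" and S: "open S" "cball z (R * norm v) \<subseteq> S" and R: "0 < R"
  shows "frechet_derivative f (at z) v = integral {0..1} (\<lambda>t.
      f (z + (of_real R * exp (2 * of_real pi * \<i> * of_real t)) *s v)
      * inverse (of_real R * exp (2 * of_real pi * \<i> * of_real t)))"
proof -
  define h where "h = (\<lambda>c. f (z + c *s v))"
  define T where "T = (\<lambda>c. z + c *s v) -` S"
  have lin: "((\<lambda>c. z + c *s v) has_derivative (\<lambda>c. c *s v)) (at c)" for c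
    by (auto intro!: derivative_eq_intros bounded_linear_imp_has_derivative bounded_linear_vector_scale_left)
  have T: "open T" unfolding T_def
    by (rule open_vimage[OF S(1)])
      (auto intro!: continuous_at_imp_continuous_on has_derivative_continuous[OF lin])
  have der: "(h has_field_derivative frechet_derivative f (at (z + c *s v)) v) (at c)" if "c \<in> T" for c
  proof -
    have i: "z + c *s v \<in> S" using that by (simp add: T_def)
    have "(h has_derivative (\<lambda>k. frechet_derivative f (at (z + c *s v)) (k *s v))) (at c)"
      unfolding h_def
      by (rule has_derivative_compose[where f="\<lambda>c. z + c *s v" and g=f, OF lin scalar_holomorphic_frechet(1)[OF hol i]])
    then show ?thesis unfolding has_field_derivative_def scalar_holomorphic_frechet(2)[OF hol i]
      by (simp add: mult.commute[of _ "frechet_derivative f (at (z + c *s v)) v"])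
  qed
  have sub: "cball 0 R \<subseteq> T"
  proof
    fix c assume "c \<in> cball (0::complex) R"
    then have "norm (c *s v) \<le> R * norm v" by (simp add: norm_vector_scale mult_right_mono)
    then have "z + c *s v \<in> cball z (R * norm v)" by (simp add: dist_norm)
    then show "c \<in> T" using S(2) by (auto simp: T_def)
  qed
  have "h holomorphic_on T" using der by (auto simp: holomorphic_on_open[OF T])
  then have "deriv h 0 = integral {0..1} (\<lambda>t. h (of_real R * exp (2 * of_real pi * \<i> * of_real t))
      * inverse (of_real R * exp (2 * of_real pi * \<i> * of_real t)))"
    using circlepath_derivative_formula[OF R _ T sub] by blast
  moreover have "deriv h 0 = frechet_derivative f (at z) v"
    using DERIV_imp_deriv[OF der[OF subsetD[OF sub, of 0]]] R by simp
  ultimately show ?thesis by (simp add: h_def)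
qed

lemma scalar_holomorphic_continuous: "scalar_holomorphic f S \<Longrightarrow> continuous_on S f"
  by (intro continuous_at_imp_continuous_on ballI has_derivative_continuous[OF scalar_holomorphic_frechet(1)])

lemma scalar_holomorphic_deriv_local:
  assumes hol: "scalar_holomorphic f S" and S: "open S" "z0 \<in> S"
  obtains \<rho> R where "\<rho> > 0" "R > 0" "ball z0 \<rho> \<subseteq> S"
    "\<And>z. z \<in> ball z0 \<rho> \<Longrightarrow> cball z (R * norm v) \<subseteq> S"
proof -
  obtain e where e: "e > 0" "ball z0 e \<subseteq> S" using S open_contains_ball by blast
  define R where "R = e / (2 * (norm v + 1))"
  have n: "norm v + 1 > 0" by (simp add: add_nonneg_pos)
  have R: "R > 0" using e n by (simp add: R_def)
  have "R * norm v \<le> R * (norm v + 1)" using R by (intro mult_left_mono) auto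
  also have "\<dots> = e / 2" using n by (simp add: R_def field_simps)
  finally have Rv: "R * norm v \<le> e / 2" .
  have "cball z (R * norm v) \<subseteq> ball z0 e" if "z \<in> ball z0 (e / 2)" for z
  proof
    fix y assume "y \<in> cball z (R * norm v)"
    then have "dist z y \<le> e / 2" using Rv by simp
    then show "y \<in> ball z0 e" using that dist_triangle[of z0 y z] by simp
  qed
  moreover have "ball z0 (e / 2) \<subseteq> S" using e subset_ball[of "e / 2" e z0] by (simp add: order_trans)
  ultimately show ?thesis using e R by (intro that[of "e / 2" R]) auto
qed

lemma continuous_on_circle_integrand:
  fixes f :: "complex ^ 'n \<Rightarrow> complex"
  assumes "continuous_on S f" "R > 0" "\<And>z. z \<in> U \<Longrightarrow> cball z (R * norm v) \<subseteq> S"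
  shows "continuous_on (U \<times> {0..1}) (\<lambda>(z, t). f (z + (of_real R * exp (2 * of_real pi * \<i> * of_real t)) *s v)
      * inverse (of_real R * exp (2 * of_real pi * \<i> * of_real t)))"
proof -
  have in_S: "z + (of_real R * exp (2 * of_real pi * \<i> * of_real t)) *s v \<in> S" if "z \<in> U" for z t
  proof -
    have "norm (exp (2 * of_real pi * \<i> * of_real t)) = 1"
      using norm_exp_i_times[of "2 * pi * t"] by (simp add: mult_ac)
    then have "z + (of_real R * exp (2 * of_real pi * \<i> * of_real t)) *s v \<in> cball z (R * norm v)"
      using assms(2) by (simp add: dist_norm norm_vector_scale norm_mult)
    then show ?thesis using assms(3)[OF that] by blast
  qed
  have c: "continuous_on (U \<times> {0..1}) (\<lambda>p. fst p + (of_real R * exp (2 * of_real pi * \<i> * of_real (snd p))) *s v)"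
    by (intro continuous_intros bounded_linear.continuous_on[OF bounded_linear_vector_scale_left])
  show ?thesis unfolding case_prod_unfold
    by (intro continuous_on_mult continuous_on_compose2[OF assms(1) c])
      (use in_S assms(2) in \<open>auto intro!: continuous_intros\<close>)
qed

text \<open>Continuity of the derivative is not part of \<open>scalar_holomorphic\<close>. It comes
  from the integral formula with continuous integrand, and it is what permits differentiating that
  formula once more.\<close>

lemma scalar_holomorphic_deriv_continuous:
  assumes hol: "scalar_holomorphic f S" and S: "open S"
  shows "continuous_on S (\<lambda>z. frechet_derivative f (at z) v)"
proof -
  have "\<exists>U. open U \<and> z0 \<in> U \<and> continuous_on U (\<lambda>z. frechet_derivative f (at z) v)" if z0: "z0 \<in> S" for z0
  proof -
    obtain \<rho> R where r: "\<rho> > 0" "R > 0" "ball z0 \<rho> \<subseteq> S" "\<And>z. z \<in> ball z0 \<rho> \<Longrightarrow> cball z (R * norm v) \<subseteq> S"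
      using scalar_holomorphic_deriv_local[OF hol S z0, of v] by blast
    define I where "I = (\<lambda>z. integral {0..1} (\<lambda>t.
      f (z + (of_real R * exp (2 * of_real pi * \<i> * of_real t)) *s v)
      * inverse (of_real R * exp (2 * of_real pi * \<i> * of_real t))))"
    have c: "continuous_on (ball z0 \<rho> \<times> cbox 0 1) (\<lambda>(z, t). f (z + (of_real R * exp (2 * of_real pi * \<i> * of_real t)) *s v)
      * inverse (of_real R * exp (2 * of_real pi * \<i> * of_real t)))"
      using continuous_on_circle_integrand[where U="ball z0 \<rho>", OF scalar_holomorphic_continuous[OF hol] r(2,4)]
      by (simp only: box_real)
    have "continuous_on (ball z0 \<rho>) I"
      using integral_continuous_on_param[OF c] by (simp add: I_def)
    moreover have "frechet_derivative f (at z) v = I z" if "z \<in> ball z0 \<rho>" for z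
      unfolding I_def using scalar_holomorphic_deriv_integral[OF hol S r(4)[OF that] r(2)] .
    ultimately have "continuous_on (ball z0 \<rho>) (\<lambda>z. frechet_derivative f (at z) v)"
      using continuous_on_cong by (metis (no_types, lifting))
    then show ?thesis using r(1) by (metis centre_in_ball open_ball)
  qed
  then have "Ck_on 0 S (\<lambda>z. frechet_derivative f (at z) v)" by (intro Ck_on_local) simp
  then show ?thesis by simp
qed

text \<open>The integral formula is differentiated under the integral sign, and complex linearity
  passes from the integrand to the result. Iteration gives smoothness of all orders.\<close>

lemma scalar_holomorphic_deriv:
  assumes hol: "scalar_holomorphic f S" and S: "open S"
  shows "scalar_holomorphic (\<lambda>z. frechet_derivative f (at z) v) S"
  unfolding scalar_holomorphic_def
proof
  fix z0 assume z0: "z0 \<in> S"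
  obtain \<rho> R where r: "\<rho> > 0" "R > 0" "ball z0 \<rho> \<subseteq> S" "\<And>z. z \<in> ball z0 \<rho> \<Longrightarrow> cball z (R * norm v) \<subseteq> S"
    using scalar_holomorphic_deriv_local[OF hol S z0, of v] by blast
  define E where "E = (\<lambda>t. of_real R * exp (2 * of_real pi * \<i> * of_real t))"
  have EV: "z + E t *s v \<in> S" if "z \<in> ball z0 \<rho>" for z and t
  proof -
    have "norm (exp (2 * of_real pi * \<i> * of_real t)) = 1"
      using norm_exp_i_times[of "2 * pi * t"] by (simp add: mult_ac)
    then have "z + E t *s v \<in> cball z (R * norm v)"
      using r(2) by (simp add: dist_norm norm_vector_scale norm_mult E_def)
    then show ?thesis using r(4)[OF that] by blast
  qed
  define I where "I = (\<lambda>z. integral {0..1} (\<lambda>t. f (z + E t *s v) * inverse (E t)))"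
  define I' where "I' = (\<lambda>w. integral {0..1} (\<lambda>t. frechet_derivative f (at (z0 + E t *s v)) w * inverse (E t)))"
  have fI: "frechet_derivative f (at z) v = I z" if "z \<in> ball z0 \<rho>" for z
    unfolding I_def E_def using scalar_holomorphic_deriv_integral[OF hol S r(4)[OF that] r(2)] .
  have "(I has_derivative I') (at z0)"
    unfolding I_def I'_def
  proof (rule has_derivative_parametric_integral[where U="ball z0 \<rho>" and
        f'="\<lambda>z t w. frechet_derivative f (at (z + E t *s v)) w * inverse (E t)"])
    fix z t assume "z \<in> ball z0 \<rho>" "t \<in> {0..1::real}"
    note d = scalar_holomorphic_frechet(1)[OF hol EV[OF this(1), of t]]
    have "((\<lambda>z. f (z + E t *s v)) has_derivative frechet_derivative f (at (z + E t *s v))) (at z)"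
      by (rule has_derivative_compose[where f="\<lambda>z. z + E t *s v" and g=f, OF _ d, simplified])
        (auto intro!: derivative_eq_intros)
    then show "((\<lambda>z. f (z + E t *s v) * inverse (E t)) has_derivative
        (\<lambda>w. frechet_derivative f (at (z + E t *s v)) w * inverse (E t))) (at z)"
      by (rule has_derivative_mult_left)
  next
    show "continuous_on (ball z0 \<rho> \<times> {0..1}) (\<lambda>(z, t). frechet_derivative f (at (z + E t *s v)) w * inverse (E t))" for w
      unfolding E_def
      using continuous_on_circle_integrand[OF scalar_holomorphic_deriv_continuous[OF hol S, of w] r(2,4)] .
  next
    fix z assume z: "z \<in> ball z0 \<rho>"
    show "continuous_on {0..1} (\<lambda>t. f (z + E t *s v) * inverse (E t))"
      unfolding E_def
      by (rule continuous_on_slice[OF continuous_on_circle_integrand[OF scalar_holomorphic_continuous[OF hol] r(2,4)] z])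
  qed (use r in auto)
  then have "((\<lambda>z. frechet_derivative f (at z) v) has_derivative I') (at z0)"
    by (rule has_derivative_transform_within_open[OF _ open_ball[of z0 \<rho>]]) (use r fI in auto)
  moreover have "I' (c *s w) = c * I' w" for c w
    unfolding I'_def using r(1) EV by (simp add: scalar_holomorphic_frechet(2)[OF hol] mult.assoc)
  ultimately show "\<exists>D. ((\<lambda>z. frechet_derivative f (at z) v) has_derivative D) (at z0) \<and> (\<forall>c v. D (c *s v) = c * D v)"
    by blast
qed

lemma scalar_holomorphic_smooth:
  assumes "scalar_holomorphic f S" "open S"
  shows "smooth_on S f"
  unfolding smooth_on_def
proof
  fix k
  show "Ck_on k S f" using assms(1)
  proof (induction k arbitrary: f)
    case 0
    then show ?case by (simp add: scalar_holomorphic_continuous)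
  next
    case (Suc k)
    show ?case
      by (rule Ck_on_SucI[OF assms(2) scalar_holomorphic_frechet(1)[OF Suc.prems]])
        (auto intro: Suc.IH scalar_holomorphic_deriv[OF Suc.prems assms(2)])
  qed
qed

lemma cholomorphic_smooth:
  fixes F :: "complex ^ 'n \<Rightarrow> complex ^ 'k"
  assumes "cholomorphic_on F S" "open S"
  shows "smooth_on S F"
proof -
  have "scalar_holomorphic (\<lambda>z. F z $ j) S" for j
    unfolding scalar_holomorphic_def
  proof
    fix z assume "z \<in> S"
    then obtain D where D: "(F has_derivative D) (at z)" "\<And>c v. D (c *s v) = c *s D v"
      using assms(1) unfolding cholomorphic_on_def by blast
    have "((\<lambda>z. F z $ j) has_derivative (\<lambda>v. D v $ j)) (at z)"
      by (rule bounded_linear.has_derivative[OF bounded_linear_vec_nth D(1)])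
    then show "\<exists>D. ((\<lambda>z. F z $ j) has_derivative D) (at z) \<and> (\<forall>c v. D (c *s v) = c * D v)"
      using D(2) by (intro exI[of _ "\<lambda>v. D v $ j"]) simp
  qed
  then have c: "smooth_on S (\<lambda>z. F z $ j)" for j using scalar_holomorphic_smooth assms(2) by blast
  show ?thesis
  proof (rule smooth_on_components[OF assms(2)])
    fix b :: "complex ^ 'k" assume "b \<in> Basis"
    then obtain j u where "b = axis j u" by (auto simp: Basis_vec_def)
    then have "F z \<bullet> b = F z $ j \<bullet> u" for z by (simp add: inner_axis)
    then show "smooth_on S (\<lambda>x. F x \<bullet> b)"
      using smooth_on_compose_linear[OF assms(2) bounded_linear_inner_left c] by simp
  qed
qed

subsection \<open>Charts and smooth functions\<close>

definition dm :: "('m, 'n::finite) chart \<Rightarrow> (complex ^ 'n) set" where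
  "dm c = snd c ` fst c"

definition pt :: "('m, 'n::finite) chart \<Rightarrow> complex ^ 'n \<Rightarrow> 'm" where
  "pt c = inv_into (fst c) (snd c)"

definition tdom :: "('m, 'n::finite) chart \<Rightarrow> ('m, 'n) chart \<Rightarrow> (complex ^ 'n) set" where
  "tdom c d = {x \<in> dm c. pt c x \<in> fst d}"

definition trn :: "('m, 'n::finite) chart \<Rightarrow> ('m, 'n) chart \<Rightarrow> complex ^ 'n \<Rightarrow> complex ^ 'n" where
  "trn c d x = snd d (pt c x)"

definition ext :: "('m, 'n::finite) chart \<Rightarrow> (complex ^ 'n \<Rightarrow> real) \<Rightarrow> 'm \<Rightarrow> real" where
  "ext c u q = (if q \<in> fst c then u (snd c q) else 0)"

definition dd :: "('m, 'n::finite) chart \<Rightarrow> ('m \<Rightarrow> real) \<Rightarrow> complex ^ 'n \<Rightarrow> complex ^ 'n \<Rightarrow> real" where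
  "dd c f x = frechet_derivative (\<lambda>y. f (pt c y)) (at x)"

lemma smooth_fun_iff:
  "smooth_fun A f \<longleftrightarrow> (\<forall>c\<in>A. smooth_on (dm c) (\<lambda>x. f (pt c x)))"
  unfolding smooth_fun_def smooth_on_def dm_def pt_def by (auto simp: case_prod_unfold o_def)

locale cmanifold =
  fixes A :: "('m::{t2_space, second_countable_topology}, 'n::finite) chart set"
  assumes atlas: "complex_atlas A"
begin

lemma chart_ex: obtains c where "c \<in> A" "p \<in> fst c"
proof -
  have "p \<in> (\<Union>(U, \<phi>)\<in>A. U)" using atlas unfolding complex_atlas_def by simp
  then obtain c where "c \<in> A" "p \<in> fst c" by (auto simp: case_prod_unfold)
  then show ?thesis by (rule that)
qed

context
  fixes c assumes c: "c \<in> A"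
begin

lemma open_fst: "open (fst c)"
  using atlas c unfolding complex_atlas_def by (auto simp: case_prod_unfold)

lemma open_dm: "open (dm c)"
  using atlas c unfolding complex_atlas_def dm_def by (auto simp: case_prod_unfold)

lemma chart_homeomorphism: "homeomorphism (fst c) (dm c) (snd c) (pt c)"
  using atlas c unfolding complex_atlas_def dm_def pt_def by (auto simp: case_prod_unfold)

lemma pt_in: "x \<in> dm c \<Longrightarrow> pt c x \<in> fst c"
  using chart_homeomorphism unfolding homeomorphism_def by blast

lemma snd_pt: "x \<in> dm c \<Longrightarrow> snd c (pt c x) = x"
  using chart_homeomorphism unfolding homeomorphism_def by blast

lemma pt_snd: "q \<in> fst c \<Longrightarrow> pt c (snd c q) = q"
  using chart_homeomorphism unfolding homeomorphism_def by blast

lemma snd_in: "q \<in> fst c \<Longrightarrow> snd c q \<in> dm c"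
  by (simp add: dm_def)

lemma continuous_on_pt: "continuous_on (dm c) (pt c)"
  using chart_homeomorphism unfolding homeomorphism_def by blast

lemma continuous_on_snd_chart: "continuous_on (fst c) (snd c)"
  using chart_homeomorphism unfolding homeomorphism_def by blast

lemma open_pt_image: "open N \<Longrightarrow> N \<subseteq> dm c \<Longrightarrow> open (pt c ` N)"
proof -
  assume N: "open N" "N \<subseteq> dm c"
  have "pt c ` N = fst c \<inter> snd c -` N"
    using N pt_in snd_pt pt_snd by (force simp: image_iff)
  then show ?thesis
    using continuous_on_open_vimage[OF open_fst] continuous_on_snd_chart N(1) by (metis Int_commute)
qed

lemma open_pt_vimage: "open V \<Longrightarrow> open {x \<in> dm c. pt c x \<in> V}"
proof -
  assume V: "open V"
  have "open (dm c \<inter> pt c -` V)"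
    using continuous_on_open_vimage[OF open_dm] continuous_on_pt V by (metis Int_commute)
  moreover have "dm c \<inter> pt c -` V = {x \<in> dm c. pt c x \<in> V}" by auto
  ultimately show ?thesis by simp
qed

end

lemma open_tdom: "c \<in> A \<Longrightarrow> d \<in> A \<Longrightarrow> open (tdom c d)"
  unfolding tdom_def by (intro open_pt_vimage open_fst)

lemma tdom_image: "c \<in> A \<Longrightarrow> tdom c d = snd c ` (fst c \<inter> fst d)"
proof
  assume c: "c \<in> A"
  show "tdom c d \<subseteq> snd c ` (fst c \<inter> fst d)"
  proof
    fix x assume "x \<in> tdom c d"
    then have "pt c x \<in> fst c \<inter> fst d" "x = snd c (pt c x)"
      using pt_in[OF c, of x] snd_pt[OF c, of x] by (auto simp: tdom_def)
    then show "x \<in> snd c ` (fst c \<inter> fst d)" by (rule rev_image_eqI)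
  qed
  show "snd c ` (fst c \<inter> fst d) \<subseteq> tdom c d"
    using pt_snd[OF c] snd_in[OF c] by (auto simp: tdom_def)
qed

lemma trans_holomorphic: "c \<in> A \<Longrightarrow> d \<in> A \<Longrightarrow> cholomorphic_on (trn c d) (tdom c d)"
proof -
  assume "c \<in> A" "d \<in> A"
  then have "cholomorphic_on (snd d \<circ> inv_into (fst c) (snd c)) (snd c ` (fst c \<inter> fst d))"
    using atlas unfolding complex_atlas_def by (fastforce simp: case_prod_unfold)
  then show ?thesis using tdom_image[OF \<open>c \<in> A\<close>] by (simp add: trn_def[abs_def] pt_def o_def)
qed

lemma trans_smooth: "c \<in> A \<Longrightarrow> d \<in> A \<Longrightarrow> smooth_on (tdom c d) (trn c d)"
  by (intro cholomorphic_smooth trans_holomorphic open_tdom)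

lemma trans_in: "c \<in> A \<Longrightarrow> d \<in> A \<Longrightarrow> x \<in> tdom c d \<Longrightarrow> trn c d x \<in> tdom d c"
  unfolding tdom_def trn_def by (auto simp: snd_in pt_snd pt_in)

lemma pt_trans: "d \<in> A \<Longrightarrow> x \<in> tdom c d \<Longrightarrow> pt d (trn c d x) = pt c x"
  unfolding tdom_def trn_def by (auto simp: pt_snd)

lemma trans_trans: "c \<in> A \<Longrightarrow> d \<in> A \<Longrightarrow> x \<in> tdom c d \<Longrightarrow> trn d c (trn c d x) = x"
  unfolding tdom_def trn_def by (auto simp: pt_snd snd_pt)

lemma trans_derivative:
  assumes "c \<in> A" "d \<in> A" "x \<in> tdom c d"
  shows "(trn c d has_derivative frechet_derivative (trn c d) (at x)) (at x)"
    "frechet_derivative (trn c d) (at x) (z *s v) = z *s frechet_derivative (trn c d) (at x) v"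
proof -
  obtain D where D: "(trn c d has_derivative D) (at x)" "\<And>z v. D (z *s v) = z *s D v"
    using trans_holomorphic[OF assms(1,2)] assms(3) unfolding cholomorphic_on_def by blast
  with frechet_derivative_at[OF D(1)] show "(trn c d has_derivative frechet_derivative (trn c d) (at x)) (at x)"
    "frechet_derivative (trn c d) (at x) (z *s v) = z *s frechet_derivative (trn c d) (at x) v" by simp_all
qed

lemma smooth_fun_chart: "smooth_fun A f \<Longrightarrow> c \<in> A \<Longrightarrow> smooth_on (dm c) (\<lambda>x. f (pt c x))"
  by (simp add: smooth_fun_iff)

text \<open>Near the image of \<open>K\<close> the extension is \<open>u\<close> composed with a
  transition map. Away from it the extension is 0 on an open set, because the image of
  \<open>K\<close> is compact and hence closed in a Hausdorff space.\<close>

lemma smooth_fun_ext: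
  assumes c: "c \<in> A" and W: "open W" "smooth_on W u" and K: "compact K" "K \<subseteq> W" "K \<subseteq> dm c"
    and 0: "\<And>x. x \<in> dm c \<Longrightarrow> x \<notin> K \<Longrightarrow> u x = 0"
  shows "smooth_fun A (ext c u)"
  unfolding smooth_fun_iff
proof
  fix d assume d: "d \<in> A"
  show "smooth_on (dm d) (\<lambda>x. ext c u (pt d x))"
  proof (rule smooth_on_local)
    fix x assume x: "x \<in> dm d"
    show "\<exists>T. open T \<and> x \<in> T \<and> smooth_on T (\<lambda>x. ext c u (pt d x))"
    proof (cases "pt d x \<in> pt c ` K")
      case True
      then obtain y where y: "y \<in> K" "pt d x = pt c y" by auto
      have xt: "x \<in> tdom d c" using x y K(3) pt_in[OF c] by (auto simp: tdom_def)
      have tx: "trn d c x \<in> W" using y(2) K(2) y(1) snd_pt[OF c subsetD[OF K(3) y(1)]] by (auto simp: trn_def)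
      define T where "T = tdom d c \<inter> trn d c -` W"
      have oT: "open T"
        unfolding T_def using continuous_on_open_vimage[OF open_tdom[OF d c]]
          smooth_on_continuous[OF trans_smooth[OF d c]] W(1) by (metis Int_commute)
      have "smooth_on T (\<lambda>x. u (trn d c x))"
        by (rule smooth_on_compose[OF oT W(1) smooth_on_subset[OF trans_smooth[OF d c]] W(2)])
          (auto simp: T_def)
      moreover have "ext c u (pt d x) = u (trn d c x)" if "x \<in> T" for x
        using that by (auto simp: T_def tdom_def ext_def trn_def)
      ultimately have "smooth_on T (\<lambda>x. ext c u (pt d x))"
        using smooth_on_cong[OF oT, of "\<lambda>x. ext c u (pt d x)" "\<lambda>x. u (trn d c x)"] by simp
      then show ?thesis using oT xt tx by (auto simp: T_def)
    next
      case False
      have "compact (pt c ` K)"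
        using K continuous_on_pt[OF c] continuous_on_subset compact_continuous_image by blast
      then have "open (- (pt c ` K))" by (simp add: compact_imp_closed open_Compl)
      then have o: "open {x \<in> dm d. pt d x \<in> - (pt c ` K)}" by (rule open_pt_vimage[OF d])
      have z: "ext c u (pt d x) = 0" if "x \<in> {x \<in> dm d. pt d x \<in> - (pt c ` K)}" for x
        using that 0[of "snd c (pt d x)"] pt_snd[OF c] snd_in[OF c] by (force simp: ext_def)
      have "smooth_on {x \<in> dm d. pt d x \<in> - (pt c ` K)} (\<lambda>x. ext c u (pt d x))"
        using smooth_on_cong[OF o, of "\<lambda>x. ext c u (pt d x)" "\<lambda>x. 0"] z smooth_on_const by blast
      then show ?thesis using o x False by blast
    qed
  qed
qed

lemma smooth_fun_const: "smooth_fun A (\<lambda>q. k)"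
  by (simp add: smooth_fun_iff smooth_on_const)

lemma smooth_fun_add: "smooth_fun A f \<Longrightarrow> smooth_fun A h \<Longrightarrow> smooth_fun A (\<lambda>q. f q + h q)"
  by (simp add: smooth_fun_iff smooth_on_add open_dm)

lemma smooth_fun_diff: "smooth_fun A f \<Longrightarrow> smooth_fun A h \<Longrightarrow> smooth_fun A (\<lambda>q. f q - h q)"
  by (simp add: smooth_fun_iff smooth_on_diff open_dm)

lemma smooth_fun_mult: "smooth_fun A f \<Longrightarrow> smooth_fun A h \<Longrightarrow> smooth_fun A (\<lambda>q. f q * h q)"
  by (simp add: smooth_fun_iff smooth_on_mult open_dm)

lemma smooth_fun_sum: "(\<And>i. i \<in> I \<Longrightarrow> smooth_fun A (f i)) \<Longrightarrow> smooth_fun A (\<lambda>q. \<Sum>i\<in>I. f i q)"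
  by (simp add: smooth_fun_iff smooth_on_sum open_dm)

lemma smooth_fun_inverse:
  "smooth_fun A f \<Longrightarrow> (\<And>q. f q \<noteq> 0) \<Longrightarrow> smooth_fun A (\<lambda>q. inverse (f q))"
  by (simp add: smooth_fun_iff smooth_on_inverse open_dm)

lemma chart_bump:
  assumes "c \<in> A" "open W" "x0 \<in> W" "W \<subseteq> dm c"
  obtains \<beta> :: "complex ^ 'n \<Rightarrow> real" and K r where "smooth_on UNIV \<beta>" "compact K" "K \<subseteq> W" "\<And>x. x \<notin> K \<Longrightarrow> \<beta> x = 0"
    "\<And>x. 0 \<le> \<beta> x" "\<And>x. \<beta> x \<le> 1" "r > 0" "ball x0 r \<subseteq> W" "\<And>x. x \<in> ball x0 r \<Longrightarrow> \<beta> x = 1"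
proof -
  obtain e where e: "e > 0" "cball x0 e \<subseteq> W" using assms open_contains_cball by blast
  obtain b where b: "smooth_on UNIV b" "\<And>x. 0 \<le> b x" "\<And>x. b x \<le> 1"
    "\<And>x. dist x x0 \<le> e / 2 \<Longrightarrow> b x = 1" "\<And>x. x \<notin> cball x0 (2 * (e / 2)) \<Longrightarrow> b x = (0::real)"
    using bump_exists[of "e / 2" x0] e by auto
  show ?thesis
  proof (rule that[of b "cball x0 e" "e / 2"])
    show "ball x0 (e / 2) \<subseteq> W" using e by (auto simp: subset_eq)
  qed (use b e in \<open>auto simp: dist_commute\<close>)
qed

text \<open>A cut-off by a bump function leaves \<open>u\<close> unchanged near \<open>x0\<close>.
  Coordinates and other local functions become arguments of tangent vectors in this way.\<close>

lemma germ_fun: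
  assumes "c \<in> A" "open W" "x0 \<in> W" "W \<subseteq> dm c" "smooth_on W u"
  obtains f r where "smooth_fun A f" "r > 0" "ball x0 r \<subseteq> W" "\<And>x. x \<in> ball x0 r \<Longrightarrow> f (pt c x) = u x"
proof -
  obtain \<beta> K r where b: "smooth_on UNIV \<beta>" "compact K" "K \<subseteq> W" "\<And>x. x \<notin> K \<Longrightarrow> \<beta> x = (0::real)"
    "r > 0" "ball x0 r \<subseteq> W" "\<And>x. x \<in> ball x0 r \<Longrightarrow> \<beta> x = 1"
    using chart_bump[OF assms(1-4)] by metis
  have "smooth_fun A (ext c (\<lambda>x. \<beta> x * u x))"
  proof (rule smooth_fun_ext[OF assms(1,2) _ b(2,3)])
    show "smooth_on W (\<lambda>x. \<beta> x * u x)"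
      by (intro smooth_on_mult assms(2,5) smooth_on_subset[OF b(1)]) auto
  qed (use b assms in auto)
  moreover have "ext c (\<lambda>x. \<beta> x * u x) (pt c x) = u x" if "x \<in> ball x0 r" for x
    using that b(6,7) assms(1,4) by (auto simp: ext_def pt_in snd_pt subset_eq)
  ultimately show ?thesis using b(5,6) that by blast
qed

subsection \<open>Tangent vectors\<close>

lemma tangent_lin:
  "v \<in> tangent_space A p \<Longrightarrow> smooth_fun A f \<Longrightarrow> smooth_fun A h \<Longrightarrow>
    v (\<lambda>q. a * f q + b * h q) = a * v f + b * v h"
  unfolding tangent_space_def by blast

lemma tangent_mult:
  "v \<in> tangent_space A p \<Longrightarrow> smooth_fun A f \<Longrightarrow> smooth_fun A h \<Longrightarrow>
    v (\<lambda>q. f q * h q) = f p * v h + v f * h p"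
  unfolding tangent_space_def by blast

lemma tangent_not_smooth: "v \<in> tangent_space A p \<Longrightarrow> \<not> smooth_fun A f \<Longrightarrow> v f = 0"
  unfolding tangent_space_def by blast

lemma tangent_const: "v \<in> tangent_space A p \<Longrightarrow> v (\<lambda>q. k) = 0"
proof -
  assume v: "v \<in> tangent_space A p"
  have "v (\<lambda>q. 1) = 0" using tangent_mult[OF v smooth_fun_const smooth_fun_const, of 1 1] by simp
  then show ?thesis using tangent_lin[OF v smooth_fun_const smooth_fun_const, of k 1 0 1] by simp
qed

lemma tangent_add: "v \<in> tangent_space A p \<Longrightarrow> smooth_fun A f \<Longrightarrow> smooth_fun A h \<Longrightarrow>
    v (\<lambda>q. f q + h q) = v f + v h"
  using tangent_lin[of v p f h 1 1] by simp

lemma tangent_diff: "v \<in> tangent_space A p \<Longrightarrow> smooth_fun A f \<Longrightarrow> smooth_fun A h \<Longrightarrow>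
    v (\<lambda>q. f q - h q) = v f - v h"
  using tangent_lin[of v p f h 1 "-1"] by simp

lemma tangent_sum:
  "v \<in> tangent_space A p \<Longrightarrow> (\<And>i. i \<in> I \<Longrightarrow> smooth_fun A (f i)) \<Longrightarrow>
    v (\<lambda>q. \<Sum>i\<in>I. f i q) = (\<Sum>i\<in>I. v (f i))"
proof (induction I rule: infinite_finite_induct)
  case (insert i I)
  have "v (\<lambda>q. f i q + (\<Sum>i\<in>I. f i q)) = v (f i) + v (\<lambda>q. \<Sum>i\<in>I. f i q)"
    using insert.prems by (intro tangent_add smooth_fun_sum) auto
  then show ?case using insert by simp
qed (auto simp: tangent_const)

text \<open>The difference of the two functions times a bump supported in \<open>N\<close> is
  identically 0. By the product rule at \<open>p\<close>, where the bump is 1 and the difference 0,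
  \<open>v\<close> annihilates the difference.\<close>

lemma tangent_local:
  assumes v: "v \<in> tangent_space A p" and f: "smooth_fun A f" "smooth_fun A h"
    and N: "open N" "p \<in> N" "\<And>q. q \<in> N \<Longrightarrow> f q = h q"
  shows "v f = v h"
proof -
  obtain c where c: "c \<in> A" "p \<in> fst c" by (rule chart_ex)
  have o: "open {x \<in> dm c. pt c x \<in> N}" by (rule open_pt_vimage[OF c(1) N(1)])
  have i: "snd c p \<in> {x \<in> dm c. pt c x \<in> N}" using c N(2) by (auto simp: snd_in pt_snd)
  obtain \<beta> K r where b: "smooth_on UNIV \<beta>" "compact K" "K \<subseteq> {x \<in> dm c. pt c x \<in> N}"
    "\<And>x. x \<notin> K \<Longrightarrow> \<beta> x = (0::real)" "r > 0" "\<And>x. x \<in> ball (snd c p) r \<Longrightarrow> \<beta> x = 1"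
    using chart_bump[OF c(1) o i] by (metis (no_types, lifting) mem_Collect_eq subsetI)
  have s: "smooth_fun A (ext c \<beta>)"
    by (rule smooth_fun_ext[OF c(1) open_UNIV b(1,2)]) (use b in auto)
  have "(f q - h q) * ext c \<beta> q = 0" for q
    using N(3) b(3,4) pt_snd[OF c(1)] by (fastforce simp: ext_def)
  then have "(\<lambda>q. (f q - h q) * ext c \<beta> q) = (\<lambda>q. 0)" by (rule HOL.ext)
  then have "v (\<lambda>q. (f q - h q) * ext c \<beta> q) = 0" using tangent_const[OF v, of 0] by metis
  moreover have "ext c \<beta> p = 1" using c b by (simp add: ext_def)
  ultimately have "v (\<lambda>q. f q - h q) = 0"
    using tangent_mult[OF v smooth_fun_diff[OF f] s] N by simp
  then show ?thesis using tangent_diff[OF v f] by simp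
qed

lemma dd_has_derivative:
  "smooth_fun A f \<Longrightarrow> c \<in> A \<Longrightarrow> x \<in> dm c \<Longrightarrow> ((\<lambda>y. f (pt c y)) has_derivative dd c f x) (at x)"
  unfolding dd_def by (rule smooth_onD[OF smooth_fun_chart])

lemma dd_eqI:
  "((\<lambda>y. f (pt c y)) has_derivative D) (at x) \<Longrightarrow> dd c f x = D"
  unfolding dd_def by (metis frechet_derivative_at)

lemma dd_linear: "smooth_fun A f \<Longrightarrow> c \<in> A \<Longrightarrow> x \<in> dm c \<Longrightarrow> linear (dd c f x)"
  by (rule has_derivative_linear[OF dd_has_derivative])

lemma coord_vec_dd:
  "coord_vec A c p e f = (if smooth_fun A f then dd c f (snd c p) e else 0)"
  by (simp add: coord_vec_def dd_def pt_def o_def)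

lemma coord_vec_tangent:
  assumes "c \<in> A" "p \<in> fst c"
  shows "coord_vec A c p e \<in> tangent_space A p"
  unfolding tangent_space_def
proof (intro CollectI conjI allI impI)
  fix f h a b assume s: "smooth_fun A f" "smooth_fun A h"
  note x = snd_in[OF assms]
  note df = dd_has_derivative[OF s(1) assms(1) x] and dh = dd_has_derivative[OF s(2) assms(1) x]
  have "dd c (\<lambda>q. a * f q + b * h q) (snd c p) = (\<lambda>e. a * dd c f (snd c p) e + b * dd c h (snd c p) e)"
    by (rule dd_eqI) (intro has_derivative_add has_derivative_mult_right df dh)
  moreover have "smooth_fun A (\<lambda>q. a * f q + b * h q)"
    by (intro smooth_fun_add smooth_fun_mult smooth_fun_const s)
  ultimately show "coord_vec A c p e (\<lambda>q. a * f q + b * h q) = a * coord_vec A c p e f + b * coord_vec A c p e h"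
    using s by (simp add: coord_vec_dd)
next
  fix f h assume s: "smooth_fun A f" "smooth_fun A h"
  note x = snd_in[OF assms]
  note df = dd_has_derivative[OF s(1) assms(1) x] and dh = dd_has_derivative[OF s(2) assms(1) x]
  have "dd c (\<lambda>q. f q * h q) (snd c p) = (\<lambda>e. f p * dd c h (snd c p) e + dd c f (snd c p) e * h p)"
    by (rule dd_eqI) (use has_derivative_mult[OF df dh] in \<open>simp add: pt_snd[OF assms]\<close>)
  then show "coord_vec A c p e (\<lambda>q. f q * h q) = f p * coord_vec A c p e h + coord_vec A c p e f * h p"
    using s smooth_fun_mult by (simp add: coord_vec_dd)
qed (simp add: coord_vec_def)

text \<open>The components of \<open>e\<close> are recovered by applying the vector to global
  functions that agree near \<open>p\<close> with the linear coordinates.\<close>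

lemma coord_vec_inj:
  assumes "c \<in> A" "p \<in> fst c" "coord_vec A c p e = coord_vec A c p e'"
  shows "e = e'"
proof (rule euclidean_eqI)
  fix b :: "complex ^ 'n" assume "b \<in> Basis"
  note x = snd_in[OF assms(1,2)]
  obtain f r where f: "smooth_fun A f" "r > 0" "ball (snd c p) r \<subseteq> dm c"
    "\<And>y. y \<in> ball (snd c p) r \<Longrightarrow> f (pt c y) = y \<bullet> b"
    by (rule germ_fun[OF assms(1) open_dm[OF assms(1)] x order_refl
      smooth_on_bounded_linear[OF open_dm[OF assms(1)] bounded_linear_inner_left[of b]]]) (rule that)
  have "dd c f (snd c p) = (\<lambda>e. e \<bullet> b)"
  proof (rule dd_eqI)
    have "((\<lambda>y. y \<bullet> b) has_derivative (\<lambda>e. e \<bullet> b)) (at (snd c p))"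
      by (rule bounded_linear_imp_has_derivative[OF bounded_linear_inner_left])
    then show "((\<lambda>y. f (pt c y)) has_derivative (\<lambda>e. e \<bullet> b)) (at (snd c p))"
      by (rule has_derivative_transform_within_open[OF _ open_ball]) (use f in auto)
  qed
  then show "e \<bullet> b = e' \<bullet> b" using fun_cong[OF assms(3), of f] f(1) by (simp add: coord_vec_dd)
qed

text \<open>Hadamard's decomposition reduces a derivation to its values on the coordinates
  \<open>X b\<close>. Both factors of each product are first replaced by global functions with the
  same germ; \<open>tangent_local\<close> then identifies \<open>f\<close> with the global sum
  \<open>F\<close>.\<close>

lemma tangent_coord_ex:
  assumes c: "c \<in> A" "p \<in> fst c" and v: "v \<in> tangent_space A p"
  obtains e where "v = coord_vec A c p e"
proof -
  define x0 where "x0 = snd c p"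
  have x0: "x0 \<in> dm c" using snd_in[OF c] by (simp add: x0_def)
  have p0: "pt c x0 = p" using pt_snd[OF c] by (simp add: x0_def)
  obtain R where R: "R > 0" "ball x0 R \<subseteq> dm c" using open_dm[OF c(1)] x0 open_contains_ball by blast
  have x0R: "x0 \<in> ball x0 R" using R by simp
  have "\<exists>X r. smooth_fun A X \<and> r > 0 \<and> ball x0 r \<subseteq> ball x0 R \<and> (\<forall>x\<in>ball x0 r. X (pt c x) = (x - x0) \<bullet> b)" for b
    by (rule germ_fun[OF c(1) open_ball x0R R(2) smooth_on_vec_inner[OF open_ball
          smooth_on_diff[OF open_ball smooth_on_id[OF open_ball] smooth_on_const[of _ x0]], where b=b]]) blast
  then obtain X rX where X: "\<And>b. smooth_fun A (X b)" "\<And>b. rX b > 0" "\<And>b. ball x0 (rX b) \<subseteq> ball x0 R"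
      "\<And>b x. x \<in> ball x0 (rX b) \<Longrightarrow> X b (pt c x) = (x - x0) \<bullet> b" by metis
  define e where "e = (\<Sum>b\<in>Basis. v (X b) *\<^sub>R b)"
  have "v f = coord_vec A c p e f" for f
  proof (cases "smooth_fun A f")
    case False
    then show ?thesis using tangent_not_smooth[OF v] by (simp add: coord_vec_dd)
  next
    case True
    have "smooth_on (ball x0 R) (\<lambda>x. f (pt c x))"
      using smooth_fun_chart[OF True c(1)] smooth_on_subset R(2) by blast
    then obtain g where g: "\<And>b. smooth_on (ball x0 R) (g b)"
      "\<And>x. x \<in> ball x0 R \<Longrightarrow> f (pt c x) = f (pt c x0) + (\<Sum>b\<in>Basis. ((x - x0) \<bullet> b) * g b x)"
      "\<And>b. g b x0 = frechet_derivative (\<lambda>x. f (pt c x)) (at x0) b"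
      by (rule hadamard) (rule that)
    have "\<exists>G r. smooth_fun A G \<and> r > 0 \<and> ball x0 r \<subseteq> ball x0 R \<and> (\<forall>x\<in>ball x0 r. G (pt c x) = g b x)" for b
      by (rule germ_fun[OF c(1) open_ball x0R R(2) g(1)[of b]]) blast
    then obtain G rG where G: "\<And>b. smooth_fun A (G b)" "\<And>b. rG b > 0" "\<And>b. ball x0 (rG b) \<subseteq> ball x0 R"
        "\<And>b x. x \<in> ball x0 (rG b) \<Longrightarrow> G b (pt c x) = g b x" by metis
    define N where "N = ball x0 R \<inter> (\<Inter>b\<in>Basis. ball x0 (rX b) \<inter> ball x0 (rG b))"
    have oN: "open N" unfolding N_def by (intro open_Int open_INT open_ball) auto
    have N0: "x0 \<in> N" using R X(2) G(2) by (auto simp: N_def)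
    define F where "F = (\<lambda>q. f p + (\<Sum>b\<in>Basis. X b q * G b q))"
    have sXG: "smooth_fun A (\<lambda>q. X b q * G b q)" for b by (intro smooth_fun_mult X G)
    have sF: "smooth_fun A F" unfolding F_def by (intro smooth_fun_add smooth_fun_const smooth_fun_sum sXG)
    have "f (pt c x) = F (pt c x)" if "x \<in> N" for x
    proof -
      have "(\<Sum>b\<in>Basis. X b (pt c x) * G b (pt c x)) = (\<Sum>b\<in>Basis. ((x - x0) \<bullet> b) * g b x)"
        by (rule sum.cong) (use that X(4) G(4) in \<open>auto simp: N_def\<close>)
      then show ?thesis using g(2)[of x] that by (simp add: F_def p0 N_def)
    qed
    then have "v f = v F"
      by (intro tangent_local[OF v True sF open_pt_image[OF c(1) oN]])
        (use R N0 p0 in \<open>auto simp: N_def\<close>)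
    also have "\<dots> = v (\<lambda>q. f p) + v (\<lambda>q. \<Sum>b\<in>Basis. X b q * G b q)"
      unfolding F_def by (intro tangent_add[OF v] smooth_fun_const smooth_fun_sum sXG)
    also have "\<dots> = v (\<lambda>q. \<Sum>b\<in>Basis. X b q * G b q)" by (simp add: tangent_const[OF v])
    also have "\<dots> = (\<Sum>b\<in>Basis. v (\<lambda>q. X b q * G b q))" by (rule tangent_sum[OF v sXG])
    also have "\<dots> = (\<Sum>b\<in>Basis. v (X b) * dd c f x0 b)"
    proof (rule sum.cong)
      fix b :: "complex ^ 'n"
      have "X b p = 0" using X(4)[of x0 b] X(2) p0 by simp
      moreover have "G b p = dd c f x0 b" using G(4)[of x0 b] G(2) p0 g(3) by (simp add: dd_def)
      ultimately show "v (\<lambda>q. X b q * G b q) = v (X b) * dd c f x0 b"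
        using tangent_mult[OF v X(1) G(1), of b b] by simp
    qed simp
    also have "\<dots> = dd c f x0 e"
      unfolding e_def using dd_linear[OF True c(1) x0] by (simp add: linear_sum linear_scale)
    finally show ?thesis using True by (simp add: coord_vec_dd x0_def)
  qed
  then show ?thesis using that by blast
qed

definition crd :: "('m, 'n) chart \<Rightarrow> 'm \<Rightarrow> 'm tvec \<Rightarrow> complex ^ 'n" where
  "crd c p v = (THE e. v = coord_vec A c p e)"

lemma crd_coord_vec: "c \<in> A \<Longrightarrow> p \<in> fst c \<Longrightarrow> crd c p (coord_vec A c p e) = e"
  unfolding crd_def by (rule the_equality) (auto dest: coord_vec_inj)

lemma coord_vec_crd: "c \<in> A \<Longrightarrow> p \<in> fst c \<Longrightarrow> v \<in> tangent_space A p \<Longrightarrow> coord_vec A c p (crd c p v) = v"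
  using tangent_coord_ex crd_coord_vec by metis

lemma crd_apply:
  "c \<in> A \<Longrightarrow> p \<in> fst c \<Longrightarrow> v \<in> tangent_space A p \<Longrightarrow> smooth_fun A f \<Longrightarrow> v f = dd c f (snd c p) (crd c p v)"
  using coord_vec_crd coord_vec_dd by metis

lemma coord_vec_lin:
  assumes "c \<in> A" "p \<in> fst c"
  shows "(\<lambda>f. a * coord_vec A c p u f + b * coord_vec A c p w f) = coord_vec A c p (a *\<^sub>R u + b *\<^sub>R w)"
  by (rule HOL.ext) (simp add: coord_vec_dd linear_add linear_scale dd_linear assms snd_in)

lemma coord_vec_trans:
  assumes "c \<in> A" "d \<in> A" "p \<in> fst c" "p \<in> fst d"
  shows "coord_vec A c p e = coord_vec A d p (frechet_derivative (trn c d) (at (snd c p)) e)"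
proof (rule HOL.ext)
  fix f
  have t: "snd c p \<in> tdom c d" using assms by (simp add: tdom_def snd_in pt_snd)
  have tr: "trn c d (snd c p) = snd d p" using assms by (simp add: trn_def pt_snd)
  show "coord_vec A c p e f = coord_vec A d p (frechet_derivative (trn c d) (at (snd c p)) e) f"
  proof (cases "smooth_fun A f")
    case True
    note 1 = dd_has_derivative[OF True assms(2) snd_in[OF assms(2,4)]]
    have "((\<lambda>x. f (pt d (trn c d x))) has_derivative
       (\<lambda>e. dd d f (snd d p) (frechet_derivative (trn c d) (at (snd c p)) e))) (at (snd c p))"
      by (rule has_derivative_compose[where f="trn c d" and g="\<lambda>y. f (pt d y)",
            OF trans_derivative(1)[OF assms(1,2) t]]) (use 1 tr in simp)
    then have "((\<lambda>x. f (pt c x)) has_derivative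
       (\<lambda>e. dd d f (snd d p) (frechet_derivative (trn c d) (at (snd c p)) e))) (at (snd c p))"
      by (rule has_derivative_transform_within_open[OF _ open_tdom[OF assms(1,2)] t])
        (simp add: pt_trans[OF assms(2)])
    then have "dd c f (snd c p) = (\<lambda>e. dd d f (snd d p) (frechet_derivative (trn c d) (at (snd c p)) e))"
      by (rule dd_eqI)
    then show ?thesis using True by (simp add: coord_vec_dd)
  qed (simp add: coord_vec_dd)
qed

lemma crd_trans:
  assumes "c \<in> A" "d \<in> A" "p \<in> fst c" "p \<in> fst d" "v \<in> tangent_space A p"
  shows "crd d p v = frechet_derivative (trn c d) (at (snd c p)) (crd c p v)"
  using coord_vec_trans[OF assms(1-4), of "crd c p v"] coord_vec_crd[OF assms(1,3,5)]
    crd_coord_vec[OF assms(2,4)] by metis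

text \<open>The description in \<open>cstruct\<close> ranges over all charts at \<open>p\<close>; it
  is single-valued because transition maps have complex linear derivatives.\<close>

lemma cstruct_coord_vec:
  assumes "c \<in> A" "p \<in> fst c"
  shows "cstruct A p (coord_vec A c p e) = coord_vec A c p (\<i> *s e)"
  unfolding cstruct_def
proof (rule the_equality)
  show "\<exists>ca\<in>A. \<exists>ea. p \<in> fst ca \<and> coord_vec A c p e = coord_vec A ca p ea \<and>
      coord_vec A c p (\<i> *s e) = coord_vec A ca p (\<i> *s ea)" using assms by blast
  fix w assume "\<exists>ca\<in>A. \<exists>ea. p \<in> fst ca \<and> coord_vec A c p e = coord_vec A ca p ea \<and> w = coord_vec A ca p (\<i> *s ea)"
  then obtain d ea where d: "d \<in> A" "p \<in> fst d" "coord_vec A c p e = coord_vec A d p ea" "w = coord_vec A d p (\<i> *s ea)"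
    by blast
  have t: "snd c p \<in> tdom c d" using assms d by (simp add: tdom_def snd_in pt_snd)
  have "ea = frechet_derivative (trn c d) (at (snd c p)) e"
    using d(3) coord_vec_trans[OF assms(1) d(1) assms(2) d(2)] coord_vec_inj[OF d(1,2)] by metis
  then show "w = coord_vec A c p (\<i> *s e)"
    using d(4) coord_vec_trans[OF assms(1) d(1) assms(2) d(2)] trans_derivative(2)[OF assms(1) d(1) t] by metis
qed

end

section \<open>Product rules for families of bilinear maps\<close>

lemma bilinear_expansion:
  fixes B :: "'b::euclidean_space \<Rightarrow> 'c::euclidean_space \<Rightarrow> 'd::real_vector"
  assumes "bilinear B"
  shows "B u v = (\<Sum>a\<in>Basis. \<Sum>b\<in>Basis. ((u \<bullet> a) * (v \<bullet> b)) *\<^sub>R B a b)"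
proof -
  have "B u v = (\<Sum>a\<in>Basis. (u \<bullet> a) *\<^sub>R B a v)"
    using linear_basis_expansion[of "\<lambda>u. B u v" u] assms by (simp add: bilinear_def)
  also have "\<dots> = (\<Sum>a\<in>Basis. (u \<bullet> a) *\<^sub>R (\<Sum>b\<in>Basis. (v \<bullet> b) *\<^sub>R B a b))"
    using linear_basis_expansion[of "B a" v for a] assms by (simp add: bilinear_def)
  finally show ?thesis by (simp add: scaleR_sum_right)
qed

text \<open>The derivative of \<open>B y u v\<close> is given for fixed \<open>u\<close>,
  \<open>v\<close> only; expansion in both bases reduces moving arguments to that case.
  \<open>B'_sum\<close> expresses bilinearity of the derivative and is a premise because derivatives
  within an arbitrary set need not be unique.\<close>

lemma bilinear_family_has_derivative_within:
  fixes B :: "'a::real_normed_vector \<Rightarrow> 'b::euclidean_space \<Rightarrow> 'c::euclidean_space \<Rightarrow> 'd::real_normed_vector"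
  assumes S: "x \<in> S" and bil: "\<And>y. y \<in> S \<Longrightarrow> bilinear (B y)"
    and B'_sum: "\<And>u v h. B' u v h = (\<Sum>a\<in>Basis. \<Sum>b\<in>Basis. ((u \<bullet> a) * (v \<bullet> b)) *\<^sub>R B' a b h)"
    and B': "\<And>u v. ((\<lambda>y. B y u v) has_derivative B' u v) (at x within S)"
    and \<eta>: "(\<eta> has_derivative \<eta>') (at x within S)" and \<zeta>: "(\<zeta> has_derivative \<zeta>') (at x within S)"
  shows "((\<lambda>y. B y (\<eta> y) (\<zeta> y)) has_derivative
    (\<lambda>h. B' (\<eta> x) (\<zeta> x) h + B x (\<eta>' h) (\<zeta> x) + B x (\<eta> x) (\<zeta>' h))) (at x within S)"
proof -
  note ex = bilinear_expansion[OF bil]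
  have in1: "((\<lambda>y. (\<eta> y \<bullet> a) * (\<zeta> y \<bullet> b)) has_derivative
      (\<lambda>h. (\<eta> x \<bullet> a) * (\<zeta>' h \<bullet> b) + (\<eta>' h \<bullet> a) * (\<zeta> x \<bullet> b))) (at x within S)" for a b
    by (intro has_derivative_mult bounded_linear.has_derivative[OF bounded_linear_inner_left] \<eta> \<zeta>)
  have "((\<lambda>y. \<Sum>a\<in>Basis. \<Sum>b\<in>Basis. ((\<eta> y \<bullet> a) * (\<zeta> y \<bullet> b)) *\<^sub>R B y a b) has_derivative
     (\<lambda>h. \<Sum>a\<in>Basis. \<Sum>b\<in>Basis. ((\<eta> x \<bullet> a) * (\<zeta> x \<bullet> b)) *\<^sub>R B' a b h
        + ((\<eta> x \<bullet> a) * (\<zeta>' h \<bullet> b) + (\<eta>' h \<bullet> a) * (\<zeta> x \<bullet> b)) *\<^sub>R B x a b)) (at x within S)"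
    by (intro has_derivative_sum has_derivative_scaleR B' in1)
  then have "((\<lambda>y. B y (\<eta> y) (\<zeta> y)) has_derivative
     (\<lambda>h. \<Sum>a\<in>Basis. \<Sum>b\<in>Basis. ((\<eta> x \<bullet> a) * (\<zeta> x \<bullet> b)) *\<^sub>R B' a b h
        + ((\<eta> x \<bullet> a) * (\<zeta>' h \<bullet> b) + (\<eta>' h \<bullet> a) * (\<zeta> x \<bullet> b)) *\<^sub>R B x a b)) (at x within S)"
    by (rule has_derivative_transform[OF S, rotated]) (rule ex)
  then show ?thesis
  proof (rule has_derivative_eq_rhs)
    show "(\<lambda>h. \<Sum>a\<in>Basis. \<Sum>b\<in>Basis. ((\<eta> x \<bullet> a) * (\<zeta> x \<bullet> b)) *\<^sub>R B' a b h
        + ((\<eta> x \<bullet> a) * (\<zeta>' h \<bullet> b) + (\<eta>' h \<bullet> a) * (\<zeta> x \<bullet> b)) *\<^sub>R B x a b)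
      = (\<lambda>h. B' (\<eta> x) (\<zeta> x) h + B x (\<eta>' h) (\<zeta> x) + B x (\<eta> x) (\<zeta>' h))"
      by (rule HOL.ext) (subst B'_sum, subst ex[OF S], subst ex[OF S, of "\<eta> x"],
        simp add: sum.distrib scaleR_left.add add_ac)
  qed
qed

lemma bilinear_derivative_expansion:
  fixes B :: "'a::real_normed_vector \<Rightarrow> 'b::euclidean_space \<Rightarrow> 'c::euclidean_space \<Rightarrow> 'd::real_normed_vector"
  assumes S: "open S" "x \<in> S" and bil: "\<And>y. y \<in> S \<Longrightarrow> bilinear (B y)"
    and B': "\<And>u v. ((\<lambda>y. B y u v) has_derivative B' u v) (at x)"
  shows "B' u v h = (\<Sum>a\<in>Basis. \<Sum>b\<in>Basis. ((u \<bullet> a) * (v \<bullet> b)) *\<^sub>R B' a b h)"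
proof -
  have 1: "((\<lambda>y. \<Sum>a\<in>Basis. \<Sum>b\<in>Basis. ((u \<bullet> a) * (v \<bullet> b)) *\<^sub>R B y a b) has_derivative
     (\<lambda>h. \<Sum>a\<in>Basis. \<Sum>b\<in>Basis. ((u \<bullet> a) * (v \<bullet> b)) *\<^sub>R B' a b h)) (at x)"
    by (intro has_derivative_sum has_derivative_scaleR_right B')
  have "((\<lambda>y. B y u v) has_derivative
     (\<lambda>h. \<Sum>a\<in>Basis. \<Sum>b\<in>Basis. ((u \<bullet> a) * (v \<bullet> b)) *\<^sub>R B' a b h)) (at x)"
    by (rule has_derivative_transform_within_open[OF 1 S]) (rule bilinear_expansion[OF bil, symmetric])
  from has_derivative_unique[OF B' this] show ?thesis by (rule fun_cong)
qed

lemma bilinear_family_has_derivative: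
  fixes B :: "'a::real_normed_vector \<Rightarrow> 'b::euclidean_space \<Rightarrow> 'c::euclidean_space \<Rightarrow> 'd::real_normed_vector"
  assumes S: "open S" "x \<in> S" and bil: "\<And>y. y \<in> S \<Longrightarrow> bilinear (B y)"
    and B': "\<And>u v. ((\<lambda>y. B y u v) has_derivative B' u v) (at x)"
    and \<eta>: "(\<eta> has_derivative \<eta>') (at x)" and \<zeta>: "(\<zeta> has_derivative \<zeta>') (at x)"
  shows "((\<lambda>y. B y (\<eta> y) (\<zeta> y)) has_derivative
    (\<lambda>h. B' (\<eta> x) (\<zeta> x) h + B x (\<eta>' h) (\<zeta> x) + B x (\<eta> x) (\<zeta>' h))) (at x)"
proof -
  have "((\<lambda>y. B y (\<eta> y) (\<zeta> y)) has_derivative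
    (\<lambda>h. B' (\<eta> x) (\<zeta> x) h + B x (\<eta>' h) (\<zeta> x) + B x (\<eta> x) (\<zeta>' h))) (at x within S)"
    by (rule bilinear_family_has_derivative_within[OF S(2) bil bilinear_derivative_expansion[OF S bil B']])
      (assumption, assumption, rule has_derivative_at_withinI[OF B'], rule has_derivative_at_withinI[OF \<eta>], rule has_derivative_at_withinI[OF \<zeta>])
  then show ?thesis using S by (simp only: at_within_open)
qed

subsection \<open>Vector fields in charts\<close>

lemma sum_vfield_apply: "(\<Sum>b\<in>I. F b) p f = (\<Sum>b\<in>I. (F b :: 'm vfield) p f)"
  by (induction I rule: infinite_finite_induct) auto

context cmanifold
begin

definition rep :: "('m, 'n) chart \<Rightarrow> 'm vfield \<Rightarrow> complex ^ 'n \<Rightarrow> complex ^ 'n" where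
  "rep c X x = crd c (pt c x) (X (pt c x))"

abbreviation vf :: "'m vfield \<Rightarrow> bool" where "vf \<equiv> vector_field A"

lemma vf_tangent: "vf X \<Longrightarrow> X p \<in> tangent_space A p"
  by (simp add: vector_field_def)

lemma vf_smooth: "vf X \<Longrightarrow> smooth_fun A f \<Longrightarrow> smooth_fun A (\<lambda>p. X p f)"
  by (simp add: vector_field_def)

lemma rep_apply:
  "c \<in> A \<Longrightarrow> x \<in> dm c \<Longrightarrow> vf X \<Longrightarrow> smooth_fun A f \<Longrightarrow> X (pt c x) f = dd c f x (rep c X x)"
  unfolding rep_def
  using crd_apply[OF _ pt_in[of c x] vf_tangent[of X "pt c x"], of f] snd_pt[of c x] by simp

lemma coord_vec_rep:
  "c \<in> A \<Longrightarrow> x \<in> dm c \<Longrightarrow> vf X \<Longrightarrow> coord_vec A c (pt c x) (rep c X x) = X (pt c x)"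
  unfolding rep_def by (simp add: coord_vec_crd pt_in vf_tangent)

lemma rep_eqI: "c \<in> A \<Longrightarrow> x \<in> dm c \<Longrightarrow> X (pt c x) = coord_vec A c (pt c x) e \<Longrightarrow> rep c X x = e"
  unfolding rep_def by (simp add: crd_coord_vec pt_in)

lemma vf_eqI:
  assumes "vf X" "vf Y" "\<And>c x. c \<in> A \<Longrightarrow> x \<in> dm c \<Longrightarrow> rep c X x = rep c Y x"
  shows "X = Y"
proof (rule HOL.ext)
  fix p
  obtain c where c: "c \<in> A" "p \<in> fst c" by (rule chart_ex)
  show "X p = Y p"
    using coord_vec_rep[OF c(1) snd_in[OF c] assms(1)] coord_vec_rep[OF c(1) snd_in[OF c] assms(2)]
      assms(3)[OF c(1) snd_in[OF c]] pt_snd[OF c] by simp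
qed

lemma rep_smooth:
  assumes "c \<in> A" "vf X"
  shows "smooth_on (dm c) (rep c X)"
proof (rule smooth_on_components[OF open_dm[OF assms(1)]], rule smooth_on_local)
  fix b x0 assume x0: "x0 \<in> dm c"
  obtain f r where f: "smooth_fun A f" "r > 0" "ball x0 r \<subseteq> dm c"
    "\<And>y. y \<in> ball x0 r \<Longrightarrow> f (pt c y) = y \<bullet> b"
    by (rule germ_fun[OF assms(1) open_dm[OF assms(1)] x0 order_refl
      smooth_on_bounded_linear[OF open_dm[OF assms(1)] bounded_linear_inner_left[of b]]]) (rule that)
  have d: "dd c f x = (\<lambda>e. e \<bullet> b)" if "x \<in> ball x0 r" for x
  proof (rule dd_eqI)
    have "((\<lambda>y. y \<bullet> b) has_derivative (\<lambda>e. e \<bullet> b)) (at x)"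
      by (rule bounded_linear_imp_has_derivative[OF bounded_linear_inner_left])
    then show "((\<lambda>y. f (pt c y)) has_derivative (\<lambda>e. e \<bullet> b)) (at x)"
      by (rule has_derivative_transform_within_open[OF _ open_ball that]) (use f in auto)
  qed
  have e: "rep c X x \<bullet> b = X (pt c x) f" if "x \<in> ball x0 r" for x
    using rep_apply[OF assms(1) _ assms(2) f(1), of x] f(3) that d[OF that] by auto
  have "smooth_on (ball x0 r) (\<lambda>x. X (pt c x) f)"
    using smooth_fun_chart[OF vf_smooth[OF assms(2) f(1)] assms(1)] f(3) smooth_on_subset by blast
  then have "smooth_on (ball x0 r) (\<lambda>x. rep c X x \<bullet> b)"
    using smooth_on_cong[OF open_ball, of x0 r "\<lambda>x. rep c X x \<bullet> b" "\<lambda>x. X (pt c x) f"] e by simp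
  then show "\<exists>T. open T \<and> x0 \<in> T \<and> smooth_on T (\<lambda>x. rep c X x \<bullet> b)"
    using f(2) by (intro exI[of _ "ball x0 r"]) auto
qed

lemma rep_has_derivative:
  "c \<in> A \<Longrightarrow> vf X \<Longrightarrow> x \<in> dm c \<Longrightarrow> (rep c X has_derivative frechet_derivative (rep c X) (at x)) (at x)"
  by (rule smooth_onD[OF rep_smooth])

lemma vector_fieldI:
  assumes "\<And>c. c \<in> A \<Longrightarrow> smooth_on (dm c) (\<xi> c)"
    and "\<And>c x. c \<in> A \<Longrightarrow> x \<in> dm c \<Longrightarrow> X (pt c x) = coord_vec A c (pt c x) (\<xi> c x)"
  shows "vf X"
  unfolding vector_field_def
proof (intro conjI allI impI)
  fix p
  obtain c where c: "c \<in> A" "p \<in> fst c" by (rule chart_ex)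
  show "X p \<in> tangent_space A p"
    using assms(2)[OF c(1) snd_in[OF c]] pt_snd[OF c] coord_vec_tangent[OF c] by simp
next
  fix f assume f: "smooth_fun A f"
  show "smooth_fun A (\<lambda>p. X p f)"
    unfolding smooth_fun_iff
  proof
    fix c assume c: "c \<in> A"
    have "smooth_on (dm c) (\<lambda>x. frechet_derivative (\<lambda>y. f (pt c y)) (at x) (\<xi> c x))"
      by (rule smooth_on_deriv_field[OF open_dm[OF c] smooth_fun_chart[OF f c] assms(1)[OF c]])
    then show "smooth_on (dm c) (\<lambda>x. X (pt c x) f)"
      using smooth_on_cong[OF open_dm[OF c], of "\<lambda>x. X (pt c x) f"
          "\<lambda>x. frechet_derivative (\<lambda>y. f (pt c y)) (at x) (\<xi> c x)"] f
      by (simp add: assms(2)[OF c] coord_vec_dd dd_def snd_pt[OF c])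
  qed
qed

lemma lin_field:
  assumes "vf X" "vf Y" "smooth_fun A a" "smooth_fun A b"
  shows "vf (\<lambda>p f. a p * X p f + b p * Y p f)"
    and "c \<in> A \<Longrightarrow> x \<in> dm c \<Longrightarrow>
      rep c (\<lambda>p f. a p * X p f + b p * Y p f) x = a (pt c x) *\<^sub>R rep c X x + b (pt c x) *\<^sub>R rep c Y x"
proof -
  have e: "(\<lambda>f. a (pt c x) * X (pt c x) f + b (pt c x) * Y (pt c x) f) =
      coord_vec A c (pt c x) (a (pt c x) *\<^sub>R rep c X x + b (pt c x) *\<^sub>R rep c Y x)"
    if "c \<in> A" "x \<in> dm c" for c x
    by (simp only: coord_vec_lin[OF that(1) pt_in[OF that], symmetric] coord_vec_rep[OF that assms(1)]
        coord_vec_rep[OF that assms(2)])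
  show "vf (\<lambda>p f. a p * X p f + b p * Y p f)"
    by (rule vector_fieldI[OF _ e])
      (intro smooth_on_add smooth_on_scaleR open_dm smooth_fun_chart rep_smooth assms)
  show "c \<in> A \<Longrightarrow> x \<in> dm c \<Longrightarrow>
      rep c (\<lambda>p f. a p * X p f + b p * Y p f) x = a (pt c x) *\<^sub>R rep c X x + b (pt c x) *\<^sub>R rep c Y x"
    by (rule rep_eqI) (auto intro: e)
qed

lemma vfield_lin_forms:
  "X + Y = (\<lambda>p f. (\<lambda>_. 1) p * X p f + (\<lambda>_. 1) p * Y p f)"
  "X - Y = (\<lambda>p f. (\<lambda>_. 1) p * X p f + (\<lambda>_. -1) p * Y p f)"
  "- X = (\<lambda>p f. (\<lambda>_. -1) p * X p f + (\<lambda>_. 0) p * X p f)"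
  "fmult h X = (\<lambda>p f. h p * X p f + (\<lambda>_. 0) p * X p f)"
  for X Y :: "'m vfield"
  by (auto simp: fun_eq_iff fmult_def)

lemma vf_add: "vf X \<Longrightarrow> vf Y \<Longrightarrow> vf (X + Y)"
  and vf_diff: "vf X \<Longrightarrow> vf Y \<Longrightarrow> vf (X - Y)"
  and vf_minus: "vf X \<Longrightarrow> vf (- X)"
  and vf_fmult: "smooth_fun A h \<Longrightarrow> vf X \<Longrightarrow> vf (fmult h X)"
  by (subst vfield_lin_forms, rule lin_field; simp add: smooth_fun_const)+

lemma vf_zero: "vf 0"
proof (rule vector_fieldI[where \<xi> = "\<lambda>_ _. 0"])
  fix c x assume c: "c \<in> A" "x \<in> dm c"
  show "0 (pt c x) = coord_vec A c (pt c x) 0"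
    by (rule HOL.ext) (simp add: coord_vec_dd snd_pt[OF c] linear_0[OF dd_linear[OF _ c]])
qed (rule smooth_on_const)

lemma vf_sum: "(\<And>i. i \<in> I \<Longrightarrow> vf (F i)) \<Longrightarrow> vf (\<Sum>i\<in>I. F i)"
  by (induction I rule: infinite_finite_induct) (auto intro: vf_zero vf_add)

context
  fixes c x assumes c: "c \<in> A" and x: "x \<in> dm c"
begin

lemma rep_add: "vf X \<Longrightarrow> vf Y \<Longrightarrow> rep c (X + Y) x = rep c X x + rep c Y x"
  by (subst vfield_lin_forms, subst lin_field(2)[OF _ _ smooth_fun_const smooth_fun_const c x]) auto

lemma rep_diff: "vf X \<Longrightarrow> vf Y \<Longrightarrow> rep c (X - Y) x = rep c X x - rep c Y x"
  by (subst vfield_lin_forms, subst lin_field(2)[OF _ _ smooth_fun_const smooth_fun_const c x]) auto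

lemma rep_minus: "vf X \<Longrightarrow> rep c (- X) x = - rep c X x"
  by (subst vfield_lin_forms, subst lin_field(2)[OF _ _ smooth_fun_const smooth_fun_const c x]) auto

lemma rep_fmult: "smooth_fun A h \<Longrightarrow> vf X \<Longrightarrow> rep c (fmult h X) x = h (pt c x) *\<^sub>R rep c X x"
  by (subst vfield_lin_forms, subst lin_field(2)[OF _ _ _ smooth_fun_const c x]) auto

lemma rep_zero: "rep c 0 x = 0"
  using rep_diff[OF vf_zero vf_zero] by simp

lemma rep_sum: "(\<And>i. i \<in> I \<Longrightarrow> vf (F i)) \<Longrightarrow> rep c (\<Sum>i\<in>I. F i) x = (\<Sum>i\<in>I. rep c (F i) x)"
  by (induction I rule: infinite_finite_induct) (auto simp: rep_zero rep_add vf_sum)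

lemma rep_eq_zero_iff: "vf X \<Longrightarrow> rep c X x = 0 \<longleftrightarrow> X (pt c x) = 0"
proof -
  assume X: "vf X"
  have z: "coord_vec A c (pt c x) 0 = 0"
    by (rule HOL.ext) (simp add: coord_vec_dd snd_pt[OF c x] linear_0[OF dd_linear[OF _ c x]])
  show ?thesis using coord_vec_rep[OF c x X] coord_vec_inj[OF c pt_in[OF c x], of "rep c X x" 0] z by metis
qed

end

lemma Jfield_facts:
  assumes "vf X"
  shows vf_J: "vf (Jfield A X)"
    and rep_J: "c \<in> A \<Longrightarrow> x \<in> dm c \<Longrightarrow> rep c (Jfield A X) x = \<i> *s rep c X x"
proof -
  have e: "Jfield A X (pt c x) = coord_vec A c (pt c x) (\<i> *s rep c X x)" if "c \<in> A" "x \<in> dm c" for c x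
    unfolding Jfield_def cstruct_coord_vec[OF that(1) pt_in[OF that], symmetric] coord_vec_rep[OF that assms] ..
  show "vf (Jfield A X)"
    by (rule vector_fieldI[OF _ e])
      (intro smooth_on_compose_linear[OF _ bounded_linear_vector_scale] open_dm rep_smooth assms)
  show "c \<in> A \<Longrightarrow> x \<in> dm c \<Longrightarrow> rep c (Jfield A X) x = \<i> *s rep c X x"
    by (rule rep_eqI) (auto intro: e)
qed

lemma vapply_has_derivative:
  assumes "c \<in> A" "x \<in> dm c" "vf Y" "smooth_fun A f"
  shows "((\<lambda>y. vapply Y f (pt c y)) has_derivative
    (\<lambda>u. frechet_derivative (\<lambda>y. dd c f y (rep c Y x)) (at x) u
       + dd c f x (frechet_derivative (rep c Y) (at x) u))) (at x)"
  unfolding dd_def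
  by (rule has_derivative_transform_within_open[OF
      has_derivative_deriv_field[OF open_dm[OF assms(1)] smooth_fun_chart[OF assms(4,1)] assms(2)
        rep_has_derivative[OF assms(1,3,2)]] open_dm[OF assms(1)] assms(2)])
    (simp add: vapply_def rep_apply[OF assms(1) _ assms(3,4)] dd_def)

text \<open>The second derivatives of the test function cancel by symmetry, so that the commutator
  is again a coordinate vector.\<close>

lemma lie_bracket_facts:
  assumes "vf X" "vf Y"
  shows vf_bracket: "vf (lie_bracket X Y)"
    and rep_bracket: "c \<in> A \<Longrightarrow> x \<in> dm c \<Longrightarrow> rep c (lie_bracket X Y) x =
      frechet_derivative (rep c Y) (at x) (rep c X x) - frechet_derivative (rep c X) (at x) (rep c Y x)"
proof -
  have e: "lie_bracket X Y (pt c x) = coord_vec A c (pt c x)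
      (frechet_derivative (rep c Y) (at x) (rep c X x) - frechet_derivative (rep c X) (at x) (rep c Y x))"
    if c: "c \<in> A" "x \<in> dm c" for c x
  proof (rule HOL.ext)
    fix f
    show "lie_bracket X Y (pt c x) f = coord_vec A c (pt c x)
      (frechet_derivative (rep c Y) (at x) (rep c X x) - frechet_derivative (rep c X) (at x) (rep c Y x)) f"
    proof (cases "smooth_fun A f")
      case False
      then have "vapply X f = (\<lambda>p. 0)" "vapply Y f = (\<lambda>p. 0)"
        using tangent_not_smooth[OF vf_tangent[OF assms(1)]] tangent_not_smooth[OF vf_tangent[OF assms(2)]]
        by (auto simp: vapply_def)
      then show ?thesis using False tangent_const[OF vf_tangent[OF assms(1)]] tangent_const[OF vf_tangent[OF assms(2)]]
        by (simp add: lie_bracket_def coord_vec_dd)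
    next
      case True
      have sX: "smooth_fun A (vapply X f)" and sY: "smooth_fun A (vapply Y f)"
        unfolding vapply_def using True assms by (auto intro: vf_smooth)
      have "X (pt c x) (vapply Y f) = frechet_derivative (\<lambda>y. dd c f y (rep c Y x)) (at x) (rep c X x)
          + dd c f x (frechet_derivative (rep c Y) (at x) (rep c X x))"
        unfolding rep_apply[OF c assms(1) sY] dd_eqI[OF vapply_has_derivative[OF c assms(2) True]] ..
      moreover have "Y (pt c x) (vapply X f) = frechet_derivative (\<lambda>y. dd c f y (rep c X x)) (at x) (rep c Y x)
          + dd c f x (frechet_derivative (rep c X) (at x) (rep c Y x))"
        unfolding rep_apply[OF c assms(2) sX] dd_eqI[OF vapply_has_derivative[OF c assms(1) True]] ..
      moreover have "frechet_derivative (\<lambda>y. dd c f y (rep c Y x)) (at x) (rep c X x)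
          = frechet_derivative (\<lambda>y. dd c f y (rep c X x)) (at x) (rep c Y x)"
        unfolding dd_def
        by (rule second_derivative_symmetric[OF open_dm[OF c(1)] smooth_fun_chart[OF True c(1)] c(2)])
      ultimately show ?thesis using True
        by (simp add: lie_bracket_def coord_vec_dd snd_pt[OF c] linear_diff[OF dd_linear[OF True c]])
    qed
  qed
  show "vf (lie_bracket X Y)"
    by (rule vector_fieldI[OF _ e])
      (intro smooth_on_diff smooth_on_deriv_field open_dm rep_smooth assms)
  show "c \<in> A \<Longrightarrow> x \<in> dm c \<Longrightarrow> rep c (lie_bracket X Y) x =
      frechet_derivative (rep c Y) (at x) (rep c X x) - frechet_derivative (rep c X) (at x) (rep c Y x)"
    by (rule rep_eqI) (auto intro: e)
qed

lemma extended_field: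
  assumes c: "c \<in> A" and W: "open W" "smooth_on W y" and K: "compact K" "K \<subseteq> W" "W \<subseteq> dm c"
    and 0: "\<And>x. x \<in> dm c \<Longrightarrow> x \<notin> K \<Longrightarrow> y x = 0"
  shows "vf (\<lambda>q. if q \<in> fst c then coord_vec A c q (y (snd c q)) else 0)" (is "vf ?Y")
  unfolding vector_field_def
proof (intro conjI allI impI)
  fix p
  have "(0 :: 'm tvec) \<in> tangent_space A p" using vf_tangent[OF vf_zero, of p] by simp
  then show "?Y p \<in> tangent_space A p" using coord_vec_tangent[OF c] by simp
next
  fix f assume f: "smooth_fun A f"
  have "smooth_fun A (ext c (\<lambda>x. frechet_derivative (\<lambda>y. f (pt c y)) (at x) (y x)))"
  proof (rule smooth_fun_ext[OF c W(1) _ K(1,2)])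
    show "smooth_on W (\<lambda>x. frechet_derivative (\<lambda>y. f (pt c y)) (at x) (y x))"
      by (intro smooth_on_deriv_field W smooth_on_subset[OF smooth_fun_chart[OF f c] K(3)])
    show "frechet_derivative (\<lambda>y. f (pt c y)) (at x) (y x) = 0" if "x \<in> dm c" "x \<notin> K" for x
      using 0[OF that] linear_0[OF dd_linear[OF f c that(1)]] by (simp add: dd_def)
  qed (use K in auto)
  moreover have "ext c (\<lambda>x. frechet_derivative (\<lambda>y. f (pt c y)) (at x) (y x)) = (\<lambda>p. ?Y p f)"
    using f by (auto simp: ext_def coord_vec_dd dd_def)
  ultimately show "smooth_fun A (\<lambda>p. ?Y p f)" by simp
qed

lemma germ_field:
  assumes "c \<in> A" "open W" "x0 \<in> W" "W \<subseteq> dm c" "smooth_on W y"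
  obtains Y r where "vf Y" "r > 0" "ball x0 r \<subseteq> W" "\<And>x. x \<in> ball x0 r \<Longrightarrow> rep c Y x = y x"
proof -
  obtain \<beta> K r where b: "smooth_on UNIV \<beta>" "compact K" "K \<subseteq> W" "\<And>x. x \<notin> K \<Longrightarrow> \<beta> x = (0::real)"
    "r > 0" "ball x0 r \<subseteq> W" "\<And>x. x \<in> ball x0 r \<Longrightarrow> \<beta> x = 1"
    using chart_bump[OF assms(1-4)] by metis
  define Y where "Y = (\<lambda>q. if q \<in> fst c then coord_vec A c q (\<beta> (snd c q) *\<^sub>R y (snd c q)) else 0)"
  have "vf Y" unfolding Y_def
  proof (rule extended_field[OF assms(1,2) _ b(2,3) assms(4)])
    show "smooth_on W (\<lambda>x. \<beta> x *\<^sub>R y x)"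
      by (intro smooth_on_scaleR assms(2,5) smooth_on_subset[OF b(1)]) auto
  qed (use b in auto)
  moreover have "rep c Y x = y x" if "x \<in> ball x0 r" for x
  proof (rule rep_eqI[OF assms(1)])
    show x: "x \<in> dm c" using that b(6) assms(4) by blast
    show "Y (pt c x) = coord_vec A c (pt c x) (y x)"
      using x that b(7) pt_in[OF assms(1) x] snd_pt[OF assms(1) x] by (simp add: Y_def)
  qed
  ultimately show ?thesis using b(5,6) that by blast
qed

lemma constant_field:
  assumes "c \<in> A" "x0 \<in> dm c"
  obtains Y r where "vf Y" "r > 0" "ball x0 r \<subseteq> dm c" "\<And>x. x \<in> ball x0 r \<Longrightarrow> rep c Y x = v"
  by (rule germ_field[OF assms(1) open_dm[OF assms(1)] assms(2) order_refl smooth_on_const[of _ v]]) (rule that)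

text \<open>With a bump \<open>\<beta>\<close> equal to 1 near \<open>p\<close>, write
  \<open>Y\<close> as \<open>(1 - \<beta>\<^sup>2) Y\<close> plus the sum of the fields
  \<open>(\<beta> Y\<^sub>b) (\<beta> \<partial>\<^sub>b)\<close>. The bump is used twice in each
  summand, to globalise the component function and to globalise the coordinate field.\<close>

lemma vanishing_field_decomposition:
  assumes c: "c \<in> A" "p \<in> fst c" and Y: "vf Y" "Y p = 0"
  obtains h0 h Z where "smooth_fun A h0" "h0 p = 0" "\<And>b. smooth_fun A (h b)" "\<And>b. h b p = 0" "\<And>b. vf (Z b)"
    "Y = fmult h0 Y + (\<Sum>b\<in>(Basis :: (complex ^ 'n) set). fmult (h b) (Z b))"
proof -
  define x0 where "x0 = snd c p"
  have x0: "x0 \<in> dm c" using snd_in[OF c] by (simp add: x0_def)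
  have p0: "pt c x0 = p" using pt_snd[OF c] by (simp add: x0_def)
  have r0: "rep c Y x0 = 0" using rep_eq_zero_iff[OF c(1) x0 Y(1)] Y(2) p0 by simp
  obtain \<beta> K r where b: "smooth_on UNIV \<beta>" "compact K" "K \<subseteq> dm c" "\<And>x. x \<notin> K \<Longrightarrow> \<beta> x = (0::real)"
    "r > 0" "ball x0 r \<subseteq> dm c" "\<And>x. x \<in> ball x0 r \<Longrightarrow> \<beta> x = 1"
    using chart_bump[OF c(1) open_dm[OF c(1)] x0 order_refl] by metis
  have sb: "smooth_on (dm c) \<beta>" using smooth_on_subset[OF b(1)] by simp
  define h0 where "h0 = (\<lambda>q. 1 - ext c \<beta> q * ext c \<beta> q)"
  define h where "h = (\<lambda>b. ext c (\<lambda>x. \<beta> x * (rep c Y x \<bullet> b)))"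
  define Z where "Z = (\<lambda>b q. if q \<in> fst c then coord_vec A c q (\<beta> (snd c q) *\<^sub>R b) else 0)"
  have s: "smooth_fun A (ext c \<beta>)"
    by (rule smooth_fun_ext[OF c(1) open_dm[OF c(1)] sb b(2,3,3)]) (use b in auto)
  show ?thesis
  proof (rule that[of h0 h Z])
    show "smooth_fun A h0" unfolding h0_def by (intro smooth_fun_diff smooth_fun_mult smooth_fun_const s)
    show "h0 p = 0" using b(5,7) c by (simp add: h0_def ext_def x0_def[symmetric])
    show "smooth_fun A (h b)" for b unfolding h_def
      by (rule smooth_fun_ext[OF c(1) open_dm[OF c(1)] _ b(2,3,3)])
        (use b in \<open>auto intro!: smooth_on_mult sb smooth_on_vec_inner rep_smooth open_dm c Y\<close>)
    show "h b p = 0" for b using r0 by (simp add: h_def ext_def x0_def)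
    show "vf (Z b)" for b unfolding Z_def
      by (rule extended_field[OF c(1) open_dm[OF c(1)] _ b(2,3) order_refl])
        (use b in \<open>auto intro!: smooth_on_scaleR sb smooth_on_const open_dm c\<close>)
    show "Y = fmult h0 Y + (\<Sum>b\<in>Basis. fmult (h b) (Z b))"
    proof (intro HOL.ext)
      fix q f
      show "Y q f = (fmult h0 Y + (\<Sum>b\<in>Basis. fmult (h b) (Z b))) q f"
      proof (cases "q \<in> fst c \<and> smooth_fun A f")
        case True
        define x where "x = snd c q"
        have x: "x \<in> dm c" "pt c x = q" using True snd_in[OF c(1)] pt_snd[OF c(1)] by (auto simp: x_def)
        have l: "linear (dd c f x)" using dd_linear True c x by blast
        have "(\<Sum>b\<in>Basis. fmult (h b) (Z b)) q f = (\<Sum>b\<in>Basis. \<beta> x * (rep c Y x \<bullet> b) * (\<beta> x * dd c f x b))"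
          using True by (simp add: sum_vfield_apply fmult_def h_def ext_def Z_def coord_vec_dd x_def[symmetric] linear_scale[OF l])
        also have "\<dots> = \<beta> x * \<beta> x * (\<Sum>b\<in>Basis. (rep c Y x \<bullet> b) *\<^sub>R dd c f x b)"
          by (simp add: sum_distrib_left mult_ac)
        also have "\<dots> = \<beta> x * \<beta> x * Y q f"
          using rep_apply[OF c(1) x(1) Y(1), of f] True x(2) linear_basis_expansion[OF l, of "rep c Y x"] by simp
        finally show ?thesis using True by (simp add: fmult_def h0_def ext_def x_def[symmetric] algebra_simps)
      next
        case False
        show ?thesis
        proof (cases "smooth_fun A f")
          case True
          then show ?thesis using False by (simp add: sum_vfield_apply fmult_def h0_def h_def ext_def)
        next
          case ns: False
          then show ?thesis using tangent_not_smooth[OF vf_tangent[OF Y(1)] ns]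
            by (auto simp: sum_vfield_apply fmult_def Z_def coord_vec_dd intro!: sum.neutral)
        qed
      qed
    qed
  qed
qed

text \<open>The classical argument that linearity over functions implies pointwise dependence: each
  term of \<open>\<Phi> Y\<close> keeps a coefficient that vanishes at \<open>p\<close>.\<close>

lemma tensorial_zero:
  fixes \<Phi> :: "'m vfield \<Rightarrow> 'm vfield"
  assumes add: "\<And>X Y. vf X \<Longrightarrow> vf Y \<Longrightarrow> \<Phi> (X + Y) = \<Phi> X + \<Phi> Y"
    and mult: "\<And>h X. smooth_fun A h \<Longrightarrow> vf X \<Longrightarrow> \<Phi> (fmult h X) = fmult h (\<Phi> X)"
    and Y: "vf Y" "Y p = 0"
  shows "\<Phi> Y p = 0"
proof -
  obtain c where c: "c \<in> A" "p \<in> fst c" by (rule chart_ex)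
  obtain h0 h Z where d: "smooth_fun A h0" "h0 p = 0" "\<And>b. smooth_fun A (h b)" "\<And>b. h b p = 0" "\<And>b. vf (Z b)"
    "Y = fmult h0 Y + (\<Sum>b\<in>(Basis :: (complex ^ 'n) set). fmult (h b) (Z b))"
    by (rule vanishing_field_decomposition[OF c Y]) (rule that)
  have z: "\<Phi> 0 = 0" using add[OF vf_zero vf_zero] by simp
  have s: "\<Phi> (\<Sum>b\<in>I. fmult (h b) (Z b)) = (\<Sum>b\<in>I. fmult (h b) (\<Phi> (Z b)))" for I
  proof (induction I rule: infinite_finite_induct)
    case (infinite I)
    show ?case unfolding sum.infinite[OF infinite] by (rule z)
  next
    case empty
    show ?case unfolding sum.empty by (rule z)
  next
    case (insert i I)
    have "\<Phi> (fmult (h i) (Z i) + (\<Sum>b\<in>I. fmult (h b) (Z b))) = \<Phi> (fmult (h i) (Z i)) + \<Phi> (\<Sum>b\<in>I. fmult (h b) (Z b))"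
      by (intro add vf_fmult vf_sum d(3,5))
    then show ?case unfolding sum.insert[OF insert(1,2)] insert.IH mult[OF d(3,5)] .
  qed
  have "\<Phi> Y = \<Phi> (fmult h0 Y) + \<Phi> (\<Sum>b\<in>(Basis :: (complex ^ 'n) set). fmult (h b) (Z b))"
    by (subst d(6)) (intro add vf_fmult vf_sum d Y)
  then have e: "\<Phi> Y = fmult h0 (\<Phi> Y) + (\<Sum>b\<in>(Basis :: (complex ^ 'n) set). fmult (h b) (\<Phi> (Z b)))"
    unfolding s mult[OF d(1) Y(1)] .
  have "\<Phi> Y p f = 0" for f
    by (subst e) (simp add: fmult_def sum_vfield_apply d(2,4))
  then show ?thesis by (intro HOL.ext) simp
qed

end

subsection \<open>Connections in charts\<close>

lemma frechet_derivative_cong_ev: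
  assumes "\<forall>\<^sub>F y in nhds x. f y = h y"
  shows "frechet_derivative f (at x) = frechet_derivative h (at x)"
proof -
  have imp: "(h has_derivative D) (at x)" if "(f has_derivative D) (at x)" "\<forall>\<^sub>F y in nhds x. f y = h y" for f h :: "'a \<Rightarrow> 'b" and D
  proof (rule has_derivative_transform_eventually[OF that(1)])
    show "\<forall>\<^sub>F y in at x. f y = h y" using that(2) by (simp add: eventually_at_filter eventually_mono)
    show "f x = h x" using that(2) by (rule eventually_nhds_x_imp_x)
  qed simp
  have "(f has_derivative D) (at x) \<longleftrightarrow> (h has_derivative D) (at x)" for D
    using imp[of f D h] imp[of h D f] assms by (auto simp: eq_commute)
  then show ?thesis by (simp add: frechet_derivative_def)
qed

locale connection_manifold = cmanifold A
  for A :: "('m::{t2_space, second_countable_topology}, 'n::finite) chart set" +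
  fixes D :: "'m connection"
  assumes conn: "affine_connection A D"
begin

lemma D_vf: "vf X \<Longrightarrow> vf Y \<Longrightarrow> vf (D X Y)"
  using conn unfolding affine_connection_def by blast

lemma D_add_left: "vf X \<Longrightarrow> vf Y \<Longrightarrow> vf Z \<Longrightarrow> D (X + Y) Z = D X Z + D Y Z"
  using conn unfolding affine_connection_def by blast

lemma D_add_right: "vf X \<Longrightarrow> vf Y \<Longrightarrow> vf Z \<Longrightarrow> D X (Y + Z) = D X Y + D X Z"
  using conn unfolding affine_connection_def by blast

lemma D_fmult_left: "smooth_fun A h \<Longrightarrow> vf X \<Longrightarrow> vf Y \<Longrightarrow> D (fmult h X) Y = fmult h (D X Y)"
  using conn unfolding affine_connection_def by blast

lemma D_leibniz: "smooth_fun A h \<Longrightarrow> vf X \<Longrightarrow> vf Y \<Longrightarrow>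
    D X (fmult h Y) = fmult (vapply X h) Y + fmult h (D X Y)"
  using conn unfolding affine_connection_def by blast

lemma D_diff_left: "vf X \<Longrightarrow> vf Y \<Longrightarrow> vf Z \<Longrightarrow> D (X - Y) Z = D X Z - D Y Z"
  using D_add_left[of "X - Y" Y Z] by (simp add: vf_diff algebra_simps)

lemma D_diff_right: "vf X \<Longrightarrow> vf Y \<Longrightarrow> vf Z \<Longrightarrow> D X (Y - Z) = D X Y - D X Z"
  using D_add_right[of X "Y - Z" Z] by (simp add: vf_diff algebra_simps)

lemma D_zero_left: "vf Z \<Longrightarrow> D 0 Z = 0"
  using D_diff_left[OF vf_zero vf_zero, of Z] by simp

lemma D_zero_right: "vf X \<Longrightarrow> D X 0 = 0"
  using D_diff_right[OF _ vf_zero vf_zero, of X] by simp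

lemma D_sum_right: "vf X \<Longrightarrow> (\<And>i. i \<in> I \<Longrightarrow> vf (F i)) \<Longrightarrow> D X (\<Sum>i\<in>I. F i) = (\<Sum>i\<in>I. D X (F i))"
proof (induction I rule: infinite_finite_induct)
  case (insert i I)
  have "D X (F i + (\<Sum>i\<in>I. F i)) = D X (F i) + D X (\<Sum>i\<in>I. F i)"
    using insert.prems by (intro D_add_right vf_sum) auto
  moreover have "D X (\<Sum>i\<in>I. F i) = (\<Sum>i\<in>I. D X (F i))"
    by (rule insert.IH) (use insert.prems in auto)
  ultimately show ?case unfolding sum.insert[OF insert(1,2)] by (rule trans[OF _ arg_cong])
qed (simp_all add: D_zero_right)

lemma D_vanish_left: "vf X \<Longrightarrow> vf Y \<Longrightarrow> X p = 0 \<Longrightarrow> D X Y p = 0"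
  by (rule tensorial_zero[of "\<lambda>X. D X Y"]) (auto simp: D_add_left D_fmult_left)

text \<open>In the Leibniz rule for the decomposition all terms with an undifferentiated coefficient
  vanish at \<open>x\<close>. What remains are derivatives of the coefficients, and the same terms
  make up the derivative of \<open>rep c Y\<close>.\<close>

lemma D_vanish_right:
  assumes "vf X" "vf Y" "c \<in> A" "x \<in> dm c" "rep c Y x = 0"
  shows "rep c (D X Y) x = frechet_derivative (rep c Y) (at x) (rep c X x)"
proof -
  define p where "p = pt c x"
  have p: "p \<in> fst c" using assms by (simp add: p_def pt_in)
  have Yp: "Y p = 0" using rep_eq_zero_iff[OF assms(3,4,2)] assms(5) by (simp add: p_def)
  obtain h0 h Z where d: "smooth_fun A h0" "h0 p = 0" "\<And>b. smooth_fun A (h b)" "\<And>b. h b p = 0" "\<And>b. vf (Z b)"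
    and e: "Y = fmult h0 Y + (\<Sum>b\<in>(Basis :: (complex ^ 'n) set). fmult (h b) (Z b))"
    by (rule vanishing_field_decomposition[OF assms(3) p assms(2) Yp]) (rule that)
  have vh: "smooth_fun A (vapply X f)" if "smooth_fun A f" for f
    using vf_smooth[OF assms(1) that] by (simp add: vapply_def)
  have "D X Y = D X (fmult h0 Y) + D X (\<Sum>b\<in>(Basis :: (complex ^ 'n) set). fmult (h b) (Z b))"
    by (subst e) (intro D_add_right vf_fmult vf_sum d assms)
  also have "\<dots> = (fmult (vapply X h0) Y + fmult h0 (D X Y)) +
      (\<Sum>b\<in>(Basis :: (complex ^ 'n) set). fmult (vapply X (h b)) (Z b) + fmult (h b) (D X (Z b)))"
    by (simp add: D_leibniz D_sum_right vf_fmult assms d)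
  finally have "rep c (D X Y) x = rep c ((fmult (vapply X h0) Y + fmult h0 (D X Y)) +
      (\<Sum>b\<in>(Basis :: (complex ^ 'n) set). fmult (vapply X (h b)) (Z b) + fmult (h b) (D X (Z b)))) x" by (rule arg_cong)
  also have "\<dots> = (\<Sum>b\<in>Basis. vapply X (h b) p *\<^sub>R rep c (Z b) x)"
    using d(2,4) assms(5)
    by (simp add: rep_add[OF assms(3,4)] rep_sum[OF assms(3,4)] rep_fmult[OF assms(3,4)] vf_add vf_sum vf_fmult
      D_vf vh d assms(1,2) p_def)
  finally have 1: "rep c (D X Y) x = (\<Sum>b\<in>Basis. vapply X (h b) p *\<^sub>R rep c (Z b) x)" .
  have ry: "rep c Y y = h0 (pt c y) *\<^sub>R rep c Y y + (\<Sum>b\<in>Basis. h b (pt c y) *\<^sub>R rep c (Z b) y)" if "y \<in> dm c" for y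
    using arg_cong[OF e, of "\<lambda>F. rep c F y"]
    by (simp add: rep_add[OF assms(3) that] rep_sum[OF assms(3) that] rep_fmult[OF assms(3) that] vf_sum vf_fmult d assms(2))
  have "((\<lambda>y. h0 (pt c y) *\<^sub>R rep c Y y + (\<Sum>b\<in>Basis. h b (pt c y) *\<^sub>R rep c (Z b) y)) has_derivative
     (\<lambda>u. (h0 (pt c x) *\<^sub>R frechet_derivative (rep c Y) (at x) u + dd c h0 x u *\<^sub>R rep c Y x) +
        (\<Sum>b\<in>Basis. h b (pt c x) *\<^sub>R frechet_derivative (rep c (Z b)) (at x) u + dd c (h b) x u *\<^sub>R rep c (Z b) x))) (at x)"
    by (intro has_derivative_add has_derivative_sum has_derivative_scaleR dd_has_derivative rep_has_derivative d assms)
  then have "(rep c Y has_derivative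
     (\<lambda>u. (h0 (pt c x) *\<^sub>R frechet_derivative (rep c Y) (at x) u + dd c h0 x u *\<^sub>R rep c Y x) +
        (\<Sum>b\<in>Basis. h b (pt c x) *\<^sub>R frechet_derivative (rep c (Z b)) (at x) u + dd c (h b) x u *\<^sub>R rep c (Z b) x))) (at x)"
    by (rule has_derivative_transform_within_open[OF _ open_dm[OF assms(3)] assms(4)]) (rule ry[symmetric])
  from fun_cong[OF frechet_derivative_at[OF this], of "rep c X x"]
  have "frechet_derivative (rep c Y) (at x) (rep c X x) = (\<Sum>b\<in>Basis. dd c (h b) x (rep c X x) *\<^sub>R rep c (Z b) x)"
    using d(2,4) assms(5) by (simp add: p_def)
  then show ?thesis using 1 rep_apply[OF assms(3,4,1) d(3)] by (simp add: p_def vapply_def)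
qed

text \<open>The Christoffel symbols. The choice of the fields is immaterial, since the difference
  between the covariant and the coordinate derivative is tensorial in both arguments, see
  \<open>rep_D_raw\<close>.\<close>

definition Gam :: "('m, 'n) chart \<Rightarrow> complex ^ 'n \<Rightarrow> complex ^ 'n \<Rightarrow> complex ^ 'n \<Rightarrow> complex ^ 'n" where
  "Gam c x u v = (SOME w. \<exists>X Y. vf X \<and> vf Y \<and> rep c X x = u \<and> rep c Y x = v \<and>
     w = rep c (D X Y) x - frechet_derivative (rep c Y) (at x) u)"

definition dGam :: "('m, 'n) chart \<Rightarrow> complex ^ 'n \<Rightarrow> complex ^ 'n \<Rightarrow> complex ^ 'n \<Rightarrow> complex ^ 'n \<Rightarrow> complex ^ 'n" where
  "dGam c x u v w = frechet_derivative (\<lambda>y. Gam c y v w) (at x) u"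

definition Tor :: "('m, 'n) chart \<Rightarrow> complex ^ 'n \<Rightarrow> complex ^ 'n \<Rightarrow> complex ^ 'n \<Rightarrow> complex ^ 'n" where
  "Tor c x u v = Gam c x u v - Gam c x v u"

definition Rm :: "('m, 'n) chart \<Rightarrow> complex ^ 'n \<Rightarrow> complex ^ 'n \<Rightarrow> complex ^ 'n \<Rightarrow> complex ^ 'n \<Rightarrow> complex ^ 'n" where
  "Rm c x u v w = dGam c x u v w - dGam c x v u w + Gam c x u (Gam c x v w) - Gam c x v (Gam c x u w)"

text \<open>Fields with constant coordinates near \<open>x\<close>: their coordinate derivatives
  vanish there, so identities between fields become identities between \<open>Gam\<close>,
  \<open>Tor\<close> and \<open>Rm\<close>.\<close>

definition cf :: "('m, 'n) chart \<Rightarrow> complex ^ 'n \<Rightarrow> complex ^ 'n \<Rightarrow> 'm vfield \<Rightarrow> bool" where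
  "cf c x v Y \<longleftrightarrow> vf Y \<and> (\<forall>\<^sub>F y in nhds x. y \<in> dm c \<and> rep c Y y = v)"

lemma cf_ex: assumes "c \<in> A" "x \<in> dm c" obtains Y where "cf c x v Y"
proof -
  obtain Y r where Y: "vf Y" "r > 0" "ball x r \<subseteq> dm c" "\<And>y. y \<in> ball x r \<Longrightarrow> rep c Y y = v"
    by (rule constant_field[OF assms]) (rule that)
  have "\<forall>\<^sub>F y in nhds x. y \<in> dm c \<and> rep c Y y = v"
    using eventually_nhds_in_open[OF open_ball, of x x r] Y by (auto elim!: eventually_mono)
  then show ?thesis using that Y(1) by (simp add: cf_def)
qed

lemma cf_vf: "cf c x v Y \<Longrightarrow> vf Y" by (simp add: cf_def)

lemma cf_rep: "cf c x v Y \<Longrightarrow> rep c Y x = v"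
  unfolding cf_def using eventually_nhds_x_imp_x by blast

lemma cf_frechet: "cf c x v Y \<Longrightarrow> frechet_derivative (rep c Y) (at x) u = 0"
  using frechet_derivative_cong_ev[where x = x and f = "rep c Y" and h = "\<lambda>_. v"]
  by (auto simp: cf_def eventually_conj_iff)

text \<open>The arguments are exchanged one after the other: \<open>X - X'\<close> and
  \<open>Y - Y'\<close> vanish at the point, where \<open>D_vanish_left\<close> and
  \<open>D_vanish_right\<close> apply.\<close>

lemma rep_D_raw:
  assumes c: "c \<in> A" "x \<in> dm c" and v: "vf X" "vf Y" "vf X'" "vf Y'"
    and e: "rep c X x = rep c X' x" "rep c Y x = rep c Y' x"
  shows "rep c (D X Y) x - frechet_derivative (rep c Y) (at x) (rep c X x) =
    rep c (D X' Y') x - frechet_derivative (rep c Y') (at x) (rep c X x)"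
proof -
  have "rep c (D (X - X') Y) x = 0"
  proof -
    have "(X - X') (pt c x) = 0"
      using rep_eq_zero_iff[OF c vf_diff[OF v(1,3)]] rep_diff[OF c v(1,3)] e by simp
    then show ?thesis
      using D_vanish_left[OF vf_diff[OF v(1,3)] v(2)] rep_eq_zero_iff[OF c D_vf[OF vf_diff[OF v(1,3)] v(2)]] by simp
  qed
  then have 1: "rep c (D X Y) x = rep c (D X' Y) x"
    using v by (simp add: D_diff_left rep_diff[OF c] D_vf)
  have rd: "rep c (Y - Y') y = rep c Y y - rep c Y' y" if "y \<in> dm c" for y
    by (rule rep_diff[OF c(1) that v(2,4)])
  have "(rep c (Y - Y') has_derivative
      (\<lambda>u. frechet_derivative (rep c Y) (at x) u - frechet_derivative (rep c Y') (at x) u)) (at x)"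
    by (rule has_derivative_transform_within_open[OF has_derivative_diff[OF
          rep_has_derivative[OF c(1) v(2) c(2)] rep_has_derivative[OF c(1) v(4) c(2)]] open_dm[OF c(1)] c(2)])
      (rule rd[symmetric])
  from fun_cong[OF frechet_derivative_at[OF this]]
  have f: "frechet_derivative (rep c (Y - Y')) (at x) u
      = frechet_derivative (rep c Y) (at x) u - frechet_derivative (rep c Y') (at x) u" for u by (rule sym)
  have "rep c (Y - Y') x = 0" using rd[OF c(2)] e(2) by simp
  from D_vanish_right[OF v(3) vf_diff[OF v(2,4)] c this]
  have "rep c (D X' Y) x - rep c (D X' Y') x =
      frechet_derivative (rep c Y) (at x) (rep c X x) - frechet_derivative (rep c Y') (at x) (rep c X x)"
    using v e(1) by (simp add: D_diff_right rep_diff[OF c] D_vf f)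
  then show ?thesis using 1 by (simp add: algebra_simps)
qed

context
  fixes c x assumes c: "c \<in> A" and x: "x \<in> dm c"
begin

lemma rep_D:
  assumes "vf X" "vf Y"
  shows "rep c (D X Y) x = frechet_derivative (rep c Y) (at x) (rep c X x) + Gam c x (rep c X x) (rep c Y x)"
proof -
  have "\<exists>X' Y'. vf X' \<and> vf Y' \<and> rep c X' x = rep c X x \<and> rep c Y' x = rep c Y x \<and>
     Gam c x (rep c X x) (rep c Y x) = rep c (D X' Y') x - frechet_derivative (rep c Y') (at x) (rep c X x)"
    unfolding Gam_def by (rule someI_ex) (use assms in blast)
  then obtain X' Y' where "vf X'" "vf Y'" "rep c X' x = rep c X x" "rep c Y' x = rep c Y x"
     "Gam c x (rep c X x) (rep c Y x) = rep c (D X' Y') x - frechet_derivative (rep c Y') (at x) (rep c X x)"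
    by blast
  with rep_D_raw[OF c x assms, of X' Y']
  have "rep c (D X Y) x - frechet_derivative (rep c Y) (at x) (rep c X x) = Gam c x (rep c X x) (rep c Y x)" by simp
  then show ?thesis by (simp add: diff_eq_eq add.commute)
qed

lemma Gam_eq: "vf X \<Longrightarrow> rep c X x = u \<Longrightarrow> cf c x v Y \<Longrightarrow> Gam c x u v = rep c (D X Y) x"
  using rep_D[of X Y] cf_vf[of c x v Y] cf_rep[of c x v Y] cf_frechet[of c x v Y u] by simp

lemma cf_add: "cf c x v Y \<Longrightarrow> cf c x v' Y' \<Longrightarrow> cf c x (v + v') (Y + Y')"
  unfolding cf_def by (auto simp: vf_add rep_add[OF c] elim: eventually_elim2)

lemma cf_fmult: "cf c x v Y \<Longrightarrow> cf c x (a *\<^sub>R v) (fmult (\<lambda>_. a) Y)"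
  unfolding cf_def by (auto simp: vf_fmult smooth_fun_const rep_fmult[OF c] elim: eventually_mono)

lemma cf_J: "cf c x v Y \<Longrightarrow> cf c x (\<i> *s v) (Jfield A Y)"
  unfolding cf_def by (auto simp: vf_J rep_J[OF _ c] elim: eventually_mono)

lemma bilinear_Gam: "bilinear (Gam c x)"
  unfolding bilinear_def
proof (intro conjI allI linearI)
  fix u u' v v' :: "complex ^ 'n" and a :: real
  obtain X where X: "cf c x u X" by (rule cf_ex[OF c x])
  obtain X' where X': "cf c x u' X'" by (rule cf_ex[OF c x])
  obtain Y where Y: "cf c x v Y" by (rule cf_ex[OF c x])
  obtain Y' where Y': "cf c x v' Y'" by (rule cf_ex[OF c x])
  note v = cf_vf[OF X] cf_vf[OF X'] cf_vf[OF Y] cf_vf[OF Y']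
  note r = cf_rep[OF X] cf_rep[OF X'] cf_rep[OF Y] cf_rep[OF Y']
  note sc = smooth_fun_const
  show "Gam c x (u + u') v = Gam c x u v + Gam c x u' v"
    using Gam_eq[OF vf_add[OF v(1,2)] _ Y] Gam_eq[OF v(1) r(1) Y] Gam_eq[OF v(2) r(2) Y] v r
    by (simp add: rep_add[OF c x] D_add_left D_vf)
  show "Gam c x (a *\<^sub>R u) v = a *\<^sub>R Gam c x u v"
    using Gam_eq[OF vf_fmult[OF smooth_fun_const[of a] v(1)] _ Y, where u = "a *\<^sub>R u"] Gam_eq[OF v(1) r(1) Y] v r
    by (simp add: rep_fmult[OF c x] D_fmult_left D_vf sc)
  show "Gam c x u (v + v') = Gam c x u v + Gam c x u v'"
    using Gam_eq[OF v(1) r(1) cf_add[OF Y Y']] Gam_eq[OF v(1) r(1) Y] Gam_eq[OF v(1) r(1) Y'] v r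
    by (simp add: rep_add[OF c x] D_add_right D_vf)
  have va: "vapply X (\<lambda>_. a) = (\<lambda>_. 0)" unfolding vapply_def using tangent_const[OF vf_tangent[OF v(1)]] by simp
  show "Gam c x u (a *\<^sub>R v) = a *\<^sub>R Gam c x u v"
    using Gam_eq[OF v(1) r(1) cf_fmult[OF Y, of a]] Gam_eq[OF v(1) r(1) Y] v r
    by (simp add: rep_fmult[OF c x] rep_add[OF c x] D_leibniz D_vf sc va vf_fmult)
qed

lemmas Gam_simps = bilinear_ladd[OF bilinear_Gam] bilinear_radd[OF bilinear_Gam]
  bilinear_lmul[OF bilinear_Gam] bilinear_rmul[OF bilinear_Gam]
  bilinear_lneg[OF bilinear_Gam] bilinear_rneg[OF bilinear_Gam]
  bilinear_lzero[OF bilinear_Gam] bilinear_rzero[OF bilinear_Gam]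
  bilinear_lsub[OF bilinear_Gam] bilinear_rsub[OF bilinear_Gam]

end

text \<open>Fields with constant coordinates near \<open>x0\<close> exhibit \<open>Gam\<close> on a
  whole neighbourhood as the coordinates of a single smooth field \<open>D X Y\<close>.\<close>

lemma Gam_smooth:
  assumes "c \<in> A"
  shows "smooth_on (dm c) (\<lambda>x. Gam c x u v)"
proof (rule smooth_on_local)
  fix x0 assume x0: "x0 \<in> dm c"
  obtain X where X: "cf c x0 u X" by (rule cf_ex[OF assms x0])
  obtain Y where Y: "cf c x0 v Y" by (rule cf_ex[OF assms x0])
  have "\<forall>\<^sub>F y in nhds x0. y \<in> dm c \<and> rep c X y = u \<and> rep c Y y = v"
    using X Y unfolding cf_def by (auto elim: eventually_elim2)
  then obtain T where T: "open T" "x0 \<in> T" "\<And>y. y \<in> T \<Longrightarrow> y \<in> dm c \<and> rep c X y = u \<and> rep c Y y = v"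
    unfolding eventually_nhds by blast
  have "Gam c y u v = rep c (D X Y) y" if "y \<in> T" for y
  proof (rule Gam_eq[OF assms _ cf_vf[OF X]])
    show "cf c y v Y" unfolding cf_def using cf_vf[OF Y] T that
      by (auto simp: eventually_nhds intro!: exI[of _ T])
  qed (use T that in auto)
  moreover have "smooth_on T (rep c (D X Y))"
    using T by (intro smooth_on_subset[OF rep_smooth[OF assms D_vf[OF cf_vf[OF X] cf_vf[OF Y]]]]) auto
  ultimately have "smooth_on T (\<lambda>x. Gam c x u v)"
    using smooth_on_cong[OF T(1), of "\<lambda>x. Gam c x u v" "rep c (D X Y)"] by simp
  then show "\<exists>T. open T \<and> x0 \<in> T \<and> smooth_on T (\<lambda>x. Gam c x u v)" using T by blast
qed

lemma Gam_has_derivative: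
  "c \<in> A \<Longrightarrow> x \<in> dm c \<Longrightarrow> ((\<lambda>y. Gam c y v w) has_derivative (\<lambda>u. dGam c x u v w)) (at x)"
  unfolding dGam_def by (rule smooth_onD[OF Gam_smooth])

lemma vf_torsion: "vf X \<Longrightarrow> vf Y \<Longrightarrow> vf (torsion D X Y)"
  unfolding torsion_def by (intro vf_diff D_vf vf_bracket)

lemma vf_curvature: "vf X \<Longrightarrow> vf Y \<Longrightarrow> vf Z \<Longrightarrow> vf (curvature D X Y Z)"
  unfolding curvature_def by (intro vf_diff D_vf vf_bracket)

lemma rep_torsion:
  assumes "c \<in> A" "x \<in> dm c" "vf X" "vf Y"
  shows "rep c (torsion D X Y) x = Tor c x (rep c X x) (rep c Y x)"
  unfolding torsion_def Tor_def
  by (simp add: rep_diff[OF assms(1,2)] vf_diff D_vf vf_bracket assms rep_D[OF assms(1,2)] rep_bracket)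

text \<open>The second derivatives of \<open>Z\<close> cancel by symmetry; all other derivatives of
  the fields cancel against the bracket term or in the antisymmetrisation.\<close>

lemma rep_curvature:
  assumes c: "c \<in> A" "x \<in> dm c" and v: "vf X" "vf Y" "vf Z"
  shows "rep c (curvature D X Y Z) x = Rm c x (rep c X x) (rep c Y x) (rep c Z x)"
proof -
  define F where "F = (\<lambda>X x. frechet_derivative (rep c X) (at x))"
  define S where "S = (\<lambda>u v. frechet_derivative (\<lambda>y. F Z y v) (at x) u)"
  have DD: "rep c (D X (D Y Z)) x = S (rep c X x) (rep c Y x) + F Z x (F Y x (rep c X x))
      + (dGam c x (rep c X x) (rep c Y x) (rep c Z x) + Gam c x (F Y x (rep c X x)) (rep c Z x)
         + Gam c x (rep c Y x) (F Z x (rep c X x)))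
      + Gam c x (rep c X x) (F Z x (rep c Y x) + Gam c x (rep c Y x) (rep c Z x))"
    if v: "vf X" "vf Y" for X Y
  proof -
    have h1: "((\<lambda>y. F Z y (rep c Y y)) has_derivative
       (\<lambda>u. S u (rep c Y x) + F Z x (F Y x u))) (at x)"
      unfolding F_def S_def
      by (rule has_derivative_deriv_field[OF open_dm[OF c(1)] rep_smooth[OF c(1) assms(5)] c(2)
            rep_has_derivative[OF c(1) v(2) c(2)]])
    have h2: "((\<lambda>y. Gam c y (rep c Y y) (rep c Z y)) has_derivative
       (\<lambda>u. dGam c x u (rep c Y x) (rep c Z x) + Gam c x (F Y x u) (rep c Z x)
         + Gam c x (rep c Y x) (F Z x u))) (at x)"
      unfolding F_def
      by (rule bilinear_family_has_derivative[where B="Gam c" and B'="\<lambda>v w u. dGam c x u v w" and S="dm c"])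
        (intro open_dm c bilinear_Gam Gam_has_derivative rep_has_derivative v assms(5); simp)+
    have "(rep c (D Y Z) has_derivative (\<lambda>u. (S u (rep c Y x) + F Z x (F Y x u)) +
       (dGam c x u (rep c Y x) (rep c Z x) + Gam c x (F Y x u) (rep c Z x)
         + Gam c x (rep c Y x) (F Z x u)))) (at x)"
      by (rule has_derivative_transform_within_open[OF has_derivative_add[OF h1 h2] open_dm[OF c(1)] c(2)])
        (simp add: rep_D[OF c(1) _ v(2) assms(5)] F_def)
    from fun_cong[OF frechet_derivative_at[OF this]]
    have "frechet_derivative (rep c (D Y Z)) (at x) u = (S u (rep c Y x) + F Z x (F Y x u)) +
       (dGam c x u (rep c Y x) (rep c Z x) + Gam c x (F Y x u) (rep c Z x)
         + Gam c x (rep c Y x) (F Z x u))" for u by (rule sym)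
    then show ?thesis
      using rep_D[OF c v(1) D_vf[OF v(2) assms(5)]] rep_D[OF c v(2) assms(5)] by (simp add: F_def add_ac)
  qed
  have sym: "S u w = S w u" for u w
    unfolding S_def F_def
    by (rule second_derivative_symmetric_vec[OF open_dm[OF c(1)] rep_smooth[OF c(1) v(3)] c(2)])
  have lF: "F Z x (a - b) = F Z x a - F Z x b" for a b
    unfolding F_def using linear_diff[OF has_derivative_linear[OF rep_has_derivative[OF c(1) v(3) c(2)]]] .
  have br: "rep c (D (lie_bracket X Y) Z) x = F Z x (F Y x (rep c X x) - F X x (rep c Y x))
     + Gam c x (F Y x (rep c X x) - F X x (rep c Y x)) (rep c Z x)"
    using rep_D[OF c vf_bracket[OF v(1,2)] v(3)] rep_bracket[OF v(1,2) c] by (simp add: F_def)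
  have rd: "rep c (curvature D X Y Z) x = rep c (D X (D Y Z)) x - rep c (D Y (D X Z)) x
      - rep c (D (lie_bracket X Y) Z) x"
    unfolding curvature_def by (simp add: rep_diff[OF c] vf_diff D_vf vf_bracket v)
  show ?thesis
    unfolding rd Rm_def DD[OF v(1,2)] DD[OF v(2,1)] br lF sym[of "rep c Y x" "rep c X x"] Gam_simps[OF c]
    by simp
qed

subsection \<open>Identities between fields\<close>

lemma bracket_nonsmooth: "vf X \<Longrightarrow> vf Y \<Longrightarrow> \<not> smooth_fun A f \<Longrightarrow> lie_bracket X Y p f = 0"
  by (rule tangent_not_smooth[OF vf_tangent[OF vf_bracket]])

lemma bracket_add_left:
  assumes "vf X" "vf Y" "vf Z"
  shows "lie_bracket (X + Y) Z = lie_bracket X Z + lie_bracket Y Z"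
proof (intro HOL.ext)
  fix p f
  show "lie_bracket (X + Y) Z p f = (lie_bracket X Z + lie_bracket Y Z) p f"
  proof (cases "smooth_fun A f")
    case True
    have "vapply (X + Y) f = (\<lambda>q. vapply X f q + vapply Y f q)" by (simp add: vapply_def fun_eq_iff)
    then have "Z p (vapply (X + Y) f) = Z p (vapply X f) + Z p (vapply Y f)"
      using tangent_add[OF vf_tangent[OF assms(3)] vf_smooth[OF assms(1) True] vf_smooth[OF assms(2) True]]
      by (simp add: vapply_def)
    then show ?thesis by (simp add: lie_bracket_def)
  qed (use assms in \<open>simp add: bracket_nonsmooth vf_add\<close>)
qed

lemma bracket_anti: "lie_bracket X Y = - lie_bracket Y X"
  by (intro HOL.ext) (simp add: lie_bracket_def)

lemma bracket_jacobi:
  assumes "vf X" "vf Y" "vf Z"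
  shows "lie_bracket (lie_bracket X Y) Z + lie_bracket (lie_bracket Y Z) X + lie_bracket (lie_bracket Z X) Y = 0"
proof (intro HOL.ext)
  fix p f
  show "(lie_bracket (lie_bracket X Y) Z + lie_bracket (lie_bracket Y Z) X + lie_bracket (lie_bracket Z X) Y) p f = 0 p f"
  proof (cases "smooth_fun A f")
    case True
    have s1: "smooth_fun A (vapply U h)" if "vf U" "smooth_fun A h" for U h
      unfolding vapply_def using that by (rule vf_smooth)
    have s: "smooth_fun A (vapply U f)" "smooth_fun A (vapply V (vapply U f))" if "vf U" "vf V" for U V
      by (intro s1 that True)+
    have e: "lie_bracket (lie_bracket U V) W p f =
        U p (vapply V (vapply W f)) - V p (vapply U (vapply W f)) - (W p (vapply U (vapply V f)) - W p (vapply V (vapply U f)))"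
      if "vf U" "vf V" "vf W" for U V W
    proof -
      have "vapply (lie_bracket U V) f = (\<lambda>q. vapply U (vapply V f) q - vapply V (vapply U f) q)"
        by (simp add: vapply_def lie_bracket_def)
      then show ?thesis
        using tangent_diff[OF vf_tangent[OF that(3)] s(2)[OF that(2,1)] s(2)[OF that(1,2)]]
        by (simp add: lie_bracket_def)
    qed
    show ?thesis using e[of X Y Z] e[of Y Z X] e[of Z X Y] assms by simp
  qed (use assms in \<open>simp add: bracket_nonsmooth vf_bracket\<close>)
qed

lemma torsion_anti: "torsion D X Y = - torsion D Y X"
  unfolding torsion_def using bracket_anti[of X Y] by (simp add: algebra_simps)

lemma curvature_anti:
  assumes "vf X" "vf Y" "vf Z"
  shows "curvature D X Y Z = - curvature D Y X Z"
proof -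
  have "D (lie_bracket X Y) Z = - D (lie_bracket Y X) Z"
    using D_diff_left[OF vf_zero vf_bracket[OF assms(2,1)] assms(3)] D_zero_left[OF assms(3)] bracket_anti[of X Y] by simp
  then show ?thesis unfolding curvature_def by simp
qed

lemma torsion_diff_left:
  assumes "vf X" "vf Y" "vf Z"
  shows "torsion D (X - Y) Z = torsion D X Z - torsion D Y Z"
proof -
  have "lie_bracket X Z = lie_bracket (X - Y) Z + lie_bracket Y Z"
    using bracket_add_left[OF vf_diff[OF assms(1,2)] assms(2,3)] by simp
  then show ?thesis unfolding torsion_def using assms
    by (simp add: D_diff_left D_diff_right algebra_simps)
qed

lemma torsion_diff_right:
  "vf X \<Longrightarrow> vf Y \<Longrightarrow> vf Z \<Longrightarrow> torsion D X (Y - Z) = torsion D X Y - torsion D X Z"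
  using torsion_diff_left[of Y Z X] torsion_anti[of X "Y - Z"] torsion_anti[of X Y] torsion_anti[of X Z] by simp

lemma curvature_diff_left:
  assumes "vf X" "vf Y" "vf Z" "vf W"
  shows "curvature D (X - Y) Z W = curvature D X Z W - curvature D Y Z W"
proof -
  have "lie_bracket X Z = lie_bracket (X - Y) Z + lie_bracket Y Z"
    using bracket_add_left[OF vf_diff[OF assms(1,2)] assms(2,3)] by simp
  then have "D (lie_bracket X Z) W = D (lie_bracket (X - Y) Z) W + D (lie_bracket Y Z) W"
    using assms by (simp add: D_add_left vf_bracket vf_diff)
  then show ?thesis unfolding curvature_def using assms
    by (simp add: D_diff_left D_diff_right D_vf algebra_simps)
qed

lemma curvature_diff_right:
  assumes "vf X" "vf Y" "vf Z" "vf W"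
  shows "curvature D X Y (Z - W) = curvature D X Y Z - curvature D X Y W"
  unfolding curvature_def using assms by (simp add: D_diff_right D_vf vf_bracket algebra_simps)

lemma curvature_diff_mid:
  assumes "vf X" "vf Y" "vf Z" "vf W"
  shows "curvature D X (Y - Z) W = curvature D X Y W - curvature D X Z W"
  using curvature_diff_left[OF assms(2,3,1,4)] curvature_anti[OF assms(1) vf_diff[OF assms(2,3)] assms(4)]
    curvature_anti[OF assms(1,2,4)] curvature_anti[OF assms(1,3,4)] by simp

lemma vfield_eq_at: "X = Y \<Longrightarrow> (X :: 'm vfield) p f = Y p f"
  by simp

lemmas vf_intros = D_vf vf_bracket vf_torsion vf_curvature vf_diff vf_add

end

section \<open>Bianchi and Ricci identities for parallel torsion and curvature\<close>

locale parallel_connection = connection_manifold +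
  assumes par_torsion: "parallel_torsion A D" and par_curvature: "parallel_curvature A D"
begin

lemma diff_diff_eq_0: "x - a - b = 0 \<Longrightarrow> x = a + b" "x - a - b - c = 0 \<Longrightarrow> x = a + b + c"
  for x a b c :: "'z::ab_group_add"
  by (simp_all add: algebra_simps)

lemma par_tor: "vf W \<Longrightarrow> vf X \<Longrightarrow> vf Y \<Longrightarrow>
    D W (torsion D X Y) = torsion D (D W X) Y + torsion D X (D W Y)"
  by (rule diff_diff_eq_0(1)) (use par_torsion in \<open>simp add: parallel_torsion_def\<close>)

lemma par_cur: "vf W \<Longrightarrow> vf X \<Longrightarrow> vf Y \<Longrightarrow> vf Z \<Longrightarrow>
    D W (curvature D X Y Z) = curvature D (D W X) Y Z + curvature D X (D W Y) Z + curvature D X Y (D W Z)"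
  by (rule diff_diff_eq_0(2)) (use par_curvature in \<open>simp add: parallel_curvature_def\<close>)

text \<open>In general the two sides differ by the cyclic sum of the covariant derivative of the
  torsion, which is 0 here. Evaluation at a point on a function turns the verification into linear
  arithmetic over the reals.\<close>

lemma first_bianchi:
  assumes "vf X" "vf Y" "vf Z"
  shows "curvature D X Y Z + curvature D Y Z X + curvature D Z X Y =
    torsion D (torsion D X Y) Z + torsion D (torsion D Y Z) X + torsion D (torsion D Z X) Y"
proof (intro HOL.ext)
  fix p f
  note ev = vfield_eq_at[where p = p and f = f]
  have e: "D X (torsion D Y Z) p f = D X (D Y Z) p f - D X (D Z Y) p f - D X (lie_bracket Y Z) p f"
    if "vf X" "vf Y" "vf Z" for X Y Z
  proof -
    have "D X (torsion D Y Z) = D X (D Y Z) - D X (D Z Y) - D X (lie_bracket Y Z)"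
      by (simp add: torsion_def[of D Y Z] D_diff_right vf_intros that)
    from ev[OF this] show ?thesis by simp
  qed
  have q: "D X (torsion D Y Z) p f = torsion D (D X Y) Z p f - torsion D (D X Z) Y p f"
    if "vf X" "vf Y" "vf Z" for X Y Z
    using ev[OF par_tor[OF that]] ev[OF torsion_anti[of Y "D X Z"]] by simp
  have t: "torsion D (lie_bracket X Y) Z p f = D (lie_bracket X Y) Z p f - D Z (lie_bracket X Y) p f
      - lie_bracket (lie_bracket X Y) Z p f" for X Y Z
    by (simp add: torsion_def)
  have l: "torsion D (torsion D X Y) Z p f = torsion D (D X Y) Z p f - torsion D (D Y X) Z p f
      - torsion D (lie_bracket X Y) Z p f" if "vf X" "vf Y" "vf Z" for X Y Z
  proof -
    have "torsion D (torsion D X Y) Z = torsion D (D X Y) Z - torsion D (D Y X) Z - torsion D (lie_bracket X Y) Z"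
      by (simp add: torsion_def[of D X Y] torsion_diff_left vf_intros that)
    from ev[OF this] show ?thesis by simp
  qed
  have r: "curvature D X Y Z p f = D X (D Y Z) p f - D Y (D X Z) p f - D (lie_bracket X Y) Z p f" for X Y Z
    by (simp add: curvature_def)
  \<comment> \<open>Parallel torsion, solved for \<open>torsion D (D X Y) Z\<close>. The terms
    \<open>torsion D (D X Z) Y\<close> that it introduces cancel in the cyclic sum.\<close>
  have k: "torsion D (D X Y) Z p f = D X (D Y Z) p f - D X (D Z Y) p f - D X (lie_bracket Y Z) p f
      + torsion D (D X Z) Y p f" if "vf X" "vf Y" "vf Z" for X Y Z
    using e[OF that] q[OF that] by simp
  have jac: "lie_bracket (lie_bracket Z X) Y p f = - lie_bracket (lie_bracket X Y) Z p f - lie_bracket (lie_bracket Y Z) X p f"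
    using ev[OF bracket_jacobi[OF assms]] by simp
  show "(curvature D X Y Z + curvature D Y Z X + curvature D Z X Y) p f =
    (torsion D (torsion D X Y) Z + torsion D (torsion D Y Z) X + torsion D (torsion D Z X) Y) p f"
    unfolding plus_fun_apply r l[OF assms] l[OF assms(2,3,1)] l[OF assms(3,1,2)] t jac
      k[OF assms] k[OF assms(2,3,1)] k[OF assms(3,1,2)] by simp
qed

text \<open>The general identity also contains the cyclic sum of the covariant derivative of the
  curvature, which vanishes by hypothesis.\<close>

lemma second_bianchi:
  assumes "vf X" "vf Y" "vf Z" "vf W"
  shows "curvature D (torsion D X Y) Z W + curvature D (torsion D Y Z) X W + curvature D (torsion D Z X) Y W = 0"
proof (intro HOL.ext)
  fix p f
  note ev = vfield_eq_at[where p = p and f = f]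
  have a: "D X (curvature D Y Z W) p f = D X (D Y (D Z W)) p f - D X (D Z (D Y W)) p f - D X (D (lie_bracket Y Z) W) p f"
    if "vf X" "vf Y" "vf Z" for X Y Z
  proof -
    have "D X (curvature D Y Z W) = D X (D Y (D Z W)) - D X (D Z (D Y W)) - D X (D (lie_bracket Y Z) W)"
      by (simp add: curvature_def[of D Y Z] D_diff_right vf_intros that assms)
    from ev[OF this] show ?thesis by simp
  qed
  have b: "curvature D Y Z U p f = D Y (D Z U) p f - D Z (D Y U) p f - D (lie_bracket Y Z) U p f" for Y Z U
    by (simp add: curvature_def)
  have j: "D (lie_bracket (lie_bracket X Y) Z) W p f + D (lie_bracket (lie_bracket Y Z) X) W p f
      + D (lie_bracket (lie_bracket Z X) Y) W p f = 0"
  proof -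
    have "D (lie_bracket (lie_bracket X Y) Z + lie_bracket (lie_bracket Y Z) X + lie_bracket (lie_bracket Z X) Y) W = 0"
      unfolding bracket_jacobi[OF assms(1-3)] by (rule D_zero_left[OF assms(4)])
    then have "D (lie_bracket (lie_bracket X Y) Z) W + D (lie_bracket (lie_bracket Y Z) X) W
      + D (lie_bracket (lie_bracket Z X) Y) W = 0"
      by (simp add: D_add_left vf_intros assms)
    from ev[OF this] show ?thesis by simp
  qed
  have q: "D X (curvature D Y Z W) p f = curvature D (D X Y) Z W p f - curvature D (D X Z) Y W p f
      + curvature D Y Z (D X W) p f" if "vf X" "vf Y" "vf Z" for X Y Z
    using ev[OF par_cur[OF that assms(4)]] ev[OF curvature_anti[of Y "D X Z" W]] that assms by (simp add: D_vf)
  have l: "curvature D (torsion D X Y) Z W p f = curvature D (D X Y) Z W p f - curvature D (D Y X) Z W p f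
      - curvature D (lie_bracket X Y) Z W p f" if "vf X" "vf Y" "vf Z" for X Y Z
  proof -
    have "curvature D (torsion D X Y) Z W = curvature D (D X Y) Z W - curvature D (D Y X) Z W - curvature D (lie_bracket X Y) Z W"
      by (simp add: torsion_def[of D X Y] curvature_diff_left vf_intros that assms)
    from ev[OF this] show ?thesis by simp
  qed
  have k: "curvature D (D X Y) Z W p f = D X (D Y (D Z W)) p f - D X (D Z (D Y W)) p f - D X (D (lie_bracket Y Z) W) p f
      + curvature D (D X Z) Y W p f - (D Y (D Z (D X W)) p f - D Z (D Y (D X W)) p f - D (lie_bracket Y Z) (D X W) p f)"
    if "vf X" "vf Y" "vf Z" for X Y Z
    using a[OF that] q[OF that] b[of Y Z "D X W"] by simp
  have jac: "D (lie_bracket (lie_bracket Z X) Y) W p f = - D (lie_bracket (lie_bracket X Y) Z) W p f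
      - D (lie_bracket (lie_bracket Y Z) X) W p f" using j by simp
  show "(curvature D (torsion D X Y) Z W + curvature D (torsion D Y Z) X W + curvature D (torsion D Z X) Y W) p f = 0 p f"
    unfolding plus_fun_apply zero_fun_apply l[OF assms(1-3)] l[OF assms(2,3,1)] l[OF assms(3,1,2)]
      b[of "lie_bracket Y Z" X W] b[of "lie_bracket Z X" Y W] b[of "lie_bracket X Y" Z W] jac
      k[OF assms(1-3)] k[OF assms(2,3,1)] k[OF assms(3,1,2)] by simp
qed

text \<open>Ricci identity: the commutator of covariant derivatives acts on tensors as a derivation
  and annihilates parallel ones. Mixed terms, with one derivative on each argument, are symmetric in
  \<open>X\<close>, \<open>Y\<close> and cancel.\<close>

lemma curvature_on_torsion:
  assumes "vf X" "vf Y" "vf Z" "vf W"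
  shows "curvature D X Y (torsion D Z W) = torsion D (curvature D X Y Z) W + torsion D Z (curvature D X Y W)"
proof -
  have dd: "D X (D Y (torsion D Z W)) = torsion D (D X (D Y Z)) W + torsion D (D Y Z) (D X W)
      + (torsion D (D X Z) (D Y W) + torsion D Z (D X (D Y W)))" if "vf X" "vf Y" for X Y
    by (simp add: par_tor D_add_right vf_intros that assms)
  have "curvature D X Y (torsion D Z W) = D X (D Y (torsion D Z W)) - D Y (D X (torsion D Z W))
      - D (lie_bracket X Y) (torsion D Z W)" by (rule curvature_def)
  also have "\<dots> = torsion D (D X (D Y Z) - D Y (D X Z) - D (lie_bracket X Y) Z) W
      + torsion D Z (D X (D Y W) - D Y (D X W) - D (lie_bracket X Y) W)"
    unfolding dd[OF assms(1,2)] dd[OF assms(2,1)]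
    by (simp add: par_tor torsion_diff_left torsion_diff_right vf_intros assms; simp add: algebra_simps)
  finally show ?thesis unfolding curvature_def[of D X Y] .
qed

lemma curvature_on_curvature:
  assumes "vf X" "vf Y" "vf Z" "vf W" "vf V"
  shows "curvature D X Y (curvature D Z W V) = curvature D (curvature D X Y Z) W V
    + curvature D Z (curvature D X Y W) V + curvature D Z W (curvature D X Y V)"
proof -
  let ?R = "curvature D"
  have dd: "D X (D Y (?R Z W V)) = (?R (D X (D Y Z)) W V + ?R (D Y Z) (D X W) V + ?R (D Y Z) W (D X V))
    + (?R (D X Z) (D Y W) V + ?R Z (D X (D Y W)) V + ?R Z (D Y W) (D X V))
    + (?R (D X Z) W (D Y V) + ?R Z (D X W) (D Y V) + ?R Z W (D X (D Y V)))" if "vf X" "vf Y" for X Y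
    by (simp add: par_cur D_add_right vf_intros that assms)
  have "?R X Y (?R Z W V) = D X (D Y (?R Z W V)) - D Y (D X (?R Z W V)) - D (lie_bracket X Y) (?R Z W V)"
    by (rule curvature_def)
  also have "\<dots> = ?R (D X (D Y Z) - D Y (D X Z) - D (lie_bracket X Y) Z) W V
    + ?R Z (D X (D Y W) - D Y (D X W) - D (lie_bracket X Y) W) V + ?R Z W (D X (D Y V) - D Y (D X V) - D (lie_bracket X Y) V)"
    unfolding dd[OF assms(1,2)] dd[OF assms(2,1)]
    by (simp add: par_cur curvature_diff_left curvature_diff_mid curvature_diff_right vf_intros assms; simp add: algebra_simps)
  finally show ?thesis unfolding curvature_def[of D X Y] .
qed

end

subsection \<open>Torsion and curvature at a point\<close>

lemma vector_scale_Re_Im: "z *s v = Re z *\<^sub>R v + Im z *\<^sub>R (\<i> *s v)" for v :: "complex ^ 'n"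
  by (simp add: vec_eq_iff complex_eq_iff)

lemma i_scale_i: "\<i> *s (\<i> *s v) = - v" for v :: "complex ^ 'n"
  by (simp add: vec_eq_iff)

lemma vector_scale_minus: "(- z) *s v = - (z *s v)" "z *s (- v) = - (z *s v)" for v :: "complex ^ 'n"
  by (simp_all add: vec_eq_iff)

lemma vector_scale_diff: "z *s (u - v) = z *s u - z *s v" for v :: "complex ^ 'n"
  by (simp add: vec_eq_iff algebra_simps)

text \<open>The rank-one map \<open>b \<mapsto> l b *s w\<close> has complex trace
  \<open>l w\<close>, and the real trace of a complex linear map is twice the real part of its
  complex trace.\<close>

lemma trace_rank_one:
  fixes w :: "complex ^ 'n"
  assumes add: "\<And>a b. l (a + b) = l a + l b" and scale: "\<And>z a. l (z *s a) = z * l a"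
  shows "(\<Sum>b\<in>Basis. (l b *s w) \<bullet> b) = 2 * Re (l w)"
proof -
  have ax: "axis j (z :: complex) = z *s axis j 1" for j :: 'n and z by (simp add: vec_eq_iff axis_def)
  have sum_l: "l (\<Sum>j\<in>I. F j) = (\<Sum>j\<in>I. l (F j))" for F :: "'n \<Rightarrow> complex ^ 'n" and I
    by (induction I rule: infinite_finite_induct) (use scale[of 0 0] in \<open>auto simp: add\<close>)
  have w: "w = (\<Sum>j\<in>UNIV. w $ j *s axis j 1)"
    by (simp add: vec_eq_iff axis_def if_distrib cong: if_cong)
  have "l w = (\<Sum>j\<in>UNIV. w $ j * l (axis j 1))"
    by (subst w) (simp add: sum_l scale)
  moreover have "(\<Sum>b\<in>Basis. (l b *s w) \<bullet> b) = (\<Sum>j\<in>UNIV. \<Sum>u\<in>Basis. (l (axis j u) *s w) \<bullet> axis j u)"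
  proof -
    have e: "(Basis :: (complex ^ 'n) set) = (\<lambda>(j, u). axis j u) ` (UNIV \<times> Basis)"
      by (auto simp: Basis_vec_def)
    have i: "inj_on (\<lambda>(j :: 'n, u). axis j u) (UNIV \<times> (Basis :: complex set))"
      by (auto simp: inj_on_def axis_eq_axis)
    show ?thesis unfolding e sum.reindex[OF i]
      by (simp add: sum.cartesian_product case_prod_unfold)
  qed
  moreover have "(\<Sum>u\<in>Basis. (l (axis j u) *s w) \<bullet> axis j u) = 2 * Re (w $ j * l (axis j 1))" for j
    by (simp add: Basis_complex_def inner_axis ax[of j "\<i>"] scale inner_complex_def algebra_simps)
  ultimately show ?thesis by (simp add: sum_distrib_left)
qed

text \<open>The identities of a Chern connection with parallel torsion and curvature at one point.
  \<open>T\<close> is complex bilinear, but \<open>R\<close> is only real bilinear in its first two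
  arguments; its type has to be derived.\<close>

locale chern_algebra =
  fixes T :: "complex ^ 'n \<Rightarrow> complex ^ 'n \<Rightarrow> complex ^ 'n"
    and R :: "complex ^ 'n \<Rightarrow> complex ^ 'n \<Rightarrow> complex ^ 'n \<Rightarrow> complex ^ 'n"
    and G :: "complex ^ 'n \<Rightarrow> complex ^ 'n \<Rightarrow> real"
  assumes T_add: "T (a + b) c = T a c + T b c" and T_scale: "T (z *s a) b = z *s T a b"
    and T_anti: "T a b = - T b a"
    and R_add: "R (a + b) c d = R a c d + R b c d" and R_scaleR: "R (r *\<^sub>R a) c d = r *\<^sub>R R a c d"
    and R_anti: "R a b c = - R b a c"
    and R_add3: "R a b (c + d) = R a b c + R a b d" and R_scale3: "R a b (z *s c) = z *s R a b c"
    and G_add: "G (a + b) c = G a c + G b c" and G_scaleR: "G (r *\<^sub>R a) c = r * G a c"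
    and G_sym: "G a b = G b a" and G_i: "G (\<i> *s a) (\<i> *s b) = G a b"
    and G_pos: "a \<noteq> 0 \<Longrightarrow> G a a > 0"
    and R_skew: "G (R a b c) d = - G c (R a b d)"
    and B1: "R a b c + R b c a + R c a b = T (T a b) c + T (T b c) a + T (T c a) b"
    and B2: "R (T a b) c d + R (T b c) a d + R (T c a) b d = 0"
    and R_on_T: "R a b (T c d) = T (R a b c) d + T c (R a b d)"
    and R_on_R: "R a b (R c d e) = R (R a b c) d e + R c (R a b d) e + R c d (R a b e)"
begin

lemma T_add2: "T a (b + c) = T a b + T a c"
  by (subst (1 2 3) T_anti) (simp add: T_add)

lemma T_scale2: "T a (z *s b) = z *s T a b"
  by (subst (1 2) T_anti) (simp add: T_scale vector_scale_minus)

lemma R_add2: "R a (b + c) d = R a b d + R a c d"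
  by (subst (1 2 3) R_anti) (simp add: R_add)

lemma R_scaleR2: "R a (r *\<^sub>R b) d = r *\<^sub>R R a b d"
  by (subst (1 2) R_anti) (simp add: R_scaleR)

lemma R_neg: "R (- a) b c = - R a b c" "R a (- b) c = - R a b c" "R a b (- c) = - R a b c"
  using R_scaleR[of "-1" a b c] R_scaleR2[of a "-1" b c] R_scale3[of a b "-1" c] by simp_all

lemma G_add2: "G a (b + c) = G a b + G a c"
  by (metis G_add G_sym)

lemma G_scaleR2: "G a (r *\<^sub>R b) = r * G a b"
  by (metis G_scaleR G_sym)

lemma G_neg: "G (- a) b = - G a b" "G a (- b) = - G a b"
  using G_scaleR[of "-1" a b] G_scaleR2[of a "-1" b] by simp_all

lemma G_diff: "G (a - b) c = G a c - G b c" "G c (a - b) = G c a - G c b"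
  using G_add[of "a - b" b c] G_add2[of c "a - b" b] by simp_all

lemma G_i2: "G (\<i> *s a) b = - G a (\<i> *s b)"
  using G_i[of "\<i> *s a" b] by (simp add: i_scale_i G_neg)

lemma G_zero_eq: "(\<And>b. G a b = 0) \<Longrightarrow> a = 0"
  using G_pos[of a] by fastforce

text \<open>Multiplication by \<open>\<i>\<close> is itself skew and commutes with \<open>B\<close>,
  so \<open>A\<close> is symmetric as well as skew.\<close>

lemma skew_pair_zero:
  assumes "\<And>a b. G (A a) b = - G a (A b)" "\<And>a b. G (B a) b = - G a (B b)"
    and "\<And>a. A a = \<i> *s B a" "\<And>a. B (\<i> *s a) = \<i> *s B a"
  shows "A a = 0"
proof (rule G_zero_eq)
  fix b
  have "G (A a) b = - G (B a) (\<i> *s b)" by (simp add: assms(3) G_i2)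
  also have "\<dots> = G a (A b)" by (simp add: assms(2-4))
  also have "\<dots> = - G (A a) b" by (simp add: assms(1))
  finally show "G (A a) b = 0" by simp
qed

text \<open>For real \<open>v, w\<close> this is, up to a factor, the curvature \<open>R(v\<^sup>1\<^sup>,\<^sup>0, w\<^sup>0\<^sup>,\<^sup>1)\<close>:
  it is complex linear in \<open>v\<close> and antilinear in \<open>w\<close>.\<close>

definition P where "P v w u = R v (\<i> *s w) u - \<i> *s R v w u"

text \<open>The first Bianchi identity for \<open>\<i> *s w\<close> minus \<open>\<i>\<close> times
  the one for \<open>w\<close>: the torsion sides agree because \<open>T\<close> is complex
  bilinear, the terms with \<open>R u v\<close> because \<open>R u v\<close> is complex
  linear.\<close>

lemma P_sym: "P v w u = P u w v"
proof -
  have "R u v (\<i> *s w) + R v (\<i> *s w) u + R (\<i> *s w) u v = \<i> *s (R u v w + R v w u + R w u v)"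
    unfolding B1 by (simp add: T_scale T_scale2 vector_add_ldistrib)
  then show ?thesis
    using R_anti[of "\<i> *s w" u v] R_anti[of w u v]
    by (simp add: P_def R_scale3 vector_add_ldistrib vector_scale_minus algebra_simps)
qed

lemma P_scale3: "P v w (z *s u) = z *s P v w u"
  by (simp add: P_def R_scale3 vector_scale_diff vector_smult_assoc mult.commute)

text \<open>Symmetry carries complex linearity from the last slot, where it is given, to the first,
  where it is new information about \<open>R\<close> and leads to \<open>R_ii\<close>.\<close>

lemma P_scale1: "P (z *s v) w u = z *s P v w u"
  using P_sym P_scale3 by metis

lemma P_add3: "P v w (u + u') = P v w u + P v w u'"
  by (simp add: P_def R_add3 vector_add_ldistrib)

lemma P_add1: "P (v + v') w u = P v w u + P v' w u"
  using P_sym P_add3 by metis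

lemma P_add2: "P v (w + w') u = P v w u + P v w' u"
  by (simp add: P_def R_add2 vector_add_ldistrib)

lemma P_i2: "P v (\<i> *s w) u = - (\<i> *s P v w u)"
  by (simp add: P_def i_scale_i R_neg vector_scale_diff)

lemma P_scale2: "P v (z *s w) u = cnj z *s P v w u"
proof -
  have "P v (r *\<^sub>R w) u = r *\<^sub>R P v w u" for r w
  proof -
    have "\<i> *s (r *\<^sub>R x) = r *\<^sub>R (\<i> *s x)" for x :: "complex ^ 'n" by (simp add: vec_eq_iff)
    then show ?thesis by (simp add: P_def R_scaleR2 scaleR_diff_right)
  qed
  then have "P v (z *s w) u = Re z *\<^sub>R P v w u - Im z *\<^sub>R (\<i> *s P v w u)"
    by (subst vector_scale_Re_Im) (simp add: P_add2 P_i2)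
  then show ?thesis by (subst vector_scale_Re_Im) simp
qed

lemma P_neg: "P (- v) w u = - P v w u" "P v (- w) u = - P v w u" "P v w (- u) = - P v w u"
  using P_scale1[of "-1" v w u] P_scale2[of v "-1" w u] P_scale3[of v w "-1" u] by simp_all

text \<open>The curvature has type (1,1): linearity of \<open>P\<close> in its first slot writes the
  difference of the two sides as \<open>\<i>\<close> times another skew operator, so
  \<open>skew_pair_zero\<close> applies.\<close>

lemma R_ii: "R (\<i> *s v) (\<i> *s w) u = R v w u"
proof -
  have e: "R (\<i> *s v) (\<i> *s w) u - R v w u = \<i> *s (R (\<i> *s v) w u + R v (\<i> *s w) u)" for u
  proof -
    have "R (\<i> *s v) (\<i> *s w) u - \<i> *s R (\<i> *s v) w u = \<i> *s R v (\<i> *s w) u - (- R v w u)"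
      using P_scale1[of "\<i>" v w u] unfolding P_def vector_scale_diff i_scale_i .
    then show ?thesis unfolding vector_add_ldistrib by (simp add: diff_eq_eq add.commute add.left_commute)
  qed
  have "R (\<i> *s v) (\<i> *s w) u - R v w u = 0"
  proof (rule skew_pair_zero[where A = "\<lambda>u. R (\<i> *s v) (\<i> *s w) u - R v w u" and
          B = "\<lambda>u. R (\<i> *s v) w u + R v (\<i> *s w) u", OF _ _ e])
    show "G (R (\<i> *s v) (\<i> *s w) a - R v w a) b = - G a (R (\<i> *s v) (\<i> *s w) b - R v w b)" for a b
      by (simp add: G_diff R_skew)
    show "G (R (\<i> *s v) w a + R v (\<i> *s w) a) b = - G a (R (\<i> *s v) w b + R v (\<i> *s w) b)" for a b
      by (simp add: G_add G_add2 R_skew)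
    show "R (\<i> *s v) w (\<i> *s a) + R v (\<i> *s w) (\<i> *s a) = \<i> *s (R (\<i> *s v) w a + R v (\<i> *s w) a)" for a
      by (simp add: R_scale3 vector_add_ldistrib)
  qed
  then show ?thesis by simp
qed

lemma R_i1: "R (\<i> *s v) w u = - R v (\<i> *s w) u"
  using R_ii[of "\<i> *s v" w u] R_ii[of v "\<i> *s w" u] by (simp add: i_scale_i R_neg)

text \<open>If \<open>P v w\<close> vanishes, then the skew operator \<open>R v (\<i> *s w)\<close>
  is \<open>\<i>\<close> times the skew operator \<open>R v w\<close>, and
  \<open>skew_pair_zero\<close> kills both. Hence nothing is lost in passing from \<open>R\<close>
  to \<open>P\<close>.\<close>

lemma P_zero_imp:
  assumes "\<And>u. P v w u = 0"
  shows "R v w u = 0"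
proof -
  have e: "R v (\<i> *s w) u = \<i> *s R v w u" for u using assms[of u] by (simp add: P_def)
  have "R v (\<i> *s w) u = 0"
    by (rule skew_pair_zero[OF R_skew R_skew e R_scale3])
  then have "\<i> *s (\<i> *s R v w u) = 0" using e by simp
  then show ?thesis by (simp add: i_scale_i)
qed

lemma P_swap: "P u x z = R x (\<i> *s u) z + \<i> *s R x u z"
  unfolding P_def R_anti[of u "\<i> *s x" z] R_anti[of u x z] R_i1 vector_scale_minus by simp

lemma P_adjoint: "G (P v w u) z = - G u (P w v z)"
  unfolding P_swap[of w v] unfolding P_def G_diff G_add2 G_i2 R_skew R_scale3 by simp

text \<open>The second Bianchi identity becomes \<open>star\<close>. Replacing \<open>u\<close> by
  \<open>\<i> *s u\<close> multiplies the left side and the first term on the right by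
  \<open>\<i>\<close>, but the last term, where \<open>u\<close> sits in the antilinear slot, by
  \<open>-\<i>\<close>. So the last term is 0, for all arguments, and the others follow.\<close>

lemma P_T: "P (T a b) w z = 0" "P v (T a b) z = 0"
proof -
  have star: "P (T u v) w z = P u (T v w) z + P v (T w u) z" for u v w
  proof -
    have 1: "R (T u v) (\<i> *s w) z + R (\<i> *s T v w) u z + R (\<i> *s T w u) v z = 0"
      using B2[of u v "\<i> *s w" z] by (simp add: T_scale T_scale2)
    have 2: "\<i> *s (R (T u v) w z + R (T v w) u z + R (T w u) v z) = 0"
      using B2[of u v w z] by simp
    show ?thesis using 1 2 unfolding P_swap[of u] P_swap[of v] unfolding P_def
      by (simp add: R_i1 vector_add_ldistrib algebra_simps)
  qed
  have 0: "P v (T w u) z = 0" for u v w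
  proof -
    have "\<i> *s P (T u v) w z = \<i> *s P u (T v w) z - \<i> *s P v (T w u) z"
      using star[of "\<i> *s u" v w] by (simp add: T_scale T_scale2 P_scale1 P_i2)
    then have "\<i> *s P v (T w u) z = - (\<i> *s P v (T w u) z)"
      unfolding star by (simp add: vector_add_ldistrib)
    then have "\<i> *s (\<i> *s P v (T w u) z) = 0"
      by (metis (no_types, lifting) add.inverse_neutral eq_neg_iff_add_eq_0 vector_scale_minus(2) scaleR_2 scaleR_eq_0_iff zero_neq_numeral vector_smult_rzero)
    then show ?thesis by (simp add: i_scale_i)
  qed
  show "P v (T a b) z = 0" by (rule 0)
  show "P (T a b) w z = 0" unfolding star 0 by simp
qed

lemma P_T3: "P v w (T a b) = 0"
  using P_sym P_T(1) by metis

text \<open>In the first two slots \<open>P_zero_imp\<close> transfers the vanishing of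
  \<open>P\<close>. In the third, with \<open>t = T a b\<close>, vanishing of \<open>P\<close> reads
  \<open>R v (\<i> *s w) t = \<i> *s R v w t\<close>; the left side is symmetric in
  \<open>v\<close>, \<open>w\<close> by type (1,1), the right side antisymmetric.\<close>

lemma R_T: "R v w (T a b) = 0"
  and R_T1: "R (T a b) v w = 0"
proof -
  have z: "R v (T a b) w = 0" for v w by (rule P_zero_imp) (rule P_T(2))
  then show "R (T a b) v w = 0" using R_anti[of "T a b" v w] by simp
  have 1: "P v w (T a b) = 0" by (rule P_T3)
  have 2: "P v (\<i> *s w) (T a b) = 0" by (rule P_T3)
  \<comment> \<open>the skew part of \<open>P v w\<close> is \<open>R v (\<i> w)\<close>, its symmetric part is \<open>R v w\<close>\<close>
  have "R v (\<i> *s w) (T a b) = \<i> *s R v w (T a b)" for v w using P_T3[of v w a b] by (simp add: P_def)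
  moreover have "R w (\<i> *s v) (T a b) = R v (\<i> *s w) (T a b)" for v w
    using R_anti[of w "\<i> *s v" "T a b"] R_i1[of v w "T a b"] by simp
  ultimately have "\<i> *s R w v (T a b) = \<i> *s R v w (T a b)" for v w by metis
  then have "\<i> *s (\<i> *s R w v (T a b)) = \<i> *s (\<i> *s R v w (T a b))" by simp
  then have "R w v (T a b) = R v w (T a b)" by (simp add: i_scale_i)
  then have "R v w (T a b) = - R v w (T a b)" using R_anti[of v w "T a b"] by simp
  then have "2 *\<^sub>R R v w (T a b) = 0" by (metis eq_neg_iff_add_eq_0 scaleR_2)
  then show "R v w (T a b) = 0" by simp
qed

lemma T_R: "T (R x y a) b + T a (R x y b) = 0"
  using R_on_T[of x y a b] R_T[of x y a b] by simp

lemma R_on_P: "R x y (P v w u) = P (R x y v) w u + P v (R x y w) u + P v w (R x y u)"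
proof -
  have "R x y (P v w u) = R x y (R v (\<i> *s w) u) - \<i> *s R x y (R v w u)"
    unfolding P_def diff_conv_add_uminus R_add3 R_neg R_scale3 ..
  then show ?thesis unfolding R_on_R[of x y v "\<i> *s w" u] R_on_R[of x y v w u] R_scale3
    by (simp add: P_def R_scale3 vector_add_ldistrib)
qed

text \<open>The derivation property of the curvature, written for \<open>P x y\<close>. On the
  antilinear slot it acts through \<open>P y x\<close>: the factor \<open>\<i>\<close> changes sign
  there, which is the difference between \<open>P x y\<close> and \<open>P y x\<close> by
  \<open>P_swap\<close>.\<close>

lemma P_commutator: "P x y (P v w u) - P v w (P x y u) = P (P x y v) w u + P v (P y x w) u"
proof -
  have sub: "P (a - b) w u = P a w u - P b w u" "P v w (a - b) = P v w a - P v w b" for a b v w u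
    using P_add1[of "a - b" b w u] P_add3[of v w "a - b" b] by simp_all
  have e1: "P x y (P v w u) = R x (\<i> *s y) (P v w u) - \<i> *s R x y (P v w u)" by (rule P_def)
  have e2: "P v w (P x y u) = P v w (R x (\<i> *s y) u) - \<i> *s P v w (R x y u)"
    by (simp add: P_def[of x y] sub P_scale3)
  have e3: "P (P x y v) w u = P (R x (\<i> *s y) v) w u - \<i> *s P (R x y v) w u"
    by (simp add: P_def[of x y] sub P_scale1)
  have e4: "P v (P y x w) u = P v (R x (\<i> *s y) w) u - \<i> *s P v (R x y w) u"
    by (simp add: P_swap[of y x] P_add2 P_i2)
  show ?thesis unfolding e1 e2 e3 e4 R_on_P by (simp add: vector_add_ldistrib)
qed

subsection \<open>The Hermitian form\<close>

text \<open>The Hermitian form with real part \<open>G\<close>, linear in the first argument and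
  antilinear in the second; it provides the complex orthogonality in which the operators
  \<open>R x y\<close> are diagonalised.\<close>

definition H where "H u v = Complex (G u v) (G u (\<i> *s v))"

lemma H_add: "H (a + b) c = H a c + H b c" "H a (b + c) = H a b + H a c"
  by (simp_all add: H_def G_add G_add2 vector_add_ldistrib complex_eq_iff)

lemma H_scale: "H (z *s a) b = z * H a b" "H a (z *s b) = cnj z * H a b"
proof -
  have s: "\<i> *s (r *\<^sub>R x) = r *\<^sub>R (\<i> *s x)" for r and x :: "complex ^ 'n" by (simp add: vec_eq_iff)
  have r: "H (r *\<^sub>R a) b = of_real r * H a b" "H a (r *\<^sub>R b) = of_real r * H a b" for r a b
    unfolding H_def s G_scaleR G_scaleR2 by (simp_all add: complex_eq_iff)
  have i: "H (\<i> *s a) b = \<i> * H a b" "H a (\<i> *s b) = - \<i> * H a b" for a b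
    unfolding H_def i_scale_i G_i G_i2 G_neg by (simp_all add: complex_eq_iff)
  show "H (z *s a) b = z * H a b" "H a (z *s b) = cnj z * H a b"
    unfolding vector_scale_Re_Im[of z] H_add r i by (simp_all add: complex_eq_iff)
qed

lemma H_neg: "H (- a) b = - H a b" "H a (- b) = - H a b"
  using H_scale(1)[of "-1" a b] H_scale(2)[of a "-1" b] by simp_all

lemma H_cnj: "H b a = cnj (H a b)"
  using G_sym[of a b] G_i2[of a b] G_sym[of "\<i> *s a" b] by (simp add: H_def complex_eq_iff)

lemma H_diff: "H (a - b) c = H a c - H b c"
  using H_add(1)[of "a - b" b c] by simp

lemma H_zero: "H 0 c = 0" "H c 0 = 0"
  using H_scale[of 0 0 c] H_scale(2)[of c 0 0] by simp_all

lemma H_pos: "a \<noteq> 0 \<Longrightarrow> H a a \<noteq> 0"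
  using G_pos[of a] by (auto simp: H_def complex_eq_iff)

lemma H_sum: "H (\<Sum>i\<in>I. F i) c = (\<Sum>i\<in>I. H (F i) c)"
  by (induction I rule: infinite_finite_induct) (auto simp: H_zero H_add)

lemma H_skew: "H (R x y a) b = - H a (R x y b)"
  by (simp add: H_def R_skew R_scale3 complex_eq_iff flip: R_scale3)

lemma H_P_adjoint: "H (P v w a) b = - H a (P w v b)"
  by (simp add: H_def P_adjoint complex_eq_iff flip: P_scale3)

lemma orthogonal_independent:
  assumes "finite B" "0 \<notin> B" "\<And>a b. a \<in> B \<Longrightarrow> b \<in> B \<Longrightarrow> a \<noteq> b \<Longrightarrow> H a b = 0"
  shows "vec.independent B"
proof
  assume "vec.dependent B"
  then obtain u v where u: "v \<in> B" "u v \<noteq> 0" "(\<Sum>b\<in>B. u b *s b) = 0"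
    using vec.dependent_finite[OF assms(1)] by blast
  have "H (\<Sum>b\<in>B. u b *s b) v = (\<Sum>b\<in>B. u b * H b v)" by (simp add: H_sum H_scale)
  also have "\<dots> = (\<Sum>b\<in>B. if b = v then u v * H v v else 0)"
    by (rule sum.cong) (use assms(3) u(1) in auto)
  also have "\<dots> = u v * H v v" using assms(1) u(1) by simp
  finally have "u v * H v v = 0" using u(3) by (simp add: H_zero)
  then show False using u(1,2) assms(2) H_pos by (metis mult_eq_0_iff)
qed

text \<open>One Gram-Schmidt step: fewer vectors than the dimension do not span, and a vector
  outside the span is reduced by its projection.\<close>

lemma orthogonal_extend:
  assumes "finite B" "0 \<notin> B" "\<And>a b. a \<in> B \<Longrightarrow> b \<in> B \<Longrightarrow> a \<noteq> b \<Longrightarrow> H a b = 0" "card B < CARD('n)"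
  obtains v where "v \<noteq> 0" "\<And>b. b \<in> B \<Longrightarrow> H v b = 0"
proof -
  have "vec.dim (vec.span B) \<le> card B" by (metis assms(1) vec.dim_le_card' vec.dim_span)
  then have "vec.span B \<noteq> UNIV" using assms(4) by (metis vec.dim_UNIV vec_dim_card not_less)
  then obtain w where w: "w \<notin> vec.span B" by blast
  define v where "v = w - (\<Sum>b\<in>B. (H w b / H b b) *s b)"
  have "v \<noteq> 0"
  proof
    assume "v = 0"
    then have "w = (\<Sum>b\<in>B. (H w b / H b b) *s b)" by (simp add: v_def)
    then have "w \<in> vec.span B" by (rule ssubst) (intro vec.span_sum vec.span_scale vec.span_base)
    then show False using w by simp
  qed
  moreover have "H v b = 0" if "b \<in> B" for b
  proof -
    have "H (\<Sum>a\<in>B. (H w a / H a a) *s a) b = (\<Sum>a\<in>B. (H w a / H a a) * H a b)" by (simp add: H_sum H_scale)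
    also have "\<dots> = (\<Sum>a\<in>B. if a = b then H w b else 0)"
    proof (rule sum.cong)
      fix a assume a: "a \<in> B"
      show "H w a / H a a * H a b = (if a = b then H w b else 0)"
        using assms(2,3) a that H_pos[of b] by auto
    qed simp
    finally show ?thesis using assms(1) that by (simp add: v_def H_diff)
  qed
  ultimately show ?thesis using that by blast
qed

end

section \<open>Dimension three: torsion in an eigenbasis of a curvature operator\<close>

locale chern_algebra3 = chern_algebra T R G
  for T :: "complex ^ 3 \<Rightarrow> complex ^ 3 \<Rightarrow> complex ^ 3" and R G
begin

text \<open>An eigenbasis \<open>t, e1, e2\<close> of the skew operator \<open>A = R x y\<close>; by the derivation property of \<open>A\<close>,
  \<open>T(e1, e2)\<close> and \<open>T(e\<^sub>i, t)\<close> are eigenvectors of \<open>A\<close>, while \<open>A\<close> vanishes on values of \<open>T\<close>.\<close>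

context
  fixes x y a b t e1 e2 :: "complex ^ 3" and m1 m2 :: complex
  assumes t: "t = T a b" "t \<noteq> 0" and ne: "e1 \<noteq> 0" "e2 \<noteq> 0"
    and o1: "H e1 t = 0" and o2: "H e2 t = 0" and o3: "H e2 e1 = 0"
    and A1: "R x y e1 = m1 *s e1" and A2: "R x y e2 = m2 *s e2"
    and im1: "cnj m1 = - m1" and im2: "cnj m2 = - m2" and m1: "m1 \<noteq> 0"
begin

definition ct where "ct v = H v t / H t t"
definition c1 where "c1 v = H v e1 / H e1 e1"
definition c2 where "c2 v = H v e2 / H e2 e2"

lemma orth_sym: "H t e1 = 0" "H t e2 = 0" "H e1 e2 = 0"
  using H_cnj[of t e1] H_cnj[of t e2] H_cnj[of e1 e2] o1 o2 o3 by (metis complex_cnj_zero complex_cnj_cnj)+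

lemma coeff_add: "ct (u + v) = ct u + ct v" "c1 (u + v) = c1 u + c1 v" "c2 (u + v) = c2 u + c2 v"
  by (simp_all add: ct_def c1_def c2_def H_add add_divide_distrib)

lemma coeff_scale: "ct (z *s v) = z * ct v" "c1 (z *s v) = z * c1 v" "c2 (z *s v) = z * c2 v"
  by (simp_all add: ct_def c1_def c2_def H_scale)

lemma coeff_basis: "ct t = 1" "ct e1 = 0" "ct e2 = 0" "c1 t = 0" "c1 e1 = 1" "c1 e2 = 0" "c2 t = 0" "c2 e1 = 0" "c2 e2 = 1"
  using H_pos t(2) ne o1 o2 o3 orth_sym by (simp_all add: ct_def c1_def c2_def)

lemma coeff_zero: "ct 0 = 0" "c1 0 = 0" "c2 0 = 0"
  by (simp_all add: ct_def c1_def c2_def H_zero)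

lemma coeff_diff: "ct (u - v) = ct u - ct v" "c1 (u - v) = c1 u - c1 v" "c2 (u - v) = c2 u - c2 v"
  by (simp_all add: ct_def c1_def c2_def H_diff diff_divide_distrib)

lemma coeff_neg: "ct (- v) = - ct v" "c1 (- v) = - c1 v" "c2 (- v) = - c2 v"
  using coeff_diff[of 0 v] coeff_zero by simp_all

text \<open>The dimension enters here: a nonzero remainder would be orthogonal to \<open>t\<close>,
  \<open>e1\<close>, \<open>e2\<close> and yield four independent vectors.\<close>

lemma coeff_expand: "v = ct v *s t + c1 v *s e1 + c2 v *s e2"
proof -
  define w where "w = v - (ct v *s t + c1 v *s e1 + c2 v *s e2)"
  have o: "ct w = 0" "c1 w = 0" "c2 w = 0"
    by (simp_all add: w_def coeff_diff coeff_add coeff_scale coeff_basis)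
  then have o': "H w t = 0" "H w e1 = 0" "H w e2 = 0"
    using H_pos t(2) ne by (auto simp: ct_def c1_def c2_def)
  have o'': "H t w = 0" "H e1 w = 0" "H e2 w = 0"
    using o' H_cnj[of t w] H_cnj[of e1 w] H_cnj[of e2 w] by (metis complex_cnj_zero complex_cnj_cnj)+
  have "w = 0"
  proof (rule ccontr)
    assume w: "w \<noteq> 0"
    have d: "t \<noteq> e1" "t \<noteq> e2" "e1 \<noteq> e2" "w \<noteq> t" "w \<noteq> e1" "w \<noteq> e2"
      using o1 o2 o3 o' H_pos[OF t(2)] H_pos[OF ne(1)] H_pos[OF ne(2)] by auto
    have "vec.independent {w, t, e1, e2}"
      by (rule orthogonal_independent) (use w t(2) ne o' o'' o1 o2 o3 orth_sym in auto)
    then have "card {w, t, e1, e2} \<le> vec.dim (UNIV :: (complex ^ 3) set)"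
      by (intro vec.independent_card_le_dim) auto
    then show False using d by (simp add: card_cart_basis)
  qed
  then show ?thesis by (simp add: w_def)
qed

lemma coeff_eqI: "ct u = ct v \<Longrightarrow> c1 u = c1 v \<Longrightarrow> c2 u = c2 v \<Longrightarrow> u = v"
  using coeff_expand[of u] coeff_expand[of v] by simp

lemma R_t: "R v w t = 0" by (simp add: t R_T)

lemma R_orth: "H e t = 0 \<Longrightarrow> ct (R v w e) = 0"
  using H_skew[of v w e t] by (simp add: ct_def R_t H_zero)

lemma T_self: "T u u = 0"
proof -
  have "T u u + T u u = 0" using T_anti[of u u] by (metis add.right_inverse)
  then have "2 *\<^sub>R T u u = 0" by (simp add: scaleR_2)
  then show ?thesis by simp
qed

lemma T_e1_t: "T e1 t = 0"
proof -
  have "m1 *s T e1 t = 0" using T_R[of x y e1 t] T_scale2[of e1 0 0] by (simp add: A1 R_t T_scale)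
  then show ?thesis using m1 by simp
qed

lemma T_e2_t: "m2 *s T e2 t = 0"
  using T_R[of x y e2 t] T_scale2[of e2 0 0] by (simp add: A2 R_t T_scale)

lemma T_e1_e2: "(m1 + m2) *s T e1 e2 = 0"
  using T_R[of x y e1 e2] by (simp add: A1 A2 T_scale T_scale2 vector_sadd_rdistrib)

text \<open>Of the three basic entries of the skew map \<open>T\<close>, \<open>T e1 t\<close> is 0
  because \<open>m1\<close> is not. The other two are kept; \<open>T e2 t\<close> can be nonzero
  only if \<open>m2 = 0\<close>, and \<open>T e1 e2\<close> only if
  \<open>m1 + m2 = 0\<close>.\<close>

lemma T_expand: "T u v = (c2 u * ct v - ct u * c2 v) *s T e2 t + (c1 u * c2 v - c2 u * c1 v) *s T e1 e2"
proof -
  have s: "T e2 e1 = - T e1 e2" "T t e1 = 0" "T t e2 = - T e2 t"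
    using T_anti[of e2 e1] T_anti[of t e1] T_anti[of t e2] T_e1_t by simp_all
  have "T u v = T (ct u *s t + c1 u *s e1 + c2 u *s e2) (ct v *s t + c1 v *s e1 + c2 v *s e2)"
    using coeff_expand[of u] coeff_expand[of v] by metis
  also have "\<dots> = (c2 u * ct v - ct u * c2 v) *s T e2 t + (c1 u * c2 v - c2 u * c1 v) *s T e1 e2"
    by (simp add: T_add T_add2 T_scale T_scale2 T_self T_e1_t s vec_eq_iff algebra_simps)
  finally show ?thesis .
qed

text \<open>Only \<open>w = T e2 t\<close> is left, so every \<open>T u\<close> has rank at most
  one. As \<open>R x y\<close> kills \<open>w\<close>, and \<open>e1\<close> has a nonzero
  eigenvalue, \<open>w\<close> lies in the span of \<open>t\<close> and \<open>e2\<close>, where the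
  linear form attached to \<open>T u\<close> can be prescribed through \<open>u\<close>.\<close>

lemma trace_case:
  assumes "m2 = 0"
  shows "\<exists>u. (\<Sum>b\<in>Basis. T u b \<bullet> b) \<noteq> 0"
proof -
  define w where "w = T e2 t"
  have z: "T e1 e2 = 0" using T_e1_e2 assms m1 by simp
  have Tw: "T u v = (c2 u * ct v - ct u * c2 v) *s w" for u v
    using T_expand[of u v] by (simp add: z w_def)
  have "w \<noteq> 0" using t Tw[of a b] by auto
  have "R x y w = 0" unfolding w_def by (rule R_T)
  then have "m1 * H w e1 = 0"
    using H_skew[of x y w e1] by (simp add: A1 H_scale H_zero im1)
  then have "c1 w = 0" using m1 by (simp add: c1_def)
  then have w: "w = ct w *s t + c2 w *s e2" using coeff_expand[of w] by simp
  \<comment> \<open>Chosen so that the form \<open>c2 u * ct v - ct u * c2 v\<close> takes at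
    \<open>v = w\<close> the value \<open>|ct w|\<^sup>2 + |c2 w|\<^sup>2\<close>.\<close>
  define u where "u = cnj (ct w) *s e2 - cnj (c2 w) *s t"
  have cu: "c2 u = cnj (ct w)" "ct u = - cnj (c2 w)"
    by (simp_all add: u_def coeff_diff coeff_scale coeff_basis)
  have "(\<Sum>b\<in>Basis. T u b \<bullet> b) = (\<Sum>b\<in>Basis. ((c2 u * ct b - ct u * c2 b) *s w) \<bullet> b)"
    by (simp only: Tw)
  also have "\<dots> = 2 * Re (c2 u * ct w - ct u * c2 w)"
    by (rule trace_rank_one) (simp_all add: coeff_add coeff_scale algebra_simps)
  also have "\<dots> = 2 * ((norm (ct w))\<^sup>2 + (norm (c2 w))\<^sup>2)"
    by (simp add: cu cmod_def power2_eq_square)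
  finally have "(\<Sum>b\<in>Basis. T u b \<bullet> b) = 2 * ((norm (ct w))\<^sup>2 + (norm (c2 w))\<^sup>2)" .
  moreover have "ct w \<noteq> 0 \<or> c2 w \<noteq> 0" using w \<open>w \<noteq> 0\<close> by auto
  then have "(norm (ct w))\<^sup>2 + (norm (c2 w))\<^sup>2 \<noteq> 0" by (simp add: sum_power2_eq_zero_iff)
  ultimately have "(\<Sum>b\<in>Basis. T u b \<bullet> b) \<noteq> 0" by (metis mult_eq_0_iff zero_neq_numeral)
  then show ?thesis by blast
qed

text \<open>Here the torsion trace gives no information, so the contradiction comes from the
  curvature. By covariance of \<open>P\<close>, \<open>P e\<^sub>i e\<^sub>j e\<^sub>k\<close> is 0
  or an eigenvector for \<open>m\<^sub>i - m\<^sub>j + m\<^sub>k\<close>. With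
  \<open>m2 = - m1\<close> and the trace condition this leaves two unknowns \<open>p\<close>,
  \<open>q\<close>, which turn out to be 0; then \<open>R x y e1 = 0\<close>, against
  \<open>m1 \<noteq> 0\<close>.\<close>

lemma opposite_case:
  assumes "m2 \<noteq> 0"
  shows False
proof -
  have z: "T e2 t = 0" using T_e2_t assms by simp
  have n12: "T e1 e2 \<noteq> 0" using T_expand[of a b] t z by auto
  have "m1 + m2 = 0" using T_e1_e2 n12 by (simp only: vector_mul_eq_0 simp_thms)
  then have m2: "m2 = - m1" by (simp add: eq_neg_iff_add_eq_0 add.commute)
  \<comment> \<open>\<open>T e1 e2\<close> is nonzero, and every \<open>R v w\<close>, not only
    \<open>R x y\<close>, acts trivially on it; so each of them has trace 0 on the span of
    \<open>e1\<close> and \<open>e2\<close>.\<close>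
  have tr: "c1 (R v w e1) + c2 (R v w e2) = 0" for v w
  proof -
    have "T (R v w e1) e2 + T e1 (R v w e2) = (c1 (R v w e1) + c2 (R v w e2)) *s T e1 e2"
      using T_expand[of "R v w e1" e2] T_expand[of e1 "R v w e2"]
      by (simp add: z coeff_basis vector_sadd_rdistrib)
    then have "(c1 (R v w e1) + c2 (R v w e2)) *s T e1 e2 = 0" using T_R[of v w e1 e2] by simp
    then show ?thesis using n12 by (simp only: vector_mul_eq_0 simp_thms)
  qed
  have trP: "c1 (P v w e1) + c2 (P v w e2) = 0" for v w
    using tr[of v "\<i> *s w"] tr[of v w]
    by (simp add: P_def coeff_diff coeff_scale algebra_simps) (metis (no_types) add.commute add_diff_cancel_left' diff_0 minus_add_cancel mult_minus_right mult_zero_right distrib_left eq_neg_iff_add_eq_0 add_diff_eq)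
  have ctP: "ct (P v w e1) = 0" "ct (P v w e2) = 0" for v w
    using R_orth[OF o1] R_orth[OF o2] by (simp_all add: P_def coeff_diff coeff_scale)
  have AP: "R x y (P v w u) = P (R x y v) w u + P v (R x y w) u + P v w (R x y u)" for v w u by (rule R_on_P)
  have AX: "R x y X = (m1 * c1 X) *s e1 - (m1 * c2 X) *s e2" for X
    by (subst coeff_expand[of X])
      (simp add: R_add3 R_scale3 R_t A1 A2 m2 vec_eq_iff algebra_simps)
  have eig: "(k - m1) * c1 X = 0" "(k + m1) * c2 X = 0" if "R x y X = k *s X" for X k
  proof -
    have "k * c1 X = m1 * c1 X" "k * c2 X = - (m1 * c2 X)"
      using that AX[of X] by (metis coeff_scale(2) coeff_diff(2) coeff_basis(5,6) mult.right_neutral mult_zero_right diff_zero,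
        metis coeff_scale(3) coeff_diff(3) coeff_basis(8,9) mult.right_neutral mult_zero_right diff_0)
    then show "(k - m1) * c1 X = 0" "(k + m1) * c2 X = 0" by (simp_all add: algebra_simps)
  qed
  note sc = A1 A2 m2 P_scale1 P_scale2 P_scale3 P_neg im1 vector_scale_minus
  \<comment> \<open>The antilinear second slot contributes \<open>cnj m = - m\<close>. The value
    \<open>3 * m1\<close> is not an eigenvalue of \<open>R x y\<close>, so the entries with this
    weight vanish.\<close>
  have E: "R x y (P e1 e1 e1) = m1 *s P e1 e1 e1" "R x y (P e1 e1 e2) = (- m1) *s P e1 e1 e2"
    "R x y (P e1 e2 e1) = (3 * m1) *s P e1 e2 e1" "R x y (P e1 e2 e2) = m1 *s P e1 e2 e2"
    "R x y (P e2 e1 e1) = (- m1) *s P e2 e1 e1" "R x y (P e2 e1 e2) = (- 3 * m1) *s P e2 e1 e2"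
    "R x y (P e2 e2 e1) = m1 *s P e2 e2 e1" "R x y (P e2 e2 e2) = (- m1) *s P e2 e2 e2"
    by (simp_all add: AP sc) (simp_all add: vec_eq_iff algebra_simps)
  define p where "p = c1 (P e1 e1 e1)"
  define q where "q = c1 (P e1 e2 e2)"
  have P111: "P e1 e1 e1 = p *s e1"
    by (rule coeff_eqI) (use eig[OF E(1)] m1 in \<open>simp_all add: ctP coeff_scale coeff_basis p_def\<close>)
  have P112: "P e1 e1 e2 = (- p) *s e2"
    by (rule coeff_eqI) (use eig[OF E(2)] m1 trP[of e1 e1] in \<open>simp_all add: ctP coeff_scale coeff_basis coeff_neg p_def eq_neg_iff_add_eq_0 add.commute\<close>)
  have P121: "P e1 e2 e1 = 0"
    by (rule coeff_eqI) (use eig[OF E(3)] m1 in \<open>simp_all add: ctP coeff_zero\<close>)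
  have P122: "P e1 e2 e2 = q *s e1"
    by (rule coeff_eqI) (use eig[OF E(4)] m1 in \<open>simp_all add: ctP coeff_scale coeff_basis q_def\<close>)
  have P211: "P e2 e1 e1 = (- p) *s e2" using P_sym[of e2 e1 e1] P112 by simp
  have P212: "P e2 e1 e2 = 0"
    by (rule coeff_eqI) (use eig[OF E(6)] m1 in \<open>simp_all add: ctP coeff_zero\<close>)
  have P221: "P e2 e2 e1 = q *s e1" using P_sym[of e2 e2 e1] P122 by simp
  have P222: "P e2 e2 e2 = (- q) *s e2"
    by (rule coeff_eqI) (use eig[OF E(8)] m1 trP[of e2 e2] in
      \<open>simp_all add: ctP coeff_scale coeff_basis coeff_neg P221 eq_neg_iff_add_eq_0 add.commute\<close>)
  \<comment> \<open>The instance of the commutator identity in which both unknowns meet: it gives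
    \<open>cnj p = 2 * p\<close> unless \<open>q = 0\<close>.\<close>
  have "P e1 e2 (P e2 e1 e1) - P e2 e1 (P e1 e2 e1) = P (P e1 e2 e2) e1 e1 + P e2 (P e2 e1 e1) e1"
    by (rule P_commutator)
  then have "(- p * q) *s e1 = (q * p - cnj p * q) *s e1"
    unfolding P211 P121 P122
    using P_scale3[of e2 e1 0 0]
    by (simp add: P_scale1 P_scale2 P_scale3 P_neg P122 P111 P221 vector_scale_diff; simp add: vec_eq_iff algebra_simps)
  then have 1: "- p * q = q * p - cnj p * q"
    using ne(1) by (metis coeff_scale(2) coeff_basis(5) mult.right_neutral)
  \<comment> \<open>\<open>P e1 e2\<close> and \<open>P e2 e1\<close> are adjoint up to sign, which
    ties \<open>q\<close> to \<open>p\<close>.\<close>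
  have 2: "q * H e1 e1 = cnj p * H e2 e2"
    using H_P_adjoint[of e1 e2 e2 e1] unfolding P122 P211 by (simp add: H_scale H_neg)
  have "p = 0 \<and> q = 0"
  proof (cases "q = 0")
    case True
    then show ?thesis using 2 H_pos[OF ne(2)] by simp
  next
    case False
    then have "cnj p = 2 * p" using 1 by (simp add: algebra_simps)
    then have "p = 0" by (simp add: complex_eq_iff)
    then show ?thesis using 2 H_pos[OF ne(1)] False by simp
  qed
  then have P0: "P e1 e1 e1 = 0" "P e1 e1 e2 = 0" "P e1 e2 e1 = 0" "P e1 e2 e2 = 0"
    "P e2 e1 e1 = 0" "P e2 e1 e2 = 0" "P e2 e2 e1 = 0" "P e2 e2 e2 = 0"
    using P111 P112 P121 P122 P211 P212 P221 P222 by simp_all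
  have "P v w u = 0" for v w u
  proof -
    have 3: "P v' w' u = 0" if "P v' w' e1 = 0" "P v' w' e2 = 0" for v' w' u
      by (subst coeff_expand[of u]) (simp add: P_add3 P_scale3 that t P_T3)
    have 2: "P v' w u = 0" if "\<And>u. P v' e1 u = 0" "\<And>u. P v' e2 u = 0" for v' w u
      by (subst coeff_expand[of w]) (simp add: P_add2 P_scale2 that t P_T)
    have "P e1 w u = 0" "P e2 w u = 0" for w u by (rule 2; rule 3; simp add: P0)+
    then show ?thesis
      by (subst coeff_expand[of v]) (simp add: P_add1 P_scale1 t P_T)
  qed
  then have "R x y e1 = 0" by (intro P_zero_imp)
  then show False using A1 m1 ne(1) by simp
qed

end

text \<open>The quadratic formula gives an eigenvalue \<open>m\<close>. For
  \<open>r \<noteq> 0\<close> the pair \<open>(r, m - p)\<close> is a row eigenvector, and for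
  \<open>r = 0\<close> the second unit vector is one.\<close>

lemma complex_eigenvector2:
  fixes p q r s :: complex
  obtains m a b where "(a, b) \<noteq> (0, 0)" "a * p + b * r = m * a" "a * q + b * s = m * b"
proof (cases "r = 0")
  case True
  show ?thesis
    by (rule that[of 0 1 s]) (use True in auto)
next
  case False
  define d where "d = csqrt ((p + s)\<^sup>2 - 4 * (p * s - q * r))"
  define m where "m = ((p + s) + d) / 2"
  have dd: "d * d = (p + s)\<^sup>2 - 4 * (p * s - q * r)"
    using power2_csqrt[of "(p + s)\<^sup>2 - 4 * (p * s - q * r)"] by (simp add: d_def power2_eq_square)
  have "4 * (m * m - (p + s) * m + (p * s - q * r)) = d * d - (p + s)\<^sup>2 + 4 * (p * s - q * r)"
    by (simp add: m_def power2_eq_square field_simps)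
  then have "4 * (m * m - (p + s) * m + (p * s - q * r)) = 0" unfolding dd by simp
  then have "m * m - (p + s) * m + (p * s - q * r) = 0" by (metis mult_eq_0_iff zero_neq_numeral)
  then show ?thesis
    by (intro that[of r "m - p" m]) (use False in \<open>auto simp: algebra_simps\<close>)
qed

text \<open>\<open>R x y\<close> kills the value \<open>t\<close> of \<open>T\<close> and is skew
  for \<open>H\<close>, so it preserves the orthogonal complement of \<open>t\<close> and is
  diagonalised there. The two preceding cases are applied with the roles of \<open>e1\<close> and
  \<open>e2\<close> exchanged when \<open>m2\<close> is the eigenvalue known to be nonzero.\<close>

theorem trace_torsion_nonzero:
  assumes "R x y z \<noteq> 0" "T a b \<noteq> 0"
  shows "\<exists>u. (\<Sum>b\<in>Basis. T u b \<bullet> b) \<noteq> 0"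
proof -
  define t where "t = T a b"
  have t0: "t \<noteq> 0" using assms by (simp add: t_def)
  have Rt: "R v w t = 0" for v w by (simp add: t_def R_T)
  have cs: "H u v = 0 \<longleftrightarrow> H v u = 0" for u v using H_cnj[of u v] by auto
  obtain f1 where f1: "f1 \<noteq> 0" "H f1 t = 0"
    by (rule orthogonal_extend[of "{t}"]) (use t0 in auto)
  have ft: "f1 \<noteq> t" using f1 H_pos[OF t0] by auto
  obtain f2 where f2: "f2 \<noteq> 0" "H f2 t = 0" "H f2 f1 = 0"
    by (rule orthogonal_extend[of "{t, f1}"]) (use t0 f1 ft cs[of t f1] in auto)
  define A where "A = R x y"
  have expand: "v = (H v u1 / H u1 u1) *s u1 + (H v u2 / H u2 u2) *s u2"
    if u: "u1 \<noteq> 0" "u2 \<noteq> 0" "H u1 t = 0" "H u2 t = 0" "H u2 u1 = 0" "H v t = 0" for u1 u2 v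
  proof -
    define w where "w = v - ((H v u1 / H u1 u1) *s u1 + (H v u2 / H u2 u2) *s u2)"
    have u12: "H u1 u2 = 0" using u cs by blast
    have o: "H w t = 0" "H w u1 = 0" "H w u2 = 0"
      using u u12 H_pos[of u1] H_pos[of u2] by (simp_all add: w_def H_diff H_add H_scale)
    have "w = 0"
    proof (rule ccontr)
      assume w: "w \<noteq> 0"
      have d: "t \<noteq> u1" "t \<noteq> u2" "u1 \<noteq> u2" "w \<noteq> t" "w \<noteq> u1" "w \<noteq> u2"
        using u o H_pos[OF t0] H_pos[OF u(1)] H_pos[OF u(2)] by auto
      have "vec.independent {w, t, u1, u2}"
        by (rule orthogonal_independent) (use w t0 u u12 o cs in auto)
      then have "card {w, t, u1, u2} \<le> vec.dim (UNIV :: (complex ^ 3) set)"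
        by (intro vec.independent_card_le_dim) auto
      then show False using d by (simp add: card_cart_basis)
    qed
    then show ?thesis by (simp add: w_def)
  qed
  have At: "H (A v) t = 0" for v using H_skew[of x y v t] by (simp add: A_def Rt H_zero)
  define p q r s where "p = H (A f1) f1 / H f1 f1" and "q = H (A f1) f2 / H f2 f2"
    and "r = H (A f2) f1 / H f1 f1" and "s = H (A f2) f2 / H f2 f2"
  have Af: "A f1 = p *s f1 + q *s f2" "A f2 = r *s f1 + s *s f2"
    unfolding p_def q_def r_def s_def by (rule expand; use f1 f2 At in simp)+
  obtain m1 k l where kl: "(k, l) \<noteq> (0, 0)" "k * p + l * r = m1 * k" "k * q + l * s = m1 * l"
    by (rule complex_eigenvector2)
  define e1 where "e1 = k *s f1 + l *s f2"
  have e1t: "H e1 t = 0" by (simp add: e1_def H_add H_scale f1 f2)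
  have e10: "e1 \<noteq> 0"
  proof
    assume "e1 = 0"
    then have "H e1 f1 = 0" "H e1 f2 = 0" by (simp_all add: H_zero)
    then show False using kl(1) f1 f2 cs[of f1 f2] H_pos[OF f1(1)] H_pos[OF f2(1)]
      by (auto simp: e1_def H_add H_scale)
  qed
  have A1: "R x y e1 = m1 *s e1"
  proof -
    have "R x y e1 = k *s A f1 + l *s A f2" by (simp add: e1_def A_def R_add3 R_scale3)
    also have "\<dots> = (k * p + l * r) *s f1 + (k * q + l * s) *s f2"
      by (simp add: Af vec_eq_iff algebra_simps)
    finally show ?thesis by (simp add: kl e1_def vec_eq_iff algebra_simps)
  qed
  have et: "e1 \<noteq> t" using e1t H_pos[OF t0] by auto
  obtain e2 where e2: "e2 \<noteq> 0" "H e2 t = 0" "H e2 e1 = 0"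
    by (rule orthogonal_extend[of "{t, e1}"]) (use t0 e10 e1t et cs[of t e1] in auto)
  have "H (R x y e2) e1 = 0" using H_skew[of x y e2 e1] e2 by (simp add: A1 H_scale)
  then obtain m2 where A2: "R x y e2 = m2 *s e2"
    using expand[OF e10 e2(1) e1t e2(2,3), of "R x y e2"] At[of e2] by (auto simp: A_def)
  have im: "cnj m = - m" if "R x y e = m *s e" "e \<noteq> 0" for e m
  proof -
    have "m * H e e = - (cnj m * H e e)" using H_skew[of x y e e] that by (simp add: H_scale)
    then have "(m + cnj m) * H e e = 0" by (simp add: algebra_simps)
    then show ?thesis using H_pos[OF that(2)] by (simp add: eq_neg_iff_add_eq_0 add.commute)
  qed
  note im1 = im[OF A1 e10] and im2 = im[OF A2 e2(1)]
  have e12: "H e1 e2 = 0" using e2(3) cs by blast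
  \<comment> \<open>Otherwise \<open>R x y\<close> would vanish on the whole basis, contrary to the
    choice of \<open>z\<close>.\<close>
  have "m1 \<noteq> 0 \<or> m2 \<noteq> 0"
  proof (rule ccontr)
    assume "\<not> (m1 \<noteq> 0 \<or> m2 \<noteq> 0)"
    then have z: "R x y e1 = 0" "R x y e2 = 0" using A1 A2 by simp_all
    define v where "v = z - (H z t / H t t) *s t"
    have "H v t = 0" using H_pos[OF t0] by (simp add: v_def H_diff H_scale)
    from expand[OF e10 e2(1) e1t e2(2,3) this]
    have "R x y v = R x y ((H v e1 / H e1 e1) *s e1 + (H v e2 / H e2 e2) *s e2)" by (rule arg_cong)
    then have "R x y v = 0" by (simp only: R_add3 R_scale3 z vector_smult_rzero add_0)
    moreover have "z = v + (H z t / H t t) *s t" by (simp add: v_def)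
    then have "R x y z = R x y (v + (H z t / H t t) *s t)" by (rule arg_cong)
    ultimately have "R x y z = 0" by (simp only: R_add3 R_scale3 Rt vector_smult_rzero add_0)
    then show False using assms by simp
  qed
  then show ?thesis
  proof
    assume m: "m1 \<noteq> 0"
    show ?thesis
      using trace_case[OF t_def t0 e10 e2(1) e1t e2(2,3) A1 A2 im1 im2 m]
        opposite_case[OF t_def t0 e10 e2(1) e1t e2(2,3) A1 A2 im1 im2 m] by blast
  next
    assume m: "m2 \<noteq> 0"
    show ?thesis
      using trace_case[OF t_def t0 e2(1) e10 e2(2) e1t e12 A2 A1 im2 im1 m]
        opposite_case[OF t_def t0 e2(1) e10 e2(2) e1t e12 A2 A1 im2 im1 m] by blast
  qed
qed

end

subsection \<open>The Chern connection in charts\<close>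

locale chern_manifold = parallel_connection A D
  for A :: "('m::{t2_space, second_countable_topology}, 'n::finite) chart set" and D :: "'m connection" +
  fixes g :: "'m metric_tensor"
  assumes herm: "hermitian_manifold A g" and chern: "chern_connection A g D"
begin

definition G :: "('m, 'n) chart \<Rightarrow> complex ^ 'n \<Rightarrow> complex ^ 'n \<Rightarrow> complex ^ 'n \<Rightarrow> real" where
  "G c x u v = g (pt c x) (coord_vec A c (pt c x) u) (coord_vec A c (pt c x) v)"

lemma riem: "riemannian_metric A g"
  using herm by (simp add: hermitian_manifold_def)

lemma g_lin: "u \<in> tangent_space A p \<Longrightarrow> v \<in> tangent_space A p \<Longrightarrow> w \<in> tangent_space A p \<Longrightarrow>
    g p (\<lambda>f. a * u f + b * v f) w = a * g p u w + b * g p v w"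
  using riem unfolding riemannian_metric_def by blast

lemma g_sym: "u \<in> tangent_space A p \<Longrightarrow> v \<in> tangent_space A p \<Longrightarrow> g p u v = g p v u"
  using riem unfolding riemannian_metric_def by blast

lemma g_pos: "u \<in> tangent_space A p \<Longrightarrow> u \<noteq> 0 \<Longrightarrow> g p u u > 0"
  using riem unfolding riemannian_metric_def by blast

lemma gfun_smooth: "vf X \<Longrightarrow> vf Y \<Longrightarrow> smooth_fun A (gfun g X Y)"
  using riem unfolding riemannian_metric_def by blast

lemma g_J: "u \<in> tangent_space A p \<Longrightarrow> v \<in> tangent_space A p \<Longrightarrow> g p (cstruct A p u) (cstruct A p v) = g p u v"
  using herm unfolding hermitian_manifold_def by blast

lemma D_metric: "vf X \<Longrightarrow> vf Y \<Longrightarrow> vf Z \<Longrightarrow>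
    vapply X (gfun g Y Z) = gfun g (D X Y) Z + gfun g Y (D X Z)"
  using chern unfolding chern_connection_def by blast

lemma D_J: "vf X \<Longrightarrow> vf Y \<Longrightarrow> D X (Jfield A Y) = Jfield A (D X Y)"
  using chern unfolding chern_connection_def by blast

context
  fixes c x assumes c: "c \<in> A" and x: "x \<in> dm c"
begin

lemma G_comb: "G c x (a *\<^sub>R u + b *\<^sub>R v) w = a * G c x u w + b * G c x v w"
  unfolding G_def coord_vec_lin[OF c pt_in[OF c x], symmetric]
  by (intro g_lin coord_vec_tangent c pt_in x)

lemma G_sym: "G c x u v = G c x v u"
  unfolding G_def by (intro g_sym coord_vec_tangent c pt_in x)

lemma G_add: "G c x (u + v) w = G c x u w + G c x v w"
  using G_comb[of 1 u 1 v w] by simp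

lemma G_scaleR: "G c x (a *\<^sub>R u) w = a * G c x u w"
  using G_comb[of a u 0 u w] by simp

lemma bilinear_G: "bilinear (G c x)"
  unfolding bilinear_def
  by (auto intro!: linearI simp: G_add G_scaleR) (metis G_sym G_add, metis G_sym G_scaleR)

lemma G_pos: "u \<noteq> 0 \<Longrightarrow> G c x u u > 0"
proof -
  assume u: "u \<noteq> 0"
  have "coord_vec A c (pt c x) u \<noteq> 0"
  proof
    assume "coord_vec A c (pt c x) u = 0"
    also have "0 = coord_vec A c (pt c x) 0"
      by (rule HOL.ext) (simp add: coord_vec_dd snd_pt[OF c x] linear_0[OF dd_linear[OF _ c x]])
    finally show False using u coord_vec_inj[OF c pt_in[OF c x]] by blast
  qed
  then show ?thesis unfolding G_def by (intro g_pos coord_vec_tangent c pt_in x)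
qed

lemma G_i: "G c x (\<i> *s u) (\<i> *s v) = G c x u v"
  unfolding G_def cstruct_coord_vec[OF c pt_in[OF c x], symmetric]
  by (intro g_J coord_vec_tangent c pt_in x)

lemma gfun_rep: "vf X \<Longrightarrow> vf Y \<Longrightarrow> gfun g X Y (pt c x) = G c x (rep c X x) (rep c Y x)"
  unfolding G_def gfun_def by (simp add: coord_vec_rep[OF c x])

end

lemma G_smooth:
  assumes c: "c \<in> A"
  shows "smooth_on (dm c) (\<lambda>x. G c x u v)"
proof (rule smooth_on_local)
  fix x0 assume x0: "x0 \<in> dm c"
  obtain X where X: "cf c x0 u X" by (rule cf_ex[OF assms x0])
  obtain Y where Y: "cf c x0 v Y" by (rule cf_ex[OF assms x0])
  have "\<forall>\<^sub>F y in nhds x0. y \<in> dm c \<and> rep c X y = u \<and> rep c Y y = v"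
    using X Y unfolding cf_def by (auto elim: eventually_elim2)
  then obtain T where T: "open T" "x0 \<in> T" "\<And>y. y \<in> T \<Longrightarrow> y \<in> dm c \<and> rep c X y = u \<and> rep c Y y = v"
    unfolding eventually_nhds by blast
  have "G c y u v = gfun g X Y (pt c y)" if "y \<in> T" for y
    using gfun_rep[OF c _ cf_vf[OF X] cf_vf[OF Y], of y] T(3)[OF that] by simp
  moreover have "smooth_on T (\<lambda>y. gfun g X Y (pt c y))"
    using T by (intro smooth_on_subset[OF smooth_fun_chart[OF gfun_smooth[OF cf_vf[OF X] cf_vf[OF Y]] c]]) auto
  ultimately have "smooth_on T (\<lambda>x. G c x u v)"
    using smooth_on_cong[OF T(1), of "\<lambda>x. G c x u v" "\<lambda>y. gfun g X Y (pt c y)"] by simp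
  then show "\<exists>T. open T \<and> x0 \<in> T \<and> smooth_on T (\<lambda>x. G c x u v)" using T by blast
qed

text \<open>Metric compatibility, read off on fields with constant coordinates.\<close>

lemma G_has_derivative:
  assumes c: "c \<in> A" and x: "x \<in> dm c"
  shows "((\<lambda>y. G c y v w) has_derivative (\<lambda>u. G c x (Gam c x u v) w + G c x v (Gam c x u w))) (at x)"
proof -
  obtain Y where Y: "cf c x v Y" by (rule cf_ex[OF c x])
  obtain Z where Z: "cf c x w Z" by (rule cf_ex[OF c x])
  note v = cf_vf[OF Y] cf_vf[OF Z]
  have ev: "\<forall>\<^sub>F y in nhds x. gfun g Y Z (pt c y) = G c y v w"
  proof -
    have "\<forall>\<^sub>F y in nhds x. y \<in> dm c \<and> rep c Y y = v \<and> rep c Z y = w"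
      using Y Z unfolding cf_def by (auto simp: eventually_conj_iff)
    then show ?thesis by (rule eventually_mono) (simp add: gfun_rep[OF c] v)
  qed
  have "frechet_derivative (\<lambda>y. G c y v w) (at x) u = G c x (Gam c x u v) w + G c x v (Gam c x u w)" for u
  proof -
    obtain X where X: "cf c x u X" by (rule cf_ex[OF c x])
    note vx = cf_vf[OF X] and r = cf_rep[OF X] cf_rep[OF Y] cf_rep[OF Z]
    have "frechet_derivative (\<lambda>y. G c y v w) (at x) u = dd c (gfun g Y Z) x u"
      unfolding dd_def frechet_derivative_cong_ev[OF ev] ..
    also have "\<dots> = vapply X (gfun g Y Z) (pt c x)"
      unfolding vapply_def rep_apply[OF c x vx gfun_smooth[OF v]] r ..
    also have "\<dots> = G c x (rep c (D X Y) x) w + G c x v (rep c (D X Z) x)"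
      unfolding D_metric[OF vx v] by (simp add: gfun_rep[OF c x] D_vf v vx r)
    finally show ?thesis using Gam_eq[OF c x vx r(1) Y] Gam_eq[OF c x vx r(1) Z] by simp
  qed
  then show ?thesis using smooth_onD[OF G_smooth[OF c, of v w] x] by (metis (no_types, lifting) has_derivative_eq_rhs HOL.ext)
qed

lemma J_J: "vf X \<Longrightarrow> Jfield A (- Jfield A X) = X"
  by (rule vf_eqI) (simp_all add: vf_J vf_minus rep_J rep_minus i_scale_i vector_scale_minus)

context
  fixes c x assumes c: "c \<in> A" and x: "x \<in> dm c"
begin

lemma Gam_i2: "Gam c x u (\<i> *s v) = \<i> *s Gam c x u v"
proof -
  obtain X where X: "cf c x u X" by (rule cf_ex[OF c x])
  obtain Y where Y: "cf c x v Y" by (rule cf_ex[OF c x])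
  note v = cf_vf[OF X] cf_vf[OF Y]
  show ?thesis
    unfolding Gam_eq[OF c x v(1) cf_rep[OF X] cf_J[OF c x Y]] Gam_eq[OF c x v(1) cf_rep[OF X] Y]
      D_J[OF v] rep_J[OF D_vf[OF v] c x] ..
qed

text \<open>The (1,0)-field \<open>X - \<i> J X\<close> is encoded as the pair
  \<open>(X, - Jfield A X)\<close>; the claim is the second component of the vanishing mixed
  torsion.\<close>

lemma Tor_i: "Tor c x u (\<i> *s v) = Tor c x (\<i> *s u) v"
proof -
  obtain X where X: "cf c x u X" by (rule cf_ex[OF c x])
  obtain Y where Y: "cf c x v Y" by (rule cf_ex[OF c x])
  note v = cf_vf[OF X] cf_vf[OF Y]
  have f: "field_10 A (Z, - Jfield A Z)" if "vf Z" for Z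
    using that by (simp add: field_10_def vf_minus vf_J J_J)
  have "ctorsion D (X, - Jfield A X) (conj_field (Y, - Jfield A Y)) = (0, 0)"
    using chern f[OF v(1)] f[OF v(2)] unfolding chern_connection_def by blast
  then have "torsion D X (- (- Jfield A Y)) + torsion D (- Jfield A X) Y = 0"
    by (simp add: ctorsion_def conj_field_def)
  then have "rep c (torsion D X (Jfield A Y) + torsion D (- Jfield A X) Y) x = 0"
    using rep_zero[OF c x] by simp
  then have "Tor c x u (\<i> *s v) + Tor c x (- (\<i> *s u)) v = 0"
    by (simp add: rep_add[OF c x] vf_torsion vf_J vf_minus v rep_torsion[OF c x] rep_J[OF _ c x] rep_minus[OF c x]
        cf_rep[OF X] cf_rep[OF Y])
  then show ?thesis unfolding Tor_def by (simp add: Gam_simps[OF c x] algebra_simps)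
qed

text \<open>The part of \<open>\<Gamma>\<close> antilinear in its first slot is skew by the torsion condition, hence
  antilinear as well as linear in its second slot, so it vanishes.\<close>

lemma Gam_i1: "Gam c x (\<i> *s u) v = \<i> *s Gam c x u v"
proof -
  define N where "N u v = Gam c x (\<i> *s u) v - \<i> *s Gam c x u v" for u v
  have anti: "N u v = - N v u" for u v
    using Tor_i[of u v] unfolding Tor_def N_def Gam_i2 by (simp add: algebra_simps)
  have n2: "N u (\<i> *s v) = \<i> *s N u v" for u v by (simp add: N_def Gam_i2 vector_scale_diff)
  have n1: "N (\<i> *s u) v = - (\<i> *s N u v)" for u v
    by (simp add: N_def i_scale_i Gam_simps[OF c x] vector_scale_diff)
  have "\<i> *s N u v = - (\<i> *s N u v)"
    using n2[of u v] anti[of u "\<i> *s v"] n1[of v u] anti[of v u] by (simp add: vector_scale_minus)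
  then have "2 *\<^sub>R (\<i> *s N u v) = 0" by (metis eq_neg_iff_add_eq_0 scaleR_2)
  then have "N u v = 0" by simp
  then show ?thesis by (simp add: N_def)
qed

lemma Gam_scale: "Gam c x (z *s u) v = z *s Gam c x u v" "Gam c x u (z *s v) = z *s Gam c x u v"
  unfolding vector_scale_Re_Im[of z] by (simp_all add: Gam_simps[OF c x] Gam_i1 Gam_i2)

lemma Tor_scale: "Tor c x (z *s u) v = z *s Tor c x u v"
  by (simp add: Tor_def Gam_scale vector_scale_diff)

end

lemma dGam_scale:
  assumes c: "c \<in> A" and x: "x \<in> dm c"
  shows "dGam c x u v (z *s w) = z *s dGam c x u v w"
proof -
  have "((\<lambda>y. Gam c y v (z *s w)) has_derivative (\<lambda>u. z *s dGam c x u v w)) (at x)"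
    by (rule has_derivative_transform_within_open[OF bounded_linear.has_derivative[OF bounded_linear_vector_scale
          Gam_has_derivative[OF c x]] open_dm[OF c] x]) (simp add: Gam_scale[OF c])
  from fun_cong[OF has_derivative_unique[OF Gam_has_derivative[OF c x] this], of u] show ?thesis .
qed

lemma dGam_add:
  assumes c: "c \<in> A" and x: "x \<in> dm c"
  shows "dGam c x u v (w + w') = dGam c x u v w + dGam c x u v w'"
    "dGam c x u (w + w') v = dGam c x u w v + dGam c x u w' v"
    "dGam c x (u + u') v w = dGam c x u v w + dGam c x u' v w"
    "dGam c x (r *\<^sub>R u) v w = r *\<^sub>R dGam c x u v w"
    "dGam c x u (r *\<^sub>R v) w = r *\<^sub>R dGam c x u v w"
proof -
  note d = Gam_has_derivative[OF c x]
  have "((\<lambda>y. Gam c y v (w + w')) has_derivative (\<lambda>u. dGam c x u v w + dGam c x u v w')) (at x)"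
    by (rule has_derivative_transform_within_open[OF has_derivative_add[OF d d] open_dm[OF c] x])
      (simp add: Gam_simps[OF c])
  from fun_cong[OF has_derivative_unique[OF d this], of u]
  show "dGam c x u v (w + w') = dGam c x u v w + dGam c x u v w'" .
  have "((\<lambda>y. Gam c y (w + w') v) has_derivative (\<lambda>u. dGam c x u w v + dGam c x u w' v)) (at x)"
    by (rule has_derivative_transform_within_open[OF has_derivative_add[OF d d] open_dm[OF c] x])
      (simp add: Gam_simps[OF c])
  from fun_cong[OF has_derivative_unique[OF d this], of u]
  show "dGam c x u (w + w') v = dGam c x u w v + dGam c x u w' v" .
  have "((\<lambda>y. Gam c y (r *\<^sub>R v) w) has_derivative (\<lambda>u. r *\<^sub>R dGam c x u v w)) (at x)"
    by (rule has_derivative_transform_within_open[OF has_derivative_scaleR_right[OF d] open_dm[OF c] x])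
      (simp add: Gam_simps[OF c])
  from fun_cong[OF has_derivative_unique[OF d this], of u]
  show "dGam c x u (r *\<^sub>R v) w = r *\<^sub>R dGam c x u v w" .
  show "dGam c x (u + u') v w = dGam c x u v w + dGam c x u' v w"
    "dGam c x (r *\<^sub>R u) v w = r *\<^sub>R dGam c x u v w"
    using linear_add[OF has_derivative_linear[OF d]] linear_scale[OF has_derivative_linear[OF d]] by blast+
qed

text \<open>The commutator of \<open>X\<close> and \<open>Y\<close> on the function
  \<open>gfun g Z W\<close> is the bracket. Expanding both sides by metric compatibility, the mixed
  terms cancel and the curvature terms remain.\<close>

lemma curvature_skew:
  assumes "vf X" "vf Y" "vf Z" "vf W"
  shows "gfun g (curvature D X Y Z) W p + gfun g Z (curvature D X Y W) p = 0"
proof -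
  have add: "gfun g (X - Y) Z p = gfun g X Z p - gfun g Y Z p" "gfun g Z (X - Y) p = gfun g Z X p - gfun g Z Y p"
    if v: "vf X" "vf Y" "vf Z" for X Y Z
  proof -
    obtain c where c: "c \<in> A" "p \<in> fst c" by (rule chart_ex)
    note x = snd_in[OF c] and p = pt_snd[OF c]
    note b = bilinear_lsub[OF bilinear_G[OF c(1) x]] bilinear_rsub[OF bilinear_G[OF c(1) x]]
    show "gfun g (X - Y) Z p = gfun g X Z p - gfun g Y Z p" "gfun g Z (X - Y) p = gfun g Z X p - gfun g Z Y p"
      using gfun_rep[OF c(1) x, unfolded p] v by (simp_all add: vf_diff rep_diff[OF c(1) x] b)
  qed
  have dd: "vapply X (vapply Y (gfun g Z W)) p = gfun g (D X (D Y Z)) W p + gfun g (D Y Z) (D X W) p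
      + (gfun g (D X Z) (D Y W) p + gfun g Z (D X (D Y W)) p)" if v: "vf X" "vf Y" for X Y
  proof -
    have "vapply Y (gfun g Z W) = (\<lambda>q. gfun g (D Y Z) W q + gfun g Z (D Y W) q)"
      using D_metric[OF v(2) assms(3,4)] by (simp add: plus_fun_def)
    then have "vapply X (vapply Y (gfun g Z W)) p = vapply X (gfun g (D Y Z) W) p + vapply X (gfun g Z (D Y W)) p"
      unfolding vapply_def[of X] using tangent_add[OF vf_tangent[OF v(1)] gfun_smooth gfun_smooth] assms v
      by (simp add: D_vf)
    then show ?thesis using assms v by (simp add: D_metric D_vf)
  qed
  have "vapply (lie_bracket X Y) (gfun g Z W) p
      = vapply X (vapply Y (gfun g Z W)) p - vapply Y (vapply X (gfun g Z W)) p"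
    by (simp add: vapply_def lie_bracket_def)
  moreover have "vapply (lie_bracket X Y) (gfun g Z W) p = gfun g (D (lie_bracket X Y) Z) W p + gfun g Z (D (lie_bracket X Y) W) p"
    using assms by (simp add: D_metric vf_bracket)
  ultimately show ?thesis
    using dd[OF assms(1,2)] dd[OF assms(2,1)] unfolding curvature_def by (simp add: add vf_intros assms)
qed

text \<open>The identities between fields are evaluated on fields with prescribed values at the
  point; the linearity properties come from the expressions of \<open>Tor\<close> and
  \<open>Rm\<close> in \<open>Gam\<close>.\<close>

lemma pointwise_chern_algebra:
  assumes c: "c \<in> A" and x: "x \<in> dm c"
  shows "chern_algebra (Tor c x) (Rm c x) (G c x)"
proof
  note [simp] = Gam_simps[OF c x] dGam_add[OF c x] Gam_scale[OF c x] dGam_scale[OF c x]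
  fix u v w u' w' :: "complex ^ 'n" and z :: complex and r :: real
  show "Tor c x (u + v) w = Tor c x u w + Tor c x v w" by (simp add: Tor_def)
  show "Tor c x (z *s u) v = z *s Tor c x u v" by (rule Tor_scale[OF c x])
  show "Tor c x u v = - Tor c x v u" by (simp add: Tor_def)
  show "Rm c x (u + v) w u' = Rm c x u w u' + Rm c x v w u'" by (simp add: Rm_def)
  show "Rm c x (r *\<^sub>R u) v w = r *\<^sub>R Rm c x u v w" by (simp add: Rm_def algebra_simps)
  show "Rm c x u v w = - Rm c x v u w" by (simp add: Rm_def)
  show "Rm c x u v (w + w') = Rm c x u v w + Rm c x u v w'" by (simp add: Rm_def)
  show "Rm c x u v (z *s w) = z *s Rm c x u v w" by (simp add: Rm_def vec_eq_iff algebra_simps)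
  show "G c x (u + v) w = G c x u w + G c x v w" by (rule G_add[OF c x])
  show "G c x (r *\<^sub>R u) v = r * G c x u v" by (rule G_scaleR[OF c x])
  show "G c x u v = G c x v u" by (rule G_sym[OF c x])
  show "G c x (\<i> *s u) (\<i> *s v) = G c x u v" by (rule G_i[OF c x])
  show "u \<noteq> 0 \<Longrightarrow> 0 < G c x u u" by (rule G_pos[OF c x])
  obtain X where X: "cf c x u X" by (rule cf_ex[OF c x])
  obtain Y where Y: "cf c x v Y" by (rule cf_ex[OF c x])
  obtain Z where Z: "cf c x w Z" by (rule cf_ex[OF c x])
  obtain W where W: "cf c x u' W" by (rule cf_ex[OF c x])
  obtain V where V: "cf c x w' V" by (rule cf_ex[OF c x])
  note vs = cf_vf[OF X] cf_vf[OF Y] cf_vf[OF Z] cf_vf[OF W] cf_vf[OF V]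
  note rs = cf_rep[OF X] cf_rep[OF Y] cf_rep[OF Z] cf_rep[OF W] cf_rep[OF V]
  note rr = rep_torsion[OF c x] rep_curvature[OF c x] rep_add[OF c x] rep_zero[OF c x]
  show "G c x (Rm c x u v w) u' = - G c x w (Rm c x u v u')"
    using curvature_skew[OF vs(1-4), of "pt c x"] by (simp add: gfun_rep[OF c x] vf_intros vs rr rs)
  show "Rm c x u v w + Rm c x v w u + Rm c x w u v =
      Tor c x (Tor c x u v) w + Tor c x (Tor c x v w) u + Tor c x (Tor c x w u) v"
    using arg_cong[OF first_bianchi[OF vs(1-3)], of "\<lambda>F. rep c F x"] by (simp add: vf_intros vs rr rs)
  show "Rm c x (Tor c x u v) w u' + Rm c x (Tor c x v w) u u' + Rm c x (Tor c x w u) v u' = 0"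
    using arg_cong[OF second_bianchi[OF vs(1-4)], of "\<lambda>F. rep c F x"] by (simp add: vf_intros vs rr rs)
  show "Rm c x u v (Tor c x w u') = Tor c x (Rm c x u v w) u' + Tor c x w (Rm c x u v u')"
    using arg_cong[OF curvature_on_torsion[OF vs(1-4)], of "\<lambda>F. rep c F x"] by (simp add: vf_intros vs rr rs)
  show "Rm c x u v (Rm c x w u' w') = Rm c x (Rm c x u v w) u' w' + Rm c x w (Rm c x u v u') w' + Rm c x w u' (Rm c x u v w')"
    using arg_cong[OF curvature_on_curvature[OF vs], of "\<lambda>F. rep c F x"] by (simp add: vf_intros vs rr rs)
qed

text \<open>Parallelism in coordinates: along a curve the components of the torsion solve a
  homogeneous linear system, so a zero at one point spreads.\<close>

lemma Tor_has_derivative: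
  assumes c: "c \<in> A" and x: "x \<in> dm c"
  shows "((\<lambda>y. Tor c y u v) has_derivative
    (\<lambda>w. Tor c x (Gam c x w u) v + Tor c x u (Gam c x w v) - Gam c x w (Tor c x u v))) (at x)"
proof -
  obtain X where X: "cf c x u X" by (rule cf_ex[OF c x])
  obtain Y where Y: "cf c x v Y" by (rule cf_ex[OF c x])
  note vs = cf_vf[OF X] cf_vf[OF Y] and rs = cf_rep[OF X] cf_rep[OF Y]
  have ev: "\<forall>\<^sub>F y in nhds x. rep c (torsion D X Y) y = Tor c y u v"
  proof -
    have "\<forall>\<^sub>F y in nhds x. y \<in> dm c \<and> rep c X y = u \<and> rep c Y y = v"
      using X Y unfolding cf_def by (auto simp: eventually_conj_iff)
    then show ?thesis by (rule eventually_mono) (simp add: rep_torsion[OF c] vs)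
  qed
  have d: "((\<lambda>y. Tor c y u v) has_derivative frechet_derivative (\<lambda>y. Tor c y u v) (at x)) (at x)"
    unfolding Tor_def by (rule smooth_onD[OF smooth_on_diff[OF open_dm[OF c] Gam_smooth[OF c] Gam_smooth[OF c]] x])
  have "frechet_derivative (\<lambda>y. Tor c y u v) (at x) w
      = Tor c x (Gam c x w u) v + Tor c x u (Gam c x w v) - Gam c x w (Tor c x u v)" for w
  proof -
    obtain W where W: "cf c x w W" by (rule cf_ex[OF c x])
    note vw = cf_vf[OF W] and rw = cf_rep[OF W]
    have "rep c (D W (torsion D X Y)) x = rep c (torsion D (D W X) Y + torsion D X (D W Y)) x"
      using par_tor[OF vw vs] by simp
    then have "frechet_derivative (rep c (torsion D X Y)) (at x) w + Gam c x w (Tor c x u v)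
        = Tor c x (Gam c x w u) v + Tor c x u (Gam c x w v)"
      by (simp add: rep_D[OF c x] rep_add[OF c x] rep_torsion[OF c x] vf_intros vs vw rs rw cf_frechet[OF X] cf_frechet[OF Y])
    then show ?thesis unfolding frechet_derivative_cong_ev[OF ev] by (simp add: algebra_simps)
  qed
  then show ?thesis using d by (metis (no_types, lifting) has_derivative_eq_rhs HOL.ext)
qed

lemma Rm_has_derivative:
  assumes c: "c \<in> A" and x: "x \<in> dm c"
  shows "((\<lambda>y. Rm c y u v z) has_derivative
    (\<lambda>w. Rm c x (Gam c x w u) v z + Rm c x u (Gam c x w v) z + Rm c x u v (Gam c x w z)
      - Gam c x w (Rm c x u v z))) (at x)"
proof -
  obtain X where X: "cf c x u X" by (rule cf_ex[OF c x])
  obtain Y where Y: "cf c x v Y" by (rule cf_ex[OF c x])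
  obtain Z where Z: "cf c x z Z" by (rule cf_ex[OF c x])
  note vs = cf_vf[OF X] cf_vf[OF Y] cf_vf[OF Z] and rs = cf_rep[OF X] cf_rep[OF Y] cf_rep[OF Z]
  have ev: "\<forall>\<^sub>F y in nhds x. rep c (curvature D X Y Z) y = Rm c y u v z"
  proof -
    have "\<forall>\<^sub>F y in nhds x. y \<in> dm c \<and> rep c X y = u \<and> rep c Y y = v \<and> rep c Z y = z"
      using X Y Z unfolding cf_def by (auto simp: eventually_conj_iff)
    then show ?thesis by (rule eventually_mono) (simp add: rep_curvature[OF c] vs)
  qed
  have d: "(rep c (curvature D X Y Z) has_derivative frechet_derivative (rep c (curvature D X Y Z)) (at x)) (at x)"
    by (intro rep_has_derivative c x vf_intros vs)
  have "frechet_derivative (rep c (curvature D X Y Z)) (at x) w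
      = Rm c x (Gam c x w u) v z + Rm c x u (Gam c x w v) z + Rm c x u v (Gam c x w z)
      - Gam c x w (Rm c x u v z)" for w
  proof -
    obtain W where W: "cf c x w W" by (rule cf_ex[OF c x])
    note vw = cf_vf[OF W] and rw = cf_rep[OF W]
    have "rep c (D W (curvature D X Y Z)) x = rep c (curvature D (D W X) Y Z + curvature D X (D W Y) Z
        + curvature D X Y (D W Z)) x"
      using par_cur[OF vw vs] by simp
    then have "frechet_derivative (rep c (curvature D X Y Z)) (at x) w + Gam c x w (Rm c x u v z)
        = Rm c x (Gam c x w u) v z + Rm c x u (Gam c x w v) z + Rm c x u v (Gam c x w z)"
      by (simp add: rep_D[OF c x] rep_add[OF c x] rep_curvature[OF c x] vf_intros vs vw rs rw
          cf_frechet[OF X] cf_frechet[OF Y] cf_frechet[OF Z])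
    then show ?thesis by (simp add: algebra_simps)
  qed
  then have "(rep c (curvature D X Y Z) has_derivative (\<lambda>w. Rm c x (Gam c x w u) v z + Rm c x u (Gam c x w v) z
      + Rm c x u v (Gam c x w z) - Gam c x w (Rm c x u v z))) (at x)"
    using d by (metis (no_types, lifting) has_derivative_eq_rhs HOL.ext)
  then show ?thesis
  proof (rule has_derivative_transform_eventually)
    show "\<forall>\<^sub>F y in at x. rep c (curvature D X Y Z) y = Rm c y u v z"
      using ev by (simp add: eventually_at_filter eventually_mono)
    show "rep c (curvature D X Y Z) x = Rm c x u v z" using ev by (rule eventually_nhds_x_imp_x)
  qed simp
qed

subsection \<open>Change of charts\<close>

lemma rep_trn:
  assumes "c \<in> A" "d \<in> A" "x \<in> tdom c d" "vf X"
  shows "rep d X (trn c d x) = frechet_derivative (trn c d) (at x) (rep c X x)"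
proof -
  have x: "x \<in> dm c" "pt c x \<in> fst d" using assms(3) by (auto simp: tdom_def)
  show ?thesis
    unfolding rep_def pt_trans[OF assms(2,3)]
    using crd_trans[OF assms(1,2) pt_in[OF assms(1) x(1)] x(2) vf_tangent[OF assms(4)]]
    by (simp add: snd_pt[OF assms(1) x(1)])
qed

lemma Tor_trn:
  assumes "c \<in> A" "d \<in> A" "x \<in> tdom c d"
  defines "L \<equiv> frechet_derivative (trn c d) (at x)"
  shows "Tor d (trn c d x) (L u) (L v) = L (Tor c x u v)"
proof -
  have x: "x \<in> dm c" using assms(3) by (simp add: tdom_def)
  have y: "trn c d x \<in> dm d" using trans_in[OF assms(1-3)] by (simp add: tdom_def)
  obtain X where X: "cf c x u X" by (rule cf_ex[OF assms(1) x])
  obtain Y where Y: "cf c x v Y" by (rule cf_ex[OF assms(1) x])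
  note vs = cf_vf[OF X] cf_vf[OF Y]
  show ?thesis
    using rep_torsion[OF assms(2) y vs] rep_torsion[OF assms(1) x vs]
    by (simp add: rep_trn[OF assms(1-3)] vs vf_torsion L_def cf_rep[OF X] cf_rep[OF Y])
qed

lemma G_trn:
  assumes "c \<in> A" "d \<in> A" "x \<in> tdom c d"
  defines "L \<equiv> frechet_derivative (trn c d) (at x)"
  shows "G d (trn c d x) (L u) (L v) = G c x u v"
proof -
  have x: "x \<in> dm c" "pt c x \<in> fst d" using assms(3) by (auto simp: tdom_def)
  show ?thesis
    unfolding G_def pt_trans[OF assms(2,3)] L_def
    using coord_vec_trans[OF assms(1,2) pt_in[OF assms(1) x(1)] x(2)]
    by (simp add: snd_pt[OF assms(1) x(1)])
qed

end

subsection \<open>Ordinary differential equations\<close>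

lemma gronwall_bound:
  fixes u :: "real \<Rightarrow> 'a::real_normed_vector"
  assumes der: "\<And>t. t \<in> {0..\<epsilon>} \<Longrightarrow> (u has_vector_derivative u' t) (at t within {0..\<epsilon>})"
    and bnd: "\<And>t. t \<in> {0..\<epsilon>} \<Longrightarrow> norm (u' t) \<le> L * norm (u t) + k"
    and L: "0 \<le> L" "0 \<le> k" "0 \<le> \<epsilon>" "L * \<epsilon> \<le> 1 / 2" and t: "t \<in> {0..\<epsilon>}"
  shows "norm (u t) \<le> 2 * (norm (u 0) + k * \<epsilon>)"
proof -
  have cont: "continuous_on {0..\<epsilon>} (\<lambda>t. norm (u t))"
    unfolding continuous_on_eq_continuous_within
    by (intro ballI continuous_norm has_vector_derivative_continuous[OF der])
  obtain s where s: "s \<in> {0..\<epsilon>}" "\<And>t. t \<in> {0..\<epsilon>} \<Longrightarrow> norm (u t) \<le> norm (u s)"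
    using continuous_attains_sup[OF _ _ cont] t by auto
  have "norm (u s - u 0) \<le> (L * norm (u s) + k) * norm (s - 0)"
  proof (rule differentiable_bound[where S = "{0..\<epsilon>}" and f' = "\<lambda>t h. h *\<^sub>R u' t"])
    show "(u has_derivative (\<lambda>h. h *\<^sub>R u' t)) (at t within {0..\<epsilon>})" if "t \<in> {0..\<epsilon>}" for t
      using der[OF that] by (simp add: has_vector_derivative_def)
    show "onorm (\<lambda>h. h *\<^sub>R u' t) \<le> L * norm (u s) + k" if "t \<in> {0..\<epsilon>}" for t
    proof (rule onorm_le)
      fix h :: real
      have "norm (u' t) \<le> L * norm (u s) + k"
        using bnd[OF that] mult_left_mono[OF s(2)[OF that] L(1)] by linarith
      then show "norm (h *\<^sub>R u' t) \<le> (L * norm (u s) + k) * norm h"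
        by (simp add: mult.commute mult_left_mono)
    qed
  qed (use s L in auto)
  also have "\<dots> \<le> (L * norm (u s) + k) * \<epsilon>"
    using s L by (intro mult_left_mono) auto
  finally have "norm (u s) \<le> norm (u 0) + (L * norm (u s) + k) * \<epsilon>"
    using norm_triangle_sub[of "u s" "u 0"] by linarith
  moreover have "L * norm (u s) * \<epsilon> \<le> norm (u s) / 2"
    using mult_right_mono[OF L(4), of "norm (u s)"] by (simp add: mult_ac)
  ultimately have "norm (u s) \<le> 2 * (norm (u 0) + k * \<epsilon>)" by (simp add: algebra_simps)
  then show ?thesis using s(2)[OF t] by linarith
qed

text \<open>Banach's fixed point theorem on bounded continuous functions on the whole line. Time is
  clamped to \<open>{0..\<epsilon>}\<close> by \<open>cl\<close>, so that the integral operator maps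
  this complete space to itself.\<close>

lemma picard_lindeloef_global:
  fixes F :: "'a::euclidean_space \<Rightarrow> 'a"
  assumes lip: "\<And>x y. norm (F x - F y) \<le> L * norm (x - y)" and L: "0 \<le> L" "0 \<le> \<epsilon>" "L * \<epsilon> < 1"
  obtains y where "y 0 = z"
    "\<And>t. t \<in> {0..\<epsilon>} \<Longrightarrow> (y has_vector_derivative F (y t)) (at t within {0..\<epsilon>})"
proof -
  define cl where "cl t = max 0 (min \<epsilon> t)" for t :: real
  have cl: "cl t \<in> {0..\<epsilon>}" for t using L by (auto simp: cl_def)
  have cl_id: "cl t = t" if "t \<in> {0..\<epsilon>}" for t using that by (auto simp: cl_def)
  have clc: "continuous_on UNIV cl" unfolding cl_def by (intro continuous_intros)
  have Fc: "continuous_on UNIV F"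
  proof (rule continuous_at_imp_continuous_on, rule ballI, rule isCont_iff[THEN iffD2], rule Lim_null[THEN iffD2],
      rule Lim_null_comparison)
    fix x
    show "\<forall>\<^sub>F h in at 0. norm (F (x + h) - F x) \<le> L * norm h"
      using lip[of "x + h" x for h] by (intro always_eventually allI) simp
    show "((\<lambda>h. L * norm h) \<longlongrightarrow> 0) (at (0 :: 'a))" by (auto intro!: tendsto_eq_intros)
  qed
  define \<Phi> where "\<Phi> f t = z + integral {0..cl t} (\<lambda>s. F (apply_bcontfun f s))" for f t
  have ci: "continuous_on S (\<lambda>s. F (apply_bcontfun f s))" for f :: "real \<Rightarrow>\<^sub>C 'a" and S
    by (rule continuous_on_compose2[OF Fc]) (auto intro: continuous_on_apply_bcontfun)
  have int: "(\<lambda>s. F (apply_bcontfun f s)) integrable_on {a..b}" for f :: "real \<Rightarrow>\<^sub>C 'a" and a b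
    by (intro integrable_continuous_real ci)
  have \<Phi>: "\<Phi> f \<in> bcontfun" for f
  proof -
    have c: "continuous_on {0..\<epsilon>} (\<lambda>t. z + integral {0..t} (\<lambda>s. F (apply_bcontfun f s)))"
      by (intro continuous_intros indefinite_integral_continuous_1 int)
    have "continuous_on UNIV (\<Phi> f)"
      unfolding \<Phi>_def by (rule continuous_on_compose2[OF c clc]) (use cl in auto)
    moreover have "bounded (range (\<Phi> f))"
    proof (rule bounded_subset[OF compact_imp_bounded[OF compact_continuous_image[OF c compact_Icc]]])
      show "range (\<Phi> f) \<subseteq> (\<lambda>t. z + integral {0..t} (\<lambda>s. F (apply_bcontfun f s))) ` {0..\<epsilon>}"
        using cl by (auto simp: \<Phi>_def)
    qed
    ultimately show ?thesis by (simp add: bcontfun_def)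
  qed
  have "\<exists>!f. Bcontfun (\<Phi> f) = f"
  proof (rule banach_fix_type[of "L * \<epsilon>"])
    show "\<forall>f h. dist (Bcontfun (\<Phi> f)) (Bcontfun (\<Phi> h)) \<le> L * \<epsilon> * dist f h"
    proof (intro allI dist_bound)
      fix f h :: "real \<Rightarrow>\<^sub>C 'a" and t
      have "dist (\<Phi> f t) (\<Phi> h t) = norm (integral {0..cl t} (\<lambda>s. F (apply_bcontfun f s) - F (apply_bcontfun h s)))"
        by (simp add: dist_norm \<Phi>_def integral_diff int)
      also have "\<dots> \<le> (L * dist f h) * (cl t - 0)"
      proof (rule integral_bound)
        show "continuous_on {0..cl t} (\<lambda>s. F (apply_bcontfun f s) - F (apply_bcontfun h s))"
          by (intro continuous_on_diff ci)
        show "norm (F (apply_bcontfun f s) - F (apply_bcontfun h s)) \<le> L * dist f h" for s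
          using lip[of "apply_bcontfun f s" "apply_bcontfun h s"] mult_left_mono[OF dist_bounded[of f s h] L(1)]
          by (simp add: dist_norm)
      qed (use cl[of t] in auto)
      also have "\<dots> \<le> (L * dist f h) * \<epsilon>" using cl[of t] L by (intro mult_left_mono) auto
      finally show "dist (apply_bcontfun (Bcontfun (\<Phi> f)) t) (apply_bcontfun (Bcontfun (\<Phi> h)) t) \<le> L * \<epsilon> * dist f h"
        by (simp add: Bcontfun_inverse \<Phi> mult_ac)
    qed
  qed (use L in auto)
  then obtain f where f: "Bcontfun (\<Phi> f) = f" by blast
  have e: "apply_bcontfun f t = \<Phi> f t" for t using arg_cong[OF f, of apply_bcontfun] \<Phi>[of f] by (simp add: Bcontfun_inverse)
  show ?thesis
  proof (rule that[of "apply_bcontfun f"])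
    have eq: "z + integral {0..t} (\<lambda>s. F (apply_bcontfun f s)) = apply_bcontfun f t" if "t \<in> {0..\<epsilon>}" for t
      by (subst e[of t]) (simp only: \<Phi>_def cl_id[OF that])
    show "apply_bcontfun f 0 = z" using L eq[of 0] by simp
    fix t assume t: "t \<in> {0..\<epsilon>}"
    have "((\<lambda>t. z + integral {0..t} (\<lambda>s. F (apply_bcontfun f s))) has_vector_derivative F (apply_bcontfun f t)) (at t within {0..\<epsilon>})"
      using integral_has_vector_derivative[OF ci t, of f] by (auto intro!: derivative_eq_intros)
    then show "(apply_bcontfun f has_vector_derivative F (apply_bcontfun f t)) (at t within {0..\<epsilon>})"
      by (rule has_vector_derivative_transform[OF t, rotated]) (rule eq[symmetric])
  qed
qed

lemma linear_family_bound:
  fixes A :: "'c::topological_space \<Rightarrow> 'a::euclidean_space \<Rightarrow> 'b::real_normed_vector"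
  assumes "compact S" "\<And>b. continuous_on S (\<lambda>z. A z b)" "\<And>z. z \<in> S \<Longrightarrow> linear (A z)"
  obtains L where "L \<ge> 0" "\<And>z h. z \<in> S \<Longrightarrow> norm (A z h) \<le> L * norm h"
proof -
  have "\<exists>K\<ge>0. \<forall>z\<in>S. norm (A z b) \<le> K" for b
  proof -
    have "compact ((\<lambda>z. A z b) ` S)" by (intro compact_continuous_image assms)
    then obtain K where "\<forall>x\<in>(\<lambda>z. A z b) ` S. norm x \<le> K"
      using compact_imp_bounded bounded_iff by blast
    then show ?thesis by (intro exI[of _ "max 0 K"]) auto
  qed
  then obtain K where K: "\<And>b. K b \<ge> 0" "\<And>b z. z \<in> S \<Longrightarrow> norm (A z b) \<le> K b"
    by metis
  show ?thesis
  proof (rule that[of "\<Sum>b\<in>Basis. K b"])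
    show "0 \<le> (\<Sum>b\<in>Basis. K b)" by (intro sum_nonneg K)
    fix z h assume z: "z \<in> S"
    have "norm (A z h) = norm (\<Sum>b\<in>Basis. (h \<bullet> b) *\<^sub>R A z b)"
      using linear_basis_expansion[OF assms(3)[OF z], of h] by simp
    also have "\<dots> \<le> (\<Sum>b\<in>Basis. norm h * K b)"
      by (intro order_trans[OF norm_sum] sum_mono)
        (auto intro!: mult_mono K(2)[OF z] simp: Basis_le_norm)
    finally show "norm (A z h) \<le> (\<Sum>b\<in>Basis. K b) * norm h"
      by (simp add: sum_distrib_left mult.commute)
  qed
qed

lemma smooth_deriv_bound_cball:
  fixes F :: "'a::euclidean_space \<Rightarrow> 'b::real_normed_vector"
  assumes "smooth_on S F" "cball x0 r \<subseteq> S"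
  obtains L where "L \<ge> 0" "\<And>z h. z \<in> cball x0 r \<Longrightarrow> norm (frechet_derivative F (at z) h) \<le> L * norm h"
  by (rule linear_family_bound[of "cball x0 r" "\<lambda>z. frechet_derivative F (at z)"])
    (auto intro: that continuous_on_subset[OF smooth_on_continuous[OF smooth_on_deriv[OF assms(1)]] assms(2)]
      has_derivative_linear[OF smooth_onD[OF assms(1) subsetD[OF assms(2)]]])

lemma smooth_lipschitz_cball:
  fixes F :: "'a::euclidean_space \<Rightarrow> 'b::real_normed_vector"
  assumes "smooth_on S F" "cball x0 r \<subseteq> S"
    and "\<And>z h. z \<in> cball x0 r \<Longrightarrow> norm (frechet_derivative F (at z) h) \<le> L * norm h"
    and "z \<in> cball x0 r" "z' \<in> cball x0 r"
  shows "norm (F z - F z') \<le> L * norm (z - z')"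
proof (rule differentiable_bound[OF convex_cball _ _ assms(4,5)])
  show "(F has_derivative frechet_derivative F (at x)) (at x within cball x0 r)" if "x \<in> cball x0 r" for x
    by (rule has_derivative_at_withinI[OF smooth_onD[OF assms(1) subsetD[OF assms(2) that]]])
  show "onorm (frechet_derivative F (at x)) \<le> L" if "x \<in> cball x0 r" for x
    by (rule onorm_le) (use assms(3)[OF that] in auto)
qed

text \<open>The partial derivatives are Lipschitz on the ball, and the mean value inequality is
  applied to \<open>F\<close> minus its linearisation at \<open>z\<close>. The constant is uniform
  in \<open>z\<close>, as differentiating a flow requires.\<close>

lemma smooth_quadratic_remainder:
  fixes F :: "'a::euclidean_space \<Rightarrow> 'b::real_normed_vector"
  assumes "smooth_on S F" "cball x0 r \<subseteq> S"
  obtains Q where "Q \<ge> 0" "\<And>z z'. z \<in> cball x0 r \<Longrightarrow> z' \<in> cball x0 r \<Longrightarrow>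
    norm (F z' - F z - frechet_derivative F (at z) (z' - z)) \<le> Q * (norm (z' - z))\<^sup>2"
proof -
  let ?F' = "\<lambda>z. frechet_derivative F (at z)"
  have "\<exists>K\<ge>0. \<forall>z\<in>cball x0 r. \<forall>z'\<in>cball x0 r. norm (?F' z b - ?F' z' b) \<le> K * norm (z - z')" for b
  proof -
    obtain L where L: "L \<ge> 0" "\<And>z h. z \<in> cball x0 r \<Longrightarrow> norm (frechet_derivative (\<lambda>z. ?F' z b) (at z) h) \<le> L * norm h"
      by (rule smooth_deriv_bound_cball[OF smooth_on_deriv[OF assms(1)] assms(2)]) (rule that)
    show ?thesis
      using smooth_lipschitz_cball[OF smooth_on_deriv[OF assms(1)] assms(2) L(2)] L(1) by blast
  qed
  then obtain K where K: "\<And>b. K b \<ge> 0"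
    "\<And>b z z'. z \<in> cball x0 r \<Longrightarrow> z' \<in> cball x0 r \<Longrightarrow> norm (?F' z b - ?F' z' b) \<le> K b * norm (z - z')" by metis
  define Q where "Q = (\<Sum>b\<in>Basis. K b)"
  have lin: "linear (?F' z)" if "z \<in> cball x0 r" for z
    by (rule has_derivative_linear[OF smooth_onD[OF assms(1) subsetD[OF assms(2) that]]])
  have lip: "norm (?F' w h - ?F' z h) \<le> (Q * norm (w - z)) * norm h" if "w \<in> cball x0 r" "z \<in> cball x0 r" for w z h
  proof -
    have "?F' w h - ?F' z h = (\<Sum>b\<in>Basis. (h \<bullet> b) *\<^sub>R (?F' w b - ?F' z b))"
    proof -
      have "?F' w h = (\<Sum>b\<in>Basis. (h \<bullet> b) *\<^sub>R ?F' w b)" "?F' z h = (\<Sum>b\<in>Basis. (h \<bullet> b) *\<^sub>R ?F' z b)"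
        by (intro linear_basis_expansion lin that)+
      then show ?thesis by (simp add: sum_subtractf scaleR_diff_right)
    qed
    also have "norm \<dots> \<le> (\<Sum>b\<in>Basis. norm h * (K b * norm (w - z)))"
      by (intro order_trans[OF norm_sum] sum_mono)
        (auto intro!: mult_mono K(2) that simp: Basis_le_norm)
    finally show ?thesis by (simp add: Q_def sum_distrib_left sum_distrib_right mult_ac)
  qed
  show ?thesis
  proof (rule that[of Q])
    show Q0: "Q \<ge> 0" unfolding Q_def by (intro sum_nonneg K)
    fix z z' assume z: "z \<in> cball x0 r" "z' \<in> cball x0 r"
    have seg: "closed_segment z z' \<subseteq> cball x0 r" using z convex_cball by (simp add: closed_segment_subset)
    have "norm ((F z' - ?F' z z') - (F z - ?F' z z)) \<le> (Q * norm (z' - z)) * norm (z' - z)"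
    proof (rule differentiable_bound[where S = "closed_segment z z'" and f' = "\<lambda>w h. ?F' w h - ?F' z h"])
      fix w assume w: "w \<in> closed_segment z z'"
      show "((\<lambda>w. F w - ?F' z w) has_derivative (\<lambda>h. ?F' w h - ?F' z h)) (at w within closed_segment z z')"
        using smooth_onD[OF assms(1), of w] assms(2) seg w
          smooth_onD[OF assms(1), of z, THEN has_derivative_bounded_linear] z
        by (intro has_derivative_diff has_derivative_at_withinI[OF bounded_linear_imp_has_derivative])
          (auto intro: has_derivative_at_withinI)
      show "onorm (\<lambda>h. ?F' w h - ?F' z h) \<le> Q * norm (z' - z)"
      proof (rule onorm_le)
        fix h :: 'a
        have "norm (w - z) \<le> norm (z' - z)" using w by (simp add: segment_bound1 norm_minus_commute)
        then have "(Q * norm (w - z)) * norm h \<le> (Q * norm (z' - z)) * norm h"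
          using Q0 by (intro mult_right_mono mult_left_mono) auto
        then show "norm (?F' w h - ?F' z h) \<le> Q * norm (z' - z) * norm h"
          using lip[of w z h] seg w z by fastforce
      qed
    qed auto
    then show "norm (F z' - F z - ?F' z (z' - z)) \<le> Q * (norm (z' - z))\<^sup>2"
      by (simp add: linear_diff[OF lin[OF z(1)]] power2_eq_square algebra_simps)
  qed
qed

text \<open>Outside the ball the field is replaced by its composition with the nearest point projection.\<close>

lemma picard_lindeloef_ball:
  fixes F :: "'a::euclidean_space \<Rightarrow> 'a"
  assumes lip: "\<And>x y. x \<in> cball z0 r \<Longrightarrow> y \<in> cball z0 r \<Longrightarrow> norm (F x - F y) \<le> L * norm (x - y)"
    and M: "\<And>x. x \<in> cball z0 r \<Longrightarrow> norm (F x) \<le> M"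
    and L: "0 \<le> L" "0 \<le> \<epsilon>" "L * \<epsilon> < 1" "M * \<epsilon> \<le> r / 2" "0 < r" and z: "z \<in> cball z0 (r / 2)"
  obtains y where "y 0 = z" "\<And>t. t \<in> {0..\<epsilon>} \<Longrightarrow> y t \<in> cball z0 r"
    "\<And>t. t \<in> {0..\<epsilon>} \<Longrightarrow> (y has_vector_derivative F (y t)) (at t within {0..\<epsilon>})"
proof -
  define \<pi> where "\<pi> = closest_point (cball z0 r)"
  have \<pi>: "\<pi> x \<in> cball z0 r" for x unfolding \<pi>_def using L by (intro closest_point_in_set) auto
  have \<pi>_id: "\<pi> x = x" if "x \<in> cball z0 r" for x unfolding \<pi>_def using that by (rule closest_point_self)
  have "norm (F (\<pi> x) - F (\<pi> y)) \<le> L * norm (x - y)" for x y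
  proof -
    have "norm (F (\<pi> x) - F (\<pi> y)) \<le> L * norm (\<pi> x - \<pi> y)" by (intro lip \<pi>)
    also have "\<dots> \<le> L * norm (x - y)"
      using closest_point_lipschitz[of "cball z0 r" x y] L by (intro mult_left_mono) (auto simp: \<pi>_def dist_norm)
    finally show ?thesis .
  qed
  then obtain y where y: "y 0 = z"
    "\<And>t. t \<in> {0..\<epsilon>} \<Longrightarrow> (y has_vector_derivative F (\<pi> (y t))) (at t within {0..\<epsilon>})"
    using picard_lindeloef_global[of "\<lambda>x. F (\<pi> x)" L \<epsilon> z] L by blast
  have in_ball: "y t \<in> cball z0 r" if t: "t \<in> {0..\<epsilon>}" for t
  proof -
    have "norm (y t - y 0) \<le> M * norm (t - 0)"
    proof (rule differentiable_bound[where S = "{0..\<epsilon>}" and f' = "\<lambda>t h. h *\<^sub>R F (\<pi> (y t))"])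
      show "(y has_derivative (\<lambda>h. h *\<^sub>R F (\<pi> (y t)))) (at t within {0..\<epsilon>})" if "t \<in> {0..\<epsilon>}" for t
        using y(2)[OF that] by (simp add: has_vector_derivative_def)
      show "onorm (\<lambda>h. h *\<^sub>R F (\<pi> (y t))) \<le> M" for t
        by (rule onorm_le) (use M[OF \<pi>] in \<open>auto simp: mult.commute[of M] intro: mult_left_mono\<close>)
    qed (use t L in auto)
    also have "\<dots> \<le> M * \<epsilon>"
      using t order_trans[OF norm_ge_zero M[OF \<pi>[of z]]] by (intro mult_left_mono) auto
    finally have "norm (y t - z) \<le> r / 2" using y(1) L by simp
    moreover have "norm (z - z0) \<le> r / 2" using z by (simp add: dist_norm norm_minus_commute)
    ultimately have "norm (y t - z0) \<le> r" using norm_triangle_ineq[of "y t - z" "z - z0"] by simp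
    then show ?thesis by (simp add: dist_norm norm_minus_commute)
  qed
  show ?thesis
    by (rule that[of y]) (use y in_ball \<pi>_id in auto)
qed

text \<open>Differentiability of the flow in the initial value, in quantitative form. The difference
  of two solutions stays below twice its initial size \<open>h\<close>, so the remainder is at most
  \<open>4 Q h\<^sup>2\<close>; the second Gronwall bound doubles this.\<close>

lemma flow_variation:
  fixes F :: "'a::real_normed_vector \<Rightarrow> 'a"
  assumes lip: "\<And>x y. x \<in> B \<Longrightarrow> y \<in> B \<Longrightarrow> norm (F x - F y) \<le> L * norm (x - y)"
    and F': "\<And>x h. x \<in> B \<Longrightarrow> norm (F' x h) \<le> L * norm h" "\<And>x. x \<in> B \<Longrightarrow> linear (F' x)"
    and quad: "\<And>x y. x \<in> B \<Longrightarrow> y \<in> B \<Longrightarrow> norm (F y - F x - F' x (y - x)) \<le> Q * (norm (y - x))\<^sup>2"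
    and L: "0 \<le> L" "0 \<le> Q" "0 \<le> \<epsilon>" "L * \<epsilon> \<le> 1 / 2"
    and y1: "\<And>t. t \<in> {0..\<epsilon>} \<Longrightarrow> y1 t \<in> B"
      "\<And>t. t \<in> {0..\<epsilon>} \<Longrightarrow> (y1 has_vector_derivative F (y1 t)) (at t within {0..\<epsilon>})"
    and y2: "\<And>t. t \<in> {0..\<epsilon>} \<Longrightarrow> y2 t \<in> B"
      "\<And>t. t \<in> {0..\<epsilon>} \<Longrightarrow> (y2 has_vector_derivative F (y2 t)) (at t within {0..\<epsilon>})"
    and \<zeta>: "\<zeta> 0 = y2 0 - y1 0"
      "\<And>t. t \<in> {0..\<epsilon>} \<Longrightarrow> (\<zeta> has_vector_derivative F' (y1 t) (\<zeta> t)) (at t within {0..\<epsilon>})"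
  shows "norm (y2 \<epsilon> - y1 \<epsilon> - \<zeta> \<epsilon>) \<le> 8 * Q * \<epsilon> * (norm (y2 0 - y1 0))\<^sup>2"
proof -
  have \<Delta>: "norm (y2 t - y1 t) \<le> 2 * norm (y2 0 - y1 0)" if "t \<in> {0..\<epsilon>}" for t
  proof -
    have "norm (y2 t - y1 t) \<le> 2 * (norm (y2 0 - y1 0) + 0 * \<epsilon>)"
      by (rule gronwall_bound[where u = "\<lambda>t. y2 t - y1 t" and u' = "\<lambda>t. F (y2 t) - F (y1 t)" and L = L and \<epsilon> = \<epsilon>])
        (use that L lip[OF y2(1) y1(1)] in \<open>auto intro!: has_vector_derivative_diff y1 y2\<close>)
    then show ?thesis by simp
  qed
  define h where "h = norm (y2 0 - y1 0)"
  have "norm (y2 \<epsilon> - y1 \<epsilon> - \<zeta> \<epsilon>) \<le> 2 * (norm (y2 0 - y1 0 - \<zeta> 0) + (Q * (2 * h)\<^sup>2) * \<epsilon>)"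
  proof (rule gronwall_bound[where u = "\<lambda>t. y2 t - y1 t - \<zeta> t" and u' = "\<lambda>t. F (y2 t) - F (y1 t) - F' (y1 t) (\<zeta> t)" and L = L])
    fix t assume t: "t \<in> {0..\<epsilon>}"
    show "((\<lambda>t. y2 t - y1 t - \<zeta> t) has_vector_derivative F (y2 t) - F (y1 t) - F' (y1 t) (\<zeta> t)) (at t within {0..\<epsilon>})"
      by (intro has_vector_derivative_diff y1 y2 \<zeta> t)
    have "F (y2 t) - F (y1 t) - F' (y1 t) (\<zeta> t) =
        F' (y1 t) (y2 t - y1 t - \<zeta> t) + (F (y2 t) - F (y1 t) - F' (y1 t) (y2 t - y1 t))"
      using linear_diff[OF F'(2)[OF y1(1)[OF t]]] by simp
    also have "norm \<dots> \<le> L * norm (y2 t - y1 t - \<zeta> t) + Q * (norm (y2 t - y1 t))\<^sup>2"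
      by (intro order_trans[OF norm_triangle_ineq] add_mono F' quad y1 y2 t)
    also have "\<dots> \<le> L * norm (y2 t - y1 t - \<zeta> t) + Q * (2 * h)\<^sup>2"
      using \<Delta>[OF t] L by (intro add_left_mono mult_left_mono power_mono) (auto simp: h_def)
    finally show "norm (F (y2 t) - F (y1 t) - F' (y1 t) (\<zeta> t)) \<le> L * norm (y2 t - y1 t - \<zeta> t) + Q * (2 * h)\<^sup>2" .
  qed (use L in auto)
  then show ?thesis by (simp add: \<zeta>(1) h_def power_mult_distrib mult_ac)
qed

subsection \<open>Families of complex frames\<close>

text \<open>Reads a tuple of vectors as the complex linear map sending the standard basis to it. A
  moving frame in this form is a point of a Euclidean space, to which the theory of differential
  equations applies.\<close>

definition act :: "(complex ^ 'n) ^ 'n \<Rightarrow> complex ^ 'n \<Rightarrow> complex ^ 'n" where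
  "act P v = (\<Sum>k\<in>UNIV. v $ k *s P $ k)"

definition frame_id :: "(complex ^ 'n) ^ 'n" where
  "frame_id = (\<chi> k. axis k 1)"

lemma act_frame_id: "act frame_id v = v"
  by (simp add: act_def frame_id_def vec_eq_iff axis_def if_distrib cong: if_cong)

lemma act_scale: "act P (z *s v) = z *s act P v"
  by (simp add: act_def vec_eq_iff sum_distrib_left mult.assoc)

lemma act_axis: "act P (axis k 1) = P $ k"
proof -
  have "act P (axis k 1) = (\<Sum>j\<in>UNIV. if j = k then P $ k else 0)"
    unfolding act_def by (rule sum.cong) (auto simp: axis_def)
  then show ?thesis by simp
qed

lemma bilinear_act: "bilinear act"
  unfolding bilinear_def
  by (auto intro!: linearI simp: act_def vec_eq_iff sum.distrib algebra_simps sum_distrib_left scaleR_conv_of_real[where 'a = complex])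

lemma bounded_bilinear_act: "bounded_bilinear act"
  using bilinear_act bilinear_conv_bounded_bilinear by blast

lemma act_compose:
  fixes f :: "complex ^ 'n \<Rightarrow> complex ^ 'n"
  assumes "\<And>a b. f (a + b) = f a + f b" "\<And>z a. f (z *s a) = z *s f a"
  shows "act (\<chi> k. f (P $ k)) v = f (act P v)"
proof -
  have "f (\<Sum>k\<in>I. F k) = (\<Sum>k\<in>I. f (F k))" for F :: "'n \<Rightarrow> complex ^ 'n" and I
    by (induction I rule: infinite_finite_induct) (use assms(2)[of 0 0] in \<open>auto simp: assms(1)\<close>)
  then show ?thesis by (simp add: act_def assms(2))
qed

lemma has_derivative_vec_lambda:
  fixes f :: "'n::finite \<Rightarrow> 'a::real_normed_vector \<Rightarrow> 'b::real_normed_vector"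
  assumes "\<And>k. (f k has_derivative f' k) F"
  shows "((\<lambda>x. \<chi> k. f k x) has_derivative (\<lambda>h. \<chi> k. f' k h)) F"
proof -
  have e: "(\<chi> k. y k) = (\<Sum>k\<in>UNIV. axis k (y k))" for y :: "'n \<Rightarrow> 'b"
    by (simp add: vec_eq_iff axis_def)
  have b: "bounded_linear (axis k :: 'b \<Rightarrow> 'b ^ 'n)" for k :: 'n
  proof (rule bounded_linear_intro[where K = 1])
    show "norm (axis k x) \<le> norm x * 1" for x :: 'b
    proof -
      have "(\<Sum>i\<in>UNIV. (norm (axis k x $ i))\<^sup>2) = (\<Sum>i\<in>UNIV. if i = k then (norm x)\<^sup>2 else 0)"
        by (rule sum.cong) (auto simp: axis_def)
      then show ?thesis by (simp add: norm_vec_def L2_set_def)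
    qed
  qed (auto simp: vec_eq_iff axis_def)
  show ?thesis unfolding e
    by (intro has_derivative_sum bounded_linear.has_derivative[OF b] assms)
qed

lemma has_vector_derivative_vec_lambda:
  fixes f :: "'n::finite \<Rightarrow> real \<Rightarrow> 'b::real_normed_vector"
  assumes "\<And>k. (f k has_vector_derivative f' k) F"
  shows "((\<lambda>x. \<chi> k. f k x) has_vector_derivative (\<chi> k. f' k)) F"
  using has_derivative_vec_lambda[of f "\<lambda>k h. h *\<^sub>R f' k" F] assms
  unfolding has_vector_derivative_def by (simp add: vec_eq_iff scaleR_vec_def)

lemma smooth_on_bilinear_family:
  fixes B :: "'a::euclidean_space \<Rightarrow> 'b::euclidean_space \<Rightarrow> 'c::euclidean_space \<Rightarrow> 'd::real_normed_vector"
    and \<kappa> :: "'e::real_normed_vector \<Rightarrow> 'a"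
  assumes "open S" "open U" and bil: "\<And>y. y \<in> U \<Longrightarrow> bilinear (B y)"
    and B: "\<And>u v. smooth_on U (\<lambda>y. B y u v)"
    and "smooth_on S \<kappa>" "\<And>x. x \<in> S \<Longrightarrow> \<kappa> x \<in> U" "smooth_on S \<alpha>" "smooth_on S \<beta>"
  shows "smooth_on S (\<lambda>x. B (\<kappa> x) (\<alpha> x) (\<beta> x))"
proof -
  note ex = bilinear_expansion[OF bil]
  have "smooth_on S (\<lambda>x. \<Sum>a\<in>Basis. \<Sum>b\<in>Basis. ((\<alpha> x \<bullet> a) * (\<beta> x \<bullet> b)) *\<^sub>R B (\<kappa> x) a b)"
    by (intro smooth_on_sum smooth_on_scaleR smooth_on_mult smooth_on_vec_inner assms
        smooth_on_compose[where f = \<kappa> and T = U])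
  then show ?thesis
    by (rule iffD2[OF smooth_on_cong[OF assms(1)], rotated]) (intro ex assms(6))
qed

lemma smooth_on_vec_lambda:
  fixes f :: "'n::finite \<Rightarrow> 'a::real_normed_vector \<Rightarrow> 'b::euclidean_space"
  assumes "open S" "\<And>k. smooth_on S (f k)"
  shows "smooth_on S (\<lambda>x. \<chi> k. f k x)"
proof (rule smooth_on_components[OF assms(1)])
  fix b :: "'b ^ 'n" assume "b \<in> Basis"
  then obtain k u where "b = axis k u" by (auto simp: Basis_vec_def)
  then have "(\<chi> k. f k x) \<bullet> b = f k x \<bullet> u" for x by (simp add: inner_axis)
  then show "smooth_on S (\<lambda>x. (\<chi> k. f k x) \<bullet> b)"
    using smooth_on_vec_inner[OF assms(1) assms(2)] by simp
qed

lemma smooth_on_Pair: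
  fixes f :: "'a::real_normed_vector \<Rightarrow> 'b::euclidean_space" and h :: "'a \<Rightarrow> 'c::euclidean_space"
  assumes "open S" "smooth_on S f" "smooth_on S h"
  shows "smooth_on S (\<lambda>x. (f x, h x))"
proof -
  have "smooth_on S (\<lambda>x. (f x, 0) + (0, h x))"
    by (intro smooth_on_add assms smooth_on_compose_linear[where h = "\<lambda>y. (y, 0)"]
        smooth_on_compose_linear[where h = "\<lambda>y. (0, y)"])
      (auto intro: bounded_linear_Pair bounded_linear_ident bounded_linear_zero)
  then show ?thesis by simp
qed

lemma bilinear_family_vector_derivative:
  fixes B :: "'a::real_normed_vector \<Rightarrow> 'b::euclidean_space \<Rightarrow> 'c::euclidean_space \<Rightarrow> 'd::real_normed_vector"
  assumes U: "open U" "\<And>s. s \<in> S \<Longrightarrow> \<kappa> s \<in> U" and t: "t \<in> S"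
    and bil: "\<And>y. y \<in> U \<Longrightarrow> bilinear (B y)"
    and B': "\<And>u v. ((\<lambda>y. B y u v) has_derivative (\<lambda>h. B' h u v)) (at (\<kappa> t))"
    and \<kappa>: "(\<kappa> has_vector_derivative \<kappa>') (at t within S)"
    and \<eta>: "(\<eta> has_vector_derivative \<eta>') (at t within S)" and \<zeta>: "(\<zeta> has_vector_derivative \<zeta>') (at t within S)"
  shows "((\<lambda>s. B (\<kappa> s) (\<eta> s) (\<zeta> s)) has_vector_derivative
    (B' \<kappa>' (\<eta> t) (\<zeta> t) + B (\<kappa> t) \<eta>' (\<zeta> t) + B (\<kappa> t) (\<eta> t) \<zeta>')) (at t within S)"
proof -
  have lB': "linear (\<lambda>h. B' h u v)" for u v using B' by (rule has_derivative_linear)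
  have b: "bilinear (B (\<kappa> t))" by (rule bil[OF U(2)[OF t]])
  have "((\<lambda>s. B (\<kappa> s) (\<eta> s) (\<zeta> s)) has_derivative
    (\<lambda>h. B' (h *\<^sub>R \<kappa>') (\<eta> t) (\<zeta> t) + B (\<kappa> t) (h *\<^sub>R \<eta>') (\<zeta> t) + B (\<kappa> t) (\<eta> t) (h *\<^sub>R \<zeta>'))) (at t within S)"
  proof (rule bilinear_family_has_derivative_within[where B = "\<lambda>s. B (\<kappa> s)" and B' = "\<lambda>u v h. B' (h *\<^sub>R \<kappa>') u v"])
    show "((\<lambda>s. B (\<kappa> s) u v) has_derivative (\<lambda>h. B' (h *\<^sub>R \<kappa>') u v)) (at t within S)" for u v
      using \<kappa> unfolding has_vector_derivative_def
      by (rule has_derivative_compose[where f = \<kappa> and g = "\<lambda>y. B y u v", OF _ B'])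
    show "B' (h *\<^sub>R \<kappa>') u v = (\<Sum>a\<in>Basis. \<Sum>b\<in>Basis. ((u \<bullet> a) * (v \<bullet> b)) *\<^sub>R B' (h *\<^sub>R \<kappa>') a b)" for u v h
      by (rule bilinear_derivative_expansion[where B' = "\<lambda>u v h. B' h u v", OF U(1) U(2)[OF t] bil B'])
  qed (use t bil U \<eta> \<zeta> in \<open>auto simp: has_vector_derivative_def\<close>)
  then show ?thesis unfolding has_vector_derivative_def
    by (rule has_derivative_eq_rhs)
      (simp add: linear_scale[OF lB'] bilinear_lmul[OF b] bilinear_rmul[OF b] scaleR_add_right)
qed

text \<open>The third argument is expanded in a basis, which reduces the claim to the bilinear
  rule.\<close>

lemma trilinear_family_vector_derivative:
  fixes B :: "'a::real_normed_vector \<Rightarrow> 'b::euclidean_space \<Rightarrow> 'c::euclidean_space \<Rightarrow> 'e::euclidean_space \<Rightarrow> 'd::real_normed_vector"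
  assumes U: "open U" "\<And>s. s \<in> S \<Longrightarrow> \<kappa> s \<in> U" and t: "t \<in> S"
    and bil: "\<And>y w. y \<in> U \<Longrightarrow> bilinear (\<lambda>u v. B y u v w)" and lin: "\<And>y u v. y \<in> U \<Longrightarrow> linear (B y u v)"
    and B': "\<And>u v w. ((\<lambda>y. B y u v w) has_derivative (\<lambda>h. B' h u v w)) (at (\<kappa> t))"
    and \<kappa>: "(\<kappa> has_vector_derivative \<kappa>') (at t within S)"
    and \<eta>: "(\<eta> has_vector_derivative \<eta>') (at t within S)" and \<zeta>: "(\<zeta> has_vector_derivative \<zeta>') (at t within S)"
    and \<omega>: "(\<omega> has_vector_derivative \<omega>') (at t within S)"
  shows "((\<lambda>s. B (\<kappa> s) (\<eta> s) (\<zeta> s) (\<omega> s)) has_vector_derivative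
    (B' \<kappa>' (\<eta> t) (\<zeta> t) (\<omega> t) + B (\<kappa> t) \<eta>' (\<zeta> t) (\<omega> t) + B (\<kappa> t) (\<eta> t) \<zeta>' (\<omega> t)
      + B (\<kappa> t) (\<eta> t) (\<zeta> t) \<omega>')) (at t within S)"
proof -
  have k: "\<kappa> t \<in> U" by (rule U(2)[OF t])
  have lB': "linear (B' h u v)" for h u v
  proof (rule linearI)
    fix a b :: 'e and r :: real
    have "((\<lambda>y. B y u v (a + b)) has_derivative (\<lambda>h. B' h u v a + B' h u v b)) (at (\<kappa> t))"
      by (rule has_derivative_transform_within_open[OF has_derivative_add[OF B' B'] U(1) k])
        (simp add: linear_add[OF lin])
    from fun_cong[OF has_derivative_unique[OF B' this], of h] show "B' h u v (a + b) = B' h u v a + B' h u v b" .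
    have "((\<lambda>y. B y u v (r *\<^sub>R a)) has_derivative (\<lambda>h. r *\<^sub>R B' h u v a)) (at (\<kappa> t))"
      by (rule has_derivative_transform_within_open[OF has_derivative_scaleR_right[OF B'] U(1) k])
        (simp add: linear_scale[OF lin])
    from fun_cong[OF has_derivative_unique[OF B' this], of h] show "B' h u v (r *\<^sub>R a) = r *\<^sub>R B' h u v a" .
  qed
  define d where "d e = B' \<kappa>' (\<eta> t) (\<zeta> t) e + B (\<kappa> t) \<eta>' (\<zeta> t) e + B (\<kappa> t) (\<eta> t) \<zeta>' e" for e
  have "linear d" unfolding d_def
    by (intro linear_compose_add lB' lin k)
  have e: "((\<lambda>s. B (\<kappa> s) (\<eta> s) (\<zeta> s) e) has_vector_derivative d e) (at t within S)" for e
    unfolding d_def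
    by (rule bilinear_family_vector_derivative[where B = "\<lambda>y u v. B y u v e" and B' = "\<lambda>h u v. B' h u v e",
          OF U t bil B' \<kappa> \<eta> \<zeta>])
  have w: "((\<lambda>s. \<omega> s \<bullet> e) has_vector_derivative \<omega>' \<bullet> e) (at t within S)" for e
    by (rule bounded_linear.has_vector_derivative[OF bounded_linear_inner_left \<omega>])
  have "((\<lambda>s. \<Sum>e\<in>Basis. (\<omega> s \<bullet> e) *\<^sub>R B (\<kappa> s) (\<eta> s) (\<zeta> s) e) has_vector_derivative
      (\<Sum>e\<in>Basis. (\<omega> t \<bullet> e) *\<^sub>R d e + (\<omega>' \<bullet> e) *\<^sub>R B (\<kappa> t) (\<eta> t) (\<zeta> t) e)) (at t within S)"
    by (intro has_vector_derivative_sum bounded_bilinear.has_vector_derivative[OF bounded_bilinear_scaleR w e])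
  then have "((\<lambda>s. B (\<kappa> s) (\<eta> s) (\<zeta> s) (\<omega> s)) has_vector_derivative
      (\<Sum>e\<in>Basis. (\<omega> t \<bullet> e) *\<^sub>R d e + (\<omega>' \<bullet> e) *\<^sub>R B (\<kappa> t) (\<eta> t) (\<zeta> t) e)) (at t within S)"
    by (rule has_vector_derivative_transform[OF t, rotated]) (rule linear_basis_expansion[OF lin[OF U(2)]])
  moreover have "(\<Sum>e\<in>Basis. (\<omega> t \<bullet> e) *\<^sub>R d e + (\<omega>' \<bullet> e) *\<^sub>R B (\<kappa> t) (\<eta> t) (\<zeta> t) e)
      = d (\<omega> t) + B (\<kappa> t) (\<eta> t) (\<zeta> t) \<omega>'"
    unfolding sum.distrib linear_basis_expansion[OF \<open>linear d\<close>, symmetric]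
      linear_basis_expansion[OF lin[OF k], symmetric] ..
  ultimately show ?thesis by (simp only: d_def)
qed

lemma has_derivative_quadratic:
  fixes f :: "'a::real_normed_vector \<Rightarrow> 'b::real_normed_vector"
  assumes "bounded_linear f'" "0 < \<delta>"
    and q: "\<And>h. norm h < \<delta> \<Longrightarrow> norm (f (x + h) - f x - f' h) \<le> C * (norm h)\<^sup>2"
  shows "(f has_derivative f') (at x)"
  unfolding has_derivative_at_alt
proof (intro conjI assms(1) allI impI)
  fix e :: real assume e: "e > 0"
  define d where "d = min \<delta> (e / (\<bar>C\<bar> + 1))"
  have d: "d > 0" using assms(2) e by (simp add: d_def add_nonneg_pos)
  have "norm (f y - f x - f' (y - x)) \<le> e * norm (y - x)" if y: "norm (y - x) < d" for y
  proof -
    have "norm (f (x + (y - x)) - f x - f' (y - x)) \<le> C * (norm (y - x))\<^sup>2"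
      using y by (intro q) (simp add: d_def)
    also have "\<dots> \<le> (\<bar>C\<bar> + 1) * norm (y - x) * norm (y - x)"
      by (simp add: power2_eq_square mult.assoc mult_right_mono)
    also have "\<dots> \<le> e * norm (y - x)"
    proof (rule mult_right_mono)
      have "norm (y - x) \<le> e / (\<bar>C\<bar> + 1)" using y by (simp add: d_def)
      then show "(\<bar>C\<bar> + 1) * norm (y - x) \<le> e" by (simp add: pos_le_divide_eq add_nonneg_pos mult.commute)
    qed simp
    finally show ?thesis by simp
  qed
  then show "\<exists>d>0. \<forall>y. norm (y - x) < d \<longrightarrow> norm (f y - f x - f' (y - x)) \<le> e * norm (y - x)"
    using d by blast
qed

text \<open>The energy \<open>exp (- 2 L s) |u s|\<^sup>2\<close> does not increase, by
  Cauchy-Schwarz. Unlike \<open>gronwall_bound\<close>, this works on intervals of any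
  length.\<close>

lemma linear_ode_zero:
  fixes u :: "real \<Rightarrow> 'a::real_inner"
  assumes der: "\<And>t. t \<in> {0..\<epsilon>} \<Longrightarrow> (u has_vector_derivative u' t) (at t within {0..\<epsilon>})"
    and bnd: "\<And>t. t \<in> {0..\<epsilon>} \<Longrightarrow> norm (u' t) \<le> L * norm (u t)"
    and u0: "u 0 = 0" and t: "t \<in> {0..\<epsilon>}"
  shows "u t = 0"
proof (cases "t = 0")
  case False
  define f where "f s = exp (-(2 * L * s)) * (u s \<bullet> u s)" for s
  define f' where "f' s h = h * (exp (-(2 * L * s)) * (2 * (u s \<bullet> u' s) - 2 * L * (u s \<bullet> u s)))" for s h
  have "\<exists>x\<in>{0<..<t}. f t - f 0 = f' x (t - 0)"
  proof (rule mvt_simple)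
    fix x assume x: "0 \<le> x" "x \<le> t"
    have "(u has_vector_derivative u' x) (at x within {0..t})"
      by (rule has_vector_derivative_within_subset[OF der]) (use x t in auto)
    then have d: "(u has_derivative (\<lambda>h. h *\<^sub>R u' x)) (at x within {0..t})"
      by (simp add: has_vector_derivative_def)
    have e: "((\<lambda>s. exp (-(2 * L * s))) has_derivative (\<lambda>h. h * (- 2 * L * exp (-(2 * L * x))))) (at x within {0..t})"
      by (auto intro!: derivative_eq_intros simp: algebra_simps)
    show "(f has_derivative f' x) (at x within {0..t})"
      unfolding f_def[abs_def]
      by (rule has_derivative_eq_rhs[OF has_derivative_mult[OF e has_derivative_inner[OF d d]]])
        (simp add: f'_def fun_eq_iff algebra_simps inner_commute)
  qed (use False t in auto)
  then obtain x where x: "x \<in> {0<..<t}" "f t - f 0 = f' x t" by auto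
  have xI: "x \<in> {0..\<epsilon>}" using x t by auto
  have "u x \<bullet> u' x \<le> norm (u x) * norm (u' x)" by (rule norm_cauchy_schwarz)
  also have "\<dots> \<le> norm (u x) * (L * norm (u x))" by (rule mult_left_mono[OF bnd[OF xI]]) simp
  also have "\<dots> = L * (u x \<bullet> u x)" by (simp add: dot_square_norm power2_eq_square)
  finally have "f' x t \<le> 0" unfolding f'_def using x t by (intro mult_nonneg_nonpos) auto
  then have "exp (-(2 * L * t)) * (u t \<bullet> u t) \<le> 0" using x(2) u0 by (simp add: f_def)
  then have "u t \<bullet> u t \<le> 0" by (simp add: mult_le_0_iff)
  then show ?thesis by (metis inner_eq_zero_iff inner_ge_zero order_antisym)
qed (use u0 in simp)

text \<open>As \<open>DX v\<close> stays close to \<open>\<epsilon>\<close> times the identity,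
  \<open>X\<close> bounds distances from below and is invertible onto an open set. The reflection is
  the map \<open>v \<mapsto> - v\<close> conjugated by \<open>X\<close>, which will be the
  exponential map at time \<open>\<epsilon>\<close>.\<close>

lemma point_reflection:
  fixes X :: "'a::euclidean_space \<Rightarrow> 'a" and DX :: "'a \<Rightarrow> 'a \<Rightarrow> 'a"
  assumes \<epsilon>: "0 < \<epsilon>"
    and der: "\<And>v. v \<in> ball 0 \<rho> \<Longrightarrow> (X has_derivative DX v) (at v)"
    and close: "\<And>v w. v \<in> ball 0 \<rho> \<Longrightarrow> norm (DX v w - \<epsilon> *\<^sub>R w) \<le> \<epsilon> / 2 * norm w"
  obtains s where "open (X ` ball 0 \<rho>)" "inj_on X (ball 0 \<rho>)" "\<And>v. v \<in> ball 0 \<rho> \<Longrightarrow> s (X v) = X (- v)"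
    "\<And>v. v \<in> ball 0 \<rho> \<Longrightarrow> surj (DX v)"
    "\<And>v. v \<in> ball 0 \<rho> \<Longrightarrow> \<exists>D'. (s has_derivative D') (at (X v)) \<and> (\<forall>w. D' (DX v w) = DX (- v) (- w))"
proof -
  let ?B = "ball (0 :: 'a) \<rho>"
  have expand: "\<epsilon> / 2 * norm (v - v') \<le> norm (X v - X v')" if "v \<in> ?B" "v' \<in> ?B" for v v'
  proof -
    have "norm ((X v - \<epsilon> *\<^sub>R v) - (X v' - \<epsilon> *\<^sub>R v')) \<le> \<epsilon> / 2 * norm (v - v')"
    proof (rule differentiable_bound[OF convex_ball _ _ that, where f' = "\<lambda>x h. DX x h - \<epsilon> *\<^sub>R h"])
      show "((\<lambda>v. X v - \<epsilon> *\<^sub>R v) has_derivative (\<lambda>h. DX x h - \<epsilon> *\<^sub>R h)) (at x within ?B)" if "x \<in> ?B" for x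
        using that by (intro has_derivative_diff has_derivative_scaleR_right has_derivative_ident
            has_derivative_at_withinI[OF der])
      show "onorm (\<lambda>h. DX x h - \<epsilon> *\<^sub>R h) \<le> \<epsilon> / 2" if "x \<in> ?B" for x
        by (rule onorm_le) (use close[OF that] in auto)
    qed
    moreover have "norm (\<epsilon> *\<^sub>R (v - v')) \<le> norm (X v - X v') + norm ((X v - \<epsilon> *\<^sub>R v) - (X v' - \<epsilon> *\<^sub>R v'))"
      using norm_triangle_ineq4[of "X v - X v'" "(X v - \<epsilon> *\<^sub>R v) - (X v' - \<epsilon> *\<^sub>R v')"]
      by (simp add: algebra_simps)
    ultimately show ?thesis using \<epsilon> by simp
  qed
  have inj: "inj_on X ?B"
  proof (rule inj_onI)
    fix v v' assume "v \<in> ?B" "v' \<in> ?B" "X v = X v'"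
    then show "v = v'" using expand[of v v'] \<epsilon> by (simp add: mult_le_0_iff)
  qed
  have contX: "continuous_on ?B X"
    using der has_derivative_continuous continuous_at_imp_continuous_on by blast
  have opn: "open (X ` ?B)" by (rule invariance_of_domain[OF contX open_ball inj])
  define Y where "Y = the_inv_into ?B X"
  have YX: "Y (X v) = v" if "v \<in> ?B" for v unfolding Y_def by (rule the_inv_into_f_f[OF inj that])
  have XY: "X (Y z) = z" if "z \<in> X ` ?B" for z using that YX by auto
  have lin: "linear (DX v)" if "v \<in> ?B" for v by (rule has_derivative_linear[OF der[OF that]])
  have injD: "inj (DX v)" if "v \<in> ?B" for v
  proof (rule injI)
    fix w w' assume "DX v w = DX v w'"
    then have "DX v (w - w') = 0" by (simp add: linear_diff[OF lin[OF that]])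
    with close[OF that, of "w - w'"] \<epsilon> show "w = w'" by (simp add: mult_le_0_iff)
  qed
  have surjD: "surj (DX v)" if "v \<in> ?B" for v
    using linear_injective_imp_surjective[OF lin[OF that] injD[OF that]] by simp
  have contY: "continuous (at y) Y" if y: "y \<in> X ` ?B" for y
  proof -
    have "dist (Y a) (Y b) \<le> (2 / \<epsilon>) * dist a b" if "a \<in> X ` ?B" "b \<in> X ` ?B" for a b
      using expand that YX \<epsilon> by (auto simp: dist_norm field_simps)
    then have "continuous_on (X ` ?B) Y" by (rule lipschitz_on_continuous_on[OF lipschitz_onI]) (use \<epsilon> in auto)
    then show ?thesis using opn y continuous_on_eq_continuous_at by blast
  qed
  show ?thesis
  proof (rule that[OF opn inj _ surjD, of "\<lambda>z. X (- Y z)"])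
    fix v assume v: "v \<in> ?B"
    show "X (- Y (X v)) = X (- v)" using v YX by simp
    obtain g where g: "linear g" "g \<circ> DX v = id"
      using linear_injective_left_inverse[OF lin[OF v] injD[OF v]] by blast
    have dY: "(Y has_derivative g) (at (X v))"
    proof (rule has_derivative_inverse_basic[OF _ _ g(2) contY opn])
      show "(X has_derivative DX v) (at (Y (X v)))" using der[OF v] YX[OF v] by simp
      show "bounded_linear g" using g(1) linear_conv_bounded_linear by blast
    qed (use v XY in auto)
    have mv: "- v \<in> ?B" using v by simp
    have "((\<lambda>z. X (- Y z)) has_derivative (\<lambda>u. DX (- v) (- g u))) (at (X v))"
      by (rule has_derivative_compose[where f = "\<lambda>z. - Y z" and g = X, OF has_derivative_minus[OF dY]])
        (use der[OF mv] YX[OF v] in simp)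
    moreover have "g (DX v w) = w" for w using g(2) by (simp add: fun_eq_iff)
    ultimately show "\<exists>D'. ((\<lambda>z. X (- Y z)) has_derivative D') (at (X v)) \<and> (\<forall>w. D' (DX v w) = DX (- v) (- w))"
      by (intro exI[of _ "\<lambda>u. DX (- v) (- g u)"]) simp
  qed
qed

subsection \<open>Geodesics and Jacobi fields\<close>

text \<open>A point, a frame along the geodesic, and the initial velocity, which is also the velocity
  with respect to the parallel frame.\<close>

type_synonym 'n geodesic_state = "(complex ^ 'n) \<times> ((complex ^ 'n) ^ 'n) \<times> (complex ^ 'n)"

context chern_manifold
begin

text \<open>The geodesic equation as a first-order system: the velocity of a geodesic is parallel,
  hence it is the moving frame applied to a constant vector, the third component.\<close>

definition spray :: "('m, 'n) chart \<Rightarrow> 'n geodesic_state \<Rightarrow>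
    'n geodesic_state" where
  "spray c z = (act (fst (snd z)) (snd (snd z)),
     \<chi> k. - Gam c (fst z) (act (fst (snd z)) (snd (snd z))) (fst (snd z) $ k), 0)"

text \<open>The linearisation of \<open>spray\<close>; its solutions are the variations of geodesic
  and frame with respect to the initial data.\<close>

definition spray' :: "('m, 'n) chart \<Rightarrow> 'n geodesic_state \<Rightarrow>
    'n geodesic_state \<Rightarrow>
    'n geodesic_state" where
  "spray' c z h = (act (fst (snd z)) (snd (snd h)) + act (fst (snd h)) (snd (snd z)),
     \<chi> k. - (dGam c (fst z) (fst h) (act (fst (snd z)) (snd (snd z))) (fst (snd z) $ k)
       + Gam c (fst z) (act (fst (snd z)) (snd (snd h)) + act (fst (snd h)) (snd (snd z))) (fst (snd z) $ k)
       + Gam c (fst z) (act (fst (snd z)) (snd (snd z))) (fst (snd h) $ k)), 0)"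

lemma bounded_linear_geodesic_state:
  "bounded_linear (\<lambda>z :: 'n geodesic_state. fst (snd z))" "bounded_linear (\<lambda>z :: 'n geodesic_state. snd (snd z))"
  "bounded_linear (\<lambda>z :: 'n geodesic_state. fst (snd z) $ k)"
proof -
  show 1: "bounded_linear (\<lambda>z :: 'n geodesic_state. fst (snd z))"
    by (rule bounded_linear_compose[OF bounded_linear_fst bounded_linear_snd])
  show "bounded_linear (\<lambda>z :: 'n geodesic_state. snd (snd z))"
    by (rule bounded_linear_compose[OF bounded_linear_snd bounded_linear_snd])
  show "bounded_linear (\<lambda>z :: 'n geodesic_state. fst (snd z) $ k)"
    by (rule bounded_linear_compose[OF bounded_linear_vec_nth 1])
qed

lemma spray_smooth:
  assumes c: "c \<in> A"
  shows "smooth_on (dm c \<times> UNIV) (spray c)"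
proof -
  let ?S = "dm c \<times> (UNIV :: (((complex ^ 'n) ^ 'n) \<times> (complex ^ 'n)) set)"
  have o: "open ?S" by (intro open_Times open_dm c open_UNIV)
  have p1: "smooth_on ?S (\<lambda>z. fst z)" "smooth_on ?S (\<lambda>z. fst (snd z))" "smooth_on ?S (\<lambda>z. snd (snd z))"
    "smooth_on ?S (\<lambda>z. fst (snd z) $ k)" for k
    by (rule smooth_on_bounded_linear[OF o] bounded_linear_fst bounded_linear_geodesic_state)+
  have a: "smooth_on ?S (\<lambda>z. act (fst (snd z)) (snd (snd z)))"
    by (rule smooth_on_bilinear_family[where B = "\<lambda>y. act" and \<kappa> = fst and U = UNIV])
      (auto intro: o bilinear_act smooth_on_const p1)
  have G: "smooth_on ?S (\<lambda>z. Gam c (fst z) (act (fst (snd z)) (snd (snd z))) (fst (snd z) $ k))" for k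
    by (rule smooth_on_bilinear_family[where B = "Gam c" and \<kappa> = fst and U = "dm c"])
      (auto intro: o open_dm c bilinear_Gam Gam_smooth p1 a)
  have "smooth_on ?S (\<lambda>z. (act (fst (snd z)) (snd (snd z)),
     \<chi> k. - Gam c (fst z) (act (fst (snd z)) (snd (snd z))) (fst (snd z) $ k), 0 :: complex ^ 'n))"
    by (intro smooth_on_Pair smooth_on_vec_lambda smooth_on_minus smooth_on_const a G o)
  then show ?thesis by (simp add: spray_def[abs_def])
qed

lemma spray_has_derivative:
  assumes c: "c \<in> A" and z: "fst z \<in> dm c"
  shows "(spray c has_derivative spray' c z) (at z)"
proof -
  have o: "open (dm c \<times> (UNIV :: (((complex ^ 'n) ^ 'n) \<times> (complex ^ 'n)) set))"
    by (intro open_Times open_dm c open_UNIV)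
  have zS: "z \<in> dm c \<times> UNIV" using z by (simp add: mem_Times_iff)
  have d: "((\<lambda>z. fst z) has_derivative fst) (at z)" "((\<lambda>z. fst (snd z)) has_derivative (\<lambda>h. fst (snd h))) (at z)"
    "((\<lambda>z. snd (snd z)) has_derivative (\<lambda>h. snd (snd h))) (at z)"
    "((\<lambda>z. fst (snd z) $ k) has_derivative (\<lambda>h. fst (snd h) $ k)) (at z)" for k
    by (rule bounded_linear_imp_has_derivative bounded_linear_fst bounded_linear_geodesic_state)+
  note a = bounded_bilinear.FDERIV[OF bounded_bilinear_act d(2,3)]
  have G: "((\<lambda>y. Gam c (fst y) u v) has_derivative (\<lambda>h. dGam c (fst z) (fst h) u v)) (at z)" for u v
    by (rule has_derivative_compose[where f = fst and g = "\<lambda>y. Gam c y u v", OF d(1)])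
      (rule Gam_has_derivative[OF c z])
  have b: "bilinear (Gam c (fst y))" if "y \<in> dm c \<times> (UNIV :: (((complex ^ 'n) ^ 'n) \<times> (complex ^ 'n)) set)" for y
    by (rule bilinear_Gam[OF c]) (use that in \<open>auto simp: mem_Times_iff\<close>)
  note bf = bilinear_family_has_derivative[where B = "\<lambda>z. Gam c (fst z)" and B' = "\<lambda>u v h. dGam c (fst z) (fst h) u v",
      OF o zS b G a d(4)]
  show ?thesis unfolding spray_def[abs_def] spray'_def[abs_def]
    by (intro has_derivative_Pair has_derivative_vec_lambda has_derivative_minus a bf has_derivative_const)
qed

lemma Rm_simps:
  assumes "c \<in> A" "x \<in> dm c"
  shows "bilinear (\<lambda>u v. Rm c x u v w)" "linear (Rm c x u v)"
    "Rm c x u v (a + b) = Rm c x u v a + Rm c x u v b" "Rm c x u v (\<zeta> *s a) = \<zeta> *s Rm c x u v a"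
proof -
  interpret chern_algebra "Tor c x" "Rm c x" "G c x" by (rule pointwise_chern_algebra[OF assms])
  show "Rm c x u v (a + b) = Rm c x u v a + Rm c x u v b" "Rm c x u v (\<zeta> *s a) = \<zeta> *s Rm c x u v a" for a b \<zeta>
    by (rule R_add3 R_scale3)+
  have "of_real r *s w = r *\<^sub>R w" for r and w :: "complex ^ 'n"
    by (simp add: vec_eq_iff scaleR_conv_of_real[where 'a = complex])
  then have "Rm c x u v (r *\<^sub>R w) = r *\<^sub>R Rm c x u v w" for r w
    using R_scale3[of u v "of_real r" w] by simp
  then show "linear (Rm c x u v)" by (intro linearI R_add3)
  show "bilinear (\<lambda>u v. Rm c x u v w)"
    unfolding bilinear_def by (auto intro!: linearI R_add R_scaleR R_add2 R_scaleR2)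
qed

context
  fixes c :: "('m, 'n) chart" and y V :: "real \<Rightarrow> complex ^ 'n" and P :: "real \<Rightarrow> (complex ^ 'n) ^ 'n" and \<epsilon> :: real
  assumes c: "c \<in> A" and y_dm: "\<And>t. t \<in> {0..\<epsilon>} \<Longrightarrow> y t \<in> dm c"
    and y': "\<And>t. t \<in> {0..\<epsilon>} \<Longrightarrow> (y has_vector_derivative V t) (at t within {0..\<epsilon>})"
    and P': "\<And>t. t \<in> {0..\<epsilon>} \<Longrightarrow> (P has_vector_derivative (\<chi> k. - Gam c (y t) (V t) (P t $ k))) (at t within {0..\<epsilon>})"
    and V: "continuous_on {0..\<epsilon>} V" and P0: "P 0 = frame_id"
begin

lemma transport_act:
  assumes t: "t \<in> {0..\<epsilon>}" and q: "(q has_vector_derivative q') (at t within {0..\<epsilon>})"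
  shows "((\<lambda>t. act (P t) (q t)) has_vector_derivative
    (act (P t) q' - Gam c (y t) (V t) (act (P t) (q t)))) (at t within {0..\<epsilon>})"
proof -
  have "act (\<chi> k. - Gam c (y t) (V t) (P t $ k)) (q t) = - Gam c (y t) (V t) (act (P t) (q t))"
    by (rule act_compose[where f = "\<lambda>w. - Gam c (y t) (V t) w"])
      (simp_all add: Gam_simps[OF c y_dm[OF t]] Gam_scale[OF c y_dm[OF t]] vector_scale_minus)
  then show ?thesis
    using bounded_bilinear.has_vector_derivative[OF bounded_bilinear_act P'[OF t] q] by simp
qed

lemma transport_const:
  assumes t: "t \<in> {0..\<epsilon>}"
  shows "((\<lambda>t. act (P t) a) has_vector_derivative (- Gam c (y t) (V t) (act (P t) a))) (at t within {0..\<epsilon>})"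
  using transport_act[OF t has_vector_derivative_const, of a] by (simp add: bilinear_rzero[OF bilinear_act])

lemma transport_metric:
  assumes t: "t \<in> {0..\<epsilon>}"
  shows "G c (y t) (act (P t) a) (act (P t) b) = G c (y 0) a b"
proof -
  have "((\<lambda>t. G c (y t) (act (P t) a) (act (P t) b)) has_derivative (\<lambda>h. 0)) (at t within {0..\<epsilon>})"
    if t: "t \<in> {0..\<epsilon>}" for t
  proof -
    note b = bilinear_lneg[OF bilinear_G[OF c y_dm[OF t]]] bilinear_rneg[OF bilinear_G[OF c y_dm[OF t]]]
    have "((\<lambda>t. G c (y t) (act (P t) a) (act (P t) b)) has_vector_derivative
      ((G c (y t) (Gam c (y t) (V t) (act (P t) a)) (act (P t) b) + G c (y t) (act (P t) a) (Gam c (y t) (V t) (act (P t) b)))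
       + G c (y t) (- Gam c (y t) (V t) (act (P t) a)) (act (P t) b)
       + G c (y t) (act (P t) a) (- Gam c (y t) (V t) (act (P t) b)))) (at t within {0..\<epsilon>})"
      by (rule bilinear_family_vector_derivative[where B = "G c" and \<kappa> = y and
            B' = "\<lambda>h u v. G c (y t) (Gam c (y t) h u) v + G c (y t) u (Gam c (y t) h v)",
            OF open_dm[OF c] y_dm t bilinear_G[OF c] G_has_derivative[OF c y_dm[OF t]] y'[OF t]
              transport_const[OF t] transport_const[OF t]])
    then show ?thesis by (simp add: b has_vector_derivative_def)
  qed
  from has_derivative_zero_constant[OF convex_real_interval(5) this]
  obtain k where "\<And>t. t \<in> {0..\<epsilon>} \<Longrightarrow> G c (y t) (act (P t) a) (act (P t) b) = k" by blast
  from this[OF t] this[of 0] t show ?thesis by (simp add: P0 act_frame_id)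
qed

text \<open>A parallel tensor has constant components in a parallel frame. The difference of the two
  sides solves the linear transport equation and starts at 0; uniqueness needs a bound for
  \<open>Gam\<close> along the curve, hence continuity of the velocity.\<close>

lemma transport_curvature:
  assumes t: "t \<in> {0..\<epsilon>}"
  shows "act (P t) (Rm c (y 0) a b u) = Rm c (y t) (act (P t) a) (act (P t) b) (act (P t) u)"
proof -
  have yc: "continuous_on {0..\<epsilon>} y" by (rule continuous_on_vector_derivative[OF y'])
  have linG: "linear (Gam c (y t) v)" "linear (\<lambda>v. Gam c (y t) v w)" if "t \<in> {0..\<epsilon>}" for t v w
    using bilinear_Gam[OF c y_dm[OF that]] by (simp_all add: bilinear_def)
  have "continuous_on {0..\<epsilon>} (\<lambda>t. \<Sum>e\<in>Basis. (V t \<bullet> e) *\<^sub>R Gam c (y t) e w)" for w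
    by (intro continuous_intros V continuous_on_compose2[OF smooth_on_continuous[OF Gam_smooth[OF c]] yc])
      (use y_dm in auto)
  moreover have "(\<Sum>e\<in>Basis. (V t \<bullet> e) *\<^sub>R Gam c (y t) e w) = Gam c (y t) (V t) w" if "t \<in> {0..\<epsilon>}" for t w
    by (rule linear_basis_expansion[OF linG(2)[OF that], symmetric])
  ultimately have "continuous_on {0..\<epsilon>} (\<lambda>t. Gam c (y t) (V t) w)" for w
    by (rule continuous_on_eq)
  then obtain L where L: "\<And>t h. t \<in> {0..\<epsilon>} \<Longrightarrow> norm (Gam c (y t) (V t) h) \<le> L * norm h"
    by (rule linear_family_bound[OF compact_Icc, of 0 \<epsilon> "\<lambda>t. Gam c (y t) (V t)"]) (auto intro: linG)
  let ?E = "\<lambda>t. act (P t) (Rm c (y 0) a b u) - Rm c (y t) (act (P t) a) (act (P t) b) (act (P t) u)"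
  have "?E t = 0"
  proof (rule linear_ode_zero[where u = ?E and u' = "\<lambda>t. - Gam c (y t) (V t) (?E t)" and L = L])
    fix t assume t: "t \<in> {0..\<epsilon>}"
    note simps = Gam_simps[OF c y_dm[OF t]] bilinear_lneg[OF Rm_simps(1)[OF c y_dm[OF t]]]
      bilinear_rneg[OF Rm_simps(1)[OF c y_dm[OF t]]] linear_neg[OF Rm_simps(2)[OF c y_dm[OF t]]]
    have "((\<lambda>t. Rm c (y t) (act (P t) a) (act (P t) b) (act (P t) u)) has_vector_derivative
       ((Rm c (y t) (Gam c (y t) (V t) (act (P t) a)) (act (P t) b) (act (P t) u)
         + Rm c (y t) (act (P t) a) (Gam c (y t) (V t) (act (P t) b)) (act (P t) u)
         + Rm c (y t) (act (P t) a) (act (P t) b) (Gam c (y t) (V t) (act (P t) u))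
         - Gam c (y t) (V t) (Rm c (y t) (act (P t) a) (act (P t) b) (act (P t) u)))
       + Rm c (y t) (- Gam c (y t) (V t) (act (P t) a)) (act (P t) b) (act (P t) u)
       + Rm c (y t) (act (P t) a) (- Gam c (y t) (V t) (act (P t) b)) (act (P t) u)
       + Rm c (y t) (act (P t) a) (act (P t) b) (- Gam c (y t) (V t) (act (P t) u)))) (at t within {0..\<epsilon>})"
      by (rule trilinear_family_vector_derivative[where B = "Rm c" and \<kappa> = y and
          B' = "\<lambda>h u v z. Rm c (y t) (Gam c (y t) h u) v z + Rm c (y t) u (Gam c (y t) h v) z
            + Rm c (y t) u v (Gam c (y t) h z) - Gam c (y t) h (Rm c (y t) u v z)",
          OF open_dm[OF c] y_dm t Rm_simps(1)[OF c] Rm_simps(2)[OF c] Rm_has_derivative[OF c y_dm[OF t]] y'[OF t]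
            transport_const[OF t] transport_const[OF t] transport_const[OF t]])
    then have "((\<lambda>t. Rm c (y t) (act (P t) a) (act (P t) b) (act (P t) u)) has_vector_derivative
       (- Gam c (y t) (V t) (Rm c (y t) (act (P t) a) (act (P t) b) (act (P t) u)))) (at t within {0..\<epsilon>})"
      by (simp add: simps)
    from has_vector_derivative_diff[OF transport_const[OF t] this]
    show "(?E has_vector_derivative - Gam c (y t) (V t) (?E t)) (at t within {0..\<epsilon>})"
      by (simp add: simps)
    show "norm (- Gam c (y t) (V t) (?E t)) \<le> L * norm (?E t)" using L[OF t] by simp
  qed (use t in \<open>auto simp: P0 act_frame_id\<close>)
  then show ?thesis by simp
qed

text \<open>\<open>\<theta>\<close> is the variation of the point and \<open>\<Omega>\<close> that
  of the frame, both read in the parallel frame. The term with \<open>Gam\<close> converts the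
  covariant variation of the frame into the coordinate one. Vanishing torsion enters as symmetry of
  \<open>Gam\<close>.\<close>

lemma jacobi_field:
  fixes \<Omega> :: "real \<Rightarrow> (complex ^ 'n) ^ 'n"
  assumes Vv: "\<And>t. t \<in> {0..\<epsilon>} \<Longrightarrow> V t = act (P t) v" and t: "t \<in> {0..\<epsilon>}"
    and tor: "\<And>u w. Tor c (y t) u w = 0"
    and \<theta>: "(\<theta> has_vector_derivative (w + act (\<Omega> t) v)) (at t within {0..\<epsilon>})"
    and \<Omega>: "(\<Omega> has_vector_derivative (\<chi> k. Rm c (y 0) v (\<theta> t) (axis k 1))) (at t within {0..\<epsilon>})"
  shows "((\<lambda>t. (act (P t) (\<theta> t), \<chi> k. act (P t) (\<Omega> t $ k) - Gam c (y t) (act (P t) (\<theta> t)) (P t $ k), w))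
    has_vector_derivative spray' c (y t, P t, v)
      (act (P t) (\<theta> t), \<chi> k. act (P t) (\<Omega> t $ k) - Gam c (y t) (act (P t) (\<theta> t)) (P t $ k), w))
    (at t within {0..\<epsilon>})"
proof -
  let ?\<Gamma> = "Gam c (y t)" and ?T = "act (P t) (\<theta> t)"
  define Q where "Q = (\<chi> k. act (P t) (\<Omega> t $ k) - ?\<Gamma> ?T (P t $ k))"
  note gs = Gam_simps[OF c y_dm[OF t]]
  have sym: "?\<Gamma> a b = ?\<Gamma> b a" for a b using tor[of a b] by (simp add: Tor_def)
  have Q: "act Q v = act (P t) (act (\<Omega> t) v) - ?\<Gamma> ?T (V t)"
  proof -
    have 1: "act (\<chi> k. act (P t) (\<Omega> t $ k)) v = act (P t) (act (\<Omega> t) v)"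
      by (rule act_compose) (simp_all add: bilinear_radd[OF bilinear_act] act_scale)
    have 2: "act (\<chi> k. ?\<Gamma> ?T (P t $ k)) v = ?\<Gamma> ?T (act (P t) v)"
      by (rule act_compose) (simp_all add: gs Gam_scale[OF c y_dm[OF t]])
    have "Q = (\<chi> k. act (P t) (\<Omega> t $ k)) - (\<chi> k. ?\<Gamma> ?T (P t $ k))" by (simp add: Q_def vec_eq_iff)
    then show ?thesis by (simp add: bilinear_lsub[OF bilinear_act] 1 2 Vv[OF t])
  qed
  have T: "((\<lambda>t. act (P t) (\<theta> t)) has_vector_derivative (act (P t) w + act Q v)) (at t within {0..\<epsilon>})"
    using transport_act[OF t \<theta>] by (simp add: bilinear_radd[OF bilinear_act] Q sym[of ?T] add_diff_eq)
  have Pk: "((\<lambda>t. P t $ k) has_vector_derivative (- ?\<Gamma> (V t) (P t $ k))) (at t within {0..\<epsilon>})" for k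
    using bounded_linear.has_vector_derivative[OF bounded_linear_vec_nth P'[OF t], of k] by simp
  have \<Omega>k: "((\<lambda>t. \<Omega> t $ k) has_vector_derivative Rm c (y 0) v (\<theta> t) (axis k 1)) (at t within {0..\<epsilon>})" for k
    using bounded_linear.has_vector_derivative[OF bounded_linear_vec_nth \<Omega>, of k] by simp
  have \<Omega>P: "((\<lambda>t. act (P t) (\<Omega> t $ k)) has_vector_derivative
      (dGam c (y t) (V t) ?T (P t $ k) - dGam c (y t) ?T (V t) (P t $ k) + ?\<Gamma> (V t) (?\<Gamma> ?T (P t $ k))
         - ?\<Gamma> ?T (?\<Gamma> (V t) (P t $ k)) - ?\<Gamma> (V t) (act (P t) (\<Omega> t $ k)))) (at t within {0..\<epsilon>})" for k
    using transport_act[OF t \<Omega>k[of k], unfolded transport_curvature[OF t] act_axis Vv[OF t, symmetric]]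
    by (simp only: Rm_def)
  have \<Gamma>P: "((\<lambda>t. Gam c (y t) (act (P t) (\<theta> t)) (P t $ k)) has_vector_derivative
      (dGam c (y t) (V t) ?T (P t $ k) + ?\<Gamma> (act (P t) w + act Q v) (P t $ k) + ?\<Gamma> ?T (- ?\<Gamma> (V t) (P t $ k))))
      (at t within {0..\<epsilon>})" for k
    by (rule bilinear_family_vector_derivative[where B = "Gam c" and \<kappa> = y and B' = "\<lambda>h u v. dGam c (y t) h u v",
          OF open_dm[OF c] y_dm t bilinear_Gam[OF c] Gam_has_derivative[OF c y_dm[OF t]] y'[OF t] T Pk])
  have Qk: "((\<lambda>t. act (P t) (\<Omega> t $ k) - Gam c (y t) (act (P t) (\<theta> t)) (P t $ k)) has_vector_derivative
      - (dGam c (y t) ?T (V t) (P t $ k) + ?\<Gamma> (act (P t) w + act Q v) (P t $ k) + ?\<Gamma> (V t) (Q $ k)))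
      (at t within {0..\<epsilon>})" for k
    by (rule has_vector_derivative_eq_rhs[OF has_vector_derivative_diff[OF \<Omega>P \<Gamma>P]])
      (simp add: Q_def gs)
  show ?thesis
    using has_vector_derivative_Pair[OF T has_vector_derivative_Pair[OF
          has_vector_derivative_vec_lambda[OF Qk] has_vector_derivative_const]]
    by (simp add: spray'_def Q_def[symmetric] Vv[OF t, symmetric])
qed

end

text \<open>\<open>X\<close> is the exponential map at time \<open>\<epsilon>\<close> and
  \<open>DX\<close> the Jacobi field at the end point. The derivative of the reflection is minus the
  change from the frame at one end point to the frame at the other; frames are complex linear and
  isometric, so this change is too.\<close>

lemma local_symmetry_in_chart:
  assumes c: "c \<in> A" and p: "p \<in> dm c" and tor: "\<And>x u v. x \<in> dm c \<Longrightarrow> Tor c x u v = 0"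
  obtains U s where "open U" "p \<in> U" "U \<subseteq> dm c"
    "\<And>x. x \<in> U \<Longrightarrow> s x \<in> U \<and> s (s x) = x \<and> (s x = x \<longleftrightarrow> x = p)"
    "\<And>x. x \<in> U \<Longrightarrow> \<exists>D'. (s has_derivative D') (at x) \<and> (\<forall>z v. D' (z *s v) = z *s D' v) \<and>
       (\<forall>u v. G c (s x) (D' u) (D' v) = G c x u v)"
proof -
  note act_simps = bilinear_ladd[OF bilinear_act] bilinear_radd[OF bilinear_act] bilinear_lmul[OF bilinear_act]
    bilinear_rmul[OF bilinear_act] bilinear_rneg[OF bilinear_act] bilinear_lneg[OF bilinear_act]
    bilinear_lzero[OF bilinear_act] bilinear_rzero[OF bilinear_act] bilinear_lsub[OF bilinear_act] bilinear_rsub[OF bilinear_act]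
  note Rm_p = bilinear_ladd[OF Rm_simps(1)[OF c p]] bilinear_radd[OF Rm_simps(1)[OF c p]]
    bilinear_lmul[OF Rm_simps(1)[OF c p]] bilinear_rmul[OF Rm_simps(1)[OF c p]]
    bilinear_lneg[OF Rm_simps(1)[OF c p]] bilinear_rneg[OF Rm_simps(1)[OF c p]]
  have nf: "norm (fst z) \<le> norm z" and nfs: "norm (fst (snd z)) \<le> norm z" for z :: "'n geodesic_state"
    using norm_fst_le[of "fst z" "snd z"] norm_snd_le[of "snd z" "fst z"] norm_fst_le[of "fst (snd z)" "snd (snd z)"]
    by auto
  define z0 :: "'n geodesic_state" where "z0 = (p, frame_id, 0)"
  have oS: "open (dm c \<times> (UNIV :: (((complex ^ 'n) ^ 'n) \<times> (complex ^ 'n)) set))"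
    by (intro open_Times open_dm c open_UNIV)
  have "z0 \<in> dm c \<times> UNIV" using p by (simp add: z0_def)
  then obtain r0 where r0: "r0 > 0" "cball z0 r0 \<subseteq> dm c \<times> UNIV"
    using oS open_contains_cball by blast
  obtain c0 where c0: "c0 > 0" "\<And>(P :: (complex ^ 'n) ^ 'n) v. norm (act P v) \<le> norm P * norm v * c0"
    using bounded_bilinear.pos_bounded[OF bounded_bilinear_act] by blast
  \<comment> \<open>On this radius the variation of the point grows with a velocity that differs
    from \<open>w\<close> by at most \<open>norm w / 4\<close>: the two error terms below add up to
    \<open>3 * c0 * r * norm w\<close>.\<close>
  define r where "r = min r0 (1 / (12 * c0))"
  have r: "r > 0" "cball z0 r \<subseteq> dm c \<times> UNIV" using r0 c0 by (auto simp: r_def)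
  have "r \<le> 1 / (12 * c0)" by (simp add: r_def)
  then have rc0: "12 * (c0 * r) \<le> 1" using c0(1) by (simp add: field_simps)
  have in_dm: "fst z \<in> dm c" if "z \<in> cball z0 r" for z using that r(2) by (auto simp: mem_Times_iff)
  have der: "frechet_derivative (spray c) (at z) = spray' c z" if "z \<in> cball z0 r" for z
    using frechet_derivative_at[OF spray_has_derivative[OF c in_dm[OF that]]] by simp
  obtain L where L: "L \<ge> 0" "\<And>z h. z \<in> cball z0 r \<Longrightarrow> norm (frechet_derivative (spray c) (at z) h) \<le> L * norm h"
    by (rule smooth_deriv_bound_cball[OF spray_smooth[OF c] r(2)]) (rule that)
  note lip = smooth_lipschitz_cball[OF spray_smooth[OF c] r(2) L(2)]
  obtain Q where Q: "Q \<ge> 0" "\<And>z z'. z \<in> cball z0 r \<Longrightarrow> z' \<in> cball z0 r \<Longrightarrow>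
    norm (spray c z' - spray c z - frechet_derivative (spray c) (at z) (z' - z)) \<le> Q * (norm (z' - z))\<^sup>2"
    by (rule smooth_quadratic_remainder[OF spray_smooth[OF c] r(2)]) (rule that)
  \<comment> \<open>The homogeneous part of the Jacobi system, with the curvature frozen at
    \<open>p\<close>; it is bilinear in the velocity and the pair of \<open>\<theta>\<close> and
    \<open>\<Omega>\<close>.\<close>
  define H :: "complex ^ 'n \<Rightarrow> (complex ^ 'n) \<times> ((complex ^ 'n) ^ 'n) \<Rightarrow> (complex ^ 'n) \<times> ((complex ^ 'n) ^ 'n)"
    where "H v s = (act (snd s) v, \<chi> k. Rm c p v (fst s) (axis k 1))" for v s
  have bilH: "bilinear H"
    unfolding bilinear_def H_def by (auto intro!: linearI simp: act_simps Rm_p vec_eq_iff)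
  obtain K0 where K0: "K0 > 0" "\<And>v s. norm (H v s) \<le> norm v * norm s * K0"
    using bounded_bilinear.pos_bounded[OF iffD1[OF bilinear_conv_bounded_bilinear bilH]] by blast
  define K where "K = r * K0"
  have K: "K \<ge> 0" "\<And>v s. norm v \<le> r \<Longrightarrow> norm (H v s) \<le> K * norm s"
  proof -
    show "K \<ge> 0" using r K0 by (simp add: K_def)
    fix v :: "complex ^ 'n" and s :: "(complex ^ 'n) \<times> ((complex ^ 'n) ^ 'n)"
    assume "norm v \<le> r"
    then have "norm v * (norm s * K0) \<le> r * (norm s * K0)" using K0 by (intro mult_right_mono) auto
    then show "norm (H v s) \<le> K * norm s" using K0(2)[of v s] by (simp add: K_def mult_ac)
  qed
  have "compact (spray c ` cball z0 r)"
    by (intro compact_continuous_image continuous_on_subset[OF smooth_on_continuous[OF spray_smooth[OF c]] r(2)]) simp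
  then obtain M where M: "M > 0" "\<And>z. z \<in> cball z0 r \<Longrightarrow> norm (spray c z) \<le> M"
    using compact_imp_bounded bounded_pos by (metis imageI)
  \<comment> \<open>Makes \<open>1 / (2 * N)\<close> short enough at once for the flow and its
    linearisation, for the Jacobi system, and for staying inside the ball.\<close>
  define N where "N = 1 + L + K + M / r"
  define \<epsilon> where "\<epsilon> = 1 / (2 * N)"
  have N: "N > 0" "L \<le> N" "K \<le> N" "M / r \<le> N" using L(1) K(1) M(1) r(1) by (auto simp: N_def add_nonneg_pos)
  have \<epsilon>: "\<epsilon> > 0" "L * \<epsilon> \<le> 1 / 2" "K * \<epsilon> \<le> 1 / 2" "M * \<epsilon> \<le> r / 2"
    using N r(1) by (auto simp: \<epsilon>_def field_simps)
  let ?B = "ball (0 :: complex ^ 'n) (r / 2)" and ?I = "{0..\<epsilon>}"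
  have "\<forall>v\<in>?B. \<exists>Z. Z 0 = (p, frame_id, v) \<and>
    (\<forall>t\<in>?I. Z t \<in> cball z0 r \<and> (Z has_vector_derivative spray c (Z t)) (at t within ?I))"
  proof
    fix v assume v: "v \<in> ?B"
    have zb: "(p, frame_id, v) \<in> cball z0 (r / 2)" using v by (simp add: z0_def dist_Pair_Pair)
    obtain Z where "Z 0 = (p, frame_id, v)" "\<And>t. t \<in> ?I \<Longrightarrow> Z t \<in> cball z0 r"
      "\<And>t. t \<in> ?I \<Longrightarrow> (Z has_vector_derivative spray c (Z t)) (at t within ?I)"
      by (rule picard_lindeloef_ball[OF lip M(2) L(1) _ _ \<epsilon>(4) r(1) zb]) (use \<epsilon> in auto)
    then show "\<exists>Z. Z 0 = (p, frame_id, v) \<and>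
      (\<forall>t\<in>?I. Z t \<in> cball z0 r \<and> (Z has_vector_derivative spray c (Z t)) (at t within ?I))" by blast
  qed
  from bchoice[OF this] obtain Z where Z0: "\<And>v. v \<in> ?B \<Longrightarrow> Z v 0 = (p, frame_id, v)"
    and Zb: "\<And>v t. v \<in> ?B \<Longrightarrow> t \<in> ?I \<Longrightarrow> Z v t \<in> cball z0 r"
    and Z': "\<And>v t. v \<in> ?B \<Longrightarrow> t \<in> ?I \<Longrightarrow> (Z v has_vector_derivative spray c (Z v t)) (at t within ?I)" by blast
  define y where "y v t = fst (Z v t)" for v t
  define P where "P v t = fst (snd (Z v t))" for v t
  have zI: "0 \<in> ?I" "\<epsilon> \<in> ?I" using \<epsilon> by auto
  have const: "f t = f 0" if "\<And>t. t \<in> ?I \<Longrightarrow> (f has_vector_derivative 0) (at t within ?I)" "t \<in> ?I"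
    for f :: "real \<Rightarrow> complex ^ 'n" and t
  proof -
    have "f t - f 0 = 0"
      by (rule linear_ode_zero[where u = "\<lambda>t. f t - f 0" and u' = "\<lambda>_. 0" and \<epsilon> = \<epsilon> and L = 0])
        (use that has_vector_derivative_diff[OF that(1) has_vector_derivative_const] in auto)
    then show ?thesis by simp
  qed
  have Zv: "snd (snd (Z v t)) = v" if "v \<in> ?B" "t \<in> ?I" for v t
  proof -
    have "snd (snd (Z v t)) = snd (snd (Z v 0))"
    proof (rule const[OF _ that(2)])
      fix t assume "t \<in> ?I"
      from bounded_linear.has_vector_derivative[OF bounded_linear_compose[OF bounded_linear_snd bounded_linear_snd] Z'[OF that(1) this]]
      show "((\<lambda>t. snd (snd (Z v t))) has_vector_derivative 0) (at t within ?I)" by (simp add: spray_def)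
    qed
    then show ?thesis by (simp add: Z0[OF that(1)])
  qed
  have Zeq: "Z v t = (y v t, P v t, v)" if "v \<in> ?B" "t \<in> ?I" for v t
    using Zv[OF that] by (simp add: y_def P_def prod_eq_iff)
  have yf: "(\<lambda>t. fst (Z v t)) = y v" and Pf: "(\<lambda>t. fst (snd (Z v t))) = P v" for v
    by (simp_all add: fun_eq_iff y_def P_def)
  have ydm: "y v t \<in> dm c" if "v \<in> ?B" "t \<in> ?I" for v t using in_dm[OF Zb[OF that]] by (simp add: y_def)
  have y': "(y v has_vector_derivative act (P v t) v) (at t within ?I)" if "v \<in> ?B" "t \<in> ?I" for v t
    using bounded_linear.has_vector_derivative[OF bounded_linear_fst Z'[OF that]]
    by (simp add: spray_def Zeq[OF that] yf)
  have P': "(P v has_vector_derivative (\<chi> k. - Gam c (y v t) (act (P v t) v) (P v t $ k))) (at t within ?I)"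
    if "v \<in> ?B" "t \<in> ?I" for v t
    using bounded_linear.has_vector_derivative[OF bounded_linear_compose[OF bounded_linear_fst bounded_linear_snd] Z'[OF that]]
    by (simp add: spray_def Zeq[OF that] Pf)
  have Vc: "continuous_on ?I (\<lambda>t. act (P v t) v)" if "v \<in> ?B" for v
    by (intro bounded_bilinear.continuous_on[OF bounded_bilinear_act] continuous_on_const
        continuous_on_vector_derivative[OF P'[OF that]])
  have y0: "y v 0 = p" and P0: "P v 0 = frame_id" if "v \<in> ?B" for v using Z0[OF that] by (simp_all add: y_def P_def)
  have metric: "G c (y v t) (act (P v t) a) (act (P v t) b) = G c p a b" if v: "v \<in> ?B" "t \<in> ?I" for v t a b
    using transport_metric[OF c ydm[OF v(1)] y'[OF v(1)] P'[OF v(1)] Vc[OF v(1)] P0[OF v(1)] v(2), of a b]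
    by (simp add: y0[OF v(1)])
  have uniq: "f t = h t" if v: "v \<in> ?B"
    and "\<And>t. t \<in> ?I \<Longrightarrow> (f has_vector_derivative ((w, 0) + H v (f t))) (at t within ?I)" "f 0 = 0"
    and "\<And>t. t \<in> ?I \<Longrightarrow> (h has_vector_derivative ((w, 0) + H v (h t))) (at t within ?I)" "h 0 = 0" "t \<in> ?I"
    for v w f h t
  proof -
    have "f t - h t = 0"
    proof (rule linear_ode_zero[where u = "\<lambda>t. f t - h t" and u' = "\<lambda>t. H v (f t - h t)" and L = K])
      show "((\<lambda>t. f t - h t) has_vector_derivative H v (f t - h t)) (at t within ?I)" if "t \<in> ?I" for t
        by (rule has_vector_derivative_eq_rhs[OF has_vector_derivative_diff[OF \<open>\<And>t. t \<in> ?I \<Longrightarrow>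
            (f has_vector_derivative ((w, 0) + H v (f t))) (at t within ?I)\<close>[OF that] \<open>\<And>t. t \<in> ?I \<Longrightarrow>
            (h has_vector_derivative ((w, 0) + H v (h t))) (at t within ?I)\<close>[OF that]]])
          (simp add: bilinear_rsub[OF bilH])
      show "norm (H v (f t - h t)) \<le> K * norm (f t - h t)" for t by (rule K(2)) (use v r in auto)
    qed (use that in auto)
    then show ?thesis by simp
  qed
  have ex: "\<exists>f. f 0 = 0 \<and> (\<forall>t\<in>?I. (f has_vector_derivative ((w, 0) + H v (f t))) (at t within ?I))"
    if "v \<in> ?B" for v w
  proof -
    have n: "norm v \<le> r" using that r by auto
    have lipH: "norm (((w, 0) + H v a) - ((w, 0) + H v b)) \<le> K * norm (a - b)" for a b
      using K(2)[OF n, of "a - b"] by (simp add: bilinear_rsub[OF bilH])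
    obtain f where "f 0 = 0" "\<And>t. t \<in> ?I \<Longrightarrow> (f has_vector_derivative ((w, 0) + H v (f t))) (at t within ?I)"
      by (rule picard_lindeloef_global[OF lipH K(1), of \<epsilon> 0]) (use \<epsilon> in auto)
    then show ?thesis by blast
  qed
  define J where "J v w = (SOME f. f 0 = 0 \<and>
    (\<forall>t\<in>?I. (f has_vector_derivative ((w, 0) + H v (f t))) (at t within ?I)))" for v w
  have J: "J v w 0 = 0 \<and> (\<forall>t\<in>?I. (J v w has_vector_derivative ((w, 0) + H v (J v w t))) (at t within ?I))"
    if "v \<in> ?B" for v w
    unfolding J_def by (rule someI_ex[OF ex[OF that]])
  have J0: "J v w 0 = 0" if "v \<in> ?B" for v w using J[OF that, of w] by blast
  have J1: "(J v w has_vector_derivative ((w, 0) + H v (J v w t))) (at t within ?I)" if "v \<in> ?B" "t \<in> ?I" for v w t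
    using J[OF that(1), of w] that(2) by blast
  define \<theta> where "\<theta> v w t = fst (J v w t)" for v w t
  define \<Omega> where "\<Omega> v w t = snd (J v w t)" for v w t
  have \<theta>f: "(\<lambda>t. fst (J v w t)) = \<theta> v w" and \<Omega>f: "(\<lambda>t. snd (J v w t)) = \<Omega> v w" for v w
    by (simp_all add: fun_eq_iff \<theta>_def \<Omega>_def)
  have \<theta>': "(\<theta> v w has_vector_derivative (w + act (\<Omega> v w t) v)) (at t within ?I)" if "v \<in> ?B" "t \<in> ?I" for v w t
    using bounded_linear.has_vector_derivative[OF bounded_linear_fst J1[OF that]]
    by (simp add: H_def \<theta>f \<Omega>_def)
  have \<Omega>': "(\<Omega> v w has_vector_derivative (\<chi> k. Rm c (y v 0) v (\<theta> v w t) (axis k 1))) (at t within ?I)"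
    if "v \<in> ?B" "t \<in> ?I" for v w t
    using bounded_linear.has_vector_derivative[OF bounded_linear_snd J1[OF that]]
    by (simp add: H_def \<theta>_def \<Omega>f y0[OF that(1)])
  have J_add: "J v (a + b) \<epsilon> = J v a \<epsilon> + J v b \<epsilon>" if v: "v \<in> ?B" for v a b
    by (rule uniq[OF v _ _ _ _ zI(2), where w = "a + b" and h = "\<lambda>t. J v a t + J v b t"])
      (use v J0 J1 in \<open>auto intro!: has_vector_derivative_eq_rhs[OF has_vector_derivative_add[OF J1 J1]]
        simp: bilinear_radd[OF bilH]\<close>)
  have J_scale: "J v (k *\<^sub>R a) \<epsilon> = k *\<^sub>R J v a \<epsilon>" if v: "v \<in> ?B" for v a k
    by (rule uniq[OF v _ _ _ _ zI(2), where w = "k *\<^sub>R a" and h = "\<lambda>t. k *\<^sub>R J v a t"])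
      (use v J0 J1 in \<open>auto intro!: has_vector_derivative_eq_rhs[OF bounded_linear.has_vector_derivative[OF
        bounded_linear_scaleR_right J1]] simp: bilinear_rmul[OF bilH] scaleR_add_right\<close>)
  have neg: "- v \<in> ?B" if "v \<in> ?B" for v using that by simp
  have J_neg: "J (- v) (- w) \<epsilon> = (- \<theta> v w \<epsilon>, \<Omega> v w \<epsilon>)" if v: "v \<in> ?B" for v w
  proof (rule uniq[OF neg[OF v] J1[OF neg[OF v]] J0[OF neg[OF v]] _ _ zI(2), where h = "\<lambda>t. (- \<theta> v w t, \<Omega> v w t)"])
    show "(- \<theta> v w 0, \<Omega> v w 0) = 0" using J0[OF v, of w] by (simp add: \<theta>_def \<Omega>_def zero_prod_def)
    fix t assume t: "t \<in> ?I"
    show "((\<lambda>t. (- \<theta> v w t, \<Omega> v w t)) has_vector_derivative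
        ((- w, 0) + H (- v) (- \<theta> v w t, \<Omega> v w t))) (at t within ?I)"
      by (rule has_vector_derivative_eq_rhs[OF has_vector_derivative_Pair[OF
            has_vector_derivative_minus[OF \<theta>'[OF v t]] \<Omega>'[OF v t]]])
        (simp add: H_def act_simps Rm_p y0[OF v])
  qed
  define \<zeta> where "\<zeta> v w t = (act (P v t) (\<theta> v w t),
      \<chi> k. act (P v t) (\<Omega> v w t $ k) - Gam c (y v t) (act (P v t) (\<theta> v w t)) (P v t $ k), w)" for v w t
  have \<zeta>': "(\<zeta> v w has_vector_derivative spray' c (Z v t) (\<zeta> v w t)) (at t within ?I)" if v: "v \<in> ?B" "t \<in> ?I" for v w t
    using jacobi_field[OF c ydm[OF v(1)] y'[OF v(1)] P'[OF v(1)] Vc[OF v(1)] P0[OF v(1)] refl v(2)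
        tor[OF ydm[OF v]] \<theta>'[OF v] \<Omega>'[OF v]]
    by (simp add: \<zeta>_def[abs_def] Zeq[OF v])
  have \<zeta>0: "\<zeta> v w 0 = (0, 0, w)" if v: "v \<in> ?B" for v w
    using J0[OF v, of w] ydm[OF v zI(1)]
    by (simp add: \<zeta>_def \<theta>_def \<Omega>_def act_simps Gam_simps[OF c ydm[OF v zI(1)]] vec_eq_iff)
  have \<zeta>_bound: "norm (\<zeta> v w t) \<le> 2 * norm w" if v: "v \<in> ?B" "t \<in> ?I" for v w t
  proof -
    have "norm (\<zeta> v w t) \<le> 2 * (norm (\<zeta> v w 0) + 0 * \<epsilon>)"
      by (rule gronwall_bound[OF \<zeta>'[OF v(1)], where L = L])
        (use L(2)[OF Zb[OF v(1)]] der[OF Zb[OF v(1)]] L(1) \<epsilon> v in auto)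
    then show ?thesis by (simp add: \<zeta>0[OF v(1)] norm_Pair)
  qed
  define X where "X v = y v \<epsilon>" for v
  define DX where "DX v w = act (P v \<epsilon>) (\<theta> v w \<epsilon>)" for v w
  \<comment> \<open>Gronwall with \<open>L = 0\<close> for the deviation from
    \<open>t *\<^sub>R w\<close>: a rate of at most \<open>norm w / 4\<close> gives the factor
    \<open>\<epsilon> / 2\<close>.\<close>
  have close: "norm (DX v w - \<epsilon> *\<^sub>R w) \<le> \<epsilon> / 2 * norm w" if v: "v \<in> ?B" for v w
  proof -
    have "norm (fst (\<zeta> v w \<epsilon>) - \<epsilon> *\<^sub>R w) \<le> 2 * (norm (fst (\<zeta> v w 0) - 0 *\<^sub>R w) + (norm w / 4) * \<epsilon>)"
    proof (rule gronwall_bound[where u = "\<lambda>t. fst (\<zeta> v w t) - t *\<^sub>R w" and L = 0 and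
          u' = "\<lambda>t. fst (spray' c (Z v t) (\<zeta> v w t)) - w"])
      fix t assume t: "t \<in> ?I"
      show "((\<lambda>t. fst (\<zeta> v w t) - t *\<^sub>R w) has_vector_derivative fst (spray' c (Z v t) (\<zeta> v w t)) - w) (at t within ?I)"
        by (intro has_vector_derivative_diff bounded_linear.has_vector_derivative[OF bounded_linear_fst \<zeta>'[OF v t]])
          (auto intro!: derivative_eq_intros)
      define q where "q = fst (snd (\<zeta> v w t))"
      have w: "snd (snd (\<zeta> v w t)) = w" by (simp add: \<zeta>_def)
      have q: "norm q \<le> 2 * norm w"
        unfolding q_def by (rule order_trans[OF nfs \<zeta>_bound[OF v t]])
      have "P v t - frame_id = fst (snd (Z v t - z0))" by (simp add: Zeq[OF v t] z0_def)
      then have "norm (P v t - frame_id) \<le> norm (Z v t - z0)" by (simp only: nfs)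
      then have Pr: "norm (P v t - frame_id) \<le> r" using Zb[OF v t] by (simp add: dist_norm norm_minus_commute)
      have e: "fst (spray' c (Z v t) (\<zeta> v w t)) - w = act (P v t - frame_id) w + act q v"
        by (simp add: spray'_def Zeq[OF v t] w q_def act_simps act_frame_id)
      have "norm (act (P v t - frame_id) w + act q v) \<le> norm (P v t - frame_id) * norm w * c0 + norm q * norm v * c0"
        by (intro order_trans[OF norm_triangle_ineq] add_mono c0)
      also have "\<dots> \<le> r * norm w * c0 + (2 * norm w) * r * c0"
        using Pr q v r c0 by (intro add_mono mult_right_mono mult_mono) auto
      also have "\<dots> = (12 * (c0 * r)) * (norm w / 4)" by simp
      also have "\<dots> \<le> 1 * (norm w / 4)" by (rule mult_right_mono[OF rc0]) simp
      finally show "norm (fst (spray' c (Z v t) (\<zeta> v w t)) - w) \<le> 0 * norm (fst (\<zeta> v w t) - t *\<^sub>R w) + norm w / 4"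
        unfolding e by simp
    qed (use \<epsilon> in auto)
    then show ?thesis by (simp add: \<zeta>0[OF v]) (simp add: \<zeta>_def DX_def)
  qed
  have derX: "(X has_derivative DX v) (at v)" if v: "v \<in> ?B" for v
  proof (rule has_derivative_quadratic[where \<delta> = "r / 2 - norm v" and C = "8 * Q * \<epsilon>"])
    have "linear (DX v)"
      by (rule linearI) (simp_all add: DX_def \<theta>_def J_add[OF v] J_scale[OF v] act_simps)
    then show "bounded_linear (DX v)" using linear_conv_bounded_linear by blast
    show "0 < r / 2 - norm v" using v by simp
    fix h :: "complex ^ 'n" assume "norm h < r / 2 - norm v"
    then have vh: "v + h \<in> ?B" using norm_triangle_ineq[of v h] by simp
    have "norm (Z (v + h) \<epsilon> - Z v \<epsilon> - \<zeta> v h \<epsilon>) \<le> 8 * Q * \<epsilon> * (norm (Z (v + h) 0 - Z v 0))\<^sup>2"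
    proof (rule flow_variation[OF lip _ _ _ L(1) Q(1) _ \<epsilon>(2) Zb[OF v] Z'[OF v] Zb[OF vh] Z'[OF vh] _ \<zeta>'[OF v]])
      show "norm (spray' c x k) \<le> L * norm k" "linear (spray' c x)" if "x \<in> cball z0 r" for x k
        using L(2)[OF that, of k] der[OF that] has_derivative_linear[OF spray_has_derivative[OF c in_dm[OF that]]] by simp_all
      show "norm (spray c b - spray c a - spray' c a (b - a)) \<le> Q * (norm (b - a))\<^sup>2"
        if "a \<in> cball z0 r" "b \<in> cball z0 r" for a b using Q(2)[OF that] der[OF that(1)] by simp
      show "\<zeta> v h 0 = Z (v + h) 0 - Z v 0" by (simp add: \<zeta>0[OF v] Z0[OF v] Z0[OF vh] zero_prod_def)
    qed (use \<epsilon> in auto)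
    moreover have "norm (Z (v + h) 0 - Z v 0) = norm h" by (simp add: Z0[OF v] Z0[OF vh] norm_Pair)
    moreover have "X (v + h) - X v - DX v h = fst (Z (v + h) \<epsilon> - Z v \<epsilon> - \<zeta> v h \<epsilon>)"
      by (simp add: X_def y_def \<zeta>_def DX_def)
    ultimately show "norm (X (v + h) - X v - DX v h) \<le> 8 * Q * \<epsilon> * (norm h)\<^sup>2"
      using nf[of "Z (v + h) \<epsilon> - Z v \<epsilon> - \<zeta> v h \<epsilon>"] by simp
  qed
  obtain s where s: "open (X ` ?B)" "inj_on X ?B" "\<And>v. v \<in> ?B \<Longrightarrow> s (X v) = X (- v)" "\<And>v. v \<in> ?B \<Longrightarrow> surj (DX v)"
    "\<And>v. v \<in> ?B \<Longrightarrow> \<exists>D'. (s has_derivative D') (at (X v)) \<and> (\<forall>w. D' (DX v w) = DX (- v) (- w))"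
    by (rule point_reflection[where X = X and DX = DX and \<epsilon> = \<epsilon> and \<rho> = "r / 2", OF \<epsilon>(1) derX close]) (assumption, assumption, rule that)
  have B0: "0 \<in> ?B" using r by simp
  have X0: "X 0 = p"
    using const[where f = "y 0" and t = \<epsilon>] y'[OF B0] y0[OF B0] zI by (simp add: X_def act_simps)
  show ?thesis
  proof (rule that[of "X ` ?B" s])
    show "p \<in> X ` ?B" using B0 X0 by (metis imageI)
    show "X ` ?B \<subseteq> dm c" using ydm[OF _ zI(2)] by (auto simp: X_def)
    fix x assume "x \<in> X ` ?B"
    then obtain v where v: "v \<in> ?B" "x = X v" by blast
    have "X (- v) = X v \<longleftrightarrow> v = 0"
    proof
      assume "X (- v) = X v"
      then have "- v = v" using inj_onD[OF s(2)] v(1) neg by blast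
      then have "2 *\<^sub>R v = 0" by (metis scaleR_2 ab_left_minus)
      then show "v = 0" by simp
    qed simp
    moreover have "X v = p \<longleftrightarrow> v = 0" using inj_onD[OF s(2), of v 0] v(1) B0 X0 by auto
    ultimately show "s x \<in> X ` ?B \<and> s (s x) = x \<and> (s x = x \<longleftrightarrow> x = p)"
      using v neg[OF v(1)] s(3)[OF v(1)] s(3)[OF neg[OF v(1)]] by auto
    obtain D' where D': "(s has_derivative D') (at (X v))" "\<And>w. D' (DX v w) = DX (- v) (- w)"
      using s(5)[OF v(1)] by blast
    have \<theta>_neg: "\<theta> (- v) (- w) \<epsilon> = - \<theta> v w \<epsilon>" for w using J_neg[OF v(1), of w] by (simp add: \<theta>_def)
    \<comment> \<open>Transport preserves the metric and is therefore injective, so a vector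
      determines its components in the frame; these are odd in the pair \<open>v\<close>,
      \<open>w\<close>.\<close>
    have D'_eq: "D' (act (P v \<epsilon>) a) = - act (P (- v) \<epsilon>) a" if "act (P v \<epsilon>) a = DX v w" for a w
    proof -
      have "act (P v \<epsilon>) (a - \<theta> v w \<epsilon>) = 0" using that by (simp add: DX_def act_simps)
      then have "G c p (a - \<theta> v w \<epsilon>) (a - \<theta> v w \<epsilon>) = 0"
        using metric[OF v(1) zI(2), of "a - \<theta> v w \<epsilon>" "a - \<theta> v w \<epsilon>"]
        by (simp add: bilinear_lzero[OF bilinear_G[OF c ydm[OF v(1) zI(2)]]])
      then have "a = \<theta> v w \<epsilon>" using G_pos[OF c p, of "a - \<theta> v w \<epsilon>"] by force
      then show ?thesis using D'(2)[of w] by (simp add: DX_def \<theta>_neg act_simps)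
    qed
    have D'_act: "D' (act (P v \<epsilon>) a) = - act (P (- v) \<epsilon>) a" for a
      using s(4)[OF v(1)] D'_eq by (metis surjD)
    have ex: "\<exists>a. u = act (P v \<epsilon>) a" for u using s(4)[OF v(1)] by (metis surjD DX_def)
    have "D' (z *s u) = z *s D' u" for z u
      using ex[of u] D'_act by (metis act_scale vector_scale_minus(2))
    moreover have "G c (s (X v)) (D' u) (D' w) = G c (X v) u w" for u w
    proof -
      obtain a b where ab: "u = act (P v \<epsilon>) a" "w = act (P v \<epsilon>) b" using ex by blast
      note n = bilinear_lneg[OF bilinear_G[OF c ydm[OF neg[OF v(1)] zI(2)]]]
        bilinear_rneg[OF bilinear_G[OF c ydm[OF neg[OF v(1)] zI(2)]]]
      show ?thesis
        unfolding ab D'_act s(3)[OF v(1)] unfolding X_def n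
        using metric[OF v(1) zI(2), of a b] metric[OF neg[OF v(1)] zI(2), of a b] by simp
    qed
    ultimately show "\<exists>D'. (s has_derivative D') (at x) \<and> (\<forall>z v. D' (z *s v) = z *s D' v) \<and>
       (\<forall>u v. G c (s x) (D' u) (D' v) = G c x u v)"
      using D'(1) v(2) by blast
  qed (rule s)
qed

end

subsection \<open>Vanishing of parallel tensors\<close>

text \<open>The sum of the squares of all components satisfies a scalar linear differential
  inequality, to which \<open>linear_ode_zero\<close> applies.\<close>

lemma ode_system_zero:
  fixes f :: "'i \<Rightarrow> real \<Rightarrow> 'a::real_inner"
  assumes I: "finite I" and K: "0 \<le> K"
    and der: "\<And>i t. i \<in> I \<Longrightarrow> t \<in> {0..\<epsilon>} \<Longrightarrow> (f i has_vector_derivative f' i t) (at t within {0..\<epsilon>})"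
    and bnd: "\<And>i t. i \<in> I \<Longrightarrow> t \<in> {0..\<epsilon>} \<Longrightarrow> norm (f' i t) \<le> K * (\<Sum>j\<in>I. norm (f j t))"
    and f0: "\<And>i. i \<in> I \<Longrightarrow> f i 0 = 0" and i: "i \<in> I" and t: "t \<in> {0..\<epsilon>}"
  shows "f i t = 0"
proof -
  let ?N = "\<lambda>t. \<Sum>i\<in>I. f i t \<bullet> f i t" and ?S = "\<lambda>t. \<Sum>j\<in>I. norm (f j t)"
  have "?N t = 0"
  proof (rule linear_ode_zero[where u = ?N and u' = "\<lambda>t. \<Sum>i\<in>I. 2 * (f i t \<bullet> f' i t)"
        and L = "2 * K * card I"])
    fix t assume t: "t \<in> {0..\<epsilon>}"
    have "((\<lambda>t. f i t \<bullet> f i t) has_vector_derivative 2 * (f i t \<bullet> f' i t)) (at t within {0..\<epsilon>})" if "i \<in> I" for i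
      by (rule has_vector_derivative_eq_rhs[OF bounded_bilinear.has_vector_derivative[OF bounded_bilinear_inner
            der[OF that t] der[OF that t]]]) (simp add: inner_commute)
    then show "(?N has_vector_derivative (\<Sum>i\<in>I. 2 * (f i t \<bullet> f' i t))) (at t within {0..\<epsilon>})"
      by (intro has_vector_derivative_sum)
    have "norm (\<Sum>i\<in>I. 2 * (f i t \<bullet> f' i t)) \<le> (\<Sum>i\<in>I. 2 * (norm (f i t) * (K * ?S t)))"
    proof (rule order_trans[OF norm_sum sum_mono])
      fix i assume i: "i \<in> I"
      have "\<bar>f i t \<bullet> f' i t\<bar> \<le> norm (f i t) * norm (f' i t)" by (rule Cauchy_Schwarz_ineq2)
      also have "\<dots> \<le> norm (f i t) * (K * ?S t)" by (rule mult_left_mono[OF bnd[OF i t]]) simp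
      finally show "norm (2 * (f i t \<bullet> f' i t)) \<le> 2 * (norm (f i t) * (K * ?S t))" by (simp add: abs_mult)
    qed
    also have "\<dots> = 2 * K * (?S t)\<^sup>2"
      by (simp add: sum_distrib_left[symmetric] sum_distrib_right[symmetric] power2_eq_square mult_ac)
    also have "\<dots> \<le> 2 * K * ((\<Sum>j\<in>I. (norm (f j t))\<^sup>2) * card I)"
      by (rule mult_left_mono[OF sum_squared_le_sum_of_squares]) (use K in simp)
    also have "\<dots> = 2 * K * card I * norm (?N t)"
      by (simp add: dot_square_norm sum_nonneg)
    finally show "norm (\<Sum>i\<in>I. 2 * (f i t \<bullet> f' i t)) \<le> 2 * K * card I * norm (?N t)" .
  qed (use f0 t in auto)
  then have "f i t \<bullet> f i t = 0" using I i by (subst (asm) sum_nonneg_eq_0_iff) auto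
  then show ?thesis by simp
qed

lemma linear_norm_basis_le:
  fixes h :: "'a::euclidean_space \<Rightarrow> 'b::real_normed_vector" and K S :: real
  assumes "linear h" "\<And>e. e \<in> Basis \<Longrightarrow> norm (h e) \<le> S" "norm v \<le> K"
  shows "norm (h v) \<le> DIM('a) * K * S"
proof -
  have "norm (h v) = norm (\<Sum>e\<in>Basis. (v \<bullet> e) *\<^sub>R h e)" using linear_basis_expansion[OF assms(1), of v] by simp
  also have "\<dots> \<le> (\<Sum>e\<in>(Basis :: 'a set). K * S)"
  proof (rule order_trans[OF norm_sum sum_mono])
    fix e :: 'a assume e: "e \<in> Basis"
    have "\<bar>v \<bullet> e\<bar> * norm (h e) \<le> K * S"
      using Basis_le_norm[OF e, of v] assms(2)[OF e] assms(3) order_trans[OF norm_ge_zero assms(3)]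
      by (intro mult_mono) auto
    then show "norm ((v \<bullet> e) *\<^sub>R h e) \<le> K * S" by simp
  qed
  finally show ?thesis by simp
qed

context cmanifold
begin

lemma trans_derivative_inverse:
  assumes "c \<in> A" "d \<in> A" "x \<in> tdom c d"
  shows "frechet_derivative (trn d c) (at (trn c d x)) (frechet_derivative (trn c d) (at x) u) = u"
proof -
  have "((\<lambda>y. trn d c (trn c d y)) has_derivative
     (\<lambda>u. frechet_derivative (trn d c) (at (trn c d x)) (frechet_derivative (trn c d) (at x) u))) (at x)"
    by (rule has_derivative_compose[where f = "trn c d" and g = "trn d c", OF trans_derivative(1)[OF assms]
          trans_derivative(1)[OF assms(2,1) trans_in[OF assms]]])
  moreover have "((\<lambda>y. trn d c (trn c d y)) has_derivative (\<lambda>u. u)) (at x)"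
    by (rule has_derivative_transform_within_open[OF has_derivative_ident open_tdom[OF assms(1,2)] assms(3)])
      (simp add: trans_trans[OF assms(1,2)])
  ultimately show ?thesis using has_derivative_unique fun_cong by metis
qed

lemma trans_derivative_surj:
  assumes "c \<in> A" "d \<in> A" "x \<in> tdom c d"
  obtains u where "v = frechet_derivative (trn c d) (at x) u"
  using trans_derivative_inverse[OF assms(2,1) trans_in[OF assms], of v] trans_trans[OF assms] that by metis

text \<open>Compatibility with transition maps makes the sets of points with \<open>Q\<close> and
  without \<open>Q\<close> disjoint although they are described in charts. Both are open, so one of
  them is empty by connectedness.\<close>

lemma chart_property_dichotomy:
  assumes conn: "connected (UNIV :: 'm set)"
    and tr: "\<And>c d x. c \<in> A \<Longrightarrow> d \<in> A \<Longrightarrow> x \<in> tdom c d \<Longrightarrow> Q c x \<Longrightarrow> Q d (trn c d x)"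
    and op: "\<And>c x. c \<in> A \<Longrightarrow> x \<in> dm c \<Longrightarrow> Q c x \<Longrightarrow> \<exists>T. open T \<and> x \<in> T \<and> T \<subseteq> dm c \<and> (\<forall>y\<in>T. Q c y)"
    and cl: "\<And>c x. c \<in> A \<Longrightarrow> x \<in> dm c \<Longrightarrow> \<not> Q c x \<Longrightarrow> \<exists>T. open T \<and> x \<in> T \<and> T \<subseteq> dm c \<and> (\<forall>y\<in>T. \<not> Q c y)"
  shows "(\<forall>c\<in>A. \<forall>x\<in>dm c. Q c x) \<or> (\<forall>c\<in>A. \<forall>x\<in>dm c. \<not> Q c x)"
proof -
  define S where "S P = {p. \<exists>c\<in>A. \<exists>x\<in>dm c. pt c x = p \<and> P c x}" for P
  have opn: "open (S P)" if P: "\<And>c x. c \<in> A \<Longrightarrow> x \<in> dm c \<Longrightarrow> P c x \<Longrightarrow>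
      \<exists>T. open T \<and> x \<in> T \<and> T \<subseteq> dm c \<and> (\<forall>y\<in>T. P c y)" for P
    unfolding open_subopen[of "S P"]
  proof
    fix p assume "p \<in> S P"
    then obtain c x where c: "c \<in> A" "x \<in> dm c" "pt c x = p" "P c x" by (auto simp: S_def)
    obtain T where T: "open T" "x \<in> T" "T \<subseteq> dm c" "\<forall>y\<in>T. P c y" using P[OF c(1,2,4)] by blast
    show "\<exists>T. open T \<and> p \<in> T \<and> T \<subseteq> S P"
      using open_pt_image[OF c(1) T(1,3)] T c by (intro exI[of _ "pt c ` T"]) (auto simp: S_def)
  qed
  have 1: "S Q \<union> S (\<lambda>c x. \<not> Q c x) = UNIV"
  proof -
    have "p \<in> S Q \<union> S (\<lambda>c x. \<not> Q c x)" for p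
    proof -
      obtain c where c: "c \<in> A" "p \<in> fst c" by (rule chart_ex)
      show ?thesis using c snd_in[OF c] pt_snd[OF c] by (auto simp: S_def)
    qed
    then show ?thesis by blast
  qed
  have 2: "S Q \<inter> S (\<lambda>c x. \<not> Q c x) = {}"
  proof -
    have False if a: "c \<in> A" "x \<in> dm c" "Q c x" and b: "d \<in> A" "y \<in> dm d" "\<not> Q d y" and e: "pt c x = pt d y" for c x d y
    proof -
      have "x \<in> tdom c d" using a b e pt_in[OF b(1,2)] by (simp add: tdom_def)
      moreover have "trn c d x = y" using e snd_pt[OF b(1,2)] by (simp add: trn_def)
      ultimately show False using tr[OF a(1) b(1) _ a(3)] b(3) by blast
    qed
    then show ?thesis by (force simp: S_def)
  qed
  have "S Q = {} \<or> S (\<lambda>c x. \<not> Q c x) = {}"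
    using connectedD[OF conn opn[of Q] opn[of "\<lambda>c x. \<not> Q c x"]] op cl 1 2 by auto
  then show ?thesis by (auto simp: S_def)
qed

end

context chern_manifold
begin

lemma Tor_simps:
  assumes "c \<in> A" "x \<in> dm c"
  shows "linear (Tor c x u)" "linear (\<lambda>u. Tor c x u v)"
  by (auto intro!: linearI simp: Tor_def Gam_simps[OF assms] algebra_simps)

lemma Tor_smooth: "c \<in> A \<Longrightarrow> smooth_on (dm c) (\<lambda>x. Tor c x u v)"
  unfolding Tor_def by (intro smooth_on_diff Gam_smooth open_dm)

lemma Rm_trn:
  assumes "c \<in> A" "d \<in> A" "x \<in> tdom c d"
  defines "L \<equiv> frechet_derivative (trn c d) (at x)"
  shows "Rm d (trn c d x) (L u) (L v) (L w) = L (Rm c x u v w)"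
proof -
  have x: "x \<in> dm c" using assms(3) by (simp add: tdom_def)
  have y: "trn c d x \<in> dm d" using trans_in[OF assms(1-3)] by (simp add: tdom_def)
  obtain X where X: "cf c x u X" by (rule cf_ex[OF assms(1) x])
  obtain Y where Y: "cf c x v Y" by (rule cf_ex[OF assms(1) x])
  obtain Z where Z: "cf c x w Z" by (rule cf_ex[OF assms(1) x])
  note vs = cf_vf[OF X] cf_vf[OF Y] cf_vf[OF Z]
  show ?thesis
    using rep_curvature[OF assms(2) y vs] rep_curvature[OF assms(1) x vs]
    by (simp add: rep_trn[OF assms(1-3)] vs vf_curvature L_def cf_rep[OF X] cf_rep[OF Y] cf_rep[OF Z])
qed

lemma trans_derivative_zero:
  assumes "c \<in> A" "d \<in> A" "x \<in> tdom c d"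
  shows "frechet_derivative (trn c d) (at x) 0 = 0"
  by (rule linear_0[OF has_derivative_linear[OF trans_derivative(1)[OF assms]]])

lemma segment_bound:
  assumes c: "c \<in> A" and r: "cball x0 r \<subseteq> dm c" and x: "x \<in> cball x0 r"
  obtains K where "K \<ge> 0" "\<And>t. t \<in> {0..1} \<Longrightarrow> x0 + t *\<^sub>R (x - x0) \<in> dm c"
    "\<And>t q. t \<in> {0..1} \<Longrightarrow> norm (Gam c (x0 + t *\<^sub>R (x - x0)) (x - x0) q) \<le> K * norm q"
proof -
  have seg: "x0 + t *\<^sub>R (x - x0) \<in> dm c" if "t \<in> {0..1}" for t
  proof -
    have "dist x0 (x0 + t *\<^sub>R (x - x0)) = \<bar>t\<bar> * dist x0 x" by (simp add: dist_norm norm_minus_commute)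
    also have "\<dots> \<le> 1 * dist x0 x" using that by (intro mult_right_mono) auto
    finally show ?thesis using r x by auto
  qed
  have "continuous_on {0..1} (\<lambda>t. Gam c (x0 + t *\<^sub>R (x - x0)) (x - x0) b)" for b
    by (rule continuous_on_compose2[OF smooth_on_continuous[OF Gam_smooth[OF c]]])
      (use seg in \<open>auto intro!: continuous_intros\<close>)
  then obtain K where K: "K \<ge> 0" "\<And>t q. t \<in> {0..1} \<Longrightarrow> norm (Gam c (x0 + t *\<^sub>R (x - x0)) (x - x0) q) \<le> K * norm q"
    by (rule linear_family_bound[OF compact_Icc, of 0 1 "\<lambda>t. Gam c (x0 + t *\<^sub>R (x - x0)) (x - x0)"])
      (use bilinear_Gam[OF c seg] in \<open>auto simp: bilinear_def\<close>)
  show ?thesis by (rule that[OF K(1) seg K(2)])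
qed

lemma segment_vector_derivative:
  fixes B :: "complex ^ 'n \<Rightarrow> complex ^ 'n"
  assumes "(B has_derivative B') (at (x0 + t *\<^sub>R w))"
  shows "((\<lambda>t. B (x0 + t *\<^sub>R w)) has_vector_derivative B' w) (at t within S)"
proof -
  have "((\<lambda>t. x0 + t *\<^sub>R w) has_derivative (\<lambda>h. h *\<^sub>R w)) (at t within S)"
    by (auto intro!: derivative_eq_intros)
  from has_derivative_compose[where f = "\<lambda>t. x0 + t *\<^sub>R w" and g = B, OF this assms] show ?thesis
    unfolding has_vector_derivative_def by (simp add: linear_scale[OF has_derivative_linear[OF assms]])
qed

text \<open>Along the segment from \<open>x0\<close> the basis components of the parallel torsion
  solve a homogeneous linear system with initial value 0.\<close>

lemma Tor_zero_ball:
  assumes c: "c \<in> A" and r: "cball x0 r \<subseteq> dm c" and 0: "\<And>u v. Tor c x0 u v = 0" and x: "x \<in> cball x0 r"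
  shows "Tor c x u v = 0"
proof -
  let ?w = "x - x0" and ?y = "\<lambda>t. x0 + t *\<^sub>R (x - x0)" and ?I = "(Basis :: (complex ^ 'n) set) \<times> (Basis :: (complex ^ 'n) set)"
  obtain K where K: "K \<ge> 0" "\<And>t. t \<in> {0..1} \<Longrightarrow> ?y t \<in> dm c"
    "\<And>t q. t \<in> {0..1} \<Longrightarrow> norm (Gam c (?y t) ?w q) \<le> K * norm q"
    by (rule segment_bound[OF c r x]) (rule that)
  define C where "C = real DIM(complex ^ 'n) * K"
  have Tb: "Tor c (?y 1) a b = 0" if ab: "a \<in> Basis" "b \<in> Basis" for a b
  proof -
    have "(\<lambda>(a, b) t. Tor c (?y t) a b) (a, b) 1 = 0"
    proof (rule ode_system_zero[where I = ?I and K = "2 * C + K" and \<epsilon> = 1 and f = "\<lambda>(a, b) t. Tor c (?y t) a b"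
        and f' = "\<lambda>(a, b) t. Tor c (?y t) (Gam c (?y t) ?w a) b + Tor c (?y t) a (Gam c (?y t) ?w b)
          - Gam c (?y t) ?w (Tor c (?y t) a b)"])
      show "finite ?I" by simp
      show "0 \<le> 2 * C + K" using K(1) by (simp add: C_def)
      show "(a, b) \<in> ?I" using ab by simp
    next
      fix i and t :: real assume i: "i \<in> ?I" and t: "t \<in> {0..1}"
      obtain a b where [simp]: "i = (a, b)" and ab: "a \<in> Basis" "b \<in> Basis" using i by auto
      show "((\<lambda>(a, b) t. Tor c (?y t) a b) i has_vector_derivative (\<lambda>(a, b) t. Tor c (?y t) (Gam c (?y t) ?w a) b
          + Tor c (?y t) a (Gam c (?y t) ?w b) - Gam c (?y t) ?w (Tor c (?y t) a b)) i t) (at t within {0..1})"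
        using segment_vector_derivative[OF Tor_has_derivative[OF c K(2)[OF t], of a b]] by simp
      let ?S = "\<Sum>j\<in>?I. norm ((\<lambda>(a, b) t. Tor c (?y t) a b) j t)"
      have S: "norm (Tor c (?y t) e f) \<le> ?S" if "e \<in> Basis" "f \<in> Basis" for e f
        using member_le_sum[of "(e, f)" ?I "\<lambda>j. norm ((\<lambda>(a, b) t. Tor c (?y t) a b) j t)"] that by simp
      have n: "norm (Gam c (?y t) ?w e) \<le> K" if "e \<in> Basis" for e using K(3)[OF t, of e] that by simp
      have "norm (Tor c (?y t) (Gam c (?y t) ?w a) b) \<le> C * ?S"
        unfolding C_def by (rule linear_norm_basis_le[OF Tor_simps(2)[OF c K(2)[OF t]]]) (auto intro: S n ab)
      moreover have "norm (Tor c (?y t) a (Gam c (?y t) ?w b)) \<le> C * ?S"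
        unfolding C_def by (rule linear_norm_basis_le[OF Tor_simps(1)[OF c K(2)[OF t]]]) (auto intro: S n ab)
      moreover have "norm (Gam c (?y t) ?w (Tor c (?y t) a b)) \<le> K * ?S"
        by (rule order_trans[OF K(3)[OF t] mult_left_mono[OF S[OF ab] K(1)]])
      ultimately have "norm (Tor c (?y t) (Gam c (?y t) ?w a) b + Tor c (?y t) a (Gam c (?y t) ?w b)
          - Gam c (?y t) ?w (Tor c (?y t) a b)) \<le> C * ?S + C * ?S + K * ?S"
        using norm_triangle_ineq4[of "Tor c (?y t) (Gam c (?y t) ?w a) b + Tor c (?y t) a (Gam c (?y t) ?w b)"
            "Gam c (?y t) ?w (Tor c (?y t) a b)"]
          norm_triangle_ineq[of "Tor c (?y t) (Gam c (?y t) ?w a) b" "Tor c (?y t) a (Gam c (?y t) ?w b)"] by linarith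
      then show "norm ((\<lambda>(a, b) t. Tor c (?y t) (Gam c (?y t) ?w a) b + Tor c (?y t) a (Gam c (?y t) ?w b)
          - Gam c (?y t) ?w (Tor c (?y t) a b)) i t) \<le> (2 * C + K) * ?S" by (simp add: algebra_simps)
    next
      fix i :: "(complex ^ 'n) \<times> (complex ^ 'n)"
      show "(\<lambda>(a, b) t. Tor c (?y t) a b) i 0 = 0" by (cases i) (simp add: 0)
    qed simp
    then show ?thesis by simp
  qed
  have x1: "?y 1 \<in> dm c" by (rule K(2)) simp
  have "Tor c (?y 1) u v = 0"
    using linear_basis_expansion[OF Tor_simps(2)[OF c x1], of u v] Tb
      linear_basis_expansion[OF Tor_simps(1)[OF c x1], of _ v] by simp
  then show ?thesis by simp
qed

lemma Rm_linear:
  assumes "c \<in> A" "x \<in> dm c"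
  shows "linear (\<lambda>u. Rm c x u v w)" "linear (\<lambda>v. Rm c x u v w)"
  using Rm_simps(1)[OF assms] by (simp_all add: bilinear_def)

lemma Rm_smooth: "c \<in> A \<Longrightarrow> smooth_on (dm c) (\<lambda>x. Rm c x u v w)"
  unfolding Rm_def dGam_def
  by (intro smooth_on_add smooth_on_diff smooth_on_deriv Gam_smooth open_dm
      smooth_on_bilinear_family[where B = "Gam c" and \<kappa> = "\<lambda>x. x" and U = "dm c"] smooth_on_const smooth_on_id bilinear_Gam)

lemma Rm_zero_ball:
  assumes c: "c \<in> A" and r: "cball x0 r \<subseteq> dm c" and 0: "\<And>u v w. Rm c x0 u v w = 0" and x: "x \<in> cball x0 r"
  shows "Rm c x u v w = 0"
proof -
  let ?w = "x - x0" and ?y = "\<lambda>t. x0 + t *\<^sub>R (x - x0)" and ?B = "Basis :: (complex ^ 'n) set"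
  let ?I = "?B \<times> ?B \<times> ?B"
  obtain K where K: "K \<ge> 0" "\<And>t. t \<in> {0..1} \<Longrightarrow> ?y t \<in> dm c"
    "\<And>t q. t \<in> {0..1} \<Longrightarrow> norm (Gam c (?y t) ?w q) \<le> K * norm q"
    by (rule segment_bound[OF c r x]) (rule that)
  define C where "C = real DIM(complex ^ 'n) * K"
  let ?d = "\<lambda>(a, b, e) t. Rm c (?y t) (Gam c (?y t) ?w a) b e + Rm c (?y t) a (Gam c (?y t) ?w b) e
      + Rm c (?y t) a b (Gam c (?y t) ?w e) - Gam c (?y t) ?w (Rm c (?y t) a b e)"
  let ?f = "\<lambda>(a, b, e) t. Rm c (?y t) a b e"
  have Rb: "Rm c (?y 1) a b e = 0" if abe: "a \<in> Basis" "b \<in> Basis" "e \<in> Basis" for a b e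
  proof -
    have "?f (a, b, e) 1 = 0"
    proof (rule ode_system_zero[where I = ?I and K = "3 * C + K" and \<epsilon> = 1 and f = ?f and f' = ?d])
      show "finite ?I" by simp
      show "0 \<le> 3 * C + K" using K(1) by (simp add: C_def)
      show "(a, b, e) \<in> ?I" using abe by simp
    next
      fix i and t :: real assume i: "i \<in> ?I" and t: "t \<in> {0..1}"
      obtain a b e where [simp]: "i = (a, b, e)" and ab: "a \<in> Basis" "b \<in> Basis" "e \<in> Basis" using i by auto
      show "(?f i has_vector_derivative ?d i t) (at t within {0..1})"
        using segment_vector_derivative[OF Rm_has_derivative[OF c K(2)[OF t], of a b e]] by simp
      let ?S = "\<Sum>j\<in>?I. norm (?f j t)"
      have S: "norm (Rm c (?y t) a' b' e') \<le> ?S" if "a' \<in> Basis" "b' \<in> Basis" "e' \<in> Basis" for a' b' e'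
        using member_le_sum[of "(a', b', e')" ?I "\<lambda>j. norm (?f j t)"] that by simp
      have n: "norm (Gam c (?y t) ?w e) \<le> K" if "e \<in> Basis" for e using K(3)[OF t, of e] that by simp
      let ?X = "Rm c (?y t) (Gam c (?y t) ?w a) b e" and ?Y = "Rm c (?y t) a (Gam c (?y t) ?w b) e"
        and ?Z = "Rm c (?y t) a b (Gam c (?y t) ?w e)" and ?W = "Gam c (?y t) ?w (Rm c (?y t) a b e)"
      have "norm ?X \<le> C * ?S"
        unfolding C_def by (rule linear_norm_basis_le[OF Rm_linear(1)[OF c K(2)[OF t]]]) (auto intro: S n ab)
      moreover have "norm ?Y \<le> C * ?S"
        unfolding C_def by (rule linear_norm_basis_le[OF Rm_linear(2)[OF c K(2)[OF t]]]) (auto intro: S n ab)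
      moreover have "norm ?Z \<le> C * ?S"
        unfolding C_def by (rule linear_norm_basis_le[OF Rm_simps(2)[OF c K(2)[OF t]]]) (auto intro: S n ab)
      moreover have "norm ?W \<le> K * ?S"
        by (rule order_trans[OF K(3)[OF t] mult_left_mono[OF S[OF ab] K(1)]])
      ultimately have "norm (?X + ?Y + ?Z - ?W) \<le> C * ?S + C * ?S + C * ?S + K * ?S"
        using norm_triangle_ineq4[of "?X + ?Y + ?Z" ?W] norm_triangle_ineq[of "?X + ?Y" ?Z] norm_triangle_ineq[of ?X ?Y]
        by linarith
      then show "norm (?d i t) \<le> (3 * C + K) * ?S" by (simp add: algebra_simps)
    next
      fix i :: "(complex ^ 'n) \<times> (complex ^ 'n) \<times> (complex ^ 'n)"
      show "?f i 0 = 0" by (cases i) (simp add: 0)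
    qed simp
    then show ?thesis by simp
  qed
  have x1: "?y 1 \<in> dm c" by (rule K(2)) simp
  have "Rm c (?y 1) u v w = 0"
    using linear_basis_expansion[OF Rm_linear(1)[OF c x1], of u v w] Rb
      linear_basis_expansion[OF Rm_linear(2)[OF c x1], of _ v w]
      linear_basis_expansion[OF Rm_simps(2)[OF c x1], of _ _ w] by simp
  then show ?thesis by simp
qed

lemma ball_neighbourhood:
  assumes "c \<in> A" "x \<in> dm c" "\<And>r y. cball x r \<subseteq> dm c \<Longrightarrow> y \<in> cball x r \<Longrightarrow> P y"
  shows "\<exists>T. open T \<and> x \<in> T \<and> T \<subseteq> dm c \<and> (\<forall>y\<in>T. P y)"
proof -
  obtain r where r: "r > 0" "cball x r \<subseteq> dm c"
    using open_dm[OF assms(1)] assms(2) open_contains_cball by blast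
  show ?thesis
    using r assms(3)[OF r(2)] ball_subset_cball[of x r] by (intro exI[of _ "ball x r"]) auto
qed

lemma nonzero_neighbourhood:
  assumes "c \<in> A" "x \<in> dm c" "smooth_on (dm c) f" "f x \<noteq> 0"
  shows "\<exists>T. open T \<and> x \<in> T \<and> T \<subseteq> dm c \<and> (\<forall>y\<in>T. f y \<noteq> 0)"
proof (intro exI conjI)
  show "open {y \<in> dm c. f y \<in> - {0}}"
    using continuous_open_preimage[OF smooth_on_continuous[OF assms(3)] open_dm[OF assms(1)], of "- {0}"]
    by (simp add: vimage_def Int_def open_Compl)
qed (use assms in auto)

lemma connected_manifold: "connected (UNIV :: 'm set)"
  using herm unfolding hermitian_manifold_def by blast

text \<open>Vanishing spreads to balls by parallelism, non-vanishing to neighbourhoods by continuity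
  of a single component.\<close>

lemma torsion_dichotomy:
  "(\<forall>c\<in>A. \<forall>x\<in>dm c. \<forall>u v. Tor c x u v = 0) \<or> (\<forall>c\<in>A. \<forall>x\<in>dm c. \<not> (\<forall>u v. Tor c x u v = 0))"
proof (rule chart_property_dichotomy[OF connected_manifold])
  fix c d x assume a: "c \<in> A" "d \<in> A" "x \<in> tdom c d" "\<forall>u v. Tor c x u v = 0"
  show "\<forall>u v. Tor d (trn c d x) u v = 0"
  proof (intro allI)
    fix u v
    obtain u' v' where "u = frechet_derivative (trn c d) (at x) u'" "v = frechet_derivative (trn c d) (at x) v'"
      by (metis trans_derivative_surj[OF a(1-3)])
    then show "Tor d (trn c d x) u v = 0"
      using Tor_trn[OF a(1-3), of u' v'] a(4) trans_derivative_zero[OF a(1-3)] by simp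
  qed
next
  fix c x assume a: "c \<in> A" "x \<in> dm c" "\<forall>u v. Tor c x u v = 0"
  show "\<exists>T. open T \<and> x \<in> T \<and> T \<subseteq> dm c \<and> (\<forall>y\<in>T. \<forall>u v. Tor c y u v = 0)"
    by (rule ball_neighbourhood[OF a(1,2)]) (use Tor_zero_ball[OF a(1)] a(3) in blast)
next
  fix c x assume a: "c \<in> A" "x \<in> dm c" "\<not> (\<forall>u v. Tor c x u v = 0)"
  then obtain u v where "Tor c x u v \<noteq> 0" by blast
  then show "\<exists>T. open T \<and> x \<in> T \<and> T \<subseteq> dm c \<and> (\<forall>y\<in>T. \<not> (\<forall>u v. Tor c y u v = 0))"
    using nonzero_neighbourhood[OF a(1,2) Tor_smooth[OF a(1)]] by meson
qed

lemma curvature_dichotomy: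
  "(\<forall>c\<in>A. \<forall>x\<in>dm c. \<forall>u v w. Rm c x u v w = 0) \<or> (\<forall>c\<in>A. \<forall>x\<in>dm c. \<not> (\<forall>u v w. Rm c x u v w = 0))"
proof (rule chart_property_dichotomy[OF connected_manifold])
  fix c d x assume a: "c \<in> A" "d \<in> A" "x \<in> tdom c d" "\<forall>u v w. Rm c x u v w = 0"
  show "\<forall>u v w. Rm d (trn c d x) u v w = 0"
  proof (intro allI)
    fix u v w
    obtain u' v' w' where "u = frechet_derivative (trn c d) (at x) u'" "v = frechet_derivative (trn c d) (at x) v'"
        "w = frechet_derivative (trn c d) (at x) w'"
      by (metis trans_derivative_surj[OF a(1-3)])
    then show "Rm d (trn c d x) u v w = 0"
      using Rm_trn[OF a(1-3), of u' v' w'] a(4) trans_derivative_zero[OF a(1-3)] by simp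
  qed
next
  fix c x assume a: "c \<in> A" "x \<in> dm c" "\<forall>u v w. Rm c x u v w = 0"
  show "\<exists>T. open T \<and> x \<in> T \<and> T \<subseteq> dm c \<and> (\<forall>y\<in>T. \<forall>u v w. Rm c y u v w = 0)"
    by (rule ball_neighbourhood[OF a(1,2)]) (use Rm_zero_ball[OF a(1)] a(3) in blast)
next
  fix c x assume a: "c \<in> A" "x \<in> dm c" "\<not> (\<forall>u v w. Rm c x u v w = 0)"
  then obtain u v w where "Rm c x u v w \<noteq> 0" by blast
  then show "\<exists>T. open T \<and> x \<in> T \<and> T \<subseteq> dm c \<and> (\<forall>y\<in>T. \<not> (\<forall>u v w. Rm c y u v w = 0))"
    using nonzero_neighbourhood[OF a(1,2) Rm_smooth[OF a(1)]] by meson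
qed

lemma flat_if_curvature_zero:
  assumes "\<And>c x u v w. c \<in> A \<Longrightarrow> x \<in> dm c \<Longrightarrow> Rm c x u v w = 0"
  shows "flat A D"
  unfolding flat_def
proof (intro allI impI)
  fix X Y Z assume v: "vf X" "vf Y" "vf Z"
  show "curvature D X Y Z = 0"
    by (rule vf_eqI[OF vf_curvature[OF v] vf_zero]) (simp add: rep_curvature v assms rep_zero)
qed

subsection \<open>The torsion-free case\<close>

context
  assumes tor: "\<And>c x u v. c \<in> A \<Longrightarrow> x \<in> dm c \<Longrightarrow> Tor c x u v = 0"
begin

text \<open>Without torsion the bracket is \<open>D X Y - D Y X\<close>, and metric and complex
  structure are parallel; the covariant derivatives in the cyclic sum then cancel by antisymmetry of
  the Kaehler form.\<close>

lemma kaehler_if_torsion_free: "kaehler A g"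
  unfolding kaehler_def
proof (intro allI impI, rule HOL.ext)
  fix X Y Z p assume v: "vf X" "vf Y" "vf Z"
  obtain c where c: "c \<in> A" "p \<in> fst c" by (rule chart_ex)
  define x where "x = snd c p"
  have x: "x \<in> dm c" and p: "p = pt c x" using snd_in[OF c] pt_snd[OF c] by (simp_all add: x_def)
  note bG = bilinear_G[OF c(1) x]
  let ?w = "\<lambda>a b. G c x (\<i> *s a) b"
  have anti: "?w a b = - ?w b a" for a b
    using G_i[OF c(1) x, of "\<i> *s a" b] G_sym[OF c(1) x, of a "\<i> *s b"]
    by (simp add: i_scale_i bilinear_lneg[OF bG])
  have kf: "kaehler_form A g X Y p = ?w (rep c X x) (rep c Y x)" if "vf X" "vf Y" for X Y
    unfolding kaehler_form_def p gfun_rep[OF c(1) x vf_J[OF that(1)] that(2)] rep_J[OF that(1) c(1) x] ..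
  have der: "vapply X (kaehler_form A g Y Z) p = ?w (rep c (D X Y) x) (rep c Z x) + ?w (rep c Y x) (rep c (D X Z) x)"
    if v: "vf X" "vf Y" "vf Z" for X Y Z
  proof -
    have "vapply X (kaehler_form A g Y Z) = gfun g (Jfield A (D X Y)) Z + gfun g (Jfield A Y) (D X Z)"
      unfolding kaehler_form_def[abs_def] D_J[OF v(1,2), symmetric] by (rule D_metric[OF v(1) vf_J[OF v(2)] v(3)])
    then show ?thesis
      using kf[OF D_vf[OF v(1,2)] v(3)] kf[OF v(2) D_vf[OF v(1,3)]] by (simp add: kaehler_form_def)
  qed
  have br: "rep c (lie_bracket X Y) x = rep c (D X Y) x - rep c (D Y X) x" if v: "vf X" "vf Y" for X Y
    using rep_torsion[OF c(1) x v] tor[OF c(1) x]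
    by (simp add: torsion_def rep_diff[OF c(1) x] vf_diff D_vf vf_bracket v)
  note bi = bilinear_lsub[OF bG]
  show "(vapply X (kaehler_form A g Y Z) + vapply Y (kaehler_form A g Z X) + vapply Z (kaehler_form A g X Y)
       - kaehler_form A g (lie_bracket X Y) Z - kaehler_form A g (lie_bracket Y Z) X
       - kaehler_form A g (lie_bracket Z X) Y) p = 0 p"
    using anti[of "rep c Y x" "rep c (D X Z) x"] anti[of "rep c Z x" "rep c (D Y X) x"]
      anti[of "rep c X x" "rep c (D Z Y) x"]
    by (simp add: der v kf vf_bracket br vector_scale_diff bi)
qed

lemma locally_symmetric_if_torsion_free: "locally_hermitian_symmetric A g"
  unfolding locally_hermitian_symmetric_def
proof
  fix p
  obtain c where c: "c \<in> A" "p \<in> fst c" by (rule chart_ex)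
  define x0 where "x0 = snd c p"
  have x0: "x0 \<in> dm c" and p: "pt c x0 = p" using snd_in[OF c] pt_snd[OF c] by (simp_all add: x0_def)
  obtain U s where U: "open U" "x0 \<in> U" "U \<subseteq> dm c"
    and s: "\<And>x. x \<in> U \<Longrightarrow> s x \<in> U \<and> s (s x) = x \<and> (s x = x \<longleftrightarrow> x = x0)"
    and sd: "\<And>x. x \<in> U \<Longrightarrow> \<exists>D'. (s has_derivative D') (at x) \<and> (\<forall>z v. D' (z *s v) = z *s D' v) \<and>
       (\<forall>u v. G c (s x) (D' u) (D' v) = G c x u v)"
    by (rule local_symmetry_in_chart[OF c(1) x0 tor[OF c(1)]]) (assumption, rule that)
  have sU: "s x \<in> U" "s x \<in> dm c" "x \<in> dm c" if "x \<in> U" for x using s[OF that] U(3) that by auto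
  define W where "W = pt c ` U"
  define \<sigma> where "\<sigma> q = pt c (s (snd c q))" for q
  have oW: "open W" unfolding W_def by (rule open_pt_image[OF c(1) U(1,3)])
  have W: "snd c q \<in> U" "q \<in> fst c" "q = pt c (snd c q)" if "q \<in> W" for q
    using that U(3) snd_pt[OF c(1)] pt_in[OF c(1)] by (auto simp: W_def)
  have \<sigma>: "\<sigma> (pt c x) = pt c (s x)" if "x \<in> U" for x using snd_pt[OF c(1) sU(3)[OF that]] by (simp add: \<sigma>_def)
  have s_smooth: "smooth_on U s"
  proof (rule cholomorphic_smooth[OF _ U(1)], unfold cholomorphic_on_def, rule ballI)
    show "\<exists>D. (s has_derivative D) (at z) \<and> (\<forall>c v. D (c *s v) = c *s D v)" if "z \<in> U" for z
      using sd[OF that] by blast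
  qed
  have inj: "pt c x = pt c y \<longleftrightarrow> x = y" if "x \<in> dm c" "y \<in> dm c" for x y
    using snd_pt[OF c(1) that(1)] snd_pt[OF c(1) that(2)] by metis
  \<comment> \<open>Identifies the differential, which is described through germs of global
    functions, with the derivative of \<open>s\<close> in the chart. It is unique because every
    composition of a global function with \<open>\<sigma>\<close> has a global representative of its
    germ.\<close>
  have diff: "differential_at A \<sigma> (pt c x) (coord_vec A c (pt c x) u) = coord_vec A c (pt c (s x)) (D' u)"
    if x: "x \<in> U" and D': "(s has_derivative D') (at x)" for x u D'
    unfolding differential_at_def \<sigma>[OF x]
  proof (rule the_equality)
    let ?P = "\<lambda>w. \<forall>f h. smooth_fun A f \<longrightarrow> smooth_fun A h \<longrightarrow>
      (\<forall>\<^sub>F y in nhds (pt c x). h y = f (\<sigma> y)) \<longrightarrow> w f = coord_vec A c (pt c x) u h"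
    note xd = sU(3)[OF x] and sxd = sU(2)[OF x]
    have P: "?P (coord_vec A c (pt c (s x)) (D' u))"
    proof (intro allI impI)
      fix f h assume f: "smooth_fun A f" and h: "smooth_fun A h" and ev: "\<forall>\<^sub>F y in nhds (pt c x). h y = f (\<sigma> y)"
      obtain N where N: "open N" "pt c x \<in> N" "\<And>y. y \<in> N \<Longrightarrow> h y = f (\<sigma> y)"
        using ev by (auto simp: eventually_nhds)
      have o: "open ({y \<in> dm c. pt c y \<in> N} \<inter> U)" by (intro open_Int open_pt_vimage[OF c(1) N(1)] U(1))
      have "((\<lambda>y. f (pt c (s y))) has_derivative (\<lambda>e. dd c f (s x) (D' e))) (at x)"
        by (rule has_derivative_compose[where f = s and g = "\<lambda>y. f (pt c y)", OF D' dd_has_derivative[OF f c(1) sxd]])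
      then have "((\<lambda>y. h (pt c y)) has_derivative (\<lambda>e. dd c f (s x) (D' e))) (at x)"
        by (rule has_derivative_transform_within_open[OF _ o]) (use N x xd \<sigma> in auto)
      then have "dd c h x = (\<lambda>e. dd c f (s x) (D' e))" by (rule dd_eqI)
      then show "coord_vec A c (pt c (s x)) (D' u) f = coord_vec A c (pt c x) u h"
        by (simp add: coord_vec_dd f h snd_pt[OF c(1) xd] snd_pt[OF c(1) sxd])
    qed
    then show "coord_vec A c (pt c (s x)) (D' u) \<in> tangent_space A (pt c (s x)) \<and> ?P (coord_vec A c (pt c (s x)) (D' u))"
      using coord_vec_tangent[OF c(1) pt_in[OF c(1) sxd]] by blast
    fix w assume w: "w \<in> tangent_space A (pt c (s x)) \<and> ?P w"
    show "w = coord_vec A c (pt c (s x)) (D' u)"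
    proof (rule HOL.ext)
      fix f
      show "w f = coord_vec A c (pt c (s x)) (D' u) f"
      proof (cases "smooth_fun A f")
        case True
        have "smooth_on U (\<lambda>y. f (pt c (s y)))"
          by (rule smooth_on_compose[OF U(1) open_dm[OF c(1)] s_smooth smooth_fun_chart[OF True c(1)] sU(2)])
        then obtain h r where h: "smooth_fun A h" "r > 0" "ball x r \<subseteq> U" "\<And>y. y \<in> ball x r \<Longrightarrow> h (pt c y) = f (pt c (s y))"
          by (rule germ_fun[OF c(1) U(1) x U(3)]) (rule that)
        have "open (pt c ` ball x r)" using open_pt_image[OF c(1) open_ball] h(3) U(3) by blast
        moreover have "h y = f (\<sigma> y)" if "y \<in> pt c ` ball x r" for y using that h(3,4) \<sigma> by auto
        ultimately have "\<forall>\<^sub>F y in nhds (pt c x). h y = f (\<sigma> y)"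
          using h(2) unfolding eventually_nhds by (intro exI[of _ "pt c ` ball x r"]) auto
        then show ?thesis using w P True h(1) by metis
      next
        case False
        then show ?thesis using tangent_not_smooth[OF conjunct1[OF w] False] by (simp add: coord_vec_def)
      qed
    qed
  qed
  have cont: "continuous_on W \<sigma>"
  proof -
    have "continuous_on W (\<lambda>q. s (snd c q))"
      by (rule continuous_on_compose2[OF smooth_on_continuous[OF s_smooth]
            continuous_on_subset[OF continuous_on_snd_chart[OF c(1)]]]) (use W in auto)
    then show ?thesis
      unfolding \<sigma>_def[abs_def] by (rule continuous_on_compose2[OF continuous_on_pt[OF c(1)]]) (use W sU in auto)
  qed
  have hol_charts: "cholomorphic_on (snd e \<circ> \<sigma> \<circ> inv_into (fst d) (snd d)) (snd d ` {q \<in> fst d \<inter> W. \<sigma> q \<in> fst e})"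
    if de: "d \<in> A" "e \<in> A" for d e
  proof -
    have "cholomorphic_on (\<lambda>z. trn c e (s (trn d c z))) (snd d ` {q \<in> fst d \<inter> W. \<sigma> q \<in> fst e})"
      unfolding cholomorphic_on_def
    proof
      fix z assume "z \<in> snd d ` {q \<in> fst d \<inter> W. \<sigma> q \<in> fst e}"
      then obtain q where q: "z = snd d q" "q \<in> fst d" "q \<in> W" "\<sigma> q \<in> fst e" by blast
      have z: "z \<in> tdom d c" using q W(2)[OF q(3)] by (simp add: tdom_def snd_in[OF de(1)] pt_snd[OF de(1)])
      have tz: "trn d c z = snd c q" using q by (simp add: trn_def pt_snd[OF de(1)])
      have tU: "trn d c z \<in> U" using W(1)[OF q(3)] tz by simp
      have st: "s (trn d c z) \<in> tdom c e" using q(4) sU(2)[OF tU] tz by (simp add: tdom_def \<sigma>_def)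
      obtain D' where D': "(s has_derivative D') (at (trn d c z))" "\<And>z v. D' (z *s v) = z *s D' v"
        using sd[OF tU] by blast
      note d1 = trans_derivative[OF de(1) c(1) z] and d2 = trans_derivative[OF c(1) de(2) st]
      have "((\<lambda>z. s (trn d c z)) has_derivative (\<lambda>v. D' (frechet_derivative (trn d c) (at z) v))) (at z)"
        by (rule has_derivative_compose[where f = "trn d c" and g = s, OF d1(1) D'(1)])
      from has_derivative_compose[where f = "\<lambda>z. s (trn d c z)" and g = "trn c e", OF this d2(1)]
      show "\<exists>D. ((\<lambda>z. trn c e (s (trn d c z))) has_derivative D) (at z) \<and> (\<forall>c v. D (c *s v) = c *s D v)"
        by (intro exI conjI allI, assumption) (simp add: d1(2) d2(2) D'(2))
    qed
    moreover have "(\<lambda>z. trn c e (s (trn d c z))) = snd e \<circ> \<sigma> \<circ> inv_into (fst d) (snd d)"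
      by (simp add: fun_eq_iff trn_def \<sigma>_def pt_def)
    ultimately show ?thesis by simp
  qed
  have hol: "holomorphic_map_on A \<sigma> W"
    unfolding holomorphic_map_on_def using oW cont hol_charts by (simp add: case_prod_unfold)
  show "\<exists>U s. open U \<and> p \<in> U \<and> s ` U \<subseteq> U \<and> (\<forall>q\<in>U. s (s q) = q) \<and> (\<forall>q\<in>U. s q = q \<longleftrightarrow> q = p) \<and>
     holomorphic_map_on A s U \<and>
     (\<forall>q\<in>U. \<forall>v\<in>tangent_space A q. \<forall>w\<in>tangent_space A q.
        g (s q) (differential_at A s q v) (differential_at A s q w) = g q v w)"
  proof (intro exI[of _ W] exI[of _ \<sigma>] conjI oW hol ballI)
    show "p \<in> W" using U(2) p by (auto simp: W_def)
    show "\<sigma> ` W \<subseteq> W" using \<sigma> sU(1) by (auto simp: W_def)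
    show "\<sigma> (\<sigma> q) = q" if "q \<in> W" for q using that \<sigma> s by (auto simp: W_def)
    show "\<sigma> q = q \<longleftrightarrow> q = p" if "q \<in> W" for q
      using that \<sigma> s inj sU x0 p[symmetric] by (auto simp: W_def)
    fix q v w assume q: "q \<in> W" and v: "v \<in> tangent_space A q" "w \<in> tangent_space A q"
    obtain x where x: "x \<in> U" "q = pt c x" using q by (auto simp: W_def)
    obtain D' where D': "(s has_derivative D') (at x)" "\<And>u v. G c (s x) (D' u) (D' v) = G c x u v"
      using sd[OF x(1)] by blast
    obtain a b where ab: "v = coord_vec A c q a" "w = coord_vec A c q b"
      using tangent_coord_ex[OF c(1) W(2)[OF q]] v by metis
    show "g (\<sigma> q) (differential_at A \<sigma> q v) (differential_at A \<sigma> q w) = g q v w"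
      unfolding ab x(2) diff[OF x(1) D'(1)] \<sigma>[OF x(1)] using D'(2)[of a b] by (simp add: G_def)
  qed
qed

end

end

subsection \<open>Derivatives of determinants\<close>

lemma matrix_add_mult_distrib: "(A + B) ** C = A ** C + B ** C" for A B :: "real ^ 'k ^ 'k" and C :: "real ^ 'k ^ 'k"
  by (simp add: matrix_matrix_mult_def vec_eq_iff distrib_right sum.distrib)

lemma det_replace_row:
  fixes A :: "real ^ 'k ^ 'k"
  shows "det (\<chi> j. if j = i then B else A $ j) =
    (\<Sum>p | p permutes UNIV. of_int (sign p) * (B $ p i * (\<Prod>j\<in>UNIV - {i}. A $ j $ p j)))"
  unfolding det_def
proof (rule sum.cong[OF refl])
  fix p :: "'k \<Rightarrow> 'k"
  have "(\<Prod>j\<in>UNIV. (\<chi> j. if j = i then B else A $ j) $ j $ p j) =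
      B $ p i * (\<Prod>j\<in>UNIV - {i}. (\<chi> j. if j = i then B else A $ j) $ j $ p j)"
    by (subst prod.remove[of UNIV i]) auto
  also have "(\<Prod>j\<in>UNIV - {i}. (\<chi> j. if j = i then B else A $ j) $ j $ p j) = (\<Prod>j\<in>UNIV - {i}. A $ j $ p j)"
    by (rule prod.cong) auto
  finally show "of_int (sign p) * (\<Prod>j\<in>UNIV. (\<chi> j. if j = i then B else A $ j) $ j $ p j) =
      of_int (sign p) * (B $ p i * (\<Prod>j\<in>UNIV - {i}. A $ j $ p j))" by simp
qed

text \<open>The product rule in the Leibniz formula; exchanging the sums over permutations and rows
  recombines the terms into determinants with one differentiated row.\<close>

lemma det_has_derivative_rows:
  fixes A :: "'a::real_normed_vector \<Rightarrow> real ^ 'k ^ 'k"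
  assumes "\<And>i j. ((\<lambda>x. A x $ i $ j) has_derivative A' i j) (at x)"
  shows "((\<lambda>x. det (A x)) has_derivative
    (\<lambda>h. \<Sum>i\<in>UNIV. det (\<chi> j. if j = i then (\<chi> l. A' i l h) else A x $ j))) (at x)"
proof -
  have "((\<lambda>x. \<Sum>p | p permutes UNIV. of_int (sign p) * (\<Prod>i\<in>UNIV. A x $ i $ p i)) has_derivative
    (\<lambda>h. \<Sum>p | p permutes UNIV. of_int (sign p) * (\<Sum>i\<in>UNIV. A' i (p i) h * (\<Prod>j\<in>UNIV - {i}. A x $ j $ p j)))) (at x)"
    by (intro has_derivative_sum has_derivative_mult_right has_derivative_prod assms)
  moreover have "(\<Sum>p | p permutes UNIV. of_int (sign p) * (\<Sum>i\<in>UNIV. A' i (p i) h * (\<Prod>j\<in>UNIV - {i}. A x $ j $ p j)))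
    = (\<Sum>i\<in>UNIV. det (\<chi> j. if j = i then (\<chi> l. A' i l h) else A x $ j))" for h
    unfolding det_replace_row by (subst sum.swap) (simp add: sum_distrib_left)
  ultimately show ?thesis by (simp add: det_def[of "A _"])
qed

lemma det_differentiable:
  fixes A :: "'a::real_normed_vector \<Rightarrow> real ^ 'k ^ 'k"
  assumes "\<And>i j. (\<lambda>x. A x $ i $ j) differentiable (at x)"
  shows "(\<lambda>x. det (A x)) differentiable (at x)"
proof -
  obtain A' where "\<And>i j. ((\<lambda>x. A x $ i $ j) has_derivative A' i j) (at x)"
    using assms unfolding differentiable_def by metis
  from det_has_derivative_rows[OF this] show ?thesis unfolding differentiable_def by blast
qed

text \<open>When the \<open>i\<close>-th row is expanded, every summand except the one with
  \<open>A $ i\<close> has two equal rows.\<close>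

lemma det_rows_combination:
  fixes A C :: "real ^ 'k ^ 'k"
  shows "(\<Sum>i\<in>UNIV. det (\<chi> j. if j = i then (\<chi> l. \<Sum>k\<in>UNIV. C $ i $ k * A $ k $ l) else A $ j)) = trace C * det A"
proof -
  have "det (\<chi> j. if j = i then (\<chi> l. \<Sum>k\<in>UNIV. C $ i $ k * A $ k $ l) else A $ j) = C $ i $ i * det A" for i
  proof -
    have e: "(\<chi> l. \<Sum>k\<in>UNIV. C $ i $ k * A $ k $ l) = (\<Sum>k\<in>UNIV. C $ i $ k *s A $ k)"
      by (simp add: vec_eq_iff)
    have "det (\<chi> j. if j = i then (\<Sum>k\<in>UNIV. C $ i $ k *s A $ k) else A $ j)
      = (\<Sum>k\<in>UNIV. det (\<chi> j. if j = i then C $ i $ k *s A $ k else A $ j))"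
      by (rule det_linear_row_sum[where a = "\<lambda>_ k. C $ i $ k *s A $ k"]) simp
    also have "\<dots> = (\<Sum>k\<in>UNIV. C $ i $ k * det (\<chi> j. if j = i then A $ k else A $ j))"
      by (rule sum.cong[OF refl]) (rule det_row_mul[where a = "\<lambda>_. A $ k" for k])
    also have "\<dots> = (\<Sum>k\<in>UNIV. if k = i then C $ i $ i * det A else 0)"
    proof (rule sum.cong[OF refl])
      fix k
      show "C $ i $ k * det (\<chi> j. if j = i then A $ k else A $ j) = (if k = i then C $ i $ i * det A else 0)"
      proof (cases "k = i")
        case True
        have "(\<chi> j. if j = i then A $ k else A $ j) = A" using True by (simp add: vec_eq_iff)
        then show ?thesis using True by simp
      next
        case False
        have "det (\<chi> j. if j = i then A $ k else A $ j) = 0"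
          by (rule det_identical_rows[OF False]) (use False in \<open>simp add: row_def vec_eq_iff\<close>)
        then show ?thesis using False by simp
      qed
    qed
    finally show ?thesis unfolding e by simp
  qed
  then show ?thesis by (simp add: trace_def sum_distrib_right)
qed

text \<open>Jacobi's formula for a derivative of the form \<open>C A + A C\<^sup>T\<close>, which is \<open>(C + A C\<^sup>T A\<^sup>-\<^sup>1) A\<close>.\<close>

lemma det_has_derivative_congruence:
  fixes A :: "'a::real_normed_vector \<Rightarrow> real ^ 'k ^ 'k"
  assumes d: "\<And>i j. ((\<lambda>x. A x $ i $ j) has_derivative
      (\<lambda>h. (\<Sum>k\<in>UNIV. C h $ i $ k * A x $ k $ j) + (\<Sum>k\<in>UNIV. A x $ i $ k * C h $ j $ k))) (at x)"
    and inv: "invertible (A x)"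
  shows "((\<lambda>x. det (A x)) has_derivative (\<lambda>h. 2 * trace (C h) * det (A x))) (at x)"
proof -
  obtain B where B: "A x ** B = mat 1" "B ** A x = mat 1" using inv unfolding invertible_def by blast
  define C' where "C' h = C h + A x ** transpose (C h) ** B" for h
  have "C' h ** A x = C h ** A x + A x ** transpose (C h) ** (B ** A x)" for h
    by (simp add: C'_def matrix_add_mult_distrib matrix_mul_assoc)
  then have e: "C' h ** A x = C h ** A x + A x ** transpose (C h)" for h by (simp add: B)
  have e': "(\<Sum>k\<in>UNIV. C h $ i $ k * A x $ k $ j) + (\<Sum>k\<in>UNIV. A x $ i $ k * C h $ j $ k)
      = (\<Sum>k\<in>UNIV. C' h $ i $ k * A x $ k $ j)" for h i j
    using arg_cong[OF e[of h], of "\<lambda>M. M $ i $ j"] by (simp add: matrix_matrix_mult_def transpose_def)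
  have tt: "trace (transpose M) = trace M" for M :: "real ^ 'k ^ 'k" by (simp add: trace_def transpose_def)
  have "trace (A x ** transpose (C h) ** B) = trace (transpose (C h))" for h
    using trace_mul_sym[of "A x ** transpose (C h)" B] by (simp add: matrix_mul_assoc B)
  then have tr: "trace (C' h) = 2 * trace (C h)" for h
    unfolding C'_def trace_add by (simp add: tt)
  show ?thesis
    using det_has_derivative_rows[OF d] unfolding e' det_rows_combination tr .
qed

text \<open>Cyclicity of the trace; it gives both the independence of \<open>tau\<close> from the
  chart and the cancellation of connection terms in its derivative.\<close>

lemma trace_commute:
  fixes f h :: "'a::euclidean_space \<Rightarrow> 'a"
  assumes "linear f" "linear h"
  shows "(\<Sum>b\<in>Basis. f (h b) \<bullet> b) = (\<Sum>b\<in>Basis. h (f b) \<bullet> b)"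
proof -
  have e: "f (h b) \<bullet> b = (\<Sum>a\<in>Basis. (h b \<bullet> a) * (f a \<bullet> b))" if "linear f" for f h and b :: 'a
    by (subst linear_basis_expansion[OF that, of "h b"]) (simp add: inner_sum_left)
  show ?thesis
    unfolding e[OF assms(1), of h] e[OF assms(2), of f] by (subst sum.swap) (simp add: mult.commute)
qed

subsection \<open>Integration of functions with compact support\<close>

lemma zero_extension_continuous:
  fixes f :: "'a::t2_space \<Rightarrow> 'b::real_normed_vector"
  assumes S: "open S" and K: "compact K" "K \<subseteq> S" and c: "continuous_on S f"
    and 0: "\<And>x. x \<in> S \<Longrightarrow> x \<notin> K \<Longrightarrow> f x = 0"
  shows "continuous_on UNIV (\<lambda>x. if x \<in> S then f x else 0)"
proof -
  have o: "open (- K)" using K by (simp add: compact_imp_closed open_Compl)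
  have 1: "continuous_on S (\<lambda>x. if x \<in> S then f x else 0)" using c by (rule continuous_on_eq) simp
  have 2: "continuous_on (- K) (\<lambda>x. if x \<in> S then f x else 0)"
    by (rule continuous_on_eq[OF continuous_on_const[of _ 0]]) (use 0 in auto)
  have U: "S \<union> - K = UNIV" using K(2) by blast
  show ?thesis using continuous_on_open_Un[OF S o 1 2] unfolding U .
qed

lemma zero_extension_has_derivative:
  fixes f :: "'a::real_normed_vector \<Rightarrow> 'b::real_normed_vector"
  assumes S: "open S" and K: "compact K" "K \<subseteq> S" and d: "\<And>x. x \<in> S \<Longrightarrow> (f has_derivative f' x) (at x)"
    and 0: "\<And>x. x \<in> S \<Longrightarrow> x \<notin> K \<Longrightarrow> f x = 0"
  shows "((\<lambda>x. if x \<in> S then f x else 0) has_derivative (if x \<in> S then f' x else (\<lambda>h. 0))) (at x)"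
proof (cases "x \<in> S")
  case True
  then show ?thesis using has_derivative_transform_within_open[OF d[OF True] S True, of "\<lambda>x. if x \<in> S then f x else 0"] by simp
next
  case False
  have o: "open (- K)" using K by (simp add: compact_imp_closed open_Compl)
  have "((\<lambda>x. if x \<in> S then f x else 0) has_derivative (\<lambda>h. 0)) (at x)"
    by (rule has_derivative_transform_within_open[OF has_derivative_const[of 0] o]) (use False K 0 in auto)
  then show ?thesis using False by simp
qed

lemma integral_support:
  fixes k :: "'a::euclidean_space \<Rightarrow> real"
  assumes "\<And>x. x \<notin> S \<Longrightarrow> k x = 0"
  shows "integral S k = integral UNIV k"
proof -
  have "(\<lambda>x. if x \<in> S then k x else 0) = k" using assms by auto
  then show ?thesis using integral_restrict_UNIV[of S k] by simp
qed

lemma compact_support_absolutely_integrable: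
  fixes k :: "'a::euclidean_space \<Rightarrow> real"
  assumes k: "continuous_on UNIV k" and K: "compact K" "\<And>x. x \<notin> K \<Longrightarrow> k x = 0"
  shows "k absolutely_integrable_on UNIV"
proof -
  obtain m where m: "K \<subseteq> cbox (- m) m" using bounded_subset_cbox_symmetric[OF compact_imp_bounded[OF K(1)]] by blast
  have "k absolutely_integrable_on cbox (- m) m"
    by (rule absolutely_integrable_continuous[OF continuous_on_subset[OF k]]) simp
  moreover have "(\<lambda>x. if x \<in> cbox (- m) m then k x else 0) = k"
    by (intro HOL.ext) (use K(2) m in auto)
  ultimately show ?thesis using absolutely_integrable_restrict_UNIV[of "cbox (- m) m" k] by simp
qed

lemma integral_nonneg_eq_0_imp:
  fixes k :: "'a::euclidean_space \<Rightarrow> real"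
  assumes k: "continuous_on UNIV k" and K: "compact K" "\<And>x. x \<notin> K \<Longrightarrow> k x = 0" and "\<And>x. 0 \<le> k x"
    and i: "integral UNIV k = 0"
  shows "k x = 0"
proof -
  have "bounded (K \<union> ball x 1)" using K by (simp add: compact_imp_bounded)
  then obtain m where m: "K \<union> ball x 1 \<subseteq> cbox (- m) m" using bounded_subset_cbox_symmetric by blast
  have "ball x 1 \<subseteq> interior (cbox (- m) m)" using m by (intro interior_maximal) auto
  then have x: "x \<in> box (- m) m" using interior_cbox[of "- m" m] centre_in_ball[of x 1] by auto
  have "integral (cbox (- m) m) k = 0" using integral_support[of "cbox (- m) m" k] K(2) m i by auto
  moreover have "k integrable_on cbox (- m) m" by (rule integrable_continuous[OF continuous_on_subset[OF k]]) simp
  ultimately have "(k has_integral 0) (cbox (- m) m)" using integrable_integral by force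
  moreover have "continuous_on (cbox (- m) m) k" by (rule continuous_on_subset[OF k]) simp
  moreover have "x \<in> cbox (- m) m" using x by (auto simp: mem_box intro: less_imp_le)
  moreover have "box (- m) m \<noteq> {}" using x by blast
  ultimately show ?thesis using has_integral_0_cbox_imp_0[of "- m" m k x] assms(4) by blast
qed

text \<open>The integral of \<open>k\<close> is invariant under translation by
  \<open>s *\<^sub>R e\<close>; this is differentiated at \<open>s = 0\<close> under the integral
  sign. One box contains the supports of all translates with \<open>|s| \<le> 1\<close>, so the
  integration takes place over a fixed compact set.\<close>

lemma integral_directional_derivative:
  fixes k :: "'a::euclidean_space \<Rightarrow> real"
  assumes d: "\<And>x. (k has_derivative k' x) (at x)" and c: "continuous_on UNIV (\<lambda>x. k' x e)"
    and K: "compact K" "\<And>x. x \<notin> K \<Longrightarrow> k x = 0"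
  shows "integral UNIV (\<lambda>x. k' x e) = 0"
proof -
  have kc: "continuous_on UNIV k" by (intro continuous_at_imp_continuous_on ballI has_derivative_continuous[OF d])
  have cs: "continuous_on ({-1..1} \<times> K) (\<lambda>z. snd z - fst z *\<^sub>R e)" by (intro continuous_intros)
  have "bounded ((\<lambda>z. snd z - fst z *\<^sub>R e) ` ({-1..1} \<times> K))"
    by (intro compact_imp_bounded compact_continuous_image cs compact_Times K compact_Icc)
  then obtain m where m: "(\<lambda>z. snd z - fst z *\<^sub>R e) ` ({-1..1} \<times> K) \<subseteq> cbox (- m) m"
    using bounded_subset_cbox_symmetric by blast
  have in_box: "x - s *\<^sub>R e \<in> cbox (- m) m" if "s \<in> {-1..1}" "x \<in> K" for x s
    using m that by (auto simp: subset_eq)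
  have shift: "integral (cbox (- m) m) (\<lambda>x. k (x + s *\<^sub>R e)) = integral UNIV k" if s: "s \<in> {-1<..<1}" for s
  proof -
    have "integral (cbox (- m) m) (k \<circ> (+) (s *\<^sub>R e)) = integral (cbox (- m + s *\<^sub>R e) (m + s *\<^sub>R e)) k"
      by (rule integral_shift_cbox_plus)
    also have "\<dots> = integral UNIV k"
    proof (rule integral_support)
      fix x assume x: "x \<notin> cbox (- m + s *\<^sub>R e) (m + s *\<^sub>R e)"
      have "x - s *\<^sub>R e \<notin> cbox (- m) m"
        using x by (auto simp: mem_box algebra_simps)
      then show "k x = 0" using in_box[of s x] s K(2) by auto
    qed
    finally show ?thesis by (simp add: o_def add.commute)
  qed
  have "((\<lambda>s. integral (cbox (- m) m) (\<lambda>x. k (x + s *\<^sub>R e))) has_vector_derivative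
      integral (cbox (- m) m) (\<lambda>x. k' (x + 0 *\<^sub>R e) e)) (at 0 within {-1<..<1})"
  proof (rule leibniz_rule_vector_derivative[where f = "\<lambda>s x. k (x + s *\<^sub>R e)" and fx = "\<lambda>s x. k' (x + s *\<^sub>R e) e"])
    fix s :: real and x
    have "((\<lambda>s. x + s *\<^sub>R e) has_derivative (\<lambda>h. h *\<^sub>R e)) (at s within {-1<..<1})"
      by (auto intro!: derivative_eq_intros)
    from has_derivative_compose[where f = "\<lambda>s. x + s *\<^sub>R e" and g = k, OF this d]
    show "((\<lambda>s. k (x + s *\<^sub>R e)) has_vector_derivative k' (x + s *\<^sub>R e) e) (at s within {-1<..<1})"
      unfolding has_vector_derivative_def by (simp add: linear_scale[OF has_derivative_linear[OF d]])
  next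
    show "(\<lambda>x. k (x + s *\<^sub>R e)) integrable_on cbox (- m) m" for s
      by (intro integrable_continuous continuous_on_compose2[OF kc]) (auto intro!: continuous_intros)
    have "continuous_on ({-1<..<1} \<times> cbox (- m) m) (\<lambda>z. k' (snd z + fst z *\<^sub>R e) e)"
      by (intro continuous_on_compose2[OF c]) (auto intro!: continuous_intros)
    then show "continuous_on ({-1<..<1} \<times> cbox (- m) m) (\<lambda>(s, x). k' (x + s *\<^sub>R e) e)"
      by (simp add: case_prod_unfold)
  qed auto
  then have 1: "((\<lambda>s. integral (cbox (- m) m) (\<lambda>x. k (x + s *\<^sub>R e))) has_vector_derivative
      integral (cbox (- m) m) (\<lambda>x. k' x e)) (at 0)"
    by (simp add: at_within_open[of 0 "{-1<..<1}"])
  have 2: "((\<lambda>s. integral (cbox (- m) m) (\<lambda>x. k (x + s *\<^sub>R e))) has_vector_derivative 0) (at 0)"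
    by (rule has_vector_derivative_transform_within_open[OF has_vector_derivative_const[of "integral UNIV k"], of "{-1<..<1}"])
      (use shift in auto)
  have "k' x e = 0" if "x \<notin> K" for x
  proof -
    have "(k has_derivative (\<lambda>h. 0)) (at x)"
      by (rule has_derivative_transform_within_open[OF has_derivative_const[of 0], of "- K"])
        (use K that in \<open>auto simp: compact_imp_closed open_Compl\<close>)
    from fun_cong[OF has_derivative_unique[OF d this]] show ?thesis .
  qed
  moreover have "K \<subseteq> cbox (- m) m" using in_box[of 0] by auto
  ultimately have "integral (cbox (- m) m) (\<lambda>x. k' x e) = integral UNIV (\<lambda>x. k' x e)"
    by (intro integral_support) auto
  then show ?thesis using vector_derivative_unique_at[OF 1 2] by simp
qed

text \<open>The rule for vector-valued integrands, applied to values in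
  \<open>real ^ 1\<close>.\<close>

lemma integral_change_of_variables_real:
  fixes f :: "real ^ 'k::{finite,wellorder} \<Rightarrow> real" and h :: "real ^ 'k::_ \<Rightarrow> real ^ 'k::_"
  assumes S: "open S" and d: "\<And>x. x \<in> S \<Longrightarrow> (h has_derivative h' x) (at x)" and inj: "inj_on h S"
    and f: "f absolutely_integrable_on (h ` S)"
  shows "integral (h ` S) f = integral S (\<lambda>x. \<bar>det (matrix (h' x))\<bar> * f (h x))"
proof -
  let ?f = "\<lambda>x. vec (f x) :: real ^ 1" and ?D = "\<lambda>x. \<bar>det (matrix (h' x))\<bar>"
  have bl: "bounded_linear (vec :: real \<Rightarrow> real ^ 1)" using linear_vec linear_conv_bounded_linear by blast
  have vf: "?f absolutely_integrable_on (h ` S)"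
    using absolutely_integrable_linear[OF f bl] unfolding o_def .
  have SL: "S \<in> sets lebesgue" by (metis borel_open S sets_completionI_sets sets_lborel)
  have d': "(h has_derivative h' x) (at x within S)" if "x \<in> S" for x
    by (rule has_derivative_at_withinI[OF d[OF that]])
  have i: "integral (h ` S) ?f = integral S (\<lambda>x. ?D x *\<^sub>R ?f (h x))"
    by (rule integral_change_of_variables[OF SL d' inj]) (use vf in auto)
  have "(\<lambda>x. ?D x *\<^sub>R ?f (h x)) absolutely_integrable_on S"
    by (rule iffD1[OF absolutely_integrable_change_of_variables[OF SL d' inj] vf])
  then have "(\<lambda>x. ?D x *\<^sub>R ?f (h x)) integrable_on S" by (rule set_lebesgue_integral_eq_integral(1))
  from integral_component_eq_cart[OF this, of 1]
  have "integral S (\<lambda>x. ?D x * f (h x)) = integral S (\<lambda>x. ?D x *\<^sub>R ?f (h x)) $ 1" by simp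
  moreover have "integral (h ` S) f = integral (h ` S) ?f $ 1"
    using integral_component_eq_cart[OF set_lebesgue_integral_eq_integral(1)[OF vf], of 1] by simp
  ultimately show ?thesis by (simp add: i)
qed

subsection \<open>The dual vector field of the torsion trace\<close>

context chern_manifold
begin

text \<open>The real trace of \<open>T(u, \<cdot>)\<close>, taken in the standard basis;
  \<open>tau_trn\<close> shows that it does not depend on the chart.\<close>

definition tau :: "('m, 'n) chart \<Rightarrow> complex ^ 'n \<Rightarrow> complex ^ 'n \<Rightarrow> real" where
  "tau c x u = (\<Sum>b\<in>Basis. Tor c x u b \<bullet> b)"

lemma tau_linear:
  assumes "c \<in> A" "x \<in> dm c"
  shows "linear (tau c x)"
  by (rule linearI) (simp_all add: tau_def linear_add[OF Tor_simps(2)[OF assms]]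
      linear_scale[OF Tor_simps(2)[OF assms]] inner_add_left sum.distrib sum_distrib_left)

text \<open>The trace annihilates the commutator of \<open>Tor c x u\<close> with
  \<open>Gam c x h\<close>, so only the term acting on the argument \<open>u\<close> survives: the
  form \<open>\<tau>\<close> is parallel.\<close>

lemma tau_has_derivative:
  assumes c: "c \<in> A" and x: "x \<in> dm c"
  shows "((\<lambda>y. tau c y u) has_derivative (\<lambda>h. tau c x (Gam c x h u))) (at x)"
proof -
  have lG: "linear (Gam c x h)" for h using bilinear_Gam[OF c x] by (simp add: bilinear_def)
  have "((\<lambda>y. \<Sum>b\<in>Basis. Tor c y u b \<bullet> b) has_derivative (\<lambda>h. \<Sum>b\<in>Basis.
      (Tor c x (Gam c x h u) b + Tor c x u (Gam c x h b) - Gam c x h (Tor c x u b)) \<bullet> b)) (at x)"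
    by (intro has_derivative_sum bounded_linear.has_derivative[OF bounded_linear_inner_left] Tor_has_derivative c x)
  moreover have "(\<Sum>b\<in>Basis. (Tor c x (Gam c x h u) b + Tor c x u (Gam c x h b) - Gam c x h (Tor c x u b)) \<bullet> b)
      = tau c x (Gam c x h u)" for h
    using trace_commute[OF Tor_simps(1)[OF c x] lG, of u h]
    by (simp add: tau_def inner_add_left inner_diff_left sum.distrib sum_subtractf)
  ultimately show ?thesis by (simp add: tau_def)
qed

lemma tau_trn:
  assumes "c \<in> A" "d \<in> A" "x \<in> tdom c d"
  defines "L \<equiv> frechet_derivative (trn c d) (at x)"
  shows "tau d (trn c d x) (L u) = tau c x u"
proof -
  define L' where "L' = frechet_derivative (trn d c) (at (trn c d x))"
  have x: "x \<in> dm c" using assms(3) by (simp add: tdom_def)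
  have lL: "linear L" and lL': "linear L'"
    using has_derivative_linear trans_derivative(1)[OF assms(1-3)] trans_derivative(1)[OF assms(2,1) trans_in[OF assms(1-3)]]
    by (auto simp: L_def L'_def)
  have LL': "L (L' v) = v" for v
    using trans_derivative_inverse[OF assms(2,1) trans_in[OF assms(1-3)]] trans_trans[OF assms(1-3)]
    by (simp add: L_def L'_def)
  have L'L: "L' (L v) = v" for v
    using trans_derivative_inverse[OF assms(1-3)] by (simp add: L_def L'_def)
  have l: "linear (\<lambda>b. Tor c x u (L' b))"
    using linear_compose[OF lL' Tor_simps(1)[OF assms(1) x]] by (simp add: o_def)
  have "tau d (trn c d x) (L u) = (\<Sum>b\<in>Basis. L (Tor c x u (L' b)) \<bullet> b)"
    unfolding tau_def using Tor_trn[OF assms(1-3), of u "L' _"] by (simp add: L_def[symmetric] LL')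
  also have "\<dots> = (\<Sum>b\<in>Basis. Tor c x u (L' (L b)) \<bullet> b)" by (rule trace_commute[OF lL l])
  finally show ?thesis by (simp add: tau_def L'L)
qed

lemma dd_trn:
  assumes "c \<in> A" "d \<in> A" "x \<in> tdom c d" "smooth_fun A f"
  shows "dd c f x u = dd d f (trn c d x) (frechet_derivative (trn c d) (at x) u)"
proof -
  have y: "trn c d x \<in> dm d" using trans_in[OF assms(1-3)] by (simp add: tdom_def)
  have "((\<lambda>x. f (pt d (trn c d x))) has_derivative
     (\<lambda>u. dd d f (trn c d x) (frechet_derivative (trn c d) (at x) u))) (at x)"
    by (rule has_derivative_compose[where f="trn c d" and g="\<lambda>y. f (pt d y)",
          OF trans_derivative(1)[OF assms(1-3)] dd_has_derivative[OF assms(4,2) y]])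
  then have "((\<lambda>x. f (pt c x)) has_derivative
     (\<lambda>u. dd d f (trn c d x) (frechet_derivative (trn c d) (at x) u))) (at x)"
    by (rule has_derivative_transform_within_open[OF _ open_tdom[OF assms(1,2)] assms(3)])
      (simp add: pt_trans[OF assms(2)])
  then show ?thesis by (simp add: dd_eqI)
qed

lemma dd_zero:
  assumes "c \<in> A" "x \<in> dm c" "closed C" "pt c x \<notin> C" "\<And>q. q \<notin> C \<Longrightarrow> f q = 0"
  shows "dd c f x = (\<lambda>u. 0)"
proof (rule dd_eqI)
  show "((\<lambda>y. f (pt c y)) has_derivative (\<lambda>u. 0)) (at x)"
    by (rule has_derivative_transform_within_open[OF has_derivative_const[of 0] open_pt_vimage[OF assms(1), of "- C"]])
      (use assms in \<open>auto simp: open_Compl\<close>)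
qed

end

lemma sqrt_has_derivative:
  fixes f :: "'a::real_normed_vector \<Rightarrow> real"
  assumes "(f has_derivative (\<lambda>h. k h * f x)) (at x)" "0 < f x"
  shows "((\<lambda>x. sqrt (f x)) has_derivative (\<lambda>h. k h / 2 * sqrt (f x))) (at x)"
proof -
  have "f x = sqrt (f x) * sqrt (f x)" using assms(2) by simp
  then have e: "f x * inverse (sqrt (f x)) = sqrt (f x)" using assms(2) by (simp add: field_simps)
  show ?thesis
    by (rule has_derivative_eq_rhs[OF has_derivative_real_sqrt[OF assms(2,1)]]) (simp add: fun_eq_iff mult.assoc e)
qed

text \<open>Substitution in integrals takes place on \<open>real ^ 'k\<close> with a well-ordered
  index type. \<open>\<beta>\<close> numbers the real basis of \<open>complex ^ 'n\<close>, and
  \<open>J\<close>, \<open>Ji\<close> are the resulting coordinate isomorphisms; this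
  \<open>J\<close> is not the complex structure.\<close>

locale based_chern_manifold = chern_manifold A D g
  for A :: "('m::{t2_space, second_countable_topology}, 'n::finite) chart set" and D :: "'m connection" and g +
  fixes \<beta> :: "'k::{finite,wellorder} \<Rightarrow> complex ^ 'n"
  assumes \<beta>: "bij_betw \<beta> UNIV Basis"
begin

definition J :: "(real, 'k) vec \<Rightarrow> complex ^ 'n" where "J r = (\<Sum>i\<in>UNIV. r $ i *\<^sub>R \<beta> i)"

definition Ji :: "complex ^ 'n \<Rightarrow> (real, 'k) vec" where "Ji x = (\<chi> i. x \<bullet> \<beta> i)"

lemma \<beta>_Basis: "\<beta> i \<in> Basis" using \<beta> by (auto simp: bij_betw_def)

lemma \<beta>_inner: "\<beta> i \<bullet> \<beta> j = (if i = j then 1 else 0)"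
  using \<beta> by (auto simp: inner_Basis \<beta>_Basis bij_betw_def inj_eq)

lemma sum_\<beta>: "(\<Sum>i\<in>UNIV. f (\<beta> i)) = (\<Sum>b\<in>Basis. f b)"
  by (rule sum.reindex_bij_betw[OF \<beta>])

lemma \<beta>_expansion: "(\<Sum>i\<in>UNIV. (x \<bullet> \<beta> i) *\<^sub>R \<beta> i) = x"
  using sum_\<beta>[of "\<lambda>b. (x \<bullet> b) *\<^sub>R b"] by (simp add: euclidean_representation)

lemma J_Ji: "J (Ji x) = x" by (simp add: J_def Ji_def \<beta>_expansion)

lemma Ji_J: "Ji (J r) = r"
  by (simp add: vec_eq_iff J_def Ji_def inner_sum_left \<beta>_inner if_distrib cong: if_cong)

lemma bounded_linear_J: "bounded_linear J"
  unfolding J_def by (intro bounded_linear_sum bounded_linear_scaleR_left[THEN bounded_linear_compose] bounded_linear_vec_nth)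

lemma linear_Ji: "linear Ji"
  by (rule linearI) (simp_all add: Ji_def vec_eq_iff inner_add_left)

lemma bounded_linear_Ji: "bounded_linear Ji"
  using linear_Ji linear_conv_bounded_linear by blast

lemma J_axis: "J (axis i 1) = \<beta> i"
proof -
  have "J (axis i 1) = (\<Sum>j\<in>UNIV. if j = i then \<beta> i else 0)" unfolding J_def by (rule sum.cong) (auto simp: axis_def)
  then show ?thesis by simp
qed

lemma linear_expansion_\<beta>: "linear f \<Longrightarrow> f v = (\<Sum>i\<in>UNIV. (v \<bullet> \<beta> i) *\<^sub>R f (\<beta> i))"
  using linear_basis_expansion[of f v] sum_\<beta>[of "\<lambda>b. (v \<bullet> b) *\<^sub>R f b"] by simp

definition Am :: "('m, 'n) chart \<Rightarrow> complex ^ 'n \<Rightarrow> ((real, 'k) vec, 'k) vec" where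
  "Am c x = (\<chi> i j. G c x (\<beta> i) (\<beta> j))"

text \<open>The Riemannian density, i.e. the square root of \<open>\<bar>det\<bar>\<close>; squaring spares the sign of the determinant.\<close>

definition dens :: "('m, 'n) chart \<Rightarrow> complex ^ 'n \<Rightarrow> real" where
  "dens c x = sqrt (sqrt ((det (Am c x))\<^sup>2))"

text \<open>The metric dual of \<open>tau\<close>, by Cramer's rule in the basis
  \<open>\<beta>\<close>; as a quotient of determinants it is visibly differentiable.\<close>

definition Fc :: "('m, 'n) chart \<Rightarrow> complex ^ 'n \<Rightarrow> complex ^ 'n" where
  "Fc c x = (\<Sum>k\<in>UNIV. (det (\<chi> i j. if j = k then tau c x (\<beta> i) else Am c x $ i $ j) / det (Am c x)) *\<^sub>R \<beta> k)"

context
  fixes c x assumes c: "c \<in> A" and x: "x \<in> dm c"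
begin

lemma G_linear: "linear (G c x u)" "linear (\<lambda>u. G c x u v)"
  using bilinear_G[OF c x] by (simp_all add: bilinear_def)

lemma G_expand: "G c x u v = (\<Sum>k\<in>UNIV. (v \<bullet> \<beta> k) * G c x u (\<beta> k))"
  "G c x u v = (\<Sum>k\<in>UNIV. (u \<bullet> \<beta> k) * G c x (\<beta> k) v)"
  using linear_expansion_\<beta>[OF G_linear(1), of u v] linear_expansion_\<beta>[OF G_linear(2), of u v] by simp_all

lemma G_nondegenerate: "(\<And>v. G c x u v = G c x u' v) \<Longrightarrow> u = u'"
  using G_pos[OF c x, of "u - u'"] by (force simp: bilinear_lsub[OF bilinear_G[OF c x]])

lemma det_Am: "det (Am c x) \<noteq> 0" and invertible_Am: "invertible (Am c x)"
proof -
  have "r = 0" if r: "Am c x *v r = 0" for r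
  proof -
    have "G c x (\<beta> i) (J r) = 0" for i
    proof -
      have "(Am c x *v r) $ i = (\<Sum>j\<in>UNIV. r $ j * G c x (\<beta> i) (\<beta> j))"
        by (simp add: matrix_vector_mult_def Am_def mult.commute)
      also have "\<dots> = G c x (\<beta> i) (J r)"
        unfolding J_def using G_linear(1) by (simp add: linear_sum linear_scale)
      finally show ?thesis using r by simp
    qed
    then have "G c x (J r) (J r) = 0" by (subst G_expand(2)) simp
    then have "J r = 0" using G_pos[OF c x, of "J r"] by force
    then show "r = 0" using Ji_J[of r] linear_0[OF linear_Ji] by simp
  qed
  then show "invertible (Am c x)" using matrix_left_invertible_ker invertible_left_inverse by metis
  then show "det (Am c x) \<noteq> 0" by (simp add: invertible_det_nz)
qed

lemma dens_pos: "dens c x > 0" using det_Am by (simp add: dens_def)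

lemma Am_has_derivative: "((\<lambda>x. Am c x $ i $ j) has_derivative
    (\<lambda>h. (\<Sum>k\<in>UNIV. (\<chi> i k. Gam c x h (\<beta> i) \<bullet> \<beta> k) $ i $ k * Am c x $ k $ j)
      + (\<Sum>k\<in>UNIV. Am c x $ i $ k * (\<chi> i k. Gam c x h (\<beta> i) \<bullet> \<beta> k) $ j $ k))) (at x)"
  by (rule has_derivative_eq_rhs, unfold Am_def vec_lambda_beta, rule G_has_derivative[OF c x])
    (simp add: fun_eq_iff G_expand(2)[of "Gam c x _ _" "\<beta> _"] G_expand(1)[of "\<beta> _" "Gam c x _ _"] mult.commute)

text \<open>By metric compatibility the Gram matrix has derivative \<open>C A + A C\<^sup>T\<close>
  with \<open>C\<close> the matrix of \<open>Gam\<close>, so its determinant has logarithmic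
  derivative twice the trace. Squaring doubles this, and each of the two square roots halves
  it.\<close>

lemma dens_has_derivative:
  "(dens c has_derivative (\<lambda>h. (\<Sum>b\<in>Basis. Gam c x h b \<bullet> b) * dens c x)) (at x)"
proof -
  let ?t = "\<lambda>h. \<Sum>b\<in>Basis. Gam c x h b \<bullet> b"
  have tr: "trace (\<chi> i k. Gam c x h (\<beta> i) \<bullet> \<beta> k) = ?t h" for h
    using sum_\<beta>[of "\<lambda>b. Gam c x h b \<bullet> b"] by (simp add: trace_def)
  have "((\<lambda>x. det (Am c x)) has_derivative (\<lambda>h. 2 * ?t h * det (Am c x))) (at x)"
    using det_has_derivative_congruence[where A = "Am c" and C = "\<lambda>h. \<chi> i k. Gam c x h (\<beta> i) \<bullet> \<beta> k", OF Am_has_derivative invertible_Am]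
    unfolding tr .
  from has_derivative_power[OF this, of 2]
  have "((\<lambda>x. (det (Am c x))\<^sup>2) has_derivative (\<lambda>h. (4 * ?t h) * (det (Am c x))\<^sup>2)) (at x)"
    by (rule has_derivative_eq_rhs) (simp add: fun_eq_iff power2_eq_square)
  from sqrt_has_derivative[OF sqrt_has_derivative[OF this]] det_Am
  show ?thesis by (simp add: dens_def[abs_def])
qed

lemma G_Fc: "G c x (Fc c x) u = tau c x u"
proof -
  let ?r = "(\<chi> k. det (\<chi> i j. if j = k then (\<chi> i. tau c x (\<beta> i)) $ i else Am c x $ i $ j) / det (Am c x))"
  have J: "J ?r = Fc c x" by (simp add: J_def Fc_def cong: if_cong)
  have e: "Am c x *v ?r = (\<chi> i. tau c x (\<beta> i))" using cramer[OF det_Am, of ?r "\<chi> i. tau c x (\<beta> i)"] by blast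
  have "G c x (\<beta> i) (Fc c x) = tau c x (\<beta> i)" for i
  proof -
    have "G c x (\<beta> i) (J ?r) = (\<Sum>j\<in>UNIV. ?r $ j * G c x (\<beta> i) (\<beta> j))"
      unfolding J_def using G_linear(1) by (simp add: linear_sum linear_scale)
    also have "\<dots> = (Am c x *v ?r) $ i" by (simp add: matrix_vector_mult_def Am_def mult.commute)
    finally show ?thesis unfolding e J by simp
  qed
  then show ?thesis
    using G_expand(2)[of u "Fc c x"] linear_expansion_\<beta>[OF tau_linear[OF c x], of u] G_sym[OF c x, of u "Fc c x"] by simp
qed

text \<open>The dual of a parallel form under a parallel metric is parallel:
  \<open>G c x (Fc c x) v = tau c x v\<close> is differentiated, with differentiability of
  \<open>Fc\<close> known beforehand from Cramer's rule.\<close>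

lemma Fc_has_derivative: "(Fc c has_derivative (\<lambda>h. - Gam c x h (Fc c x))) (at x)"
proof -
  have dA: "(\<lambda>x. Am c x $ i $ j) differentiable (at x)" for i j
    using Am_has_derivative unfolding differentiable_def by blast
  have dt: "(\<lambda>x. tau c x u) differentiable (at x)" for u
    using tau_has_derivative[OF c x] unfolding differentiable_def by blast
  have "(\<lambda>x. (\<chi> i j. if j = k then tau c x (\<beta> i) else Am c x $ i $ j) $ i $ j) differentiable (at x)" for k i j
    using dA dt by (cases "j = k") simp_all
  then have "(\<lambda>x. det (\<chi> i j. if j = k then tau c x (\<beta> i) else Am c x $ i $ j)) differentiable (at x)" for k
    by (rule det_differentiable)
  moreover have "(\<lambda>x. det (Am c x)) differentiable (at x)" by (rule det_differentiable[OF dA])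
  ultimately have "Fc c differentiable (at x)"
    unfolding Fc_def[abs_def]
    by (intro differentiable_sum ballI differentiable_scaleR differentiable_divide differentiable_const det_Am) auto
  then obtain F' where F': "(Fc c has_derivative F') (at x)" unfolding differentiable_def by blast
  have "F' h = - Gam c x h (Fc c x)" for h
  proof (rule G_nondegenerate)
    fix v
    have "((\<lambda>y. G c y (Fc c y) v) has_derivative
      (\<lambda>h. (G c x (Gam c x h (Fc c x)) v + G c x (Fc c x) (Gam c x h v)) + G c x (F' h) v + G c x (Fc c x) 0)) (at x)"
      by (rule bilinear_family_has_derivative[OF open_dm[OF c] x bilinear_G[OF c] G_has_derivative[OF c x] F' has_derivative_const])
    note 1 = this
    have 2: "((\<lambda>y. G c y (Fc c y) v) has_derivative (\<lambda>h. tau c x (Gam c x h v))) (at x)"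
      by (rule has_derivative_transform_within_open[OF tau_has_derivative[OF c x] open_dm[OF c] x])
        (simp add: based_chern_manifold.G_Fc[OF based_chern_manifold_axioms c])
    have "(G c x (Gam c x h (Fc c x)) v + G c x (Fc c x) (Gam c x h v)) + G c x (F' h) v + G c x (Fc c x) 0
        = tau c x (Gam c x h v)"
      by (rule fun_cong[OF has_derivative_unique[OF 1 2]])
    then show "G c x (F' h) v = G c x (- Gam c x h (Fc c x)) v"
      by (simp add: G_Fc bilinear_rzero[OF bilinear_G[OF c x]] bilinear_lneg[OF bilinear_G[OF c x]])
  qed
  then show ?thesis using F' by (metis (no_types, lifting) HOL.ext)
qed

end

section \<open>The divergence of the dual field and its integrals in charts\<close>

text \<open>The Gram matrices are congruent by the Jacobian matrix, so their determinants differ by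
  the square of its determinant.\<close>

lemma dens_trn:
  assumes "c \<in> A" "d \<in> A" "x \<in> tdom c d"
  defines "L \<equiv> frechet_derivative (trn c d) (at x)"
  shows "dens c x = \<bar>det (matrix (\<lambda>r. Ji (L (J r))))\<bar> * dens d (trn c d x)"
proof -
  define M where "M = matrix (\<lambda>r. Ji (L (J r)))"
  have y: "trn c d x \<in> dm d" using trans_in[OF assms(1-3)] by (simp add: tdom_def)
  have M: "M $ l $ i = L (\<beta> i) \<bullet> \<beta> l" for l i by (simp add: M_def matrix_def J_axis Ji_def)
  have "Am c x = transpose M ** Am d (trn c d x) ** M"
  proof -
    have "Am c x $ i $ j = (\<Sum>k\<in>UNIV. (\<Sum>l\<in>UNIV. M $ l $ i * Am d (trn c d x) $ l $ k) * M $ k $ j)" for i j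
    proof -
      have "Am c x $ i $ j = G d (trn c d x) (L (\<beta> i)) (L (\<beta> j))"
        using G_trn[OF assms(1-3)] by (simp add: Am_def L_def)
      also have "\<dots> = (\<Sum>k\<in>UNIV. (L (\<beta> j) \<bullet> \<beta> k) * (\<Sum>l\<in>UNIV. (L (\<beta> i) \<bullet> \<beta> l) * G d (trn c d x) (\<beta> l) (\<beta> k)))"
        unfolding G_expand(1)[OF assms(2) y, of "L (\<beta> i)" "L (\<beta> j)"]
          G_expand(2)[OF assms(2) y, of "L (\<beta> i)" "\<beta> _"] ..
      finally show ?thesis by (simp add: M Am_def mult.commute)
    qed
    then show ?thesis by (simp add: vec_eq_iff matrix_matrix_mult_def transpose_def)
  qed
  then have "det (Am c x) = (det M)\<^sup>2 * det (Am d (trn c d x))" by (simp add: det_mul power2_eq_square)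
  moreover have "sqrt (sqrt (((det M)\<^sup>2)\<^sup>2)) = \<bar>det M\<bar>" by (simp only: real_sqrt_abs abs_power2)
  ultimately show ?thesis
    unfolding dens_def M_def[symmetric] by (simp only: power_mult_distrib real_sqrt_mult)
qed

lemma Fc_trn:
  assumes "c \<in> A" "d \<in> A" "x \<in> tdom c d"
  shows "Fc d (trn c d x) = frechet_derivative (trn c d) (at x) (Fc c x)"
proof (rule G_nondegenerate[OF assms(2)])
  have x: "x \<in> dm c" using assms(3) by (simp add: tdom_def)
  show y: "trn c d x \<in> dm d" using trans_in[OF assms(1-3)] by (simp add: tdom_def)
  fix v
  obtain u where u: "v = frechet_derivative (trn c d) (at x) u" by (rule trans_derivative_surj[OF assms])
  show "G d (trn c d x) (Fc d (trn c d x)) v = G d (trn c d x) (frechet_derivative (trn c d) (at x) (Fc c x)) v"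
    unfolding u G_Fc[OF assms(2) y] G_trn[OF assms] G_Fc[OF assms(1) x] tau_trn[OF assms] ..
qed

text \<open>By duality this is the squared length of \<open>Fc\<close>.\<close>

definition Nc :: "('m, 'n) chart \<Rightarrow> complex ^ 'n \<Rightarrow> real" where "Nc c x = tau c x (Fc c x)"

text \<open>The divergence of the field \<open>f F\<close> with respect to the Riemannian volume,
  \<open>Nc\<close> being the divergence of \<open>F\<close> itself.\<close>

definition Phi :: "('m \<Rightarrow> real) \<Rightarrow> ('m, 'n) chart \<Rightarrow> complex ^ 'n \<Rightarrow> real" where
  "Phi f c x = dd c f x (Fc c x) + Nc c x * f (pt c x)"

text \<open>The integral of a function on the chart against the Riemannian volume.\<close>

definition II :: "('m, 'n) chart \<Rightarrow> (complex ^ 'n \<Rightarrow> real) \<Rightarrow> real" where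
  "II c u = integral UNIV (\<lambda>r. if J r \<in> dm c then dens c (J r) * u (J r) else 0)"

lemma Phi_trn:
  assumes "c \<in> A" "d \<in> A" "x \<in> tdom c d" "smooth_fun A f"
  shows "Phi f d (trn c d x) = Phi f c x"
  unfolding Phi_def Nc_def Fc_trn[OF assms(1-3)] dd_trn[OF assms, symmetric] tau_trn[OF assms(1-3)]
    pt_trans[OF assms(2,3)] ..

lemma Fc_continuous: "c \<in> A \<Longrightarrow> continuous_on (dm c) (Fc c)"
  by (intro continuous_at_imp_continuous_on ballI has_derivative_continuous[OF Fc_has_derivative])

lemma dens_continuous: "c \<in> A \<Longrightarrow> continuous_on (dm c) (dens c)"
  by (intro continuous_at_imp_continuous_on ballI has_derivative_continuous[OF dens_has_derivative])

lemma linear_field_continuous: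
  fixes B :: "complex ^ 'n \<Rightarrow> complex ^ 'n \<Rightarrow> 'z::real_normed_vector"
  assumes "c \<in> A" "\<And>b. continuous_on (dm c) (\<lambda>x. B x b)" "\<And>x. x \<in> dm c \<Longrightarrow> linear (B x)"
  shows "continuous_on (dm c) (\<lambda>x. B x (Fc c x))"
proof -
  have "continuous_on (dm c) (\<lambda>x. \<Sum>b\<in>Basis. (Fc c x \<bullet> b) *\<^sub>R B x b)"
    by (intro continuous_intros assms Fc_continuous)
  moreover have "(\<Sum>b\<in>Basis. (Fc c x \<bullet> b) *\<^sub>R B x b) = B x (Fc c x)" if "x \<in> dm c" for x
    by (rule linear_basis_expansion[OF assms(3)[OF that], symmetric])
  ultimately show ?thesis by (rule continuous_on_eq)
qed

lemma dd_continuous: "c \<in> A \<Longrightarrow> smooth_fun A f \<Longrightarrow> continuous_on (dm c) (\<lambda>x. dd c f x b)"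
  unfolding dd_def by (rule smooth_on_continuous[OF smooth_on_deriv[OF smooth_fun_chart]])

lemma f_continuous: "c \<in> A \<Longrightarrow> smooth_fun A f \<Longrightarrow> continuous_on (dm c) (\<lambda>x. f (pt c x))"
  by (rule smooth_on_continuous[OF smooth_fun_chart])

lemma tau_continuous: "c \<in> A \<Longrightarrow> continuous_on (dm c) (\<lambda>x. tau c x u)"
  by (intro continuous_at_imp_continuous_on ballI has_derivative_continuous[OF tau_has_derivative])

lemma Nc_continuous: "c \<in> A \<Longrightarrow> continuous_on (dm c) (Nc c)"
  unfolding Nc_def[abs_def]
  by (rule linear_field_continuous[where B = "tau c"]) (simp_all add: tau_continuous tau_linear)

lemma Phi_continuous:
  assumes "c \<in> A" "smooth_fun A f"
  shows "continuous_on (dm c) (Phi f c)"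
proof -
  have "continuous_on (dm c) (\<lambda>x. dd c f x (Fc c x))"
    by (rule linear_field_continuous[where B = "dd c f"]) (simp_all add: dd_continuous dd_linear assms)
  then show ?thesis
    unfolding Phi_def[abs_def]
    by (intro continuous_on_add continuous_on_mult Nc_continuous f_continuous assms)
qed

lemma open_J: "c \<in> A \<Longrightarrow> open {r. J r \<in> dm c}"
  using open_vimage[OF open_dm linear_continuous_on[OF bounded_linear_J]] by (simp add: vimage_def)

lemma compact_Ji: "compact K \<Longrightarrow> compact (Ji ` K)"
  by (rule compact_continuous_image[OF linear_continuous_on[OF bounded_linear_Ji]])

lemma J_in_iff: "r \<in> Ji ` K \<longleftrightarrow> J r \<in> K"
  by (metis J_Ji Ji_J image_iff)

lemma extension_integrable:
  fixes u :: "complex ^ 'n \<Rightarrow> real"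
  assumes c: "c \<in> A" and K: "compact K" "K \<subseteq> dm c" "\<And>x. x \<in> dm c \<Longrightarrow> x \<notin> K \<Longrightarrow> u x = 0"
    and u: "continuous_on (dm c) u"
  shows "continuous_on UNIV (\<lambda>r. if J r \<in> dm c then u (J r) else 0)"
    "(\<lambda>r. if J r \<in> dm c then u (J r) else 0) absolutely_integrable_on UNIV"
proof -
  have "continuous_on {r. J r \<in> dm c} (\<lambda>r. u (J r))"
    by (rule continuous_on_compose2[OF u linear_continuous_on[OF bounded_linear_J]]) auto
  then have "continuous_on UNIV (\<lambda>r. if r \<in> {r. J r \<in> dm c} then u (J r) else 0)"
    by (rule zero_extension_continuous[OF open_J[OF c] compact_Ji[OF K(1)], rotated])
      (use K in \<open>auto simp: J_in_iff J_Ji\<close>)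
  then have 1: "continuous_on UNIV (\<lambda>r. if J r \<in> dm c then u (J r) else 0)" by simp
  then show "continuous_on UNIV (\<lambda>r. if J r \<in> dm c then u (J r) else 0)" .
  show "(\<lambda>r. if J r \<in> dm c then u (J r) else 0) absolutely_integrable_on UNIV"
    by (rule compact_support_absolutely_integrable[OF 1 compact_Ji[OF K(1)]]) (use K in \<open>auto simp: J_in_iff\<close>)
qed

text \<open>The divergence of \<open>dens f F\<close> is \<open>dens (F f + \<tau>(F) f)\<close>, as \<open>F\<close> is parallel.\<close>

lemma II_Phi_zero:
  assumes c: "c \<in> A" and f: "smooth_fun A f" and K: "compact K" "K \<subseteq> dm c"
    and 0: "\<And>x. x \<in> dm c \<Longrightarrow> x \<notin> K \<Longrightarrow> f (pt c x) = 0"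
  shows "II c (Phi f c) = 0"
proof -
  define \<phi> where "\<phi> i x = dens c x * f (pt c x) * (Fc c x \<bullet> \<beta> i)" for i x
  define \<phi>' where "\<phi>' i x h = (dens c x * f (pt c x)) * (- Gam c x h (Fc c x) \<bullet> \<beta> i)
     + (dens c x * dd c f x h + (\<Sum>b\<in>Basis. Gam c x h b \<bullet> b) * dens c x * f (pt c x)) * (Fc c x \<bullet> \<beta> i)" for i x h
  have d: "(\<phi> i has_derivative \<phi>' i x) (at x)" if x: "x \<in> dm c" for i x
    unfolding \<phi>_def[abs_def] \<phi>'_def[abs_def]
    by (intro has_derivative_mult dens_has_derivative[OF c x] dd_has_derivative[OF f c x]
        bounded_linear.has_derivative[OF bounded_linear_inner_left Fc_has_derivative[OF c x]])
  have lG: "linear (Gam c x u)" "linear (\<lambda>u. Gam c x u v)" if "x \<in> dm c" for x u v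
    using bilinear_Gam[OF c that] by (simp_all add: bilinear_def)
  have ldd: "linear (dd c f x)" if "x \<in> dm c" for x by (rule dd_linear[OF f c that])
  have cont: "continuous_on (dm c) (\<lambda>x. \<phi>' i x (\<beta> i))" for i
    unfolding \<phi>'_def
    by (intro continuous_intros dens_continuous c f_continuous f Fc_continuous dd_continuous
        linear_field_continuous[where B = "\<lambda>x. Gam c x (\<beta> i)"] lG smooth_on_continuous[OF Gam_smooth])
  have supp: "dd c f x = (\<lambda>h. 0)" "f (pt c x) = 0" if x: "x \<in> dm c" "x \<notin> K" for x
  proof -
    show "dd c f x = (\<lambda>h. 0)"
    proof (rule dd_eqI)
      show "((\<lambda>y. f (pt c y)) has_derivative (\<lambda>h. 0)) (at x)"
        by (rule has_derivative_transform_within_open[OF has_derivative_const[of 0], of "dm c \<inter> - K"])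
          (use x K 0 in \<open>auto intro!: open_Int open_dm c open_Compl compact_imp_closed\<close>)
    qed
  qed (rule 0[OF x])
  have 1: "integral UNIV (\<lambda>r. if J r \<in> dm c then \<phi>' i (J r) (\<beta> i) else 0) = 0" for i
  proof -
    have dr: "((\<lambda>r. \<phi> i (J r)) has_derivative (\<lambda>h. \<phi>' i (J r) (J h))) (at r)" if "r \<in> {r. J r \<in> dm c}" for r
      by (rule has_derivative_compose[where f = J and g = "\<phi> i", OF bounded_linear_imp_has_derivative[OF bounded_linear_J] d])
        (use that in simp)
    have z: "\<phi> i (J r) = 0" if "r \<in> {r. J r \<in> dm c}" "r \<notin> Ji ` K" for r
      using that supp(2)[of "J r"] by (simp add: \<phi>_def J_in_iff)
    have sub: "Ji ` K \<subseteq> {r. J r \<in> dm c}" using K by (auto simp: J_Ji)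
    have e: "(if r \<in> {r. J r \<in> dm c} then (\<lambda>h. \<phi>' i (J r) (J h)) else (\<lambda>h. 0)) (axis i 1)
      = (if J r \<in> dm c then \<phi>' i (J r) (\<beta> i) else 0)" for r by (simp add: J_axis)
    have "integral UNIV (\<lambda>r. (if r \<in> {r. J r \<in> dm c} then (\<lambda>h. \<phi>' i (J r) (J h)) else (\<lambda>h. 0)) (axis i 1)) = 0"
    proof (rule integral_directional_derivative[where k = "\<lambda>r. if r \<in> {r. J r \<in> dm c} then \<phi> i (J r) else 0"])
      show "((\<lambda>r. if r \<in> {r. J r \<in> dm c} then \<phi> i (J r) else 0) has_derivative
        (if r \<in> {r. J r \<in> dm c} then (\<lambda>h. \<phi>' i (J r) (J h)) else (\<lambda>h. 0))) (at r)" for r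
        by (rule zero_extension_has_derivative[where f' = "\<lambda>r h. \<phi>' i (J r) (J h)", OF open_J[OF c] compact_Ji[OF K(1)] sub dr z])
      show "continuous_on UNIV (\<lambda>r. (if r \<in> {r. J r \<in> dm c} then (\<lambda>h. \<phi>' i (J r) (J h)) else (\<lambda>h. 0)) (axis i 1))"
        unfolding e by (rule extension_integrable(1)[OF c K _ cont]) (simp add: \<phi>'_def supp)
      show "compact (Ji ` K)" by (rule compact_Ji[OF K(1)])
      show "(if r \<in> {r. J r \<in> dm c} then \<phi> i (J r) else 0) = 0" if "r \<notin> Ji ` K" for r using z that by auto
    qed
    then show ?thesis unfolding e .
  qed
  have 2: "(\<Sum>i\<in>UNIV. \<phi>' i x (\<beta> i)) = dens c x * Phi f c x" if x: "x \<in> dm c" for x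
  proof -
    have lt: "linear (\<lambda>h. \<Sum>b\<in>Basis. Gam c x h b \<bullet> b)"
      by (rule linearI) (simp_all add: Gam_simps[OF c x] inner_add_left sum.distrib sum_distrib_left)
    have a: "(\<Sum>i\<in>UNIV. (Fc c x \<bullet> \<beta> i) * (\<Sum>b\<in>Basis. Gam c x (\<beta> i) b \<bullet> b)) = (\<Sum>b\<in>Basis. Gam c x (Fc c x) b \<bullet> b)"
      using linear_expansion_\<beta>[OF lt, of "Fc c x"] by simp
    have b: "(\<Sum>i\<in>UNIV. (Fc c x \<bullet> \<beta> i) * dd c f x (\<beta> i)) = dd c f x (Fc c x)"
      using linear_expansion_\<beta>[OF ldd[OF x], of "Fc c x"] by simp
    have e: "(\<Sum>i\<in>UNIV. Gam c x (\<beta> i) (Fc c x) \<bullet> \<beta> i) = (\<Sum>b\<in>Basis. Gam c x b (Fc c x) \<bullet> b)"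
      by (rule sum_\<beta>)
    \<comment> \<open>Here the torsion enters: the density contributes the trace of
      \<open>Gam\<close> with \<open>F\<close> in the first slot, the derivative of \<open>F\<close>
      the trace with \<open>F\<close> in the second, and their difference is the trace of
      \<open>Tor\<close>.\<close>
    have n: "Nc c x = (\<Sum>b\<in>Basis. Gam c x (Fc c x) b \<bullet> b) - (\<Sum>b\<in>Basis. Gam c x b (Fc c x) \<bullet> b)"
      by (simp add: Nc_def tau_def Tor_def inner_diff_left sum_subtractf)
    have "(\<Sum>i\<in>UNIV. \<phi>' i x (\<beta> i)) = - (dens c x * f (pt c x)) * (\<Sum>i\<in>UNIV. Gam c x (\<beta> i) (Fc c x) \<bullet> \<beta> i)
      + dens c x * (\<Sum>i\<in>UNIV. (Fc c x \<bullet> \<beta> i) * dd c f x (\<beta> i))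
      + dens c x * f (pt c x) * (\<Sum>i\<in>UNIV. (Fc c x \<bullet> \<beta> i) * (\<Sum>b\<in>Basis. Gam c x (\<beta> i) b \<bullet> b))"
      unfolding sum_distrib_left[of "- (dens c x * f (pt c x))"] sum_distrib_left[of "dens c x"]
        sum_distrib_left[of "dens c x * f (pt c x)"] sum.distrib[symmetric]
      by (rule sum.cong) (simp_all add: \<phi>'_def algebra_simps)
    then show ?thesis unfolding a b e by (simp add: Phi_def n algebra_simps)
  qed
  have "II c (Phi f c) = integral UNIV (\<lambda>r. \<Sum>i\<in>UNIV. if J r \<in> dm c then \<phi>' i (J r) (\<beta> i) else 0)"
    unfolding II_def by (rule arg_cong[of _ _ "integral UNIV"]) (auto simp: fun_eq_iff 2)
  also have "\<dots> = (\<Sum>i\<in>UNIV. integral UNIV (\<lambda>r. if J r \<in> dm c then \<phi>' i (J r) (\<beta> i) else 0))"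
    by (rule integral_sum) (auto intro!: set_lebesgue_integral_eq_integral(1) extension_integrable(2)[OF c K _ cont] simp: \<phi>'_def supp)
  finally show ?thesis by (simp add: 1)
qed

text \<open>Substitution by the transition map, whose Jacobian is absorbed by the density. Both
  functions vanish outside the overlap, so both integrals live there.\<close>

lemma II_trn:
  assumes c: "c \<in> A" and d: "d \<in> A"
    and e: "\<And>x. x \<in> tdom c d \<Longrightarrow> u x = v (trn c d x)"
    and u: "\<And>x. x \<in> dm c \<Longrightarrow> x \<notin> tdom c d \<Longrightarrow> u x = 0" and v: "\<And>x. x \<in> dm d \<Longrightarrow> x \<notin> tdom d c \<Longrightarrow> v x = 0"
    and int: "(\<lambda>r. if J r \<in> dm d then dens d (J r) * v (J r) else 0) absolutely_integrable_on UNIV"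
  shows "II c u = II d v"
proof -
  let ?S = "{r. J r \<in> tdom c d}" and ?h = "\<lambda>r. Ji (trn c d (J r))" and ?f = "\<lambda>r. dens d (J r) * v (J r)"
  define h' where "h' r = (\<lambda>s. Ji (frechet_derivative (trn c d) (at (J r)) (J s)))" for r
  have oS: "open ?S" using open_vimage[OF open_tdom[OF c d] linear_continuous_on[OF bounded_linear_J]] by (simp add: vimage_def)
  have im: "?h ` ?S = {r. J r \<in> tdom d c}"
  proof (intro equalityI subsetI)
    fix r assume "r \<in> ?h ` ?S" then show "r \<in> {r. J r \<in> tdom d c}" using trans_in[OF c d] by (auto simp: J_Ji)
  next
    fix r assume "r \<in> {r. J r \<in> tdom d c}"
    then show "r \<in> ?h ` ?S" using trans_in[OF d c] trans_trans[OF d c]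
      by (intro image_eqI[of _ _ "Ji (trn d c (J r))"]) (auto simp: J_Ji Ji_J)
  qed
  have inj: "inj_on ?h ?S"
    by (rule inj_on_inverseI[where g = "\<lambda>r. Ji (trn d c (J r))"]) (simp add: J_Ji Ji_J trans_trans[OF c d])
  have dh: "(?h has_derivative h' r) (at r)" if "r \<in> ?S" for r
  proof -
    have "((\<lambda>r. trn c d (J r)) has_derivative (\<lambda>s. frechet_derivative (trn c d) (at (J r)) (J s))) (at r)"
      by (rule has_derivative_compose[where f = J and g = "trn c d",
            OF bounded_linear_imp_has_derivative[OF bounded_linear_J] trans_derivative(1)[OF c d]]) (use that in simp)
    then show ?thesis unfolding h'_def by (rule bounded_linear.has_derivative[OF bounded_linear_Ji])
  qed
  have r: "(\<lambda>r. if r \<in> {r. J r \<in> tdom d c} then ?f r else 0) = (\<lambda>r. if J r \<in> dm d then ?f r else 0)"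
    by (auto simp: fun_eq_iff v) (auto simp: tdom_def)
  have fi: "?f absolutely_integrable_on (?h ` ?S)"
    unfolding im absolutely_integrable_restrict_UNIV[symmetric, of _ ?f] r by (rule int)
  have "II d v = integral (?h ` ?S) ?f"
    unfolding im integral_restrict_UNIV[symmetric, of _ ?f] r II_def ..
  also have "\<dots> = integral ?S (\<lambda>r. \<bar>det (matrix (h' r))\<bar> * ?f (?h r))"
    by (rule integral_change_of_variables_real[OF oS dh inj fi])
  also have "\<dots> = integral UNIV (\<lambda>r. if r \<in> ?S then \<bar>det (matrix (h' r))\<bar> * ?f (?h r) else 0)"
    by (rule integral_restrict_UNIV[symmetric])
  also have "(\<lambda>r. if r \<in> ?S then \<bar>det (matrix (h' r))\<bar> * ?f (?h r) else 0) = (\<lambda>r. if J r \<in> dm c then dens c (J r) * u (J r) else 0)"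
  proof (rule HOL.ext)
    fix r
    show "(if r \<in> ?S then \<bar>det (matrix (h' r))\<bar> * ?f (?h r) else 0) = (if J r \<in> dm c then dens c (J r) * u (J r) else 0)"
    proof (cases "J r \<in> tdom c d")
      case True
      then have "J r \<in> dm c" by (simp add: tdom_def)
      then show ?thesis using True dens_trn[OF c d True] e[OF True] by (simp add: h'_def J_Ji)
    next
      case False
      then show ?thesis using u[of "J r"] by simp
    qed
  qed
  finally show ?thesis by (simp add: II_def)
qed

end

subsection \<open>Vanishing of the torsion trace on a compact manifold\<close>

context cmanifold
begin

lemma choice4: "\<forall>x. \<exists>a b c d. Q x a b c d \<Longrightarrow> \<exists>f1 f2 f3 f4. \<forall>x. Q x (f1 x) (f2 x) (f3 x) (f4 x)"
  by metis

text \<open>Finitely many bumps are positive somewhere at each point of the compact manifold, and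
  dividing by their sum normalises them. The chart and the compact support of each are recorded
  because integrals are taken there.\<close>

lemma partition_of_unity:
  assumes "compact (UNIV :: 'm set)"
  shows "\<exists>(P :: 'm set) ch f K. finite P \<and> (\<forall>p\<in>P. ch p \<in> A \<and> smooth_fun A (f p) \<and>
      compact (K p) \<and> K p \<subseteq> dm (ch p) \<and> (\<forall>q. 0 \<le> f p q) \<and> (\<forall>q. q \<notin> pt (ch p) ` K p \<longrightarrow> f p q = 0)) \<and>
    (\<forall>q. (\<Sum>p\<in>P. f p q) = 1)"
proof -
  have "\<exists>c f K N. c \<in> A \<and> smooth_fun A f \<and> compact K \<and> K \<subseteq> dm c \<and> (\<forall>q. 0 \<le> f q) \<and>
      (\<forall>q. q \<notin> pt c ` K \<longrightarrow> f q = 0) \<and> open N \<and> p \<in> N \<and> (\<forall>q\<in>N. 0 < f q)" for p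
  proof -
    obtain c where c: "c \<in> A" "p \<in> fst c" by (rule chart_ex)
    obtain b K r where b: "smooth_on UNIV b" "compact K" "K \<subseteq> dm c" "\<And>x. x \<notin> K \<Longrightarrow> b x = (0 :: real)"
        "\<And>x. 0 \<le> b x" "\<And>x. b x \<le> 1" "r > 0" "ball (snd c p) r \<subseteq> dm c" "\<And>x. x \<in> ball (snd c p) r \<Longrightarrow> b x = 1"
      by (rule chart_bump[OF c(1) open_dm[OF c(1)] snd_in[OF c] order_refl]) (rule that)
    have "smooth_fun A (ext c b)" by (rule smooth_fun_ext[OF c(1) open_UNIV b(1,2)]) (use b in auto)
    moreover have "ext c b q = 0" if "q \<notin> pt c ` K" for q
    proof (cases "q \<in> fst c")
      case True
      then have "snd c q \<notin> K" using that pt_snd[OF c(1) True] by (metis imageI)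
      then show ?thesis using b(4) by (simp add: ext_def)
    qed (simp add: ext_def)
    moreover have "open (pt c ` ball (snd c p) r)" by (rule open_pt_image[OF c(1) open_ball b(8)])
    moreover have "p \<in> pt c ` ball (snd c p) r" using b(7) pt_snd[OF c] by (intro image_eqI[of _ _ "snd c p"]) auto
    moreover have "0 < ext c b q" if q: "q \<in> pt c ` ball (snd c p) r" for q
    proof -
      obtain x where x: "x \<in> ball (snd c p) r" "q = pt c x" using q by blast
      then show ?thesis using subsetD[OF b(8) x(1)] b(9)[OF x(1)] by (simp add: ext_def pt_in[OF c(1)] snd_pt[OF c(1)])
    qed
    ultimately show ?thesis using c(1) b(2,3,5)
      by (intro exI[of _ c] exI[of _ "ext c b"] exI[of _ K] exI[of _ "pt c ` ball (snd c p) r"]) (auto simp: ext_def)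
  qed
  then have "\<exists>ch f K N. \<forall>p. ch p \<in> A \<and> smooth_fun A (f p) \<and> compact (K p) \<and> K p \<subseteq> dm (ch p) \<and> (\<forall>q. 0 \<le> f p q) \<and>
      (\<forall>q. q \<notin> pt (ch p) ` K p \<longrightarrow> f p q = 0) \<and> open (N p) \<and> p \<in> N p \<and> (\<forall>q\<in>N p. 0 < f p q)"
    by (intro choice4) blast
  then obtain ch f K N where 1: "\<And>p. ch p \<in> A" "\<And>p. smooth_fun A (f p)" "\<And>p. compact (K p)" "\<And>p. K p \<subseteq> dm (ch p)"
      "\<And>p q. 0 \<le> f p q" "\<And>p q. q \<notin> pt (ch p) ` K p \<Longrightarrow> f p q = 0" "\<And>p. open (N p)" "\<And>p. p \<in> N p"
      "\<And>p q. q \<in> N p \<Longrightarrow> 0 < f p q" by blast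
  have cover: "UNIV \<subseteq> (\<Union>p\<in>UNIV. N p)" using 1(8) by blast
  obtain P where P: "finite P" "UNIV \<subseteq> (\<Union>p\<in>P. N p)"
    by (rule compactE_image[OF assms 1(7) cover]) (rule that)
  define \<sigma> where "\<sigma> q = (\<Sum>p\<in>P. f p q)" for q
  have \<sigma>: "\<sigma> q > 0" for q
  proof -
    obtain p where p: "p \<in> P" "q \<in> N p" using P(2) by blast
    show ?thesis unfolding \<sigma>_def by (rule sum_pos2[where f = "\<lambda>p. f p q", OF P(1) p(1) 1(9)[OF p(2)]]) (rule 1(5))
  qed
  have s\<sigma>: "smooth_fun A \<sigma>" unfolding \<sigma>_def[abs_def] by (intro smooth_fun_sum 1)
  have ns: "\<sigma> q \<noteq> 0" for q using \<sigma>[of q] by simp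
  show ?thesis
  proof (intro exI[of _ P] exI[of _ ch] exI[of _ "\<lambda>p q. f p q * inverse (\<sigma> q)"] exI[of _ K] conjI ballI allI impI P(1) 1(1,3,4))
    show "smooth_fun A (\<lambda>q. f p q * inverse (\<sigma> q))" for p
      by (intro smooth_fun_mult smooth_fun_inverse 1 s\<sigma> ns)
    show "(\<Sum>p\<in>P. f p q * inverse (\<sigma> q)) = 1" for q
      unfolding sum_distrib_right[symmetric] \<sigma>_def[symmetric] using ns by simp
    show "0 \<le> f p q * inverse (\<sigma> q)" for p q using 1(5)[of p q] \<sigma>[of q] by simp
    show "f p q * inverse (\<sigma> q) = 0" if "q \<notin> pt (ch p) ` K p" for p q using 1(6)[OF that] by simp
  qed
qed

end

context based_chern_manifold
begin

lemma II_sum: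
  assumes "finite I" "\<And>i. i \<in> I \<Longrightarrow> (\<lambda>r. if J r \<in> dm c then dens c (J r) * u i (J r) else 0) absolutely_integrable_on UNIV"
  shows "II c (\<lambda>x. \<Sum>i\<in>I. u i x) = (\<Sum>i\<in>I. II c (u i))"
proof -
  have "II c (\<lambda>x. \<Sum>i\<in>I. u i x) = integral UNIV (\<lambda>r. \<Sum>i\<in>I. if J r \<in> dm c then dens c (J r) * u i (J r) else 0)"
    unfolding II_def by (rule arg_cong[of _ _ "integral UNIV"]) (auto simp: fun_eq_iff sum_distrib_left)
  also have "\<dots> = (\<Sum>i\<in>I. II c (u i))"
    unfolding II_def by (rule integral_sum[OF assms(1)]) (rule set_lebesgue_integral_eq_integral(1)[OF assms(2)])
  finally show ?thesis .
qed

text \<open>Otherwise \<open>Nc\<close> is positive everywhere. Each \<open>Phi (f p)\<close> has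
  integral 0 in its own chart, and these functions add up to \<open>Nc\<close> because the
  \<open>f p\<close> add up to 1; so a positive function would have total integral 0.\<close>

lemma torsion_trace_vanishes:
  assumes compact: "compact (UNIV :: 'm set)"
  shows "\<exists>c\<in>A. \<exists>x\<in>dm c. \<forall>u. tau c x u = 0"
proof (rule ccontr)
  assume neg: "\<not> (\<exists>c\<in>A. \<exists>x\<in>dm c. \<forall>u. tau c x u = 0)"
  have N: "Nc c x > 0" if c: "c \<in> A" "x \<in> dm c" for c x
  proof -
    obtain u where "tau c x u \<noteq> 0" using neg c by blast
    then have "Fc c x \<noteq> 0" using G_Fc[OF c, of u] by (auto simp: bilinear_lzero[OF bilinear_G[OF c]])
    from G_pos[OF c this] show ?thesis by (simp add: G_Fc[OF c] Nc_def)
  qed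
  obtain P :: "'m set" and ch f K where pu: "finite P \<and> (\<forall>p\<in>P. ch p \<in> A \<and> smooth_fun A (f p) \<and>
      compact (K p) \<and> K p \<subseteq> dm (ch p) \<and> (\<forall>q. 0 \<le> f p q) \<and> (\<forall>q. q \<notin> pt (ch p) ` K p \<longrightarrow> f p q = 0)) \<and>
    (\<forall>q. (\<Sum>p\<in>P. f p q) = 1)"
    using partition_of_unity[OF compact] by (elim exE) (rule that)
  have P: "finite P" and f1: "\<And>q. (\<Sum>p\<in>P. f p q) = 1" using pu by simp_all
  have ch: "ch p \<in> A" and f: "smooth_fun A (f p)" and K: "compact (K p)" "K p \<subseteq> dm (ch p)"
    and f0: "0 \<le> f p q" and f_supp: "q \<notin> pt (ch p) ` K p \<Longrightarrow> f p q = 0"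
    if "p \<in> P" for p q
    using pu that by simp_all
  have cK: "closed (pt (ch p) ` K p)" "pt (ch p) ` K p \<subseteq> fst (ch p)" if p: "p \<in> P" for p
  proof -
    have "compact (pt (ch p) ` K p)"
      by (rule compact_continuous_image[OF continuous_on_subset[OF continuous_on_pt[OF ch[OF p]] K(2)[OF p]] K(1)[OF p]])
    then show "closed (pt (ch p) ` K p)" by (rule compact_imp_closed)
    show "pt (ch p) ` K p \<subseteq> fst (ch p)" using pt_in[OF ch[OF p]] K(2)[OF p] by auto
  qed
  have nK: "pt (ch p) x \<notin> pt (ch p) ` K p" if "p \<in> P" "x \<in> dm (ch p)" "x \<notin> K p" for p x
  proof
    assume "pt (ch p) x \<in> pt (ch p) ` K p"
    then obtain y where "y \<in> K p" "pt (ch p) x = pt (ch p) y" by blast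
    then have "x = y" using snd_pt[OF ch[OF that(1)]] that(2) K(2)[OF that(1)] by (metis subsetD)
    with \<open>y \<in> K p\<close> that(3) show False by simp
  qed
  note fK = f_supp[OF _ nK]
  have Phi0: "Phi (f p) c x = 0" if "p \<in> P" "c \<in> A" "x \<in> dm c" "pt c x \<notin> pt (ch p) ` K p" for p c x
    using dd_zero[OF that(2,3) cK(1)[OF that(1)] that(4) f_supp[OF that(1)]] f_supp[OF that(1,4)] by (simp add: Phi_def)
  \<comment> \<open>No integral over the whole manifold is defined. Instead \<open>Phi (f p)\<close>
    is localised once more by \<open>f q\<close>, carried from the chart of \<open>p\<close> to that
    of \<open>q\<close>, and summed there over \<open>p\<close>.\<close>
  let ?u = "\<lambda>p q c x. f q (pt c x) * Phi (f p) c x"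
  have int_q: "(\<lambda>r. if J r \<in> dm (ch q) then dens (ch q) (J r) * ?u p q (ch q) (J r) else 0) absolutely_integrable_on UNIV"
    if p: "p \<in> P" and q: "q \<in> P" for p q
    by (rule extension_integrable(2)[where u = "\<lambda>x. dens (ch q) x * ?u p q (ch q) x", OF ch[OF q] K[OF q]])
      (auto intro!: continuous_on_mult dens_continuous f_continuous Phi_continuous ch f p q simp: fK[OF q q])
  have int_p: "(\<lambda>r. if J r \<in> dm (ch p) then dens (ch p) (J r) * ?u p q (ch p) (J r) else 0) absolutely_integrable_on UNIV"
    if p: "p \<in> P" and q: "q \<in> P" for p q
  proof (rule extension_integrable(2)[where u = "\<lambda>x. dens (ch p) x * ?u p q (ch p) x", OF ch[OF p] K[OF p]])
    fix x assume x: "x \<in> dm (ch p)" "x \<notin> K p"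
    show "dens (ch p) x * ?u p q (ch p) x = 0" using Phi0[OF p ch[OF p] x(1) nK[OF p x]] by simp
  qed (intro continuous_on_mult dens_continuous f_continuous Phi_continuous ch f p q)
  have "0 = (\<Sum>p\<in>P. II (ch p) (Phi (f p) (ch p)))"
    using II_Phi_zero[OF ch f K] fK by (intro sum.neutral[symmetric]) auto
  also have "\<dots> = (\<Sum>p\<in>P. \<Sum>q\<in>P. II (ch p) (?u p q (ch p)))"
  proof (rule sum.cong[OF refl])
    fix p assume p: "p \<in> P"
    have e: "Phi (f p) (ch p) = (\<lambda>x. \<Sum>q\<in>P. ?u p q (ch p) x)"
      unfolding sum_distrib_right[symmetric] f1 by simp
    show "II (ch p) (Phi (f p) (ch p)) = (\<Sum>q\<in>P. II (ch p) (?u p q (ch p)))"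
      by (rule trans, rule arg_cong[OF e, of "II (ch p)"], rule II_sum[where u = "\<lambda>q. ?u p q (ch p)", OF P int_p[OF p]])
  qed
  also have "\<dots> = (\<Sum>p\<in>P. \<Sum>q\<in>P. II (ch q) (?u p q (ch q)))"
  proof (intro sum.cong refl)
    fix p q assume p: "p \<in> P" and q: "q \<in> P"
    show "II (ch p) (?u p q (ch p)) = II (ch q) (?u p q (ch q))"
    proof (rule II_trn[OF ch[OF p] ch[OF q] _ _ _ int_q[OF p q]])
      fix x assume x: "x \<in> tdom (ch p) (ch q)"
      show "?u p q (ch p) x = ?u p q (ch q) (trn (ch p) (ch q) x)"
        unfolding Phi_trn[OF ch[OF p] ch[OF q] x f[OF p]] pt_trans[OF ch[OF q] x] ..
    next
      fix x assume x: "x \<in> dm (ch p)" "x \<notin> tdom (ch p) (ch q)"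
      then have "pt (ch p) x \<notin> pt (ch q) ` K q" using cK(2)[OF q] by (auto simp: tdom_def)
      then show "?u p q (ch p) x = 0" using f_supp[OF q] by simp
    next
      fix x assume x: "x \<in> dm (ch q)" "x \<notin> tdom (ch q) (ch p)"
      then have "pt (ch q) x \<notin> pt (ch p) ` K p" using cK(2)[OF p] by (auto simp: tdom_def)
      then show "?u p q (ch q) x = 0" using Phi0[OF p ch[OF q] x(1)] by simp
    qed
  qed
  also have "\<dots> = (\<Sum>q\<in>P. \<Sum>p\<in>P. II (ch q) (?u p q (ch q)))" by (rule sum.swap)
  also have "\<dots> = (\<Sum>q\<in>P. II (ch q) (\<lambda>x. \<Sum>p\<in>P. ?u p q (ch q) x))"
    by (rule sum.cong[OF refl]) (rule II_sum[where u = "\<lambda>p. ?u p q (ch q)" and c = "ch q" for q, OF P int_q, symmetric])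
  finally have S0: "(\<Sum>q\<in>P. II (ch q) (\<lambda>x. \<Sum>p\<in>P. ?u p q (ch q) x)) = 0" by simp
  \<comment> \<open>The derivatives of the \<open>f p\<close> add up to that of the constant 1, so
    only the terms with \<open>Nc\<close> remain.\<close>
  have PhiN: "(\<Sum>p\<in>P. Phi (f p) c x) = Nc c x" if c: "c \<in> A" "x \<in> dm c" for c x
  proof -
    have "((\<lambda>y. \<Sum>p\<in>P. f p (pt c y)) has_derivative (\<lambda>u. \<Sum>p\<in>P. dd c (f p) x u)) (at x)"
      by (intro has_derivative_sum dd_has_derivative f c)
    from fun_cong[OF has_derivative_unique[OF this[unfolded f1] has_derivative_const], of "Fc c x"]
    have "(\<Sum>p\<in>P. dd c (f p) x (Fc c x)) = 0" .
    then show ?thesis by (simp add: Phi_def sum.distrib sum_distrib_left[symmetric] f1)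
  qed
  define k where "k q r = (if J r \<in> dm (ch q) then dens (ch q) (J r) * (f q (pt (ch q) (J r)) * Nc (ch q) (J r)) else 0)" for q r
  have IIk: "II (ch q) (\<lambda>x. \<Sum>p\<in>P. ?u p q (ch q) x) = integral UNIV (k q)" if q: "q \<in> P" for q
    unfolding II_def k_def sum_distrib_left[symmetric]
    by (rule arg_cong[of _ _ "integral UNIV"]) (auto simp: fun_eq_iff PhiN[OF ch[OF q]])
  have k0: "0 \<le> k q r" if q: "q \<in> P" for q r
    using dens_pos[OF ch[OF q]] N[OF ch[OF q]] f0[OF q] by (simp add: k_def less_imp_le)
  have kc: "continuous_on UNIV (k q)" if q: "q \<in> P" for q
    unfolding k_def
    by (rule extension_integrable(1)[where u = "\<lambda>x. dens (ch q) x * (f q (pt (ch q) x) * Nc (ch q) x)", OF ch[OF q] K[OF q]])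
      (auto intro!: continuous_on_mult dens_continuous f_continuous Nc_continuous ch f q simp: fK[OF q q])
  have ks: "k q r = 0" if "q \<in> P" "r \<notin> Ji ` K q" for q r
    using that fK[OF that(1) that(1)] by (simp add: k_def J_in_iff)
  have kint: "k q integrable_on UNIV" if q: "q \<in> P" for q
    by (rule set_lebesgue_integral_eq_integral(1)[OF compact_support_absolutely_integrable[OF kc[OF q] compact_Ji[OF K(1)[OF q]] ks[OF q]]])
  have "(\<Sum>q\<in>P. integral UNIV (k q)) = 0" using S0 IIk by simp
  then have "integral UNIV (k q) = 0" if q: "q \<in> P" for q
    using sum_nonneg_eq_0_iff[OF P, of "\<lambda>q. integral UNIV (k q)"] integral_nonneg[OF kint] k0 q by auto
  then have kz: "k q r = 0" if q: "q \<in> P" for q r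
    by (intro integral_nonneg_eq_0_imp[OF kc[OF q] compact_Ji[OF K(1)[OF q]] ks[OF q] k0[OF q]]) (use q in auto)
  have "f q p = 0" if q: "q \<in> P" for q p
  proof (cases "p \<in> fst (ch q)")
    case True
    define x where "x = snd (ch q) p"
    have x: "x \<in> dm (ch q)" "pt (ch q) x = p" using snd_in[OF ch[OF q] True] pt_snd[OF ch[OF q] True] by (simp_all add: x_def)
    have "dens (ch q) x * (f q p * Nc (ch q) x) = 0" using kz[OF q, of "Ji x"] x by (simp add: k_def J_Ji)
    then show ?thesis using dens_pos[OF ch[OF q] x(1)] N[OF ch[OF q] x(1)] by simp
  next
    case False
    then show ?thesis using f_supp[OF q] cK(2)[OF q] by blast
  qed
  then show False using f1 by simp
qed

end

section \<open>Flat, torsion-free, or neither\<close>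

theorem theorem1p2:
  fixes A :: "('m::{t2_space, second_countable_topology}, 3) chart set"
    and g :: "'m metric_tensor"
    and D :: "'m connection"
  assumes "compact (UNIV :: 'm set)"
    and "hermitian_manifold A g"
    and "chern_connection A g D"
    and "parallel_torsion A D"
    and "parallel_curvature A D"
  shows "(kaehler A g \<and> locally_hermitian_symmetric A g) \<or> flat A D"
proof -
  interpret chern_manifold A D g
    by unfold_locales (use assms in \<open>simp_all add: hermitian_manifold_def chern_connection_def\<close>)
  \<comment> \<open>By the two dichotomies the third case has both tensors nonzero at every point,
    in particular at the point where \<open>torsion_trace_vanishes\<close> makes the trace 0; this
    contradicts \<open>trace_torsion_nonzero\<close>.\<close>
  consider "\<And>c x u v w. c \<in> A \<Longrightarrow> x \<in> dm c \<Longrightarrow> Rm c x u v w = 0" | "\<And>c x u v. c \<in> A \<Longrightarrow> x \<in> dm c \<Longrightarrow> Tor c x u v = 0"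
    | "\<And>c x. c \<in> A \<Longrightarrow> x \<in> dm c \<Longrightarrow> \<not> (\<forall>u v w. Rm c x u v w = 0) \<and> \<not> (\<forall>u v. Tor c x u v = 0)"
    using curvature_dichotomy torsion_dichotomy by meson
  then show ?thesis
  proof cases
    case 1
    then show ?thesis using flat_if_curvature_zero by blast
  next
    case 2
    then show ?thesis using kaehler_if_torsion_free locally_symmetric_if_torsion_free by blast
  next
    case 3
    \<comment> \<open>6 is the real dimension of \<open>complex ^ 3\<close>; as an index type it
      carries the required well-order.\<close>
    have "\<exists>\<beta> :: 6 \<Rightarrow> complex ^ 3. bij_betw \<beta> UNIV Basis"
      by (rule finite_same_card_bij) simp_all
    then obtain \<beta> :: "6 \<Rightarrow> complex ^ 3" where "bij_betw \<beta> UNIV Basis" by blast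
    then interpret based_chern_manifold A D g \<beta> by unfold_locales
    obtain c x where cx: "c \<in> A" "x \<in> dm c" "\<And>u. tau c x u = 0"
      using torsion_trace_vanishes[OF assms(1)] by blast
    interpret chern_algebra3 "Tor c x" "Rm c x" "G c x"
      by (rule chern_algebra3.intro[OF pointwise_chern_algebra[OF cx(1,2)]])
    obtain u v w a b where "Rm c x u v w \<noteq> 0" "Tor c x a b \<noteq> 0" using 3[OF cx(1,2)] by blast
    then have False using trace_torsion_nonzero cx(3) unfolding tau_def by blast
    then show ?thesis ..
  qed
qed

end
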